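(* Each of the reductions $\overline{\mathbf Z}_{1,1,0}$ and $\overline{\mathbf Z}_{1,1,\infty}$ has $q(q-1)$ connected components, and each component is (isomorphic to the affine curve over $k^{\rm ac}$ with coordinates $y\ne0$ and $Z$) defined by the equation $$Z^q=\zeta\bigl(y^{q^2-1}+y^{-(q^2-1)}\bigr)$$ with some $\zeta\in\mathbb F_q^\times$.
   Context: $F$ is a non-archimedean local field of characteristic $0$ with ring of integers $\mathcal O_F$, uniformizer $\pi$ and residue field $\mathbb F_q$ of characteristic $p\ne2$. $\mathbf C$ is the completion of an algebraic closure of $F$, $\mathcal O_{\mathbf C}$ its ring of integers, $k^{\rm ac}$ its residue field, $v$ its valuation with $v(\pi)=1$. Let $f(X)=\sum_{k\ge0}b_kX^{q^k}\in F[[u,X]]$ with $b_0=1$, $b_{-1}=0$ and $\pi b_k=b_{k-1}u^{q^{k-1}}+b_{k-2}$ for $k\ge1$; put $X+_uY=f^{-1}(f(X)+f(Y))$, $[a]_u(X)=f^{-1}(af(X))$. These have coefficients in $\mathcal O_F[[u]]$ and give, for $u\in\mathbf C$ with $v(u)>0$, a formal $\mathcal O_F$-module $\mathcal F_u$ over $\mathcal O_{\mathbf C}$. The Lubin–Tate space $\mathcal X(\pi^2)$ is the rigid analytic curve whose $\mathbf C$-points are triples $(X_2,Y_2,u)$ with $v(u)>0$ and $(X_2,Y_2)$ a basis of the free $\mathcal O_F/\pi^2$-module $\mathcal F_u[\pi^2]$; put $X_1=[\pi]_u(X_2)$, $Y_1=[\pi]_u(Y_2)$. $\mathbf Z_{1,1,0}\subset\mathcal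 X(\pi^2)$ is the affinoid defined by $v(u)=\frac12$, $v(X_1)=\frac1{2(q-1)}$, $v(X_2)=\frac1{2q^2(q-1)}$, $v(Y_1)=\frac1{2q(q-1)}$, $v(Y_2)=\frac1{2q^3(q-1)}$, and $\mathbf Z_{1,1,\infty}=\{(X_2,Y_2,u):(Y_2,X_2,u)\in\mathbf Z_{1,1,0}\}$. The reduction of an affinoid is ${\rm Spec}$ of power-bounded functions (over $\mathbf C$) modulo topologically nilpotent ones. *)

theory Defs
  imports
    "HOL-Analysis.Analysis"
    "HOL-Computational_Algebra.Formal_Power_Series"
    "HOL-Algebra.Algebraic_Closure"
    "HOL-Algebra.UnivPoly"
    "HOL-Algebra.QuotRing"
begin

section \<open>The fields \<open>F\<close> and \<open>C\<close>\<close>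

text \<open>The field \<open>C\<close> is a type \<open>'c\<close>; the local field \<open>F\<close> is a subset of it.\<close>

definition sub_rng :: "'c::field set \<Rightarrow> 'c ring"
  where "sub_rng A = \<lparr>carrier = A, mult = (*), one = 1, zero = 0, add = (+)\<rparr>"

definition val_ring :: "('c::field \<Rightarrow> ereal) \<Rightarrow> 'c set \<Rightarrow> 'c ring"
  where "val_ring v A = sub_rng {x \<in> A. 0 \<le> v x}"

definition max_ideal :: "('c::field \<Rightarrow> ereal) \<Rightarrow> 'c set \<Rightarrow> 'c set"
  where "max_ideal v A = {x \<in> A. 0 < v x}"

definition residue_field :: "('c::field \<Rightarrow> ereal) \<Rightarrow> 'c set \<Rightarrow> 'c set ring"
  where "residue_field v A = val_ring v A Quot max_ideal v A"

definition residue :: "('c::field \<Rightarrow> ereal) \<Rightarrow> 'c \<Rightarrow> 'c set"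
  where "residue v a = max_ideal v UNIV +>\<^bsub>val_ring v UNIV\<^esub> a"

text \<open>\<open>\<F>\<^sub>q\<^sup>\<times>\<close>, as a subset of the residue field of \<open>C\<close>.\<close>

definition fq_units :: "'c::field set \<Rightarrow> ('c \<Rightarrow> ereal) \<Rightarrow> 'c set set"
  where "fq_units F v = {residue v a | a. a \<in> F \<and> v a = 0}"

text \<open>The metric on \<open>C\<close> is tied to the normalized valuation by \<open>|x| = q\<^sup>-\<^sup>v\<^sup>(\<^sup>x\<^sup>)\<close>.\<close>

locale lubin_tate_setting =
  fixes F :: "'c::{field_char_0,complete_space} set"
    and v :: "'c \<Rightarrow> ereal"
    and \<pi> :: 'c
    and q p :: nat
  assumes v_eq_infinity: "v x = \<infinity> \<longleftrightarrow> x = 0"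
    and v_not_minus_infinity: "v x \<noteq> -\<infinity>"
    and v_mult: "v (x * y) = v x + v y"
    and v_add: "min (v x) (v y) \<le> v (x + y)"
    and dist_v: "dist x y =
           (if x = y then 0 else real q powr (- real_of_ereal (v (x - y))))"
    and C_completion: "\<exists>Fbar. algebraic_closure (sub_rng Fbar) F \<and> closure Fbar = UNIV"
    and F_complete: "complete F"
    and F_discrete: "x \<in> F \<Longrightarrow> x \<noteq> 0 \<Longrightarrow> \<exists>n::int. v x = ereal (of_int n)"
    and uniformizer: "\<pi> \<in> F" "v \<pi> = 1"
    and finite_residue_field: "finite (carrier (residue_field v F))"
    and card_residue_field: "card (carrier (residue_field v F)) = q"
    and residue_char: "Factorial_Ring.prime p" "0 < v (of_nat p)" "p \<noteq> 2"


section \<open>The formal modules \<open>\<F>\<^sub>u\<close>\<close>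

text \<open>The \<open>b\<^sub>k\<close> are polynomials in \<open>u\<close>, and so are the coefficients of the inverse
  series of \<open>f\<close>; everything below is therefore specialized at a point \<open>u\<close> of \<open>C\<close>
  from the start.\<close>

fun lt_b :: "'c::field \<Rightarrow> nat \<Rightarrow> 'c \<Rightarrow> nat \<Rightarrow> 'c" where
  "lt_b \<pi> q u 0 = 1"
| "lt_b \<pi> q u (Suc 0) = (lt_b \<pi> q u 0 * u ^ (q ^ 0) + 0) / \<pi>"
| "lt_b \<pi> q u (Suc (Suc k)) =
     (lt_b \<pi> q u (Suc k) * u ^ (q ^ Suc k) + lt_b \<pi> q u k) / \<pi>"

text \<open>For \<open>q > 1\<close> the index set of the sum is empty or a singleton.\<close>

definition lt_log :: "'c::field \<Rightarrow> nat \<Rightarrow> 'c \<Rightarrow> 'c fps"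
  where "lt_log \<pi> q u = Abs_fps (\<lambda>n. \<Sum>k | q ^ k = n. lt_b \<pi> q u k)"

definition lt_smult_fps :: "'c::field \<Rightarrow> nat \<Rightarrow> 'c \<Rightarrow> 'c \<Rightarrow> 'c fps"
  where "lt_smult_fps \<pi> q u a =
    fps_compose (fps_inv (lt_log \<pi> q u)) (fps_const a * lt_log \<pi> q u)"

text \<open>Coefficient of \<open>X\<^sup>i Y\<^sup>j\<close> in \<open>f\<^sup>-\<^sup>1(f(X) + f(Y))\<close>. Two-variable series are series in
  \<open>Y\<close> over series in \<open>X\<close>. As \<open>f(X) + f(Y)\<close> has no constant term, its \<open>n\<close>-th power
  does not contribute for \<open>n > i + j\<close>.\<close>

definition lt_add_coeff :: "'c::field \<Rightarrow> nat \<Rightarrow> 'c \<Rightarrow> nat \<Rightarrow> nat \<Rightarrow> 'c"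
  where "lt_add_coeff \<pi> q u i j =
    (let f = lt_log \<pi> q u;
         fX = fps_const f :: 'c fps fps;
         fY = Abs_fps (\<lambda>m. fps_const (fps_nth f m)) :: 'c fps fps
     in \<Sum>n\<le>i + j. fps_nth (fps_inv f) n * fps_nth (fps_nth ((fX + fY) ^ n) j) i)"

definition lt_smult ::
    "'c::{field_char_0,complete_space} \<Rightarrow> nat \<Rightarrow> 'c \<Rightarrow> 'c \<Rightarrow> 'c \<Rightarrow> 'c"
  where "lt_smult \<pi> q u a x = (\<Sum>n. fps_nth (lt_smult_fps \<pi> q u a) n * x ^ n)"

definition lt_add ::
    "'c::{field_char_0,complete_space} \<Rightarrow> nat \<Rightarrow> 'c \<Rightarrow> 'c \<Rightarrow> 'c \<Rightarrow> 'c"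
  where "lt_add \<pi> q u x y =
    (\<Sum>\<^sub>\<infinity>(i, j)\<in>UNIV. lt_add_coeff \<pi> q u i j * x ^ i * y ^ j)"

definition lt_torsion ::
    "('c::{field_char_0,complete_space} \<Rightarrow> ereal) \<Rightarrow> 'c \<Rightarrow> nat \<Rightarrow> 'c \<Rightarrow> 'c \<Rightarrow> 'c set"
  where "lt_torsion v \<pi> q u a = {x. 0 < v x \<and> lt_smult \<pi> q u a x = 0}"

definition torsion_basis ::
    "'c::{field_char_0,complete_space} set \<Rightarrow> ('c \<Rightarrow> ereal) \<Rightarrow> 'c \<Rightarrow> nat \<Rightarrow> 'c \<Rightarrow> 'c \<Rightarrow> 'c \<Rightarrow> bool"
  where "torsion_basis F v \<pi> q u x y \<longleftrightarrow>
    (let OF = carrier (val_ring v F); M = lt_torsion v \<pi> q u (\<pi>\<^sup>2);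
         comb = (\<lambda>a b. lt_add \<pi> q u (lt_smult \<pi> q u a x) (lt_smult \<pi> q u b y))
     in x \<in> M \<and> y \<in> M
        \<and> (\<forall>z\<in>M. \<exists>a\<in>OF. \<exists>b\<in>OF. z = comb a b)
        \<and> (\<forall>a\<in>OF. \<forall>b\<in>OF. comb a b = 0 \<longrightarrow>
              (\<exists>c\<in>OF. a = \<pi>\<^sup>2 * c) \<and> (\<exists>d\<in>OF. b = \<pi>\<^sup>2 * d)))"


section \<open>The Lubin--Tate space and the affinoids\<close>

text \<open>Points are triples \<open>(X\<^sub>2, Y\<^sub>2, u)\<close>.\<close>

definition lt_space ::
    "'c::{field_char_0,complete_space} set \<Rightarrow> ('c \<Rightarrow> ereal) \<Rightarrow> 'c \<Rightarrow> nat \<Rightarrow> ('c \<times> 'c \<times> 'c) set"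
  where "lt_space F v \<pi> q = {(X2, Y2, u). 0 < v u \<and> torsion_basis F v \<pi> q u X2 Y2}"

definition Z110 ::
    "'c::{field_char_0,complete_space} set \<Rightarrow> ('c \<Rightarrow> ereal) \<Rightarrow> 'c \<Rightarrow> nat \<Rightarrow> ('c \<times> 'c \<times> 'c) set"
  where "Z110 F v \<pi> q = {(X2, Y2, u) \<in> lt_space F v \<pi> q.
      v u = ereal (1 / 2)
    \<and> v (lt_smult \<pi> q u \<pi> X2) = ereal (1 / (2 * (real q - 1)))
    \<and> v X2 = ereal (1 / (2 * real q ^ 2 * (real q - 1)))
    \<and> v (lt_smult \<pi> q u \<pi> Y2) = ereal (1 / (2 * real q * (real q - 1)))
    \<and> v Y2 = ereal (1 / (2 * real q ^ 3 * (real q - 1)))}"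

definition Z11inf ::
    "'c::{field_char_0,complete_space} set \<Rightarrow> ('c \<Rightarrow> ereal) \<Rightarrow> 'c \<Rightarrow> nat \<Rightarrow> ('c \<times> 'c \<times> 'c) set"
  where "Z11inf F v \<pi> q = {(X2, Y2, u). (Y2, X2, u) \<in> Z110 F v \<pi> q}"


section \<open>Affinoid functions and the reduction\<close>

text \<open>Each of the coordinates \<open>u, X\<^sub>1, X\<^sub>2, Y\<^sub>1, Y\<^sub>2\<close> has constant absolute value on the
  affinoids above, which are thereby closed analytic subspaces of a five-dimensional
  polyannulus. Their affinoid algebra is hence the image of the Laurent--Tate algebra of
  that polyannulus. For a Laurent series, belonging to this Tate algebra (terms tending to
  \<open>0\<close>) is the same as being unconditionally summable at the points of the affinoid. As the affinoids
  are reduced (they are open in a smooth curve), their functions are determined by the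
  values at \<open>C\<close>-points and are represented here as functions on the set \<open>S\<close> of points,
  extended by \<^const>\<open>undefined\<close> outside \<open>S\<close>.\<close>

fun lt_monomial ::
    "'c::{field_char_0,complete_space} \<Rightarrow> nat \<Rightarrow> int \<times> int \<times> int \<times> int \<times> int \<Rightarrow> 'c \<times> 'c \<times> 'c \<Rightarrow> 'c"
  where "lt_monomial \<pi> q (n1, n2, n3, n4, n5) (X2, Y2, u) =
    u powi n1 * lt_smult \<pi> q u \<pi> X2 powi n2 * X2 powi n3
      * lt_smult \<pi> q u \<pi> Y2 powi n4 * Y2 powi n5"

definition affinoid_functions ::
    "'c::{field_char_0,complete_space} \<Rightarrow> nat \<Rightarrow> ('c \<times> 'c \<times> 'c) set \<Rightarrow> ('c \<times> 'c \<times> 'c \<Rightarrow> 'c) set"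
  where "affinoid_functions \<pi> q S = {f \<in> extensional S.
    \<exists>c. \<forall>P\<in>S. ((\<lambda>n. c n * lt_monomial \<pi> q n P) has_sum f P) UNIV}"

text \<open>The Banach algebra topology of a reduced affinoid algebra is that of uniform
  convergence on the points.\<close>

definition power_bounded ::
    "('c \<times> 'c \<times> 'c) set \<Rightarrow> ('c \<times> 'c \<times> 'c \<Rightarrow> 'c::{field_char_0,complete_space}) \<Rightarrow> bool"
  where "power_bounded S f \<longleftrightarrow> bounded {f P ^ n | P n. P \<in> S}"

definition top_nilpotent ::
    "('c \<times> 'c \<times> 'c) set \<Rightarrow> ('c \<times> 'c \<times> 'c \<Rightarrow> 'c::{field_char_0,complete_space}) \<Rightarrow> bool"
  where "top_nilpotent S f \<longleftrightarrow> uniform_limit S (\<lambda>n P. f P ^ n) (\<lambda>_. 0) sequentially"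

definition power_bounded_ring ::
    "'c::{field_char_0,complete_space} \<Rightarrow> nat \<Rightarrow> ('c \<times> 'c \<times> 'c) set \<Rightarrow> ('c \<times> 'c \<times> 'c \<Rightarrow> 'c) ring"
  where "power_bounded_ring \<pi> q S =
    \<lparr>carrier = {f \<in> affinoid_functions \<pi> q S. power_bounded S f},
     mult = (\<lambda>f g. \<lambda>P\<in>S. f P * g P), one = (\<lambda>P\<in>S. 1),
     zero = (\<lambda>P\<in>S. 0), add = (\<lambda>f g. \<lambda>P\<in>S. f P + g P)\<rparr>"

definition top_nilpotent_ideal ::
    "'c::{field_char_0,complete_space} \<Rightarrow> nat \<Rightarrow> ('c \<times> 'c \<times> 'c) set \<Rightarrow> ('c \<times> 'c \<times> 'c \<Rightarrow> 'c) set"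
  where "top_nilpotent_ideal \<pi> q S = {f \<in> affinoid_functions \<pi> q S. top_nilpotent S f}"

definition reduction_ring ::
    "'c::{field_char_0,complete_space} \<Rightarrow> nat \<Rightarrow> ('c \<times> 'c \<times> 'c) set \<Rightarrow> ('c \<times> 'c \<times> 'c \<Rightarrow> 'c) set ring"
  where "reduction_ring \<pi> q S = power_bounded_ring \<pi> q S Quot top_nilpotent_ideal \<pi> q S"

text \<open>Structure map from the valuation ring of \<open>C\<close>; it factors through the residue field.\<close>

definition reduction_const ::
    "'c::{field_char_0,complete_space} \<Rightarrow> nat \<Rightarrow> ('c \<times> 'c \<times> 'c) set \<Rightarrow> 'c \<Rightarrow> ('c \<times> 'c \<times> 'c \<Rightarrow> 'c) set"
  where "reduction_const \<pi> q S a =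
    top_nilpotent_ideal \<pi> q S +>\<^bsub>power_bounded_ring \<pi> q S\<^esub> (\<lambda>P\<in>S. a)"


section \<open>Spectra\<close>

definition prime_spectrum :: "('a, 'b) ring_scheme \<Rightarrow> 'a set set"
  where "prime_spectrum R = {P. primeideal P R}"

definition zariski_topology :: "('a, 'b) ring_scheme \<Rightarrow> 'a set topology"
  where "zariski_topology R =
    topology_generated_by {{P \<in> prime_spectrum R. f \<notin> P} | f. f \<in> carrier R}"

text \<open>The coordinate ring of a closed subset \<open>V\<close> of the spectrum with its reduced
  subscheme structure. Since reductions of affinoids are reduced rings, for \<open>V\<close> open and
  closed (as is a connected component, when there are finitely many of them) this is also
  the ring of functions on the open subscheme \<open>V\<close>.\<close>

definition closed_subset_ring :: "('a, 'b) ring_scheme \<Rightarrow> 'a set set \<Rightarrow> 'a set ring"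
  where "closed_subset_ring R V = R Quot (\<Inter>V)"

definition closed_subset_restrict ::
    "('a, 'b) ring_scheme \<Rightarrow> 'a set set \<Rightarrow> 'a \<Rightarrow> 'a set"
  where "closed_subset_restrict R V f = (\<Inter>V) +>\<^bsub>R\<^esub> f"


section \<open>The curve \<open>Z\<^sup>q = \<zeta>(y\<^sup>q\<^sup>2\<^sup>-\<^sup>1 + y\<^sup>-\<^sup>(\<^sup>q\<^sup>2\<^sup>-\<^sup>1\<^sup>))\<close> with \<open>y \<noteq> 0\<close>\<close>

text \<open>Its coordinate ring is presented as \<open>k[y, w, Z]\<close> modulo \<open>y w - 1\<close> and
  \<open>Z\<^sup>q - \<zeta>(y\<^sup>q\<^sup>2\<^sup>-\<^sup>1 + w\<^sup>q\<^sup>2\<^sup>-\<^sup>1)\<close>, the polynomial ring being \<open>k[y][w][Z]\<close>.\<close>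

definition up_const :: "('a, 'b) ring_scheme \<Rightarrow> 'a \<Rightarrow> nat \<Rightarrow> 'a"
  where "up_const R a = up_ring.monom (UP R) a 0"

definition up_var :: "('a, 'b) ring_scheme \<Rightarrow> nat \<Rightarrow> 'a"
  where "up_var R = up_ring.monom (UP R) \<one>\<^bsub>R\<^esub> 1"

definition poly3_const :: "('a, 'b) ring_scheme \<Rightarrow> 'a \<Rightarrow> nat \<Rightarrow> nat \<Rightarrow> nat \<Rightarrow> 'a"
  where "poly3_const k a = up_const (UP (UP k)) (up_const (UP k) (up_const k a))"

definition curve_ideal ::
    "('a, 'b) ring_scheme \<Rightarrow> nat \<Rightarrow> 'a \<Rightarrow> (nat \<Rightarrow> nat \<Rightarrow> nat \<Rightarrow> 'a) set"
  where "curve_ideal k q \<zeta> =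
    (let R = UP (UP (UP k));
         y = up_const (UP (UP k)) (up_const (UP k) (up_var k));
         w = up_const (UP (UP k)) (up_var (UP k));
         Z = up_var (UP (UP k));
         m = q\<^sup>2 - 1
     in Idl\<^bsub>R\<^esub> {y \<otimes>\<^bsub>R\<^esub> w \<ominus>\<^bsub>R\<^esub> \<one>\<^bsub>R\<^esub>,
               Z [^]\<^bsub>R\<^esub> q \<ominus>\<^bsub>R\<^esub> poly3_const k \<zeta> \<otimes>\<^bsub>R\<^esub> (y [^]\<^bsub>R\<^esub> m \<oplus>\<^bsub>R\<^esub> w [^]\<^bsub>R\<^esub> m)})"

definition curve_ring ::
    "('a, 'b) ring_scheme \<Rightarrow> nat \<Rightarrow> 'a \<Rightarrow> (nat \<Rightarrow> nat \<Rightarrow> nat \<Rightarrow> 'a) set ring"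
  where "curve_ring k q \<zeta> = UP (UP (UP k)) Quot curve_ideal k q \<zeta>"

definition curve_const ::
    "('a, 'b) ring_scheme \<Rightarrow> nat \<Rightarrow> 'a \<Rightarrow> 'a \<Rightarrow> (nat \<Rightarrow> nat \<Rightarrow> nat \<Rightarrow> 'a) set"
  where "curve_const k q \<zeta> a = curve_ideal k q \<zeta> +>\<^bsub>UP (UP (UP k))\<^esub> poly3_const k a"

text \<open>Isomorphism over the residue field of \<open>C\<close> of a closed subset \<open>V\<close> of the reduction with
  the curve, as an isomorphism of coordinate rings. Linearity is expressed over the
  valuation ring of \<open>C\<close>, which surjects onto the residue field.\<close>

definition isomorphic_to_curve ::
    "('c \<Rightarrow> ereal) \<Rightarrow> 'c::{field_char_0,complete_space} \<Rightarrow> nat \<Rightarrow> ('c \<times> 'c \<times> 'c) set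
      \<Rightarrow> ('c \<times> 'c \<times> 'c \<Rightarrow> 'c) set set set \<Rightarrow> 'c set \<Rightarrow> bool"
  where "isomorphic_to_curve v \<pi> q S V \<zeta> \<longleftrightarrow>
    (let R = reduction_ring \<pi> q S; k = residue_field v UNIV
     in \<exists>\<phi> \<in> ring_iso (closed_subset_ring R V) (curve_ring k q \<zeta>).
          \<forall>a \<in> carrier (val_ring v UNIV).
            \<phi> (closed_subset_restrict R V (reduction_const \<pi> q S a))
              = curve_const k q \<zeta> (residue v a))"

end

(* Fix \<lambda> with \<lambda>^(2q^3(q-1)) = \<pi>. On Z_{1,1,0} the functions W = \<Delta>/\<lambda>^(2q^3), where \<Delta> = X_1 Y_1^q - X_1^q Y_1, and
   t, the analogous normalization of the determinant of level two minus its leading part, satisfy W^q = W and t^q = t up to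
   topologically nilpotent functions. Their values in F_q^* x F_q cut the affinoid into q(q-1) pieces, and translating X_2 and
   scaling by roots of unity shows that no piece is empty. With \<eta> = Y_2/\<lambda>, the leading part of the remaining relation is the
   q-th power relation Z^q = W(\<eta>^(q^2-1) + \<eta>^(-(q^2-1))) for an explicit Z.

   On a piece, a function bounded by 1 is approximated by integral combinations of the \<eta>^i Z^l with l < q. These are
   independent after reduction: with \<eta> = \<sigma>^q, the top exponents q i + (q^2 - 1) l of \<sigma> are pairwise distinct. Hence each piece
   reduces to the curve; it is integral, so the pieces are the components, and Z/W in place of Z gives \<zeta> = 1. Exchanging the
   two basis elements carries everything over to Z_{1,1,infinity}. *)
theory Submission
  imports Defs "HOL-Computational_Algebra.Formal_Laurent_Series" "HOL-Library.Function_Algebras"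
begin

text \<open>Pointwise bounds do not suffice: on a piece a function has to be replaced by sums of
  \<eta>^i Z^l, and a function with small values is not at once a small multiple of a limit of such
  sums. The congruences are therefore proved once, in an abstract algebra \<open>G\<close> of
  functions bounded by 1 that contains the integral constants and is closed under uniform limits;
  \<open>Fil n\<close> means divisible by \<open>lam^n\<close> within \<open>G\<close>. It is used
  with all bounded functions (estimates on the affinoid), with limits of integral polynomials on a
  disc (construction of points), and with the limits generated by the normalized functions on a
  piece (normal forms). The determinant D of level two satisfies D^q - \<pi> D = \<Delta> to leading
  order. One approximate solution is a constant times W; the remaining freedom is the kernel of X^q
  - \<pi> X, a line over F_q, and this is what t measures. Z comes from X_2 Y_2^q by subtracting
  three terms whose q-th powers cancel the larger terms of its q-th power. The order in \<lambda> of
  what remains of that q-th power is prime to q, so the normalization of Z needs a q-th root of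
  \<lambda>.\<close>

unbundle no vec_syntax
unbundle fps_syntax

type_synonym 'c triple = "'c \<times> 'c \<times> 'c"

context lubin_tate_setting
begin

subsection \<open>The absolute value\<close>

definition na :: "'c => real"
  where "na x = dist x 0"

lemma na_nonneg [simp]: "0 <= na x" by (simp add: na_def)

lemma na_0 [simp]: "na 0 = 0" by (simp add: na_def)

lemma na_eq_0 [simp]: "na x = 0 \<longleftrightarrow> x = 0" by (simp add: na_def)

lemma na_pos [simp]: "0 < na x \<longleftrightarrow> x ~= 0" by (simp add: na_def)

text \<open>For q = 0 the formula \<open>dist_v\<close> would put 0 and 1 at distance 0, because
  every power of 0 under \<open>powr\<close> is 0.\<close>

lemma q_pos: "0 < q"
proof (rule ccontr)
  assume "\<not> 0 < q"
  hence "dist (1::'c) 0 = 0" using dist_v[of 1 0] by simp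
  thus False by simp
qed

lemma v_real: "x ~= 0 ==> ereal (real_of_ereal (v x)) = v x"
  using v_eq_infinity[of x] v_not_minus_infinity[of x] by (cases "v x") auto

lemma na_v: "x ~= 0 ==> na x = real q powr (- real_of_ereal (v x))" using dist_v[of x 0] by (simp add: na_def)

lemma na_mult: "na (x*y) = na x*na y"
proof (cases "x = 0 \<or> y = 0")
  case False
  hence "real_of_ereal (v (x*y)) = real_of_ereal (v x) + real_of_ereal (v y)"
    using v_mult[of x y] v_real[of x] v_real[of y] by (metis plus_ereal.simps(1) real_of_ereal.simps(1))
  thus ?thesis using False na_v[of x] na_v[of y] na_v[of "x*y"] by (simp add: powr_add[symmetric])
qed auto

lemma na_1 [simp]: "na 1 = 1"
proof -
  have "na 1*na 1 = na (1::'c)" using na_mult[of 1 1] by simp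
  moreover have "na (1::'c) ~= 0" by simp
  ultimately show ?thesis by simp
qed

lemma na_power: "na (x^n) = na x^n" by (induction n) (auto simp: na_mult)

lemma na_minus [simp]: "na (- x) = na x"
proof -
  have "na (-1::'c)*na (-1) = 1" using na_mult[of "-1" "-1"] by simp
  hence "na (-1::'c) = 1" by (metis na_nonneg abs_of_nonneg real_sqrt_abs2 real_sqrt_one)
  thus ?thesis using na_mult[of "-1" x] by simp
qed

lemma na_inverse: "na (inverse x) = inverse (na x)"
proof (cases "x = 0")
  case False
  hence "na x*na (inverse x) = 1" using na_mult[of x "inverse x"] by simp
  thus ?thesis using False by (simp add: field_simps)
qed auto

lemma na_divide: "na (x/y) = na x/na y" by (simp add: divide_inverse na_mult na_inverse)

lemma na_diff_commute: "na (x - y) = na (y - x)" using na_minus[of "x - y"] by simp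

lemma na_dist: "dist x y = na (x - y)" using dist_v[of x y] dist_v[of "x - y" 0] by (simp add: na_def)

lemma na_add: "na (x + y) <= max (na x) (na y)"
proof (cases "x = 0 \<or> y = 0 \<or> x + y = 0")
  case True
  thus ?thesis by (auto simp: le_max_iff_disj)
next
  case False
  have "min (v x) (v y) <= v (x + y)" by (rule v_add)
  hence *: "real_of_ereal (v x) <= real_of_ereal (v (x+y)) \<or> real_of_ereal (v y) <= real_of_ereal (v (x+y))"
    using False v_real[of x] v_real[of y] v_real[of "x+y"] by (metis ereal_less_eq(3) min_def)
  have "1 <= real q" using q_pos by simp
  thus ?thesis using*False na_v[of x] na_v[of y] na_v[of "x+y"] by (auto simp: le_max_iff_disj intro!: powr_mono)
qed

lemma na_add_le: "na x <= r ==> na y <= r ==> na (x + y) <= r" using na_add[of x y] by linarith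

lemma na_add_less: "na x < r ==> na y < r ==> na (x + y) < r" using na_add[of x y] by linarith

lemma na_diff_le: "na x <= r ==> na y <= r ==> na (x - y) <= r" using na_add_le[of x r "-y"] by simp

lemma na_diff_less: "na x < r ==> na y < r ==> na (x - y) < r" using na_add_less[of x r "-y"] by simp

lemma na_add_eq: "na y < na x ==> na (x + y) = na x" using na_add[of x y] na_add[of "x + y" "- y"] by auto

lemma na_eqI: "na (x - y) < na y ==> na x = na y" using na_add_eq[of "x - y" y] by simp

lemma na_sum_le: "0 <= r ==> (!!i. i : A ==> na (f i) <= r) ==> na (sum f A) <= r"
  by (induction A rule: infinite_finite_induct) (auto intro: na_add_le)

lemma na_sum_less: "0 < r ==> (!!i. i : A ==> na (f i) < r) ==> na (sum f A) < r"
  by (induction A rule: infinite_finite_induct) (auto intro: na_add_less)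

lemma na_prod: "na (prod f A) = (\<Prod>i\<in>A. na (f i))"
  by (induction A rule: infinite_finite_induct) (auto simp: na_mult)

lemma na_mult_le1: "na x <= 1 ==> na y <= r ==> na (x*y) <= r" using mult_mono[of "na x" 1 "na y" r] by (simp add: na_mult)

lemma na_mult_less1: "na x <= 1 ==> na y < r ==> na (x*y) < r"
  using mult_right_mono[of "na x" 1 "na y"] by (simp add: na_mult)

lemma na_power_le1: "na x <= 1 ==> na (x^n) <= 1" by (simp add: na_power power_le_one)

lemma na_of_nat: "na (of_nat n) <= 1" by (induction n) (auto intro: na_add_le)

lemma na_diff_power: assumes "na x <= r" "na y <= r" shows "na (x^Suc n - y^Suc n) <= na (x - y) * r^n"
proof -
  have r: "0 <= r" using assms(1) na_nonneg order_trans by blast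
  have "na (\<Sum>p<Suc n. y^(n - p)*x^p) <= r^n"
  proof (rule na_sum_le)
    fix p assume "p : {..<Suc n}"
    hence "r^n = r^(n - p) * r^p" by (simp add: power_add[symmetric])
    thus "na (y^(n - p)*x^p) <= r^n" using assms r by (auto simp: na_mult na_power intro!: mult_mono power_mono)
  qed (use r in simp)
  moreover have "x^Suc n - y^Suc n = (x - y)*(\<Sum>p<Suc n. y^(n - p)*x^p)" by (simp only: power_diff_sumr2 diff_Suc_Suc)
  ultimately show ?thesis by (simp only: na_mult mult_left_mono na_nonneg)
qed

text \<open>That F is a field is hidden in \<open>C_completion\<close>, where it is phrased with the
  operations of \<open>sub_rng Fbar\<close>; the facts are carried over to the operations of the
  type.\<close>

lemma F_subfield: shows F_0: "0 : F" and F_1: "1 : F" and F_add: "x : F ==> y : F ==> x + y : F"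
    and F_minus: "x : F ==> - x : F" and F_mult: "x : F ==> y : F ==> x*y : F" and F_inverse: "x : F ==> inverse x : F"
proof -
  obtain Fbar where "algebraic_closure (sub_rng Fbar) F" using C_completion by blast
  then interpret A: algebraic_closure "sub_rng Fbar" F .
  let ?R = "sub_rng Fbar"
  have op: "mult ?R = (*)" "add ?R = (+)" "one ?R = 1" "zero ?R = 0" "carrier ?R = Fbar" by (simp_all add: sub_rng_def)
  have sr: "subring F ?R" using subfieldE(1)[OF A.subfield_axioms] .
  note E = subringE[OF sr, unfolded op]
  show "0 : F" "1 : F" "x : F ==> y : F ==> x + y : F" "x : F ==> y : F ==> x*y : F" using E by auto
  have m1: "-1 : F"
  proof -
    have "\<ominus>\<^bsub>?R\<^esub> 1 : F" using E by (auto simp: op)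
    moreover have "1 + \<ominus>\<^bsub>?R\<^esub> 1 = 0" using A.r_neg[of 1] E by (auto simp: op)
    ultimately show ?thesis by (metis add_eq_0_iff)
  qed
  thus "x : F ==> - x : F" using E(6)[of "-1" x] by simp
  show "x : F ==> inverse x : F"
  proof (cases "x = 0")
    case False
    assume "x : F"
    hence "inv\<^bsub>?R\<^esub> x : F - {0}" "x \<otimes>\<^bsub>?R\<^esub> inv\<^bsub>?R\<^esub> x = \<one>\<^bsub>?R\<^esub>"
      using A.subfield_m_inv[OF A.subfield_axioms, of x] False by (auto simp: op)
    thus ?thesis unfolding op by (metis DiffD1 inverse_unique)
  qed (use \<open>0 \<in> F\<close> in auto)
qed

lemma F_diff: "x : F ==> y : F ==> x - y : F" using F_add[of x "-y"] F_minus by simp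

lemma F_divide: "x : F ==> y : F ==> x/y : F" by (simp add: divide_inverse F_mult F_inverse)

lemma F_power: "x : F ==> x^n : F" by (induction n) (auto simp: F_1 F_mult)

lemma F_of_nat: "of_nat n : F" by (induction n) (auto simp: F_0 F_1 F_add)

subsection \<open>Residue fields\<close>

text \<open>Covers both F and all of C, so that valuation ring, maximal ideal and residue field are
  treated once for the two.\<close>

definition subf :: "'c set => bool"
  where "subf A \<longleftrightarrow> 1 : A & (ALL x:A. ALL y:A. x - y : A & x*y : A) & (ALL x:A. inverse x : A)"

lemma subf_F: "subf F" and subf_UNIV: "subf UNIV" by (auto simp: subf_def F_1 F_diff F_mult F_inverse)

lemma v_nonneg_iff: "0 <= v x \<longleftrightarrow> na x <= 1" if "1 < q"
proof (cases "x = 0")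
  case False
  hence "0 <= v x \<longleftrightarrow> 0 <= real_of_ereal (v x)"
    using v_real[of x] by (metis ereal_less_eq(3) zero_ereal_def)
  also have "... \<longleftrightarrow> na x <= 1"
    using that na_v[OF False] powr_le_cancel_iff[of "real q" "- real_of_ereal (v x)" 0] by simp
  finally show ?thesis .
qed (use v_eq_infinity[of 0] in auto)

lemma v_pos_iff: "0 < v x \<longleftrightarrow> na x < 1" if "1 < q"
proof (cases "x = 0")
  case False
  hence "0 < v x \<longleftrightarrow> 0 < real_of_ereal (v x)" using v_real[of x] by (metis ereal_less(2) zero_ereal_def)
  also have "... \<longleftrightarrow> na x < 1"
    using that na_v[OF False] powr_less_cancel_iff[of "real q" "- real_of_ereal (v x)" 0] by simp
  finally show ?thesis .
qed (use v_eq_infinity[of 0] in auto)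

lemma v_0: "v 0 = \<infinity>" and v_1: "v 1 = 0"
proof -
  show "v 0 = \<infinity>" by (simp add: v_eq_infinity)
  have "v 1 = v 1 + v 1" using v_mult[of 1 1] by simp
  thus "v 1 = 0" using v_real[of 1]
    by (metis add_cancel_right_right ereal_eq_0(2) plus_ereal.simps(1) real_of_ereal.simps(1) zero_neq_one)
qed

lemma v_minus: "v (- x) = v x"
proof (cases "x = 0")
  case False
  have "v (-1) + v (-1) = 0" using v_mult[of "-1" "-1"] v_1 by simp
  hence "v (-1) = 0" using v_real[of "-1"]
    by (metis add.inverse_inverse add_eq_0_iff ereal_eq_0(2) linordered_ab_group_add_class.double_add_le_zero_iff_single_add_le_zero
        plus_ereal.simps(1) real_of_ereal_0 add.inverse_neutral neg_equal_zero real_of_ereal.simps(1) zero_neq_one)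
  thus ?thesis using v_mult[of "-1" x] by simp
qed auto

lemma carrier_val_ring: "carrier (val_ring v A) = {x : A. 0 <= v x}"
  and val_ring_ops: "mult (val_ring v A) = (*)" "add (val_ring v A) = (+)"
    "one (val_ring v A) = 1" "zero (val_ring v A) = 0" by (simp_all add: val_ring_def sub_rng_def)

lemma subf_props: assumes "subf A" shows subf_0: "0 : A" and subf_minus: "x : A ==> - x : A"
    and subf_add: "x : A ==> y : A ==> x + y : A"
proof -
  have d: "!!x y. x : A ==> y : A ==> x - y : A" and one: "1 : A" using assms by (auto simp: subf_def)
  show z: "0 : A" using d[OF one one] by simp
  show m: "!!x. x : A ==> - x : A" using d[OF z] by simp
  show "x : A ==> y : A ==> x + y : A" using d[of x "-y"] m by simp
qed

lemma v_nonneg_add: "0 <= v x ==> 0 <= v y ==> 0 <= v (x + y)" using v_add[of x y] by (meson min.boundedI order_trans)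

lemma v_pos_add: "0 < v x ==> 0 < v y ==> 0 < v (x + y)" using v_add[of x y] by (meson less_le_trans min_less_iff_conj)

lemma cring_val_ring: assumes "subf A" shows "cring (val_ring v A)"
proof (rule cringI)
  note [simp] = carrier_val_ring val_ring_ops
  show "abelian_group (val_ring v A)"
  proof (rule abelian_groupI)
    fix x assume "x : carrier (val_ring v A)"
    thus "EX y:carrier (val_ring v A). y \<oplus>\<^bsub>val_ring v A\<^esub> x = \<zero>\<^bsub>val_ring v A\<^esub>"
      using subf_minus[OF assms] by (intro bexI[of _ "- x"]) (auto simp: v_minus)
  qed (use subf_add[OF assms] subf_0[OF assms] in \<open>auto simp: v_0 v_nonneg_add algebra_simps\<close>)
  show "comm_monoid (val_ring v A)" using assms by (intro comm_monoidI) (auto simp: v_1 v_mult subf_def)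
qed (auto simp: carrier_val_ring val_ring_ops algebra_simps)

lemma val_ring_a_minus: assumes "subf A" "x : carrier (val_ring v A)" "y : carrier (val_ring v A)"
  shows "x \<ominus>\<^bsub>val_ring v A\<^esub> y = x - y"
proof -
  interpret cring "val_ring v A" by (rule cring_val_ring[OF assms(1)])
  have "(x \<ominus>\<^bsub>val_ring v A\<^esub> y) \<oplus>\<^bsub>val_ring v A\<^esub> y = x"
    using assms by (simp add: a_minus_def a_assoc l_neg)
  thus ?thesis by (simp add: val_ring_ops eq_diff_eq)
qed

lemma ideal_max_ideal: assumes "subf A" shows "ideal (max_ideal v A) (val_ring v A)"
proof -
  interpret cring "val_ring v A" by (rule cring_val_ring[OF assms])
  have inv: "\<ominus>\<^bsub>val_ring v A\<^esub> x = - x" if "x : carrier (val_ring v A)" for x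
    using l_neg[OF that] by (simp add: val_ring_ops eq_neg_iff_add_eq_0)
  have pn: "0 < v (a*x)" if "0 < v a" "0 <= v x" for a x using that v_mult[of a x] by (simp add: add_pos_nonneg)
  show ?thesis
  proof (rule idealI)
    show "subgroup (max_ideal v A) (add_monoid (val_ring v A))"
    proof (rule add.subgroupI)
      show "max_ideal v A ~= {}" using subf_0[OF assms] by (auto simp: max_ideal_def v_0)
    next
      fix a assume a: "a : max_ideal v A"
      hence "\<ominus>\<^bsub>val_ring v A\<^esub> a = - a" by (intro inv) (auto simp: max_ideal_def carrier_val_ring)
      thus "\<ominus>\<^bsub>val_ring v A\<^esub> a : max_ideal v A"
        using a subf_minus[OF assms] by (simp add: max_ideal_def v_minus)
    qed (auto simp: max_ideal_def carrier_val_ring val_ring_ops subf_add[OF assms] v_pos_add)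
  qed (use assms pn in \<open>auto simp: max_ideal_def carrier_val_ring val_ring_ops subf_def ring_axioms mult.commute\<close>)
qed

lemma residue_eq_iff: assumes "subf A" "a : A" "b : A" "0 <= v a" "0 <= v b"
  shows "max_ideal v A +>\<^bsub>val_ring v A\<^esub> a = max_ideal v A +>\<^bsub>val_ring v A\<^esub> b \<longleftrightarrow> 0 < v (a - b)"
proof -
  interpret ideal "max_ideal v A" "val_ring v A" by (rule ideal_max_ideal[OF assms(1)])
  have "a : carrier (val_ring v A)" "b : carrier (val_ring v A)" "a - b : A"
    using assms by (auto simp: carrier_val_ring subf_def)
  thus ?thesis using quotient_eq_iff_same_a_r_cos[OF ideal_axioms, of a b] val_ring_a_minus[OF assms(1), of a b]
    by (auto simp: max_ideal_def)
qed

lemma carrier_residue_field: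
  "carrier (residue_field v A) = (%a. max_ideal v A +>\<^bsub>val_ring v A\<^esub> a) ` carrier (val_ring v A)"
  by (auto simp: residue_field_def FactRing_def A_RCOSETS_def' )

text \<open>The residue classes of 0 and 1 differ, so the residue field has at least two
  elements.\<close>

lemma q_gt_1: "1 < q"
proof -
  let ?r = "%a. max_ideal v F +>\<^bsub>val_ring v F\<^esub> a"
  have "?r 0 ~= ?r 1" using residue_eq_iff[OF subf_F F_0 F_1] v_minus[of 1] by (simp add: v_0 v_1)
  moreover have "{?r 0, ?r 1} <= carrier (residue_field v F)"
    by (auto simp: carrier_residue_field carrier_val_ring F_0 F_1 v_0 v_1)
  ultimately have "2 <= card (carrier (residue_field v F))"
    using card_mono[OF finite_residue_field, of "{?r 0, ?r 1}"] by simp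
  thus ?thesis using card_residue_field by simp
qed

lemmas v_nonneg_na = v_nonneg_iff[OF q_gt_1]
lemmas v_pos_na = v_pos_iff[OF q_gt_1]

lemma na_pi: "na \<pi> = 1/real q"
proof -
  have "\<pi> ~= 0" using uniformizer(2) v_0 by auto
  thus ?thesis using na_v[of \<pi>] uniformizer(2) q_gt_1 by (simp add: powr_minus field_simps)
qed

text \<open>Discreteness: a positive integral valuation is at least 1. This turns smallness into
  divisibility by \<open>\<pi>\<close> for elements of F.\<close>

lemma na_F_le_pi: assumes "x : F" "na x < 1" shows "na x <= na \<pi>"
proof (cases "x = 0")
  case False
  obtain n where n: "v x = ereal (of_int n)" using F_discrete assms(1) False by blast
  have "0 < n" using assms(2) n by (simp add: v_pos_na[symmetric])
  hence "real q powr (- of_int n) <= real q powr (-1)" using q_gt_1 by (intro powr_mono) auto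
  thus ?thesis using na_v[OF False] n na_pi q_gt_1 by (simp add: powr_minus_divide)
qed auto

lemma pi_nz [simp]: "\<pi> ~= 0" using uniformizer(2) v_0 by auto

lemma na_pi_less: "na \<pi> < 1" using na_pi q_gt_1 by simp

lemma field_residue_field: assumes "subf A" shows "field (residue_field v A)"
proof -
  interpret cring "val_ring v A" by (rule cring_val_ring[OF assms])
  have "maximalideal (max_ideal v A) (val_ring v A)"
  proof (rule maximalidealI)
    show "ideal (max_ideal v A) (val_ring v A)" by (rule ideal_max_ideal[OF assms])
    have "1 : carrier (val_ring v A)" "1 \<notin> max_ideal v A"
      using assms by (auto simp: carrier_val_ring max_ideal_def v_1 subf_def)
    thus "carrier (val_ring v A) ~= max_ideal v A" by metis
  next
    fix J assume J: "ideal J (val_ring v A)" "max_ideal v A <= J" "J <= carrier (val_ring v A)"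
    show "J = max_ideal v A \<or> J = carrier (val_ring v A)"
    proof (cases "J <= max_ideal v A")
      case False
      then obtain x where x: "x : J" "x \<notin> max_ideal v A" by auto
      hence xA: "x : A" "na x = 1" using J(3) by (auto simp: carrier_val_ring max_ideal_def v_nonneg_na v_pos_na)
      hence "x ~= 0" by auto
      have "inverse x : carrier (val_ring v A)"
        using xA assms by (auto simp: carrier_val_ring subf_def v_nonneg_na na_inverse)
      hence "inverse x \<otimes>\<^bsub>val_ring v A\<^esub> x : J" using J(1) x(1) by (simp add: ideal.I_l_closed)
      hence "\<one>\<^bsub>val_ring v A\<^esub> \<in> J" using \<open>x ~= 0\<close> by (simp add: val_ring_ops)
      thus ?thesis using ideal.one_imp_carrier[OF J(1)] by simp
    qed (use J in auto)
  qed
  thus ?thesis unfolding residue_field_def by (rule maximalideal.quotient_is_field[OF _ is_cring])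
qed

lemma residue_ring_hom: assumes "subf A"
  shows "(%a. max_ideal v A +>\<^bsub>val_ring v A\<^esub> a) : ring_hom (val_ring v A) (residue_field v A)"
  unfolding residue_field_def by (rule ideal.rcos_ring_hom[OF ideal_max_ideal[OF assms]])

text \<open>A unit reduces into a group of order q - 1, and for a nonunit both terms are
  small.\<close>

lemma fermat: assumes "a : F" "na a <= 1" shows "na (a^q - a) < 1"
proof (cases "na a < 1")
  case True
  hence "na (a^q) < 1" using q_gt_1 by (simp add: na_power power_less_one_iff)
  thus ?thesis using True by (intro na_diff_less)
next
  case False
  interpret K: field "residue_field v F" by (rule field_residue_field[OF subf_F])
  interpret O: cring "val_ring v F" by (rule cring_val_ring[OF subf_F])
  let ?h = "%a. max_ideal v F +>\<^bsub>val_ring v F\<^esub> a"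
  interpret h: ring_hom_cring "val_ring v F" "residue_field v F" ?h
    by (intro ring_hom_cringI O.is_cring K.is_cring residue_ring_hom[OF subf_F])
  have aO: "a : carrier (val_ring v F)" using assms by (simp add: carrier_val_ring v_nonneg_na)
  have hpow: "?h (a^n) = ?h a [^]\<^bsub>residue_field v F\<^esub> n" for n :: nat
  proof (induction n)
    case (Suc n)
    have "a^n : carrier (val_ring v F)" using assms by (simp add: carrier_val_ring v_nonneg_na F_power na_power_le1)
    thus ?case using Suc h.hom_mult[of "a^n" a] aO by (simp add: val_ring_ops mult.commute)
  qed (use h.hom_one in \<open>simp add: val_ring_ops\<close>)
  have "?h a ~= ?h 0" using residue_eq_iff[OF subf_F, of a 0] assms False by (simp add: F_0 v_nonneg_na v_pos_na)
  hence "?h a : carrier (Multiplicative_Group.mult_of (residue_field v F))"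
    using h.hom_closed[OF aO] h.hom_zero by (simp add: val_ring_ops)
  hence "?h a [^]\<^bsub>Multiplicative_Group.mult_of (residue_field v F)\<^esub> order (Multiplicative_Group.mult_of (residue_field v F)) = \<one>\<^bsub>residue_field v F\<^esub>"
    using group.pow_order_eq_1[OF K.field_mult_group] by simp
  moreover have "order (Multiplicative_Group.mult_of (residue_field v F)) = q - 1"
    using K.order_mult_of[OF finite_residue_field] card_residue_field by (simp add: order_def)
  ultimately have "?h a [^]\<^bsub>residue_field v F\<^esub> (q - 1) = \<one>\<^bsub>residue_field v F\<^esub>"
    by (simp add: Multiplicative_Group.nat_pow_mult_of)
  hence "?h (a^(q - 1)) = ?h 1" using hpow[of "q - 1"] h.hom_one by (simp add: val_ring_ops)
  hence "na (a^(q - 1) - 1) < 1" using residue_eq_iff[OF subf_F, of "a^(q - 1)" 1] assms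
    by (simp add: F_1 F_power v_nonneg_na v_pos_na na_power power_le_one)
  hence "na (a*(a^(q - 1) - 1)) < 1" using assms by (intro na_mult_less1)
  moreover have "a*(a^(q - 1) - 1) = a^q - a" using q_gt_1 by (simp add: algebra_simps power_eq_if)
  ultimately show ?thesis by simp
qed

text \<open>p is odd, so 1 = p - 2k; if 2 were small along with p, so would be 1.\<close>

lemma na_numeral_2: "na 2 = 1"
proof -
  have "\<not> na (2::'c) < 1"
  proof
    assume "na (2::'c) < 1"
    moreover have "na (of_nat p :: 'c) < 1" using residue_char(2) v_pos_na by simp
    moreover have "odd p" using residue_char(1,3) prime_odd_nat[of p] prime_ge_2_nat[of p] by linarith
    then obtain k where "p = 2*k + 1" by (elim oddE)
    hence "(1::'c) = of_nat p - of_nat k*2" by simp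
    ultimately have "na (1::'c) < 1" by (metis na_diff_less na_mult_less1 na_of_nat)
    thus False by simp
  qed
  thus ?thesis using na_of_nat[of 2] by simp
qed

text \<open>For even q, Fermat at -1 would say that 2 is small. Oddness gives (-a)^q = -(a^q) and q
  >= 3, on which the comparisons of exponents rest.\<close>

lemma odd_q: "odd q"
proof
  assume "even q"
  hence "na ((-1)^q - (-1::'c)) < 1" by (intro fermat) (auto simp: F_minus F_1)
  thus False using \<open>even q\<close> na_numeral_2 by simp
qed

lemma q_ge_3: "3 <= q" using odd_q q_gt_1 by (metis One_nat_def Suc_leI Suc_lessI even_numeral numeral_2_eq_2 numeral_3_eq_3)

lemma residue_reps: obtains B where "finite B" "card B = q" "B <= F" "!!b. b : B ==> na b <= 1"
    "!!b c. b : B ==> c : B ==> b ~= c ==> na (b - c) = 1"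
    "!!a. a : F ==> na a <= 1 ==> EX b:B. na (a - b) < 1"
proof -
  let ?h = "%a. max_ideal v F +>\<^bsub>val_ring v F\<^esub> a"
  define r where "r = inv_into (carrier (val_ring v F)) ?h"
  define B where "B = r ` carrier (residue_field v F)"
  have hr: "?h (r x) = x" "r x : carrier (val_ring v F)" if "x : carrier (residue_field v F)" for x
    using that unfolding r_def carrier_residue_field by (auto simp: f_inv_into_f inv_into_into)
  have inj: "inj_on r (carrier (residue_field v F))" by (rule inj_onI) (metis hr(1))
  show ?thesis
  proof (rule that[of B])
    show "finite B" "card B = q" using finite_residue_field card_residue_field card_image[OF inj] by (auto simp: B_def)
    show "B <= F" "!!b. b : B ==> na b <= 1" using hr(2) by (auto simp: B_def carrier_val_ring v_nonneg_na)
    fix b c assume bc: "b : B" "c : B" "b ~= c"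
    hence "?h b ~= ?h c" "b : carrier (val_ring v F)" "c : carrier (val_ring v F)" using hr by (auto simp: B_def)
    moreover from this have "na (b - c) <= 1" by (intro na_diff_le) (auto simp: carrier_val_ring v_nonneg_na)
    ultimately show "na (b - c) = 1" using residue_eq_iff[OF subf_F, of b c] by (auto simp: carrier_val_ring v_pos_na)
  next
    fix a assume a: "a : F" "na a <= 1"
    hence aO: "a : carrier (val_ring v F)" by (simp add: carrier_val_ring v_nonneg_na)
    hence "?h a : carrier (residue_field v F)" by (auto simp: carrier_residue_field)
    hence "r (?h a) : B" "?h a = ?h (r (?h a))" "r (?h a) : carrier (val_ring v F)" using hr by (auto simp: B_def)
    hence "na (a - r (?h a)) < 1"
      using aO residue_eq_iff[OF subf_F, of a "r (?h a)"] by (auto simp: carrier_val_ring v_pos_na)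
    thus "EX b:B. na (a - b) < 1" using \<open>r (?h a) : B\<close> by blast
  qed
qed

end

subsection \<open>Roots of polynomials\<close>

hide_const (open) up_ring.coeff up_ring.monom module.smult Polynomials.degree Polynomials.lead_coeff

context lubin_tate_setting
begin

definition ip :: "'c poly => bool"
  where "ip P \<longleftrightarrow> (ALL i. na (coeff P i) <= 1)"

lemma ip_0 [simp]: "ip 0" and ip_1 [simp]: "ip 1" by (auto simp: ip_def coeff_1)

lemma ip_pCons: "ip (pCons a P) \<longleftrightarrow> na a <= 1 & ip P" by (auto simp: ip_def coeff_pCons split: nat.splits)

lemma ip_add: "ip P ==> ip Q ==> ip (P + Q)" by (auto simp: ip_def intro: na_add_le)

lemma ip_mult: "ip P ==> ip Q ==> ip (P*Q)" by (auto simp: ip_def coeff_mult intro!: na_sum_le na_mult_le1)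

lemma ip_power: "ip P ==> ip (P^n)" by (induction n) (auto intro: ip_mult)

lemma ip_smult: "na a <= 1 ==> ip P ==> ip (smult a P)" by (auto simp: ip_def intro!: na_mult_le1)

lemma ip_sum: "(!!i. i : A ==> ip (f i)) ==> ip (sum f A)" by (induction A rule: infinite_finite_induct) (auto intro: ip_add)

lemma ip_monom: "na a <= 1 ==> ip (monom a n)" by (auto simp: ip_def coeff_monom)

lemma ip_poly: "ip P ==> na x <= 1 ==> na (poly P x) <= 1"
  by (induction P) (auto simp: ip_pCons intro!: na_add_le na_mult_le1)

lemma ip_synthetic_div: "ip P ==> na c <= 1 ==> ip (synthetic_div P c)" by (induction P) (auto simp: ip_pCons ip_poly)

text \<open>Over the residue field: a polynomial with more zeros than its degree vanishes. The
  induction divides by X - a; at the other points this factor is a unit, so the quotient is small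
  there too.\<close>

lemma poly_small_coeffs: assumes "ip P" "degree P < card A" "finite A" "!!a. a : A ==> na a <= 1 & na (poly P a) < 1"
    "!!a b. a : A ==> b : A ==> a ~= b ==> na (a - b) = 1" shows "na (coeff P i) < 1" using assms
proof (induction "card A" arbitrary: A P i)
  case (Suc n)
  then obtain a where a: "a : A" by fastforce
  let ?Q = "synthetic_div P a"
  have dec: "P = [:- a, 1:] * ?Q + [:poly P a:]" by (rule synthetic_div_correct'[symmetric])
  have "na (coeff ?Q i) < 1" for i
  proof (cases "degree P = 0")
    case True
    hence "?Q = 0" by (simp add: synthetic_div_eq_0_iff)
    thus ?thesis by simp
  next
    case False
    show ?thesis
    proof (rule Suc.hyps(1)[of "A - {a}"])
      show "degree ?Q < card (A - {a})" using Suc.hyps(2) Suc.prems a False by (simp add: degree_synthetic_div)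
      fix b assume b: "b : A - {a}"
      have "poly P b = (b - a)*poly ?Q b + poly P a" by (subst dec) (simp add: algebra_simps)
      hence "na (poly P b - poly P a) = na (poly ?Q b)" using Suc.prems(5)[of b a] a b by (simp add: na_mult)
      thus "na b <= 1 & na (poly ?Q b) < 1"
        using Suc.prems(4)[of a] Suc.prems(4)[of b] a b na_diff_less[of "poly P b" 1 "poly P a"] by auto
    qed (use Suc.prems Suc.hyps a in \<open>auto intro: ip_synthetic_div\<close>)
  qed note Q = this
  show ?case
  proof (subst dec, cases i)
    case 0
    have "na a <= 1" "na (poly P a) < 1" using Suc.prems(4) a by auto
    hence "na (- (a*coeff ?Q 0) + poly P a) < 1" using Q by (intro na_add_less) (auto intro: na_mult_less1)
    thus "na (coeff ([:- a, 1:] * ?Q + [:poly P a:]) i) < 1" using 0 by simp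
  next
    case (Suc j)
    have "na (- (a*coeff ?Q (Suc j)) + coeff ?Q j) < 1"
      using Q Suc.prems(4)[OF a] by (intro na_add_less) (auto intro: na_mult_less1)
    thus "na (coeff ([:- a, 1:] * ?Q + [:poly P a:]) i) < 1" using Suc by (simp add: coeff_pCons)
  qed
qed simp

text \<open>That q is a power of p is not among the assumptions. Instead, (X + 1)^q - X^q - 1 has
  degree below q and, by Fermat, small values at q incongruent points of F, so all its coefficients
  are small.\<close>

lemma na_binomial_q: assumes "0 < i" "i < q" shows "na (of_nat (q choose i)) < 1"
proof -
  obtain B where B: "finite B" "card B = q" "B <= F" "!!b. b : B ==> na b <= 1"
    "!!b c. b : B ==> c : B ==> b ~= c ==> na (b - c) = 1" using residue_reps by metis
  define P :: "'c poly" where "P = (\<Sum>i\<in>{0<..<q}. monom (of_nat (q choose i)) i)"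
  have cP: "coeff P j = (if 0 < j & j < q then of_nat (q choose j) else 0)" for j
    unfolding P_def coeff_sum coeff_monom by auto
  have "na (coeff P i) < 1"
  proof (rule poly_small_coeffs[where A = B])
    show "ip P" by (auto simp: ip_def cP na_of_nat)
    have "degree P <= q - 1" by (rule degree_le) (use q_gt_1 in \<open>auto simp: cP\<close>)
    thus "degree P < card B" using B(2) q_gt_1 by simp
    fix b assume b: "b : B"
    have "{..q} = insert 0 (insert q {0<..<q})" using q_gt_1 by auto
    hence "(b + 1)^q = 1 + b^q + poly P b" using q_gt_1 by (simp add: binomial_ring[of b 1 q] P_def poly_sum poly_monom)
    hence "poly P b = ((b + 1)^q - (b + 1)) - (b^q - b)" by simp
    moreover have "na ((b + 1)^q - (b + 1)) < 1" "na (b^q - b) < 1"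
      using B(3,4) b by (auto intro!: fermat F_add F_1 na_add_le)
    ultimately have "na (poly P b) < 1" by (simp only: na_diff_less)
    thus "na b <= 1 & na (poly P b) < 1" using B(4)[OF b] by simp
  qed (use B in auto)
  thus ?thesis using assms by (simp add: cP)
qed

definition bq :: "nat => 'c"
  where "bq i = of_nat (q choose i)/\<pi>"

lemma bq_F: "bq i : F" by (simp add: bq_def F_divide F_of_nat uniformizer)

lemma na_bq: assumes "0 < i" "i < q" shows "na (bq i) <= 1"
proof -
  have "na (of_nat (q choose i)) <= na \<pi>" by (rule na_F_le_pi[OF F_of_nat na_binomial_q[OF assms]])
  thus ?thesis by (simp add: bq_def na_divide)
qed

text \<open>\<open>h\<close> is the embedding of constants: the identity of C,
  \<open>fps_const\<close> for power series, \<open>kc\<close> for functions. The mixed terms carry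
  the factor \<open>h \<pi>\<close> with integral cofactors.\<close>

lemma q_power_sum:
  fixes a b :: "'b::comm_ring_1" and h :: "'c => 'b" assumes "!!n. h (of_nat n) = of_nat n" "!!x y. h (x*y) = h x*h y"
  shows "(a + b)^q = a^q + b^q + h \<pi>*(\<Sum>i\<in>{0<..<q}. h (bq i)*a^i*b^(q - i))"
proof -
  have "{..q} = insert 0 (insert q {0<..<q})" using q_gt_1 by auto
  hence "(a + b)^q = b^q + (a^q + (\<Sum>i\<in>{0<..<q}. of_nat (q choose i)*a^i*b^(q - i)))"
    using q_gt_1 by (simp add: binomial_ring[of a b q])
  also have "(\<Sum>i\<in>{0<..<q}. of_nat (q choose i)*a^i*b^(q - i))
      = (\<Sum>i\<in>{0<..<q}. h \<pi>*(h (bq i)*a^i*b^(q - i)))"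
  proof (rule sum.cong, goal_cases)
    case (2 i)
    have "of_nat (q choose i) = h \<pi>*h (bq i)" unfolding assms(2)[symmetric] by (simp add: bq_def assms(1))
    thus ?case by (simp add: mult.assoc)
  qed simp
  finally show ?thesis by (simp add: sum_distrib_left algebra_simps)
qed

text \<open>In an ultrametric, consecutive differences tending to 0 already make a Cauchy
  sequence.\<close>

lemma na_convergent: assumes "(%j. na (x (Suc j) - x j)) \<longlonglongrightarrow> 0"
  shows "EX L. x \<longlonglongrightarrow> L"
proof -
  have "Cauchy x"
  proof (rule metric_CauchyI)
    fix e :: real assume "0 < e"
    then obtain N where N: "!!n. n \<ge> N ==> na (x (Suc n) - x n) < e" using LIMSEQ_D[OF assms, of e] by auto
    have *: "na (x n - x N) < e" if "n \<ge> N" for n using that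
    proof (induction n rule: dec_induct)
      case (step n)
      hence "na ((x (Suc n) - x n) + (x n - x N)) < e" using N by (intro na_add_less) auto
      thus ?case by simp
    qed (use \<open>0 < e\<close> in simp)
    have "dist (x m) (x n) < e" if "m \<ge> N" "n \<ge> N" for m n
      using na_diff_less[OF *[OF that(1)] *[OF that(2)]] by (simp add: na_dist)
    thus "EX M. \<forall>m\<ge>M. \<forall>n\<ge>M. dist (x m) (x n) < e" by blast
  qed
  thus ?thesis using Cauchy_convergent_iff convergent_def by blast
qed

lemma lim_na: "x \<longlonglongrightarrow> L \<longleftrightarrow> (%n. na (x n - L)) \<longlonglongrightarrow> 0"
  by (subst tendsto_dist_iff) (simp add: na_dist)

lemma na_lim_le: assumes "x \<longlonglongrightarrow> L" "!!n. n \<ge> N ==> na (x n) <= r" shows "na L <= r"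
proof -
  have "(%n. dist (x n) 0) \<longlonglongrightarrow> dist L 0" by (intro tendsto_intros assms)
  thus ?thesis using assms(2) by (intro LIMSEQ_le_const2[of "%n. na (x n)"]) (auto simp: na_def)
qed

section \<open>Algebraic closedness of C\<close>

lemma na_poly_bound: assumes "!!i. na (coeff P i) <= M" "na x <= R" "1 <= R" "0 <= M" "degree P <= n"
  shows "na (poly P x) <= M * R^n" unfolding poly_altdef
proof (rule na_sum_le)
  fix i assume "i : {..degree P}"
  hence "na (x^i) <= R^n" unfolding na_power
    using assms by (meson atMost_iff na_nonneg order_trans power_increasing power_mono)
  thus "na (coeff P i*x^i) <= M * R^n" unfolding na_mult using assms by (intro mult_mono) auto
qed (use assms in auto)

lemma na_poly_diff: assumes "!!i. na (coeff P i) <= M" "na x <= R" "na y <= R" "1 <= R" "0 <= M" "degree P <= n"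
  shows "na (poly P x - poly P y) <= na (x - y)*(M * R^n)"
proof -
  have "poly P x - poly P y = (\<Sum>i\<le>degree P. coeff P i*(x^i - y^i))"
    by (simp add: poly_altdef sum_subtractf algebra_simps)
  also have "na ... <= na (x - y)*(M * R^n)"
  proof (rule na_sum_le)
    fix i assume i: "i : {..degree P}"
    show "na (coeff P i*(x^i - y^i)) <= na (x - y)*(M * R^n)"
    proof (cases i)
      case (Suc j)
      have "na (x^i - y^i) <= na (x - y) * R^j" unfolding Suc by (rule na_diff_power) (use assms in auto)
      also have "... <= na (x - y) * R^n" using i assms Suc by (intro mult_left_mono power_increasing) auto
      finally have "na (coeff P i)*na (x^i - y^i) <= M*(na (x - y) * R^n)" using assms by (intro mult_mono) auto
      thus ?thesis by (simp add: na_mult ac_simps)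
    qed (use assms in simp)
  qed (use assms in auto)
  finally show ?thesis .
qed

text \<open>|P(x)| is the product of the n distances from x to the roots, hence at least the n-th
  power of the smallest one. The induction splits off one root. The parameter K allows the use over
  the algebraic closure of F first and over C afterwards.\<close>

lemma nearest_root:
  assumes K: "subf K" "!!P. lead_coeff P = 1 ==> degree P > 0 ==> (ALL i. coeff P i : K) ==> EX r:K. poly P r = 0"
    and "lead_coeff P = 1" "degree P = n" "0 < n" "ALL i. coeff P i : K"
  shows "EX r:K. poly P r = 0 & na (x - r)^n <= na (poly P x)" using assms(3-6)
proof (induction n arbitrary: P)
  case (Suc n)
  obtain r where r: "r : K" "poly P r = 0" using K(2) Suc.prems by metis
  define Q where "Q = synthetic_div P r"
  have P: "P = [:- r, 1:]*Q" using synthetic_div_correct'[of r P] r by (simp add: Q_def)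
  have K': "a : K ==> b : K ==> a + b : K & a*b : K" for a b using K(1) subf_add by (auto simp: subf_def)
  have pK: "ALL i. coeff R i : K ==> poly R r : K & (ALL i. coeff (synthetic_div R r) i : K)" for R
  proof (induction R)
    case 0 thus ?case by simp
  next
    case (pCons a R)
    hence "a : K" "ALL i. coeff R i : K" by (metis coeff_pCons_0, metis coeff_pCons_Suc)
    thus ?case using pCons.IH K' r(1) by (auto simp: coeff_pCons split: nat.splits)
  qed
  have Q: "lead_coeff Q = 1" "degree Q = n" "ALL i. coeff Q i : K"
  proof -
    show dQ: "degree Q = n" using Suc.prems by (simp add: Q_def degree_synthetic_div)
    show "ALL i. coeff Q i : K" using pK Suc.prems by (auto simp: Q_def)
    have "lead_coeff P = lead_coeff [:- r, 1:]*lead_coeff Q" using lead_coeff_mult[of "[:- r, 1:]" Q] P by simp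
    thus "lead_coeff Q = 1" using Suc.prems by simp
  qed
  have Px: "na (poly P x) = na (x - r)*na (poly Q x)" by (subst P) (simp add: na_mult[symmetric] algebra_simps)
  show ?case
  proof (cases "n = 0")
    case True
    hence "Q = 1" using Q by (metis degree_eq_zeroE lead_coeff_pCons(2) one_pCons pCons_0_0 coeff_pCons_0 degree_0)
    thus ?thesis using r Px True by auto
  next
    case False
    then obtain s where s: "s : K" "poly Q s = 0" "na (x - s)^n <= na (poly Q x)" using Suc.IH Q by blast
    show ?thesis
    proof (cases "na (x - r) <= na (x - s)")
      case True
      hence "na (x - r)^n <= na (poly Q x)" using power_mono[of "na (x - r)" "na (x - s)" n] s by simp
      thus ?thesis using r Px by (auto intro!: bexI[of _ r] mult_left_mono)
    next
      case False
      hence "na (x - s)*na (x - s)^n <= na (x - r)*na (poly Q x)" using s by (intro mult_mono) auto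
      thus ?thesis using s Px P by (auto intro!: bexI[of _ s])
    qed
  qed
qed simp

lemma Fbar_roots: obtains K where "subf K" "closure K = UNIV"
  "!!P. lead_coeff P = 1 ==> degree P > 0 ==> (ALL i. coeff P i : K) ==> EX r:K. poly P r = 0"
proof -
  obtain K where cl: "algebraic_closure (sub_rng K) F" "closure K = UNIV" using C_completion by blast
  from cl(1) interpret A: algebraic_closure "sub_rng K" F .
  let ?R = "sub_rng K"
  have op: "mult ?R = (*)" "add ?R = (+)" "one ?R = 1" "zero ?R = 0" "carrier ?R = K" by (simp_all add: sub_rng_def)
  have pow: "x [^]\<^bsub>?R\<^esub> n = x^n" for x and n :: nat by (induction n) (auto simp: op mult.commute)
  have neg: "- x : K" if "x : K" for x
  proof -
    have "\<ominus>\<^bsub>?R\<^esub> x : K" "x + \<ominus>\<^bsub>?R\<^esub> x = 0"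
      using that A.a_inv_closed[of x] A.r_neg[of x] by (simp_all add: op)
    thus ?thesis by (metis add_eq_0_iff)
  qed
  have inv: "inverse x : K" if "x : K" for x
  proof (cases "x = 0")
    case False
    hence "inv\<^bsub>?R\<^esub> x : K" "x*inv\<^bsub>?R\<^esub> x = 1"
      using that A.field_Units A.Units_inv_closed[of x] A.Units_r_inv[of x] by (auto simp: op)
    thus ?thesis by (metis inverse_unique)
  qed (use that in auto)
  have "subf K" unfolding subf_def
  proof (intro conjI ballI)
    fix x y assume xy: "x : K" "y : K"
    show "x - y : K" using A.a_closed[of x "- y"] xy neg by (simp add: op)
    show "x*y : K" using monoid.m_closed[OF A.monoid_axioms, of x y] xy by (simp add: op)
  qed (use monoid.one_closed[OF A.monoid_axioms] inv in \<open>auto simp: op\<close>)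
  moreover have "EX r:K. poly P r = 0" if P: "lead_coeff P = 1" "degree P > 0" "ALL i. coeff P i : K" for P
  proof -
    have ev: "A.eval (rev cs) x = poly (Poly cs) x" for cs x
      by (induction cs rule: rev_induct) (auto simp: op pow Poly_append poly_monom Poly_snoc)
    \<comment> \<open>Polynomials of \<open>poly_ring\<close> are coefficient lists with the leading
      coefficient first.\<close>
    let ?p = "rev (coeffs P)"
    have "P ~= 0" using P by auto
    hence ne: "coeffs P ~= []" by simp
    have "hd ?p = 1" using ne P by (simp add: hd_rev last_coeffs_eq_coeff_degree)
    moreover have "set ?p <= K" using P(3) by (auto simp: coeffs_def)
    ultimately have "?p : carrier (poly_ring ?R)"
      using \<open>subf K\<close> by (auto simp: univ_poly_carrier[symmetric] polynomial_def op subf_def)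
    hence "A.splitted ?p" and dom: "domain ?R" by (auto intro: A.roots_over_carrier A.domain_axioms)
    hence "size (A.roots ?p) = length ?p - 1" by (simp add: A.splitted_def)
    moreover have "length ?p - 1 > 0" using P by (simp add: length_coeffs_degree \<open>P ~= 0\<close>)
    ultimately obtain r where "r \<in># A.roots ?p" by (metis size_eq_0_iff_empty multiset_nonemptyE not_gr_zero)
    hence "A.is_root ?p r" using A.roots_mem_iff_is_root[OF \<open>?p : carrier (poly_ring ?R)\<close>] by simp
    hence "r : K" "A.eval ?p r = 0" by (auto simp: A.is_root_def op)
    thus ?thesis using ev[of "coeffs P" r] by (auto simp: Poly_coeffs)
  qed
  ultimately show ?thesis using that cl(2) by blast
qed

text \<open>Continuity of roots: P is approximated by monic polynomials \<open>Q j\<close> over the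
  dense algebraically closed subfield, and \<open>nearest_root\<close> chooses their roots
  \<open>x j\<close> so close to one another that they converge; the limit is a root of P.\<close>

lemma C_monic_root: assumes "lead_coeff P = 1" "degree P > 0" shows "EX r. poly P r = (0::'c)"
proof -
  obtain K where K: "subf K" "closure K = UNIV"
    "!!P. lead_coeff P = 1 ==> degree P > 0 ==> (ALL i. coeff P i : K) ==> EX r:K. poly P r = 0" using Fbar_roots by metis
  define n where "n = degree P"
  obtain B where B: "1 <= B" "!!i. na (coeff P i) <= B"
  proof
    show "1 <= Max (insert 1 ((%i. na (coeff P i)) ` {..n}))" by simp
    show "na (coeff P i) <= Max (insert 1 ((%i. na (coeff P i)) ` {..n}))" for i
    proof (cases "i <= n")
      case False
      hence "na (coeff P i) = 0" by (simp add: coeff_eq_0 n_def)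
      thus ?thesis by (simp add: Max_ge_iff)
    qed (auto intro!: max.coboundedI2 Max_ge)
  qed
  \<comment> \<open>Polynomials of degree at most n whose coefficients differ by at most
    \<open>e j\<close> differ by at most \<open>(1/2)^(j*n)\<close> on the disc of radius B; the
    n-th root of this is the step \<open>(1/2)^j\<close>.\<close>
  define e where "e j = (1/2)^(j*n)/B^n" for j :: nat
  have e: "0 < e j" "e j <= 1" "e (Suc j) <= e j" for j
  proof -
    show "0 < e j" using B by (simp add: e_def)
    have "(1/2::real)^(j*n) <= 1" "1 <= B^n" using B by (auto simp: power_le_one)
    hence "(1/2::real)^(j*n) <= B^n" by linarith
    thus "e j <= 1" using B by (simp add: e_def divide_le_eq)
    have "(1/2::real)^(Suc j*n) <= (1/2)^(j*n)" by (rule power_decreasing) auto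
    thus "e (Suc j) <= e j" using B by (auto simp: e_def intro!: divide_right_mono)
  qed
  have "EX Q. lead_coeff Q = 1 & degree Q = n & (ALL i. coeff Q i : K) & (ALL i. na (coeff P i - coeff Q i) <= e j)" for j
  proof -
    have "EX c:K. na (coeff P i - c) <= e j" for i
    proof -
      have "coeff P i : closure K" using K by simp
      then obtain c where "c : K" "dist c (coeff P i) < e j" using e unfolding closure_approachable by blast
      thus ?thesis by (auto simp: na_dist na_diff_commute[of "coeff P i"] intro!: less_imp_le)
    qed
    then obtain c where c: "!!i. c i : K" "!!i. na (coeff P i - c i) <= e j" by metis
    define Q where "Q = (\<Sum>i<n. monom (c i) i) + monom 1 n"
    have cQ: "coeff Q i = (if i < n then c i else if i = n then 1 else 0)" for i
      unfolding Q_def coeff_add coeff_sum coeff_monom by auto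
    have "degree Q = n" by (rule antisym[OF degree_le le_degree]) (auto simp: cQ)
    moreover have "ALL i. na (coeff P i - coeff Q i) <= e j"
      using c e[of j] assms(1) by (auto simp: cQ n_def coeff_eq_0 less_imp_le)
    moreover have "ALL i. coeff Q i : K" using c K(1) subf_0[OF K(1)] by (auto simp: cQ subf_def)
    moreover have "lead_coeff Q = 1" using \<open>degree Q = n\<close> by (simp add: cQ)
    ultimately show ?thesis by blast
  qed
  from choice[OF allI, OF this] have that_choice: "EX Q. ALL j. lead_coeff (Q j) = 1 & degree (Q j) = n & (ALL i. coeff (Q j) i : K) & (ALL i. na (coeff P i - coeff (Q j) i) <= e j)" .
  obtain Q where Q: "!!j. lead_coeff (Q j) = 1" "!!j. degree (Q j) = n" "!!j i. coeff (Q j) i : K"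
    "!!j i. na (coeff P i - coeff (Q j) i) <= e j" using that_choice by blast
  have n: "0 < n" using assms by (simp add: n_def)
  have QB: "na (coeff (Q j) i) <= B" for j i
    using na_diff_le[OF B(2)[of i] order_trans[OF Q(4)[of i j] order_trans[OF e(2) B(1)]]] by simp
  \<comment> \<open>Beyond the radius B the leading term of the monic polynomial would dominate all
    others.\<close>
  have rB: "na r <= B" if "poly (Q j) r = 0" for j r
  proof (rule ccontr)
    assume r: "\<not> na r <= B"
    have "poly (Q j) r = (\<Sum>i<n. coeff (Q j) i * r^i) + r^n"
      using Q(1)[of j] Q(2)[of j] by (simp add: poly_altdef lessThan_Suc_atMost[symmetric])
    hence eq: "na (r^n) = na (\<Sum>i<n. coeff (Q j) i * r^i)" using that by (metis add_eq_0_iff na_minus)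
    have "na (\<Sum>i<n. coeff (Q j) i * r^i) <= B*na r^(n - 1)"
    proof (rule na_sum_le)
      fix i assume "i : {..<n}"
      hence "na r^i <= na r^(n - 1)" using r B by (intro power_increasing) auto
      thus "na (coeff (Q j) i * r^i) <= B*na r^(n - 1)" unfolding na_mult na_power using QB B by (intro mult_mono) auto
    qed (use B in auto)
    also have "... < na r*na r^(n - 1)" using r B by (intro mult_strict_right_mono zero_less_power) linarith+
    finally have "na (r^n) < na r*na r^(n - 1)" by (simp only: eq)
    moreover have "na (r^n) = na r*na r^(n - 1)" using n by (cases n) (auto simp: na_power na_mult)
    ultimately show False by simp
  qed
  have QQ: "na (poly (Q k) r) <= (1/2)^(j*n)" if "poly (Q j) r = 0" "k = Suc j" for j k r
  proof -
    have "na (poly (Q k - Q j) r) <= e j*B^n"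
    proof (rule na_poly_bound)
      fix i
      have "na ((coeff P i - coeff (Q j) i) - (coeff P i - coeff (Q k) i)) <= e j"
        using na_diff_le[OF Q(4)[of i j] order_trans[OF Q(4)[of i "Suc j"] e(3)[of j]]] that by simp
      thus "na (coeff (Q k - Q j) i) <= e j" by simp
      show "na r <= B" "1 <= B" "0 <= e j" using rB[OF that(1)] B(1) e(1)[of j] by auto
      show "degree (Q k - Q j) <= n" using Q(2) by (intro degree_diff_le) auto
    qed
    thus ?thesis using that(1) B(1) by (simp add: e_def)
  qed
  have PQ: "na (poly P r) <= (1/2)^(j*n)" if "poly (Q j) r = 0" for j r
  proof -
    have "na (poly (P - Q j) r) <= e j*B^n"
    proof (rule na_poly_bound)
      show "na (coeff (P - Q j) i) <= e j" for i using Q(4) by simp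
      show "na r <= B" "1 <= B" "0 <= e j" using rB[OF that(1)] B(1) e(1)[of j] by auto
      show "degree (P - Q j) <= n" using Q(2) by (intro degree_diff_le) (auto simp: n_def)
    qed
    thus ?thesis using that B(1) by (simp add: e_def)
  qed
  have "EX x. ALL j. poly (Q j) (x j) = 0 & na (x (Suc j) - x j) <= (1/2)^j"
  proof (rule dependent_nat_choice)
    show "EX x. poly (Q 0) x = 0" using nearest_root[OF K(1,3) Q(1)[of 0] Q(2) n, of 0] Q(3) by blast
  next
    fix x j assume x: "poly (Q j) x = 0"
    obtain r where r: "poly (Q (Suc j)) r = 0" "na (x - r)^n <= na (poly (Q (Suc j)) x)"
      using nearest_root[OF K(1,3) Q(1)[of "Suc j"] Q(2) n, of x] Q(3) by blast
    hence "na (x - r)^n <= ((1/2)^j)^n" using order_trans[OF r(2) QQ[OF x refl]] by (simp add: power_mult)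
    hence "na (x - r) <= (1/2)^j" using n by (subst (asm) power_mono_iff) auto
    thus "EX y. poly (Q (Suc j)) y = 0 & na (y - x) <= (1/2)^j"
      using r(1) na_diff_commute[of r x] by (intro exI[of _ r]) simp
  qed
  then obtain x where x: "!!j. poly (Q j) (x j) = 0" "!!j. na (x (Suc j) - x j) <= (1/2)^j" by blast
  have half: "(%j. (1/2::real)^j) \<longlonglongrightarrow> 0" by (rule LIMSEQ_power_zero) auto
  have "(%j. na (x (Suc j) - x j)) \<longlonglongrightarrow> 0" by (rule Lim_null_comparison[OF _ half]) (use x(2) in auto)
  then obtain L where L: "x \<longlonglongrightarrow> L" using na_convergent by blast
  have LB: "na L <= B" by (rule na_lim_le[OF L, of 0]) (rule rB[OF x(1)])
  have "na (poly P L) <= na (L - x j)*(B*B^n) + (1/2)^j" for j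
  proof -
    have "na ((poly P L - poly P (x j)) + poly P (x j)) <= max (na (poly P L - poly P (x j))) (na (poly P (x j)))"
      by (rule na_add)
    moreover have "na (poly P L - poly P (x j)) <= na (L - x j)*(B*B^n)"
      using LB B rB[OF x(1)] by (intro na_poly_diff) (simp_all add: n_def)
    moreover have "na (poly P (x j)) <= (1/2)^j"
      using PQ[OF x(1)[of j]] power_decreasing[of j "j*n" "1/2::real"] n by (auto intro: order_trans)
    ultimately show ?thesis
      using na_nonneg[of "poly P (x j)"] na_nonneg[of "poly P L - poly P (x j)"] unfolding diff_add_cancel by linarith
  qed
  moreover have "(%j. na (L - x j)*(B*B^n) + (1/2)^j) \<longlonglongrightarrow> 0*(B*B^n) + 0"
    using L half by (intro tendsto_intros) (auto simp: lim_na na_diff_commute)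
  ultimately have "na (poly P L) <= 0" by (intro LIMSEQ_le_const[of _ 0]) auto
  hence "poly P L = 0" using na_nonneg[of "poly P L"] by simp
  thus ?thesis by blast
qed

lemma C_nearest_root: assumes "lead_coeff P = 1" "degree P = n" "0 < n"
  shows "EX r. poly P r = 0 & na (x - r)^n <= na (poly P x)"
  using nearest_root[OF subf_UNIV _ assms, of x] C_monic_root by auto

lemma C_root: assumes "degree P > 0" shows "EX r. poly P r = (0::'c)"
proof -
  have "P ~= 0" using assms by auto
  hence "lead_coeff (smult (inverse (lead_coeff P)) P) = 1" "degree (smult (inverse (lead_coeff P)) P) > 0"
    using assms by auto
  thus ?thesis using C_monic_root[of "smult (inverse (lead_coeff P)) P"] \<open>P ~= 0\<close> by auto
qed

lemma nth_root: assumes "0 < n" obtains r where "r^n = (a::'c)"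
proof -
  have "degree (monom 1 n - [:a:]) = n"
    using assms by (intro antisym[OF degree_le le_degree]) (auto simp: coeff_pCons split: nat.splits)
  then obtain r where "poly (monom 1 n - [:a:]) r = 0" using C_root assms by metis
  thus ?thesis using that[of r] by (simp add: poly_monom)
qed

subsection \<open>Unconditional sums\<close>

text \<open>Terms tend to 0 along cofinite sets. In a complete ultrametric field this is equivalent
  to unconditional summability, over any index set (\<open>has_sum_vanish\<close>,
  \<open>vanish_has_sum\<close>).\<close>

definition vanish :: "('i => 'c) => 'i set => bool"
  where "vanish f A \<longleftrightarrow> (\<forall>e>0. finite {i : A. e <= na (f i)})"

text \<open>The type class of \<open>'c\<close> gives a field and a complete metric without relating
  them; only the ultrametric inequality makes the operations compatible with limits, so sums are
  handled in this form.\<close>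

lemma has_sum_na: "(f has_sum s) A \<longleftrightarrow>
   (\<forall>e>0. EX E. finite E & E <= A & (ALL G. finite G & E <= G & G <= A --> na (sum f G - s) < e))"
  unfolding has_sum_def tendsto_iff eventually_finite_subsets_at_top na_dist by blast

lemma has_sum_vanish: assumes "(f has_sum s) A" shows "vanish f A" unfolding vanish_def
proof (intro allI impI)
  fix e :: real assume "0 < e"
  then obtain E where E: "finite E" "E <= A" "!!G. finite G ==> E <= G ==> G <= A ==> na (sum f G - s) < e"
    using assms unfolding has_sum_na by meson
  have "i : E" if i: "i : A" "e <= na (f i)" for i
  proof (rule ccontr)
    assume "i \<notin> E"
    hence "f i = (sum f (insert i E) - s) - (sum f E - s)" using E(1) by simp
    moreover have "na (sum f (insert i E) - s) < e" "na (sum f E - s) < e" using E(1,2) i by (intro E(3); auto)+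
    ultimately have "na (f i) < e" using na_diff_less by metis
    thus False using i by simp
  qed
  thus "finite {i : A. e <= na (f i)}" by (intro finite_subset[OF _ E(1)]) auto
qed

lemma has_sum_approx: assumes "(f has_sum s) A" "finite E" "E <= A" "!!i. i : A - E ==> na (f i) <= e" "0 <= e"
  shows "na (s - sum f E) <= e"
proof (rule field_le_epsilon)
  fix d :: real assume "0 < d"
  then obtain D where D: "finite D" "D <= A" "!!G. finite G ==> D <= G ==> G <= A ==> na (sum f G - s) < d"
    using assms(1) unfolding has_sum_na by meson
  have "na (sum f (D \<union> E) - s) < d" using D assms by auto
  hence 1: "na (s - sum f (D \<union> E)) <= e + d" using assms(5) by (simp add: na_diff_commute)
  have "sum f (D \<union> E) - sum f E = sum f (D - E)"
    using D(1) assms(2) sum.union_diff2[of D E f] by (metis Diff_Diff_Int Un_Diff add_diff_cancel_right' finite_Un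
        inf_commute sum.subset_diff sup.cobounded2 sup_ge2 Un_Diff_cancel2 Diff_cancel Un_empty_right)
  also have "na ... <= e" by (rule na_sum_le) (use assms D in auto)
  finally have "na (sum f (D \<union> E) - sum f E) <= e + d" using \<open>0 < d\<close> by simp
  from na_add_le[OF 1 this] show "na (s - sum f E) <= e + d" by simp
qed

lemma has_sum_na_le: assumes "(f has_sum s) A" "!!i. i : A ==> na (f i) <= e" "0 <= e" shows "na s <= e"
  using has_sum_approx[OF assms(1), of "{}" e] assms by simp

lemma vanish_has_sum: assumes "vanish f A" shows "EX s. (f has_sum s) A"
proof -
  define E where "E n = {i : A. (1/2)^n <= na (f i)}" for n :: nat
  have E: "finite (E n)" "E n <= A" for n using assms by (auto simp: vanish_def E_def)
  have less: "na (f i) < (1/2)^n" if "i : A - E n" for i n using that by (auto simp: E_def)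
  have half: "(%j. (1/2::real)^j) \<longlonglongrightarrow> 0" by (rule LIMSEQ_power_zero) auto
  have far: "na (sum f G - sum f (E n)) <= (1/2)^n" if "finite G" "E n <= G" "G <= A" for G n
  proof -
    have "sum f G - sum f (E n) = sum f (G - E n)" using that E by (simp add: sum_diff)
    also have "na ... <= (1/2)^n" by (rule na_sum_le) (use that less[of _ n] in \<open>auto intro: less_imp_le\<close>)
    finally show ?thesis .
  qed
  have mono: "E n <= E m" if "n <= m" for n m
  proof -
    have "(1/2::real)^m <= (1/2)^n" using that by (intro power_decreasing) auto
    from order_trans[OF this] show ?thesis unfolding E_def by blast
  qed
  have "(%j. na (sum f (E (Suc j)) - sum f (E j))) \<longlonglongrightarrow> 0"
    by (rule Lim_null_comparison[OF _ half]) (use far E mono in simp)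
  then obtain s where s: "(%n. sum f (E n)) \<longlonglongrightarrow> s" using na_convergent[of "%n. sum f (E n)"] by blast
  have "(f has_sum s) A" unfolding has_sum_na
  proof (intro allI impI)
    fix e :: real assume "0 < e"
    hence "\<forall>\<^sub>F n in sequentially. na (sum f (E n) - s) < e" "\<forall>\<^sub>F n in sequentially. (1/2::real)^n < e"
      using s half by (auto simp: tendsto_iff na_dist)
    hence "\<forall>\<^sub>F n in sequentially. na (sum f (E n) - s) < e & (1/2::real)^n < e" by eventually_elim simp
    then obtain n where n: "na (sum f (E n) - s) < e" "(1/2)^n < e" by (auto simp: eventually_sequentially)
    have "na (sum f G - s) < e" if G: "finite G" "E n <= G" "G <= A" for G
      using na_add_less[OF le_less_trans[OF far[OF G] n(2)] n(1)] by simp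
    thus "EX E. finite E & E <= A & (ALL G. finite G & E <= G & G <= A --> na (sum f G - s) < e)" using E[of n] by blast
  qed
  thus ?thesis by blast
qed

lemma has_sum_uniq: "(f has_sum (s::'c)) A ==> (f has_sum t) A ==> s = t"
  unfolding has_sum_def by (rule tendsto_unique[OF finite_subsets_at_top_neq_bot[of A]])

lemma has_sum_plus: assumes "(f has_sum (s::'c)) A" "(g has_sum t) A" shows "((%i. f i + g i) has_sum (s + t)) A"
  unfolding has_sum_na
proof (intro allI impI)
  fix e :: real assume e: "0 < e"
  obtain D where D: "finite D" "D <= A" "!!G. finite G ==> D <= G ==> G <= A ==> na (sum f G - s) < e"
    using assms(1) e unfolding has_sum_na by meson
  obtain E where E: "finite E" "E <= A" "!!G. finite G ==> E <= G ==> G <= A ==> na (sum g G - t) < e"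
    using assms(2) e unfolding has_sum_na by meson
  have "na ((\<Sum>i\<in>G. f i + g i) - (s + t)) < e" if "finite G" "D \<union> E <= G" "G <= A" for G
  proof -
    have "na ((sum f G - s) + (sum g G - t)) < e" using that D E by (intro na_add_less) auto
    thus ?thesis by (simp add: sum.distrib algebra_simps)
  qed
  thus "EX E. finite E & E <= A & (ALL G. finite G & E <= G & G <= A --> na ((\<Sum>i\<in>G. f i + g i) - (s + t)) < e)"
    using D E by (intro exI[of _ "D \<union> E"]) auto
qed

lemma has_sum_cmult: assumes "(f has_sum (s::'c)) A" shows "((%i. c*f i) has_sum (c * s)) A"
proof (cases "c = 0")
  case False
  show ?thesis unfolding has_sum_na
  proof (intro allI impI)
    fix e :: real assume e: "0 < e"
    hence "0 < e/na c" using False by simp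
    then obtain D where D: "finite D" "D <= A" "!!G. finite G ==> D <= G ==> G <= A ==> na (sum f G - s) < e/na c"
      using assms unfolding has_sum_na by meson
    have "na ((\<Sum>i\<in>G. c*f i) - c * s) < e" if "finite G" "D <= G" "G <= A" for G
      using D(3)[OF that] False by (simp add: sum_distrib_left[symmetric] right_diff_distrib[symmetric] na_mult pos_less_divide_eq mult.commute)
    thus "EX E. finite E & E <= A & (ALL G. finite G & E <= G & G <= A --> na ((\<Sum>i\<in>G. c*f i) - c * s) < e)"
      using D by blast
  qed
qed (auto simp: has_sum_na)

text \<open>Only finitely many terms reach a given size, so they lie in finitely many rows. Up to
  that size each row sum is a finite sum, and the errors of the rows do not accumulate.\<close>

lemma has_sum_Fubini: assumes "(a has_sum (s::'c)) (Sigma A B)" "!!i. i : A ==> ((%j. a (i, j)) has_sum b i) (B i)"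
  shows "(b has_sum s) A" unfolding has_sum_na
proof (intro allI impI)
  fix e' :: real assume e': "0 < e'"
  define e where "e = e'/2"
  have e: "0 < e" "e < e'" using e' by (auto simp: e_def)
  define E where "E = {x : Sigma A B. e <= na (a x)}"
  have E: "finite E" "E <= Sigma A B" using has_sum_vanish[OF assms(1)] e by (auto simp: vanish_def E_def)
  have 1: "na (s - sum a E) <= e" by (rule has_sum_approx[OF assms(1)]) (use E e in \<open>auto simp: E_def\<close>)
  have "na (sum b F - s) < e'" if F: "finite F" "fst ` E <= F" "F <= A" for F
  proof -
    define Ei where "Ei i = {j. (i, j) : E}" for i
    have fin: "finite (Ei i)" for i unfolding Ei_def by (rule finite_subset[OF _ finite_imageI[OF E(1), of snd]]) force
    have "E = Sigma F Ei" using F by (force simp: Ei_def)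
    hence "sum a E = (\<Sum>i\<in>F. \<Sum>j\<in>Ei i. a (i, j))" using F fin by (simp add: sum.Sigma)
    hence "sum b F - sum a E = (\<Sum>i\<in>F. b i - (\<Sum>j\<in>Ei i. a (i, j)))" by (simp add: sum_subtractf)
    also have "na ... <= e"
    proof (rule na_sum_le)
      fix i assume "i : F"
      thus "na (b i - (\<Sum>j\<in>Ei i. a (i, j))) <= e"
        using F E e fin by (intro has_sum_approx[OF assms(2)]) (auto simp: Ei_def E_def)
    qed (use e in simp)
    finally have "na (sum b F - s) <= e" using na_diff_le[OF _ 1, of "sum b F - sum a E"] by simp
    thus ?thesis using e by simp
  qed
  moreover have "finite (fst ` E)" "fst ` E <= A" using E by auto
  ultimately show "EX E. finite E & E <= A & (ALL G. finite G & E <= G & G <= A --> na (sum b G - s) < e')" by blast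
qed

lemma vanish_bounded: assumes "vanish f A" obtains M where "0 < M" "!!i. i : A ==> na (f i) <= M"
proof -
  define E where "E = {i : A. 1 <= na (f i)}"
  have fin: "finite E" using assms by (auto simp: vanish_def E_def)
  have "na (f i) <= Max (insert 1 ((%i. na (f i)) ` E))" if "i : A" for i
  proof (cases "i : E")
    case True thus ?thesis using fin by (intro Max_ge) auto
  next
    case False
    hence "na (f i) <= 1" using that by (auto simp: E_def)
    also have "1 <= Max (insert 1 ((%i. na (f i)) ` E))" using fin by (intro Max_ge) auto
    finally show ?thesis .
  qed
  moreover have "0 < Max (insert 1 ((%i. na (f i)) ` E))" using fin by (intro less_le_trans[OF zero_less_one Max_ge]) auto
  ultimately show ?thesis using that by blast
qed

lemma has_sum_times: assumes "(f has_sum (s::'c)) A" "(g has_sum t) B"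
  shows "((%(i, j). f i*g j) has_sum (s*t)) (A \<times> B)"
proof -
  obtain M where M: "0 < M" "!!i. i : A ==> na (f i) <= M" using vanish_bounded[OF has_sum_vanish[OF assms(1)]] by blast
  obtain N where N: "0 < N" "!!i. i : B ==> na (g i) <= N" using vanish_bounded[OF has_sum_vanish[OF assms(2)]] by blast
  have "vanish (%(i, j). f i*g j) (A \<times> B)" unfolding vanish_def
  proof (intro allI impI)
    fix e :: real assume e: "0 < e"
    have "{x : A \<times> B. e <= na (case x of (i, j) => f i*g j)} <= {i : A. e/N <= na (f i)} \<times> {j : B. e/M <= na (g j)}"
    proof safe
      fix i j assume ij: "i : A" "j : B" "e <= na (f i*g j)"
      have "e <= na (f i)*N" "e <= M*na (g j)"
        using ij mult_left_mono[OF N(2)[OF ij(2)], of "na (f i)"] mult_right_mono[OF M(2)[OF ij(1)], of "na (g j)"]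
        by (auto simp: na_mult)
      thus "e/N <= na (f i)" "e/M <= na (g j)" using M N by (auto simp: pos_divide_le_eq mult.commute)
    qed
    thus "finite {x : A \<times> B. e <= na (case x of (i, j) => f i*g j)}"
      using has_sum_vanish[OF assms(1)] has_sum_vanish[OF assms(2)] e M N by (elim finite_subset) (auto simp: vanish_def)
  qed
  then obtain u where u: "((%(i, j). f i*g j) has_sum u) (A \<times> B)" using vanish_has_sum by blast
  have "((%i. f i*t) has_sum u) A" by (rule has_sum_Fubini[OF u]) (use has_sum_cmult[OF assms(2)] in simp)
  moreover have "((%i. f i*t) has_sum (s*t)) A" using has_sum_cmult[OF assms(1), of t] by (simp add: mult.commute)
  ultimately show ?thesis using u has_sum_uniq by metis
qed

lemma vanish_geometric:
  assumes "!!i. i : A ==> na (f i) <= M * r^(g i)" "r < 1" "0 <= r" "!!n::nat. finite {i : A. g i <= n}" shows "vanish f A"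
  unfolding vanish_def
proof (intro allI impI)
  fix e :: real assume e: "0 < e"
  have "(%n. M * r^n) \<longlonglongrightarrow> M*0" by (intro tendsto_intros LIMSEQ_power_zero) (use assms in auto)
  hence "\<forall>\<^sub>F n in sequentially. M * r^n < e" using e by (auto simp: order_tendsto_iff)
  then obtain N where N: "!!n. n \<ge> N ==> M * r^n < e" by (auto simp: eventually_sequentially)
  have "{i : A. e <= na (f i)} <= {i : A. g i <= N}"
  proof safe
    fix i assume i: "i : A" "e <= na (f i)"
    hence "e <= M * r^g i" using assms(1) by (meson order_trans)
    thus "g i <= N" using N[of "g i"] by (meson linorder_not_less nat_le_linear order.strict_trans1)
  qed
  thus "finite {i : A. e <= na (f i)}" using assms(4) by (rule finite_subset)
qed

text \<open>On points, scalar multiplication is defined by an ordered series and addition by an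
  unconditional sum; this links the two.\<close>

lemma has_sum_suminf: assumes "(f has_sum (s::'c)) (UNIV :: nat set)" shows "(\<Sum>n. f n) = s"
proof -
  have "(%n. sum f {..<n}) \<longlonglongrightarrow> s" unfolding lim_na
  proof (rule LIMSEQ_I)
    fix e :: real assume "0 < e"
    then obtain E where E: "finite E" "!!G. finite G ==> E <= G ==> na (sum f G - s) < e"
      using assms unfolding has_sum_na by (metis subset_UNIV)
    obtain N where N: "E <= {..<N}" using E(1) finite_nat_iff_bounded by blast
    have "na (sum f {..<n} - s) < e" if "n \<ge> N" for n
      using E(2)[of "{..<n}"] N that by (metis finite_lessThan lessThan_subset_iff order_trans)
    thus "EX no. \<forall>n\<ge>no. norm (na (sum f {..<n} - s) - 0) < e" by auto
  qed
  hence "f sums s" by (simp add: sums_def)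
  thus ?thesis by (rule sums_unique[symmetric])
qed

lemma has_sum_finite_support: assumes "finite E" "E <= A" "!!i. i : A - E ==> f i = (0::'c)" shows "(f has_sum (sum f E)) A"
  unfolding has_sum_na
proof (intro allI impI exI[of _ E] conjI)
  fix e :: real and G assume "0 < e" "finite G & E <= G & G <= A"
  moreover from this have "sum f G = sum f E" using assms by (intro sum.mono_neutral_right) auto
  ultimately show "na (sum f G - sum f E) < e" by simp
qed (use assms in auto)

end

subsection \<open>The functional equation lemma\<close>

lemma fps_compose_nth_bound:
  fixes a h :: "'a::comm_ring_1 fps" assumes "h$0 = 0" "M <= N"
  shows "(a oo h)$M = (\<Sum>i\<le>N. (a$i)*(h^i)$M)"
proof -
  have "(\<Sum>i\<le>N. (a$i)*(h^i)$M) = (\<Sum>i\<in>{0..M}. (a$i)*(h^i)$M)"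
    using assms startsby_zero_power_prefix[OF assms(1)] by (intro sum.mono_neutral_right) auto
  thus ?thesis by (simp add: fps_compose_nth)
qed

text \<open>The series have no constant term, so for m >= 2 no factor of h^m can contribute its own
  n-th coefficient. Hence in an induction over coefficients h^m is known one step ahead of
  h.\<close>

lemma fps_power_nth_cong:
  fixes h k :: "'a::comm_ring_1 fps"
  assumes "h$0 = 0" "k$0 = 0" "!!i. i < n ==> (h$i) = k$i" "2 <= m"
  shows "(h^m)$n = (k^m)$n"
proof -
  have a: "(h^Suc j)$i = (k^Suc j)$i" if "i < n + j" for i j using that
  proof (induction j arbitrary: i)
    case (Suc j)
    have "h$l*(h^Suc j)$(i - l) = k$l*(k^Suc j)$(i - l)" if "l : {0..i}" for l
    proof (cases "l = 0")
      case False
      hence *: "(h^Suc j)$(i - l) = (k^Suc j)$(i - l)" using Suc that by auto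
      show ?thesis
      proof (cases "l < n")
        case False
        hence "i - l < Suc j" using Suc.prems by auto
        hence "(h^Suc j)$(i - l) = 0" "(k^Suc j)$(i - l) = 0"
          using startsby_zero_power_prefix assms(1,2) by blast+
        thus ?thesis by simp
      qed (use*assms(3) in simp)
    qed (use assms in simp)
    thus ?case unfolding power_Suc[of _ "Suc j"] fps_mult_nth by (rule sum.cong[OF refl])
  qed (use assms in simp)
  obtain j where "m = Suc (Suc j)" using assms(4) by (metis Suc_le_D add_2_eq_Suc numeral_2_eq_2 Suc_le_mono)
  thus ?thesis using a[of n "Suc j"] by simp
qed

text \<open>The j-th coefficient of h(X^m) can only involve the index j div m, which is below
  n.\<close>

lemma fps_compose_X_power_nth_cong:
  fixes h k :: "'a::comm_ring_1 fps" assumes "!!i. i < n ==> (h$i) = k$i" "1 < m" "0 < n" "j <= n"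
  shows "(h oo fps_X^m)$j = (k oo fps_X^m)$j"
proof -
  have "j div m < n" using assms by (metis div_less_dividend div_less_dividend le_neq_implies_less less_imp_le_nat order.strict_trans2 div_0 bot_nat_0.not_eq_extremum order_le_less_trans)
  thus ?thesis using assms by (simp add: fps_nth_compose_X_power)
qed

lemma fps_power_cong_le:
  fixes h k :: "'a::comm_ring_1 fps" assumes "!!i. i <= n ==> (h$i) = k$i" "i <= n"
  shows "(h^m)$i = (k^m)$i" using assms(2)
proof (induction m arbitrary: i)
  case (Suc m)
  thus ?case using assms(1) by (auto simp: fps_mult_nth intro!: sum.cong)
qed simp

section \<open>Families of integral power series and congruences modulo powers of pi\<close>

context lubin_tate_setting
begin

text \<open>The algebra over the integers of F generated by \<open>G\<close>, as functions. It plays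
  the role of a polynomial ring in the parameters: in u for \<open>{%u. u}\<close>, in u and x for
  \<open>{fst, snd}\<close>.\<close>

inductive_set PA :: "('w => 'c) set => ('w => 'c) set" for G where
  const: "a : F ==> na a <= 1 ==> (%_. a) : PA G"
| gen: "g : G ==> g : PA G"
| add: "g : PA G ==> h : PA G ==> (%w. g w + h w) : PA G"
| mult: "g : PA G ==> h : PA G ==> (%w. g w*h w) : PA G"

lemma PA_0: "(%_. 0) : PA G" and PA_1: "(%_. 1) : PA G" by (auto intro: PA.const F_0 F_1)

lemma PA_cmult: "a : F ==> na a <= 1 ==> h : PA G ==> (%w. a*h w) : PA G" by (rule PA.mult[OF PA.const])

lemma PA_minus: "g : PA G ==> (%w. - g w) : PA G" using PA_cmult[of "-1" g G] F_minus[OF F_1] by simp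

lemma PA_diff: "g : PA G ==> h : PA G ==> (%w. g w - h w) : PA G" using PA.add[OF _ PA_minus, of g G h] by simp

lemma PA_sum: "(!!i. i : I ==> g i : PA G) ==> (%w. \<Sum>i\<in>I. g i w) : PA G"
  by (induction I rule: infinite_finite_induct) (auto intro: PA_0 PA.add)

lemma PA_power: "g : PA G ==> (%w. g w^n) : PA G" by (induction n) (auto intro: PA_1 PA.mult)

lemma pi_F: "\<pi> \<in> F" "na \<pi> <= 1" using uniformizer na_pi_less by auto

lemma PA_pi: "h : PA G ==> (%w. \<pi>*h w) : PA G" by (rule PA_cmult[OF pi_F])

lemma PA_pi_power: "h : PA G ==> (%w. \<pi>^n*h w) : PA G" by (rule PA_cmult) (auto simp: F_power pi_F na_power_le1)

text \<open>Power series are handled in families over a parameter space with a map \<open>s\<close> that raises the parameter functions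
  to their \<open>q\<close>-th powers: this stands for the Frobenius lift \<open>u \<mapsto> u\<^sup>q\<close> in Hazewinkel's functional equation lemma.\<close>

definition frobenius_on :: "('w => 'c) set => ('w => 'w) => bool"
  where "frobenius_on G s \<longleftrightarrow> (ALL g:G. ALL w. g (s w) = g w^q)"

text \<open>Modulo \<open>\<pi>\<close>, composition with \<open>s\<close> is the q-th power. Fermat
  gives this for constants, the generators satisfy it exactly, and sums and products inherit
  it.\<close>

lemma PA_frobenius: assumes "frobenius_on G s" "g : PA G"
  shows "(%w. g (s w)) : PA G & (EX h:PA G. ALL w. g w^q = g (s w) + \<pi>*h w)" using assms(2)
proof induction
  case (const a)
  have "na ((a^q - a)/\<pi>) <= 1" using na_F_le_pi[OF _ fermat[OF const]] const by (simp add: na_divide F_diff F_power)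
  thus ?case using const by (auto intro!: PA.const bexI[of _ "%_. (a^q - a)/\<pi>"] F_divide F_diff F_power pi_F)
next
  case (gen g)
  hence "(%w. g (s w)) = (%w. g w^q)" using assms(1) by (simp add: frobenius_on_def)
  hence "g (s w) = g w^q" for w by metis
  moreover have "(%w. g w^q) : PA G" by (intro PA_power PA.gen gen)
  ultimately show ?case by (auto intro!: bexI[OF _ PA_0])
next
  case (add g h)
  then obtain g' h' where *: "g' : PA G" "!!w. g w^q = g (s w) + \<pi>*g' w" "h' : PA G" "!!w. h w^q = h (s w) + \<pi>*h' w"
    by blast
  define k where "k w = g' w + h' w + (\<Sum>i\<in>{0<..<q}. bq i*g w^i*h w^(q - i))" for w
  have "k : PA G" unfolding k_def by (intro PA.add PA_sum PA.mult PA_power*add PA.const bq_F na_bq) auto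
  moreover have "(g w + h w)^q = g (s w) + h (s w) + \<pi>*k w" for w
    using q_power_sum[of "%x. x" "g w" "h w"]*by (simp add: k_def algebra_simps)
  ultimately show ?case using add by (auto intro: PA.add)
next
  case (mult g h)
  then obtain g' h' where *: "g' : PA G" "!!w. g w^q = g (s w) + \<pi>*g' w" "h' : PA G" "!!w. h w^q = h (s w) + \<pi>*h' w"
    by blast
  define k where "k w = g' w*h (s w) + g (s w)*h' w + \<pi>*(g' w*h' w)" for w
  have "k : PA G" unfolding k_def using mult*by (intro PA.add PA.mult PA_pi) auto
  moreover have "(g w*h w)^q = g (s w)*h (s w) + \<pi>*k w" for w using*by (simp add: k_def power_mult_distrib algebra_simps)
  ultimately show ?case using mult by (auto intro: PA.mult)
qed

definition AF :: "('w => 'c) set => ('w => 'c fps) => bool"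
  where "AF G H \<longleftrightarrow> (ALL n. (%w. H w$n) : PA G)"

lemma AF_const: "g : PA G ==> AF G (%w. fps_const (g w))" unfolding AF_def
proof
  show "(%w. (fps_const (g w))$n) : PA G" if "g : PA G" for n using that by (cases "n = 0") (auto simp: PA_0)
qed

lemma AF_add: "AF G H ==> AF G K ==> AF G (%w. H w + K w)" by (auto simp: AF_def intro: PA.add)

lemma AF_mult: "AF G H ==> AF G K ==> AF G (%w. H w*K w)" by (auto simp: AF_def fps_mult_nth intro!: PA_sum PA.mult)

lemma AF_power: "AF G H ==> AF G (%w. H w^n)"
proof (induction n)
  case 0
  thus ?case using AF_const[OF PA_1, of G] by simp
qed (auto intro: AF_mult)

lemma AF_sum: "(!!i. i : I ==> AF G (H i)) ==> AF G (%w. \<Sum>i\<in>I. H i w)"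
  by (auto simp: AF_def fps_sum_nth intro!: PA_sum)

lemma AF_X: "AF G (%w. fps_X)" by (auto simp: AF_def PA_0 PA_1 fps_X_def)

lemma AF_compose_X: "AF G H ==> 0 < m ==> AF G (%w. fps_compose (H w) (fps_X^m))" unfolding AF_def
proof
  fix n assume *: "ALL n. (%w. H w$n) : PA G"
  show "(%w. (H w oo fps_X^m)$n) : PA G"
    unfolding fps_nth_compose_X_power using*by (cases "m dvd n") (auto simp: PA_0)
qed

lemma AF_cmult: "a : F ==> na a <= 1 ==> AF G H ==> AF G (%w. fps_const a*H w)" by (intro AF_mult AF_const PA.const)

definition ck :: "('w => 'c) set => nat => ('w => 'c fps) => ('w => 'c fps) => bool"
  where "ck G k H K \<longleftrightarrow> (EX M. AF G M & (ALL w. H w = K w + fps_const (\<pi>^k)*M w))"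

lemma ck_refl: "ck G k H H" unfolding ck_def by (intro exI[of _ "%_. 0"]) (auto simp: AF_def PA_0)

lemma ck_add: assumes "ck G k H H'" "ck G k K K'" shows "ck G k (%w. H w + K w) (%w. H' w + K' w)"
proof -
  obtain M N where "AF G M" "!!w. H w = H' w + fps_const (\<pi>^k)*M w" "AF G N" "!!w. K w = K' w + fps_const (\<pi>^k)*N w"
    using assms unfolding ck_def by blast
  thus ?thesis unfolding ck_def by (intro exI[of _ "%w. M w + N w"]) (auto intro: AF_add simp: algebra_simps)
qed

lemma ck_trans: assumes "ck G k H K" "ck G k K L" shows "ck G k H L"
proof -
  obtain M N where "AF G M" "!!w. H w = K w + fps_const (\<pi>^k)*M w" "AF G N" "!!w. K w = L w + fps_const (\<pi>^k)*N w"
    using assms unfolding ck_def by blast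
  thus ?thesis unfolding ck_def by (intro exI[of _ "%w. M w + N w"]) (auto intro: AF_add simp: algebra_simps)
qed

lemma ck_weaken: assumes "ck G (Suc k) H K" shows "ck G k H K"
proof -
  obtain M where "AF G M" "!!w. H w = K w + fps_const (\<pi>^Suc k)*M w" using assms unfolding ck_def by blast
  thus ?thesis unfolding ck_def
    by (intro exI[of _ "%w. fps_const \<pi>*M w"]) (auto intro: AF_cmult pi_F simp: mult.assoc[symmetric] fps_const_mult mult.commute)
qed

lemma ck_power_q_sum: assumes "AF G H" "AF G K" shows "ck G (Suc 0) (%w. (H w + K w)^q) (%w. H w^q + K w^q)" unfolding ck_def
proof (intro exI conjI allI)
  show "AF G (%w. \<Sum>i\<in>{0<..<q}. fps_const (bq i)*H w^i*K w^(q - i))"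
    by (intro AF_sum AF_mult AF_power assms AF_const PA.const bq_F na_bq) auto
  show "(H w + K w)^q = H w^q + K w^q + fps_const (\<pi>^Suc 0)*(\<Sum>i\<in>{0<..<q}. fps_const (bq i)*H w^i*K w^(q - i))" for w
    by (subst q_power_sum[of fps_const]) (auto simp: fps_of_nat)
qed

text \<open>One factor \<open>\<pi>\<close> is gained: in the mixed terms from the binomial
  coefficients, in the q-th power of the error because q(k + 1) >= k + 2.\<close>

lemma ck_power_q: assumes "ck G (Suc k) H K" "AF G K" shows "ck G (Suc (Suc k)) (%w. H w^q) (%w. K w^q)"
proof -
  obtain M where M: "AF G M" "!!w. H w = K w + fps_const (\<pi>^Suc k)*M w" using assms unfolding ck_def by blast
  let ?M = "%w. fps_const (\<pi>^Suc k)*M w"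
  define N where "N w = fps_const (\<pi>^(Suc k*q - Suc (Suc k)))*M w^q
     + (\<Sum>i\<in>{0<..<q}. fps_const (bq i)*K w^i*(?M w^(q - i - 1)*M w))" for w
  have piF: "\<pi>^n : F" "na (\<pi>^n) <= 1" for n by (auto simp: F_power pi_F na_power_le1)
  have "AF G N" unfolding N_def by (intro AF_add AF_sum AF_mult AF_power AF_const PA.const bq_F na_bq M(1) assms(2) piF) auto
  moreover have "H w^q = K w^q + fps_const (\<pi>^Suc (Suc k))*N w" for w
  proof -
    have le: "Suc (Suc k) <= Suc k*q" using q_ge_3 mult_le_mono2[of 2 q "Suc k"] by simp
    have "?M w^q = fps_const (\<pi>^(Suc k*q))*M w^q" by (simp only: power_mult_distrib fps_const_power power_mult)
    also have "\<pi>^(Suc k*q) = \<pi>^Suc (Suc k)*\<pi>^(Suc k*q - Suc (Suc k))"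
      using le by (simp only: power_add[symmetric] le_add_diff_inverse)
    finally have 1: "?M w^q = fps_const (\<pi>^Suc (Suc k))*(fps_const (\<pi>^(Suc k*q - Suc (Suc k)))*M w^q)"
      by (simp only: fps_const_mult[symmetric] mult.assoc)
    have 2: "fps_const \<pi>*(\<Sum>i\<in>{0<..<q}. fps_const (bq i)*K w^i * ?M w^(q - i))
       = fps_const (\<pi>^Suc (Suc k))*(\<Sum>i\<in>{0<..<q}. fps_const (bq i)*K w^i*(?M w^(q - i - 1)*M w))"
      unfolding sum_distrib_left
    proof (rule sum.cong, goal_cases)
      case (2 i)
      hence "?M w^(q - i) = ?M w^(q - i - 1) * ?M w" by (metis Suc_diff_1 greaterThanLessThan_iff power_Suc2 zero_less_diff)
      moreover have "fps_const (\<pi>^Suc (Suc k)) = fps_const \<pi>*fps_const (\<pi>^Suc k)" by simp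
      ultimately show ?case by (simp only: ac_simps)
    qed simp
    show ?thesis unfolding M(2)
      by (subst q_power_sum[of fps_const]) (simp_all only: fps_of_nat fps_const_mult 1 2 N_def distrib_left add.assoc)
  qed
  ultimately show ?thesis unfolding ck_def by blast
qed

text \<open>The modulus beats the denominator \<open>\<pi>^k\<close> of b_k by one factor, which is
  what \<open>lg_compose_ck\<close> exploits.\<close>

lemma ck_power_qk: assumes "ck G (Suc 0) H K" "AF G K" shows "ck G (Suc k) (%w. H w^(q^k)) (%w. K w^(q^k))"
proof (induction k)
  case (Suc k)
  have "ck G (Suc (Suc k)) (%w. (H w^(q^k))^q) (%w. (K w^(q^k))^q)" by (rule ck_power_q[OF Suc AF_power[OF assms(2)]])
  thus ?case by (simp add: power_mult[symmetric] mult.commute)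
qed (use assms in simp)

lemma ck_compose_X: assumes "ck G k H K" "0 < m"
  shows "ck G k (%w. fps_compose (H w) (fps_X^m)) (%w. fps_compose (K w) (fps_X^m))"
proof -
  obtain M where M: "AF G M" "!!w. H w = K w + fps_const (\<pi>^k)*M w" using assms unfolding ck_def by blast
  have "(fps_X^m)$0 = (0::'c)" using assms(2) by (simp add: fps_X_power_nth)
  thus ?thesis unfolding ck_def M(2) using AF_compose_X[OF M(1) assms(2)]
    by (intro exI[of _ "%w. fps_compose (M w) (fps_X^m)"])
      (auto simp: fps_compose_add_distrib fps_compose_mult_distrib)
qed

text \<open>For polynomials in X: H(X)^q is congruent to H(X^q) with coefficients moved by
  \<open>s\<close>. This goes term by term, since q-th powers are additive modulo
  \<open>\<pi>\<close>.\<close>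

lemma ck_frobenius: assumes s: "frobenius_on G s" and "finite I" and h: "!!i. i : I ==> h i : PA G"
  shows "ck G (Suc 0) (%w. (\<Sum>i\<in>I. fps_const (h i w)*fps_X^i)^q)
     (%w. fps_compose (\<Sum>i\<in>I. fps_const (h i (s w))*fps_X^i) (fps_X^q))" using assms(2) h
proof (induction I)
  case empty
  thus ?case using ck_refl[of G "Suc 0" "%_. 0"] q_gt_1 by (simp add: power_0_left)
next
  case (insert i I)
  let ?t = "%w. fps_const (h i w)*fps_X^i"
  let ?R = "%w. \<Sum>i\<in>I. fps_const (h i w)*fps_X^i"
  have q0: "(fps_X^q)$0 = (0::'c)" using q_gt_1 by (simp add: fps_X_power_nth)
  obtain k where k: "k : PA G" "!!w. h i w^q = h i (s w) + \<pi>*k w" using PA_frobenius[OF s, of "h i"] insert by auto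
  have "ck G (Suc 0) (%w. ?t w^q) (%w. fps_compose (?t (s w)) (fps_X^q))" unfolding ck_def
  proof (intro exI conjI allI)
    show "AF G (%w. fps_const (k w)*fps_X^(i*q))" by (intro AF_mult AF_const AF_power AF_X k)
    fix w
    have "(?t (s w)) oo fps_X^q = fps_const (h i (s w))*fps_X^(i*q)"
      using q0 by (simp add: fps_compose_mult_distrib fps_X_power_compose power_mult[symmetric] mult.commute)
    moreover have "?t w^q = fps_const (h i (s w) + \<pi>*k w)*fps_X^(i*q)"
      by (simp only: power_mult_distrib fps_const_power k(2) power_mult)
    ultimately show "?t w^q = fps_compose (?t (s w)) (fps_X^q) + fps_const (\<pi>^Suc 0)*(fps_const (k w)*fps_X^(i*q))"
      by (simp add: fps_const_add[symmetric] fps_const_mult[symmetric] distrib_right mult.assoc del: fps_const_add fps_const_mult)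
  qed
  from ck_add[OF this insert.IH] have 1: "ck G (Suc 0) (%w. ?t w^q + ?R w^q)
     (%w. fps_compose (?t (s w)) (fps_X^q) + fps_compose (?R (s w)) (fps_X^q))" using insert by simp
  have "ck G (Suc 0) (%w. (?t w + ?R w)^q) (%w. ?t w^q + ?R w^q)"
    using insert by (intro ck_power_q_sum AF_sum AF_mult AF_const AF_power AF_X) auto
  from ck_trans[OF this 1] show ?case using insert by (simp add: fps_compose_add_distrib)
qed

section \<open>The logarithm f and its two functional equations\<close>

abbreviation lb :: "'c => nat => 'c" where "lb \<equiv> lt_b \<pi> q"
abbreviation lg :: "'c => 'c fps" where "lg \<equiv> lt_log \<pi> q"

text \<open>With the index shifted by one, so that \<open>b\<^sub>-\<^sub>1\<close> is at \<open>0\<close>.\<close>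

fun lbs :: "'c => nat => 'c" where
  "lbs u 0 = 0"
| "lbs u (Suc k) = lb u k"

lemma lbs_rec: "\<pi>*lbs u (Suc (Suc k)) = lbs u (Suc k)*u^(q^k) + lbs u k" by (cases k) auto

text \<open>b_k is a sum over the ways to write k as an ordered sum of ones and twos. The definition
  removes the last summand; here the first one is removed, which raises u to its q-th or q^2-th
  power in the rest.\<close>

lemma lbs_rec': "\<pi>*lbs u (Suc (Suc k)) = u*lbs (u^q) (Suc k) + lbs (u^(q^2)) k"
proof (induction k rule: less_induct)
  case (less k)
  consider "k = 0" | "k = 1" | j where "k = Suc (Suc j)" by (metis One_nat_def not0_implies_Suc)
  thus ?case
  proof cases
    case 3
    have u1: "(u^q)^q^Suc j = u^q^k" "(u^q^2)^q^j = u^q^k"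
      by (simp_all add: 3 power_mult[symmetric] power2_eq_square mult.assoc)
    have "\<pi>*(\<pi>*lbs u (Suc (Suc k))) = (\<pi>*lbs u (Suc k))*u^(q^k) + \<pi>*lbs u k"
      by (subst lbs_rec) (simp add: algebra_simps)
    also have "... = (u*lbs (u^q) k + lbs (u^q^2) (Suc j))*u^(q^k)
        + (u*lbs (u^q) (Suc j) + lbs (u^q^2) j)" using less.IH[of "Suc j"] less.IH[of j] by (simp only: 3)
    also have "... = u*(lbs (u^q) (Suc (Suc j))*(u^q)^q^Suc j + lbs (u^q) (Suc j))
        + (lbs (u^q^2) (Suc j)*(u^q^2)^q^j + lbs (u^q^2) j)" unfolding u1 by (simp add: 3 algebra_simps)
    also have "... = \<pi>*(u*lbs (u^q) (Suc k) + lbs (u^q^2) k)" unfolding lbs_rec[symmetric] by (simp add: 3 algebra_simps)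
    finally show ?thesis by simp
  qed (simp_all add: field_simps power_Suc)
qed

lemma lb_integral: assumes "u : PA G" shows "(%w. \<pi>^k*lb (u w) k) : PA G"
proof -
  have "(%w. \<pi>^k*lbs (u w) (Suc k)) : PA G & (%w. \<pi>^k*lbs (u w) k) : PA G"
  proof (induction k)
    case 0
    thus ?case by (auto simp: PA_0 PA_1)
  next
    case (Suc k)
    have "\<pi>^Suc k*lbs (u w) (Suc (Suc k)) = \<pi>^k*lbs (u w) (Suc k)*u w^(q^k) + \<pi>^k*lbs (u w) k" for w
      using lbs_rec[of "u w" k] by (simp only: power_Suc2 mult.assoc distrib_left[symmetric])
    moreover have "\<pi>^Suc k*lbs (u w) (Suc k) = \<pi>*(\<pi>^k*lbs (u w) (Suc k))" for w by simp
    moreover have "(%w. \<pi>^k*lbs (u w) (Suc k)*u w^(q^k) + \<pi>^k*lbs (u w) k) : PA G"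
      "(%w. \<pi>*(\<pi>^k*lbs (u w) (Suc k))) : PA G"
      by (intro PA.add PA.mult PA_power PA_pi Suc[THEN conjunct1] Suc[THEN conjunct2] assms)+
    ultimately show ?case by presburger
  qed
  thus ?thesis by simp
qed

lemma lg_nth_0 [simp]: "lg u$0 = 0" using q_gt_1 by (simp add: lt_log_def)

lemma lg_nth_1 [simp]: "lg u$Suc 0 = 1"
proof -
  have "{k. q^k = Suc 0} = {0}" using q_gt_1 by auto
  thus ?thesis by (simp add: lt_log_def)
qed

lemma less_q_power: "k < q^k" using q_gt_1 power_gt_expt[of q k] by simp

text \<open>The power h^(q^k) starts in degree q^k > k, so every cut-off K >= N gives the same sum;
  the freedom in K is used to match shifted sums.\<close>

lemma lg_compose_nth: assumes "h$0 = 0" "N <= K"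
  shows "(lg u oo h)$N = (\<Sum>k\<le>K. lb u k*(h^(q^k))$N)"
proof -
  have fin: "finite {k. q^k = i}" for i
    by (rule finite_subset[of _ "{..i}"]) (use less_q_power in \<open>auto intro: less_imp_le\<close>)
  have "(lg u oo h)$N = (\<Sum>i\<le>N. \<Sum>k | q^k = i. lb u k*(h^(q^k))$N)"
    using assms(1) by (subst fps_compose_nth_bound[of _ N N]) (auto simp: lt_log_def sum_distrib_right intro!: sum.cong)
  also have "... = (\<Sum>k\<in>(\<Union>i\<in>{..N}. {k. q^k = i}). lb u k*(h^(q^k))$N)"
    by (rule sum.UNION_disjoint[symmetric]) (use fin in auto)
  also have "... = (\<Sum>k\<le>K. lb u k*(h^(q^k))$N)"
  proof (rule sum.mono_neutral_left)
    show "(\<Union>i\<in>{..N}. {k. q^k = i}) <= {..K}"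
      using assms(2) less_q_power by (auto intro: less_imp_le less_le_trans order_trans)
    show "ALL k:{..K} - (\<Union>i\<in>{..N}. {k. q^k = i}). lb u k*(h^(q^k))$N = 0"
      using startsby_zero_power_prefix[OF assms(1)] by auto
  qed simp
  finally show ?thesis .
qed

text \<open>Hazewinkel's functional equation, where the parameter moves by the q-power map; it is
  the recursion \<open>lbs_rec'\<close> summed up.\<close>

lemma lg_functional_eq: assumes "h$0 = 0"
  shows "lg u oo h = h + fps_const (u/\<pi>)*fps_compose (lg (u^q)) (h^q)
     + fps_const (1/\<pi>)*fps_compose (lg (u^q^2)) (h^q^2)"
proof (rule fps_ext)
  fix N
  have hq: "(h^m)$0 = 0" if "0 < m" for m using assms that by simp
  have q2: "0 < q" "0 < q^2" using q_gt_1 by auto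
  have hp: "h^(q^Suc k) = (h^q)^(q^k)" "h^(q^Suc (Suc k)) = (h^q^2)^(q^k)" for k
    by (simp_all add: power_mult[symmetric] power2_eq_square mult.assoc)
  have L: "lbs u (Suc (Suc k)) = u/\<pi>*lbs (u^q) (Suc k) + 1/\<pi>*lbs (u^(q^2)) k" for k
    using lbs_rec'[of u k] by (simp add: field_simps)
  have s: "(\<Sum>k\<le>Suc n. f k) = f 0 + (\<Sum>k\<le>n. f (Suc k))" for f :: "nat => 'c" and n
    by (rule sum.atMost_Suc_shift)
  have "(lg u oo h)$N = (\<Sum>k\<le>Suc (Suc N). lb u k*(h^(q^k))$N)"
    by (rule lg_compose_nth[OF assms]) simp
  also have "... = h$N + (\<Sum>k\<le>Suc N. lb u (Suc k)*(h^(q^Suc k))$N)" by (subst s) simp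
  also have "(\<Sum>k\<le>Suc N. lb u (Suc k)*(h^(q^Suc k))$N)
     = (\<Sum>k\<le>Suc N. lbs u (Suc (Suc k))*(h^(q^Suc k))$N)" by (simp only: lbs.simps)
  also have "... = u/\<pi>*(\<Sum>k\<le>Suc N. lbs (u^q) (Suc k)*(h^(q^Suc k))$N)
      + 1/\<pi>*(\<Sum>k\<le>Suc N. lbs (u^q^2) k*(h^(q^Suc k))$N)"
    by (simp only: L distrib_right sum.distrib sum_distrib_left mult.assoc)
  also have "(\<Sum>k\<le>Suc N. lbs (u^q) (Suc k)*(h^(q^Suc k))$N) = ((lg (u^q)) oo h^q)$N"
    by (subst lg_compose_nth[OF hq[OF q2(1)], of N "Suc N"]) (simp_all only: hp lbs.simps le_SucI order_refl)
  also have "(\<Sum>k\<le>Suc N. lbs (u^q^2) k*(h^(q^Suc k))$N) = ((lg (u^q^2)) oo h^q^2)$N"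
    by (subst s, subst lg_compose_nth[OF hq[OF q2(2)], of N N]) (simp_all only: hp(2) lbs.simps order_refl mult_zero_left add_0)
  finally show "(lg u oo h)$N = fps_nth (h + fps_const (u/\<pi>)*fps_compose (lg (u^q)) (h^q)
     + fps_const (1/\<pi>)*fps_compose (lg (u^q^2)) (h^q^2)) N" by simp
qed

text \<open>Here the defining recursion of b_k is summed up and u stays fixed. The equation becomes
  the decomposition of multiplication by \<open>\<pi>\<close> in \<open>sm_pi\<close>.\<close>

lemma lg_pi_eq: assumes "h$0 = 0"
  shows "fps_const \<pi>*fps_compose (lg u) h = fps_const \<pi>*h + fps_compose (lg u) (fps_const u*h^q) + fps_compose (lg u) (h^q^2)"
proof (rule fps_ext)
  fix N
  have hq: "(fps_const u*h^q)$0 = 0" "(h^q^2)$0 = 0" using assms q_gt_1 by auto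
  have hp: "(fps_const u*h^q)^(q^k) = fps_const (u^(q^k))*h^(q^Suc k)" "h^(q^Suc (Suc k)) = (h^q^2)^(q^k)" for k
    by (simp_all only: power_mult[symmetric] power2_eq_square mult.assoc power_Suc power_mult_distrib fps_const_power)
  have s: "(\<Sum>k\<le>Suc n. f k) = f 0 + (\<Sum>k\<le>n. f (Suc k))" for f :: "nat => 'c" and n
    by (rule sum.atMost_Suc_shift)
  have "(lg u oo h)$N = (\<Sum>k\<le>Suc (Suc N). lb u k*(h^(q^k))$N)"
    by (rule lg_compose_nth[OF assms]) simp
  also have "... = h$N + (\<Sum>k\<le>Suc N. lb u (Suc k)*(h^(q^Suc k))$N)" by (subst s) simp
  finally have eq1: "(lg u oo h)$N = h$N + (\<Sum>k\<le>Suc N. lb u (Suc k)*(h^(q^Suc k))$N)" .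
  have t: "(\<pi>*lbs u (Suc (Suc k)))*((h^(q^Suc k))$N)
     = lb u k*((fps_const u*h^q)^(q^k))$N + lbs u k*(h^(q^Suc k))$N" for k
    by (subst lbs_rec) (simp only: lbs.simps distrib_right hp(1) fps_mult_left_const_nth mult.assoc)
  note eq1
  also have eq2: "h$N + (\<Sum>k\<le>Suc N. lb u (Suc k)*(h^(q^Suc k))$N)
     = h$N + (\<Sum>k\<le>Suc N. lbs u (Suc (Suc k))*(h^(q^Suc k))$N)" by (simp only: lbs.simps)
  finally have "\<pi>*(lg u oo h)$N = \<pi>*(h$N)
     + (\<Sum>k\<le>Suc N. (\<pi>*lbs u (Suc (Suc k)))*(h^(q^Suc k))$N)"
    by (simp only: distrib_left sum_distrib_left mult.assoc)
  also have "(\<Sum>k\<le>Suc N. (\<pi>*lbs u (Suc (Suc k)))*(h^(q^Suc k))$N)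
     = (\<Sum>k\<le>Suc N. lb u k*((fps_const u*h^q)^(q^k))$N) + (\<Sum>k\<le>Suc N. lbs u k*(h^(q^Suc k))$N)"
    by (simp only: t sum.distrib)
  also have "(\<Sum>k\<le>Suc N. lbs u k*(h^(q^Suc k))$N) = (\<Sum>k\<le>N. lb u k*((h^q^2)^(q^k))$N)"
    by (subst s) (simp_all only: hp lbs.simps mult_zero_left add_0)
  also have "... = (lg u oo h^q^2)$N" by (rule lg_compose_nth[OF hq(2), symmetric]) simp
  also have "(\<Sum>k\<le>Suc N. lb u k*((fps_const u*h^q)^(q^k))$N) = (lg u oo fps_const u*h^q)$N"
    by (rule lg_compose_nth[OF hq(1), symmetric]) simp
  finally show "((fps_const \<pi>*fps_compose (lg u) h)$N)
      = (fps_const \<pi>*h + fps_compose (lg u) (fps_const u*h^q) + fps_compose (lg u) (h^q^2))$N"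
    by (simp only: fps_add_nth fps_mult_left_const_nth add.assoc)
qed

lemma lg_inv_0 [simp]: "(fps_inv (lg u))$0 = 0" by (simp add: fps_inv_def)

lemma lg_inv_right: "g$0 = 0 ==> fps_compose (lg u) ((fps_inv (lg u)) oo g) = g"
  by (subst fps_compose_assoc) (auto simp: fps_inv_right)

lemma lg_inv_left: "g$0 = 0 ==> fps_compose (fps_inv (lg u)) (lg u oo g) = g"
  by (subst fps_compose_assoc) (auto simp: fps_inv)

text \<open>By \<open>ck_power_qk\<close> the k-th term differs by a multiple of
  \<open>\<pi>^Suc k\<close>, while b_k has denominator at most \<open>\<pi>^k\<close>.\<close>

lemma lg_compose_ck:
  assumes c: "c : PA G" and ck: "ck G (Suc 0) P Q" "AF G Q" "!!w. P w$0 = 0" "!!w. Q w$0 = 0"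
  shows "EX m:PA G. ALL w. ((lg (c w)) oo P w)$N - (((lg (c w)) oo Q w)$N) = \<pi>*m w"
proof -
  have "EX M. AF G M & (ALL w. P w^(q^k) = Q w^(q^k) + fps_const (\<pi>^Suc k)*M w)" for k
    using ck_power_qk[OF ck(1,2), of k] unfolding ck_def .
  then obtain M where M: "!!k. AF G (M k)" "!!k w. P w^(q^k) = Q w^(q^k) + fps_const (\<pi>^Suc k)*M k w" by metis
  define m where "m w = (\<Sum>k\<le>N. (\<pi>^k*lb (c w) k)*M k w$N)" for w
  have "m : PA G" unfolding m_def using M(1) by (intro PA_sum PA.mult[OF lb_integral[OF c]]) (auto simp: AF_def)
  moreover have "((lg (c w)) oo P w)$N - (((lg (c w)) oo Q w)$N) = \<pi>*m w" for w
    by (simp add: lg_compose_nth[OF ck(3) order_refl] lg_compose_nth[OF ck(4) order_refl] sum_subtractf[symmetric] M(2) m_def sum_distrib_left algebra_simps)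
  ultimately show ?thesis by blast
qed

text \<open>Hazewinkel's lemma, by induction over the coefficients of h, the inverse logarithm of g.
  The functional equation writes h as the integral defect \<open>a\<close> plus differences of
  logarithms of h^q and h(X^q), and of h^(q^2) and h(X^(q^2)). In degree n these see only
  coefficients below n, and they are divisible by \<open>\<pi>\<close>.\<close>

lemma functional_equation_integrality: assumes s: "frobenius_on G s" and u: "u : PA G" "!!w. u (s w) = u w^q"
    and g: "!!w. g w$0 = 0" and fe: "AF G (%w. g w - fps_const (u w/\<pi>)*fps_compose (g (s w)) (fps_X^q)
        - fps_const (1/\<pi>)*fps_compose (g (s (s w))) (fps_X^q^2))"
  shows "AF G (%w. fps_compose (fps_inv (lg (u w))) (g w))"
proof -
  define h where "h w = fps_compose (fps_inv (lg (u w))) (g w)" for w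
  define a where "a w = g w - fps_const (u w/\<pi>)*fps_compose (g (s w)) (fps_X^q)
        - fps_const (1/\<pi>)*fps_compose (g (s (s w))) (fps_X^q^2)" for w
  have h0: "h w$0 = 0" for w by (simp add: h_def)
  have fh: "(lg (u w)) oo h w = g w" for w unfolding h_def by (rule lg_inv_right[OF g])
  have q: "0 < q" "1 < q" "0 < q^2" "1 < q^2" "2 <= q" "2 <= q^2" using q_ge_3 mult_le_mono[OF q_ge_3 q_ge_3] by (auto simp: power2_eq_square)
  have X0: "(fps_X^q)$0 = (0::'c)" "(fps_X^q^2)$0 = (0::'c)" using q by auto
  have u2: "u (s (s w)) = u w^q^2" for w using u(2) by (simp add: power_mult[symmetric] power2_eq_square)
  have g1: "(g (s w)) oo fps_X^q = fps_compose (lg (u w^q)) ((h (s w)) oo fps_X^q)" for w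
    by (subst fh[symmetric], subst fps_compose_assoc) (use X0 h0 u in auto)
  have g2: "(g (s (s w))) oo fps_X^q^2 = fps_compose (lg (u w^q^2)) ((h (s (s w))) oo fps_X^q^2)" for w
    by (subst fh[symmetric], subst fps_compose_assoc) (use X0 h0 u2 in auto)
  have heq: "h w = a w
      + fps_const (u w/\<pi>)*(fps_compose (lg (u w^q)) ((h (s w)) oo fps_X^q) - fps_compose (lg (u w^q)) (h w^q))
      + fps_const (1/\<pi>)*(fps_compose (lg (u w^q^2)) ((h (s (s w))) oo fps_X^q^2) - fps_compose (lg (u w^q^2)) (h w^q^2))" for w
    using fh[of w] lg_functional_eq[OF h0, of "u w" w] g1[of w] g2[of w] by (simp add: a_def algebra_simps)
  have "(%w. h w$n) : PA G" for n
  proof (induction n rule: less_induct)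
    case (less n)
    show ?case
    proof (cases "n = 0")
      case True
      thus ?thesis using h0 by (simp add: PA_0)
    next
      case False
      \<comment> \<open>The truncation below degree n is a polynomial with integral coefficients, so
        that \<open>ck_frobenius\<close> applies to it.\<close>
      define H where "H w = (\<Sum>i\<in>{..<n}. fps_const (h w$i)*fps_X^i)" for w
      have Hn: "H w$i = (if i < n then (h w$i) else 0)" for w i
        by (auto simp: H_def fps_sum_nth if_distrib[of "(*) _"] cong: if_cong)
      have H0: "H w$0 = 0" for w using False h0 by (simp add: Hn)
      have AH: "AF G H" unfolding H_def by (intro AF_sum AF_mult AF_const AF_power AF_X less) auto
      have AHs: "AF G (%w. H (s w))" unfolding AF_def using AH PA_frobenius[OF s] by (auto simp: AF_def)
      have AHss: "AF G (%w. H (s (s w)))" unfolding AF_def using AHs PA_frobenius[OF s] by (auto simp: AF_def)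
      have c1: "ck G (Suc 0) (%w. H w^q) (%w. fps_compose (H (s w)) (fps_X^q))"
        unfolding H_def by (rule ck_frobenius[OF s]) (use less in auto)
      have c2: "ck G (Suc 0) (%w. H w^q^2) (%w. fps_compose (H (s (s w))) (fps_X^q^2))"
      proof -
        have "ck G (Suc 0) (%w. (H w^q)^q) (%w. fps_compose (H (s w)) (fps_X^q)^q)"
          by (rule ck_weaken[OF ck_power_q[OF c1 AF_compose_X[OF AHs q(1)]]])
        moreover have "ck G (Suc 0) (%w. H (s w)^q) (%w. fps_compose (H (s (s w))) (fps_X^q))"
          unfolding H_def by (rule ck_frobenius[OF s]) (use less PA_frobenius[OF s] in auto)
        from ck_compose_X[OF this q(1)] have "ck G (Suc 0) (%w. fps_compose (H (s w)) (fps_X^q)^q) (%w. fps_compose (H (s (s w))) (fps_X^q^2))"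
          using X0 by (simp add: fps_compose_power fps_compose_assoc[symmetric] fps_X_power_compose power_mult[symmetric] power2_eq_square)
        ultimately show ?thesis using ck_trans by (simp add: power_mult[symmetric] power2_eq_square) blast
      qed
      have uq: "(%w. u w^q) : PA G" "(%w. u w^q^2) : PA G" by (auto intro: PA_power u)
      have z: "(H w^q)$0 = 0" "((H (s w)) oo fps_X^q)$0 = 0"
        "(H w^q^2)$0 = 0" "((H (s (s w))) oo fps_X^q^2)$0 = 0" for w using H0 q by auto
      obtain m1 where m1: "m1 : PA G" "!!w. (((lg (u w^q)) oo H w^q)$n)
          - (((lg (u w^q)) oo ((H (s w)) oo fps_X^q))$n) = \<pi>*m1 w"
        using lg_compose_ck[OF uq(1) c1 AF_compose_X[OF AHs q(1)], of n] z by blast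
      obtain m2 where m2: "m2 : PA G" "!!w. (((lg (u w^q^2)) oo H w^q^2)$n)
          - (((lg (u w^q^2)) oo ((H (s (s w))) oo fps_X^q^2))$n) = \<pi>*m2 w"
        using lg_compose_ck[OF uq(2) c2 AF_compose_X[OF AHss q(3)], of n] z by blast
      have lgcong: "(lg c oo A)$n = (lg c oo B)$n"
        if "!!i. i <= n ==> (A$i) = B$i" "A$0 = 0" for c A B
        using that fps_power_cong_le[of n A B n] by (subst (1 2) lg_compose_nth[of _ n n]) auto
      have p1: "(lg c oo h w^m)$n = (lg c oo H w^m)$n" if "2 <= m" for c w m
      proof (rule lgcong)
        show "(h w^m)$i = (H w^m)$i" if "i <= n" for i
          by (rule fps_power_nth_cong) (use h0 H0 Hn that \<open>2 <= m\<close> in auto)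
      qed (use h0 that in auto)
      have p2: "(lg c oo (h w oo fps_X^m))$n = (lg c oo (H w oo fps_X^m))$n" if "2 <= m" for c w m
      proof (rule lgcong)
        show "(h w oo fps_X^m)$i = (H w oo fps_X^m)$i" if "i <= n" for i
          by (rule fps_compose_X_power_nth_cong) (use Hn that \<open>2 <= m\<close> False in auto)
      qed (use h0 that in auto)
      have "h w$n = a w$n - u w*m1 w - m2 w" for w
      proof -
        have "h w$n = a w$n - u w/\<pi>*(\<pi>*m1 w) - 1/\<pi>*(\<pi>*m2 w)"
          unfolding m1(2)[symmetric] m2(2)[symmetric] p1[OF q(5), symmetric] p1[OF q(6), symmetric] p2[OF q(5), symmetric] p2[OF q(6), symmetric]
          by (subst heq) (simp only: fps_add_nth fps_sub_nth fps_mult_left_const_nth algebra_simps)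
        thus ?thesis by simp
      qed
      moreover have "(%w. a w$n) : PA G" using fe by (auto simp: a_def AF_def)
      ultimately show ?thesis by (auto intro!: PA_diff PA.mult m1 m2 u)
    qed
  qed
  thus ?thesis by (simp add: AF_def h_def)
qed

end

subsection \<open>The formal module\<close>

lemma poly_sum_unique:
  fixes c d :: "nat => 'a::{idom,ring_char_0}" assumes "!!x. (\<Sum>i\<le>N. c i*x^i) = (\<Sum>i\<le>N. d i*x^i)" "i <= N"
  shows "c i = d i"
proof -
  have "poly (\<Sum>i\<le>N. monom (c i) i) = poly (\<Sum>i\<le>N. monom (d i) i)"
    using assms(1) by (auto simp: fun_eq_iff poly_sum poly_monom)
  hence "(\<Sum>i\<le>N. monom (c i) i) = (\<Sum>i\<le>N. monom (d i) i)" by (simp only: poly_eq_poly_eq_iff)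
  hence "coeff (\<Sum>i\<le>N. monom (c i) i) i = coeff (\<Sum>i\<le>N. monom (d i) i) i" by simp
  thus ?thesis using assms(2) by (simp add: coeff_sum coeff_monom)
qed

lemma fps_mult_compose_nth:
  fixes a b h k :: "'a::comm_ring_1 fps" assumes "h$0 = 0" "k$0 = 0"
  shows "((fps_compose a h*fps_compose b k)$N)
    = (\<Sum>i\<le>N. \<Sum>j\<le>N. (a$i)*b$j*(h^i*k^j)$N)"
proof -
  have "((fps_compose a h*fps_compose b k)$N)
    = (\<Sum>l\<in>{0..N}. (\<Sum>i\<le>N. (a$i)*(h^i)$l)*(\<Sum>j\<le>N. (b$j)*(k^j)$(N - l)))"
    unfolding fps_mult_nth by (intro sum.cong refl arg_cong2[where f = "(*)"] fps_compose_nth_bound assms) auto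
  also have "... = (\<Sum>l\<in>{0..N}. \<Sum>i\<le>N. \<Sum>j\<le>N. (a$i)*b$j*((h^i)$l*(k^j)$(N - l)))"
    by (simp add: sum_product ac_simps)
  also have "... = (\<Sum>i\<le>N. \<Sum>j\<le>N. \<Sum>l\<in>{0..N}. (a$i)*b$j*((h^i)$l*(k^j)$(N - l)))"
    by (subst sum.swap, rule sum.cong[OF refl], rule sum.swap)
  finally show ?thesis by (simp add: sum_distrib_left fps_mult_nth)
qed

context lubin_tate_setting
begin

abbreviation ac :: "'c => nat => nat => 'c" where "ac \<equiv> lt_add_coeff \<pi> q"

text \<open>The coefficient of X^i Y^j in (f(X) + f(Y))^n.\<close>

definition cn :: "'c fps => nat => nat => nat => 'c"
  where "cn f n i j = (\<Sum>k\<le>n. of_nat (n choose k)*(f^k)$i*(f^(n - k))$j)"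

lemma ac_cn: assumes "i + j <= N" shows "ac u i j = (\<Sum>n\<le>N. ((fps_inv (lg u))$n)*cn (lg u) n i j)"
proof -
  let ?f = "lg u"
  let ?X = "fps_const ?f :: 'c fps fps"
  let ?Y = "Abs_fps (%m. fps_const (?f$m)) :: 'c fps fps"
  have Yp: "?Y^n = Abs_fps (%m. fps_const ((?f^n)$m))" for n
  proof (induction n)
    case 0
    show ?case by (rule fps_ext) (simp add: fps_one_nth)
  next
    case (Suc n)
    have *: "fps_const (\<Sum>i\<in>I. g i) = (\<Sum>i\<in>I. fps_const (g i))" for g :: "nat => 'c" and I
      by (induction I rule: infinite_finite_induct) (auto simp: fps_const_add[symmetric] simp del: fps_const_add)
    show ?case by (rule fps_ext) (simp add: Suc fps_mult_nth * )
  qed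
  have XY: "(((?X + ?Y)^n)$j)$i = cn ?f n i j" for n
  proof -
    have "((of_nat c * ?X^k * ?Y^m)$j)$i = of_nat c*(?f^k)$i*(?f^m)$j" for c k m
      unfolding Yp by (simp add: fps_of_nat[symmetric] mult.assoc)
    thus ?thesis unfolding cn_def binomial_ring fps_sum_nth by simp
  qed
  have "ac u i j = (\<Sum>n\<le>i + j. (fps_inv ?f)$n*cn ?f n i j)" unfolding lt_add_coeff_def Let_def XY ..
  also have "... = (\<Sum>n\<le>N. ((fps_inv ?f)$n)*cn ?f n i j)"
  proof (rule sum.mono_neutral_left)
    have "cn ?f n i j = 0" if "i + j < n" for n unfolding cn_def
    proof (rule sum.neutral, intro ballI)
      fix k assume "k : {..n}"
      hence "i < k \<or> j < n - k" using that by auto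
      hence "(?f^k)$i = 0 \<or> ((?f^(n - k))$j) = 0" using startsby_zero_power_prefix[of ?f] lg_nth_0 by blast
      thus "of_nat (n choose k)*(?f^k)$i*(?f^(n - k))$j = 0" by auto
    qed
    thus "ALL n:{..N} - {..i + j}. ((fps_inv ?f)$n)*cn ?f n i j = 0" by auto
  qed (use assms in auto)
  finally show ?thesis .
qed

text \<open>The formal sum of two series in one variable. Laws of the formal module can then be
  checked by applying f, with no series in several variables.\<close>

definition fadd :: "'c => 'c fps => 'c fps => 'c fps"
  where "fadd u h k = fps_compose (fps_inv (lg u)) (fps_compose (lg u) h + fps_compose (lg u) k)"

lemma fadd_nth: assumes "h$0 = 0" "k$0 = 0"
  shows "fadd u h k$N = (\<Sum>i\<le>N. \<Sum>j\<le>N. ac u i j*(h^i*k^j)$N)"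
proof -
  let ?f = "lg u" and ?c = "%n. (fps_inv (lg u))$n"
  have P: "((fps_compose ?f h + fps_compose ?f k)^n)$N = (\<Sum>i\<le>N. \<Sum>j\<le>N. cn ?f n i j*(h^i*k^j)$N)" for n
  proof -
    have "(((fps_compose ?f h + fps_compose ?f k)^n)$N)
      = (\<Sum>l\<le>n. of_nat (n choose l)*(fps_compose (?f^l) h*fps_compose (?f^(n - l)) k)$N)"
      using assms by (simp add: binomial_ring fps_sum_nth fps_compose_power fps_of_nat[symmetric] mult.assoc)
    also have "... = (\<Sum>l\<le>n. \<Sum>i\<le>N. \<Sum>j\<le>N. of_nat (n choose l)*(?f^l)$i*(?f^(n - l))$j*(h^i*k^j)$N)"
      using assms by (simp add: fps_mult_compose_nth sum_distrib_left mult.assoc)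
    also have "... = (\<Sum>i\<le>N. \<Sum>j\<le>N. \<Sum>l\<le>n. of_nat (n choose l)*(?f^l)$i*(?f^(n - l))$j*(h^i*k^j)$N)"
      by (subst sum.swap, rule sum.cong[OF refl], rule sum.swap)
    finally show ?thesis by (simp add: cn_def sum_distrib_right)
  qed
  have "fadd u h k$N = (\<Sum>n\<le>N. ?c n*(\<Sum>i\<le>N. \<Sum>j\<le>N. cn ?f n i j*(h^i*k^j)$N))"
    unfolding fadd_def using assms by (subst fps_compose_nth_bound[of _ N N]) (auto simp: P)
  also have "... = (\<Sum>n\<le>N. \<Sum>i\<le>N. \<Sum>j\<le>N. ?c n*cn ?f n i j*(h^i*k^j)$N)"
    by (simp add: sum_distrib_left mult.assoc)
  also have "... = (\<Sum>i\<le>N. \<Sum>j\<le>N. \<Sum>n\<le>N. ?c n*cn ?f n i j*(h^i*k^j)$N)"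
    by (subst sum.swap, rule sum.cong[OF refl], rule sum.swap)
  also have "... = (\<Sum>i\<le>N. \<Sum>j\<le>N. ac u i j*(h^i*k^j)$N)"
  proof (intro sum.cong refl)
    fix i j
    show "(\<Sum>n\<le>N. ?c n*cn ?f n i j*(h^i*k^j)$N) = ac u i j*(h^i*k^j)$N"
    proof (cases "i + j <= N")
      case False
      have "(h^i*k^j)$N = 0"
      proof -
        have "(h^i)$l*(k^j)$(N - l) = 0" if "l : {0..N}" for l
        proof -
          have "l < i \<or> N - l < j" using False that by auto
          thus ?thesis using startsby_zero_power_prefix assms by (metis mult_eq_0_iff)
        qed
        thus ?thesis unfolding fps_mult_nth by (rule sum.neutral[OF ballI])
      qed
      thus ?thesis by simp
    qed (simp add: ac_cn sum_distrib_right)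
  qed
  finally show ?thesis .
qed

lemma lg_fadd: "h$0 = 0 ==> (k$0) = 0 ==>
   fps_compose (lg u) (fadd u h k) = fps_compose (lg u) h + fps_compose (lg u) k"
  unfolding fadd_def by (rule lg_inv_right) simp

lemma fadd_0 [simp]: "fadd u h k$0 = 0" by (simp add: fadd_def)

text \<open>Restricted to (xX, X), the part of degree N of the group law is a polynomial in x whose
  coefficients are those of total degree N.\<close>

lemma fadd_linear_nth:
  "(fadd u (fps_const x*fps_X) fps_X)$N = (\<Sum>i\<le>N. ac u i (N - i)*x^i)"
proof -
  have "((fps_const x*fps_X)^i*fps_X^j)$N = (if i + j = N then x^i else 0)" for i j
    by (simp add: power_mult_distrib mult.assoc power_add[symmetric] eq_commute)
  hence "(fadd u (fps_const x*fps_X) fps_X)$N = (\<Sum>i\<le>N. \<Sum>j\<le>N. ac u i j*(if i + j = N then x^i else 0))"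
    by (subst fadd_nth) auto
  also have "... = (\<Sum>i\<le>N. ac u i (N - i)*x^i)"
  proof (intro sum.cong refl)
    fix i assume i: "i : {..N}"
    have "(\<Sum>j\<le>N. ac u i j*(if i + j = N then x^i else 0)) = (\<Sum>j\<in>{N - i}. ac u i j*(if i + j = N then x^i else 0))"
      using i by (intro sum.mono_neutral_right) auto
    thus "(\<Sum>j\<le>N. ac u i j*(if i + j = N then x^i else 0)) = ac u i (N - i)*x^i" using i by simp
  qed
  finally show ?thesis .
qed

definition PU :: "('c => 'c) set" where "PU = PA {%u. u}"

lemma PA_two_variables: assumes "g : PA {fst, snd}"
  shows "EX P. (ALL i. (%u. coeff (P u) i) : PU) & (ALL u x. g (u, x) = poly (P u) x)" using assms
proof induction
  case (const a)
  have "(%u. coeff [:a:] i) : PU" for i using const by (cases i) (auto simp: PU_def PA_0 intro: PA.const)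
  thus ?case by (intro exI[of _ "%_. [:a:]"]) auto
next
  case (gen g)
  have 1: "(%u. coeff [:u:] i) : PU" for i by (cases i) (auto simp: PU_def PA_0 intro: PA.gen)
  have 2: "(%u. coeff [:0, 1:] i) : PU" for i by (auto simp: PU_def PA_0 PA_1 coeff_pCons split: nat.splits)
  show ?case
  proof (cases "g = fst")
    case True thus ?thesis using 1 by (intro exI[of _ "%u. [:u:]"]) auto
  next
    case False thus ?thesis using 2 gen by (intro exI[of _ "%u. [:0, 1:]"]) auto
  qed
next
  case (add g h)
  then obtain P Q where "ALL i. (%u. coeff (P u) i) : PU" "ALL u x. g (u, x) = poly (P u) x"
     "ALL i. (%u. coeff (Q u) i) : PU" "ALL u x. h (u, x) = poly (Q u) x" by blast
  thus ?case by (intro exI[of _ "%u. P u + Q u"]) (auto simp: PU_def intro: PA.add)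
next
  case (mult g h)
  then obtain P Q where "ALL i. (%u. coeff (P u) i) : PU" "ALL u x. g (u, x) = poly (P u) x"
     "ALL i. (%u. coeff (Q u) i) : PU" "ALL u x. h (u, x) = poly (Q u) x" by blast
  thus ?case by (intro exI[of _ "%u. P u*Q u"]) (auto simp: PU_def coeff_mult intro!: PA_sum PA.mult)
qed

text \<open>The functional equation lemma is applied to f(xX) + f(X) with parameters (u, x) and the
  lift (u^q, x^q). The coefficients of the group law are then read off as coefficients in x.\<close>

lemma ac_PU: "(%u. ac u i j) : PU"
proof -
  let ?s = "%(u, x). (u^q, x^q)"
  let ?g = "%w. fps_compose (lg (fst w)) (fps_const (snd w)*fps_X) + fps_compose (lg (fst w)) fps_X"
  let ?G = "{fst, snd} :: ('c \<times> 'c => 'c) set"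
  have q: "0 < q" "0 < q^2" using q_gt_1 by auto
  have c: "((lg (u^m)) oo (fps_const (x^m)*fps_X)) oo fps_X^m = fps_compose (lg (u^m)) ((fps_const x*fps_X)^m)"
    if "0 < m" for u x and m using that by (subst fps_compose_assoc[symmetric])
      (auto simp: fps_compose_mult_distrib power_mult_distrib)
  have c': "((lg (u^m)) oo fps_X) oo fps_X^m = fps_compose (lg (u^m)) (fps_X^m)" if "0 < m" for u and m
    using that by (subst fps_compose_assoc[symmetric]) auto
  have "AF ?G (%w. fps_compose (fps_inv (lg (fst w))) (?g w))"
  proof (rule functional_equation_integrality[where s = ?s])
    show "frobenius_on ?G ?s" by (auto simp: frobenius_on_def)
    have "AF ?G (%w. fps_const (snd w)*fps_X + fps_X)" by (intro AF_add AF_mult AF_const AF_X PA.gen) auto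
    moreover have "?g w - fps_const (fst w/\<pi>)*fps_compose (?g (?s w)) (fps_X^q)
        - fps_const (1/\<pi>)*fps_compose (?g (?s (?s w))) (fps_X^q^2) = fps_const (snd w)*fps_X + fps_X" for w
    proof -
      obtain u x where w: "w = (u, x)" by force
      have s2: "?s (u^q, x^q) = (u^q^2, x^q^2)" by (simp add: power_mult[symmetric] power2_eq_square)
      have k1: "(?g (u^m, x^m)) oo fps_X^m = fps_compose (lg (u^m)) ((fps_const x*fps_X)^m) + fps_compose (lg (u^m)) (fps_X^m)"
        if "0 < m" for m unfolding fps_compose_add_distrib fst_conv snd_conv c[OF that] c'[OF that] ..
      have sw: "?s w = (u^q, x^q)" by (simp add: w)
      have e1: "lg u oo fps_const x*fps_X = fps_const x*fps_X
          + fps_const (u/\<pi>)*fps_compose (lg (u^q)) ((fps_const x*fps_X)^q)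
          + fps_const (1/\<pi>)*fps_compose (lg (u^q^2)) ((fps_const x*fps_X)^q^2)" by (rule lg_functional_eq) simp
      have e2: "lg u oo fps_X = fps_X
          + fps_const (u/\<pi>)*fps_compose (lg (u^q)) (fps_X^q)
          + fps_const (1/\<pi>)*fps_compose (lg (u^q^2)) (fps_X^q^2)" by (rule lg_functional_eq) simp
      have alg: "(A + c*P1 + d*Q1) + (B + c*P2 + d*Q2) - c*(P1 + P2) - d*(Q1 + Q2) = A + B"
        for A B c d P1 P2 Q1 Q2 :: "'c fps" by (simp add: algebra_simps)
      show ?thesis unfolding sw s2 k1[OF q(1)] k1[OF q(2)] unfolding w fst_conv snd_conv by (subst e1, subst e2) (rule alg)
    qed
    ultimately show "AF ?G (%w. ?g w - fps_const (fst w/\<pi>)*fps_compose (?g (?s w)) (fps_X^q)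
        - fps_const (1/\<pi>)*fps_compose (?g (?s (?s w))) (fps_X^q^2))" by presburger
  qed (auto intro: PA.gen)
  hence "(%w. (fadd (fst w) (fps_const (snd w)*fps_X) fps_X)$(i + j)) : PA ?G" by (simp add: AF_def fadd_def)
  then obtain P where P: "!!i. (%u. coeff (P u) i) : PU"
    "!!u x. (fadd u (fps_const x*fps_X) fps_X)$(i + j) = poly (P u) x" using PA_two_variables by fastforce
  have "ac u i j = coeff (P u) i" for u
  proof -
    have "poly (\<Sum>k\<le>i + j. monom (ac u k (i + j - k)) k) = poly (P u)"
      using P(2)[of u] by (auto simp: fun_eq_iff fadd_linear_nth poly_sum poly_monom)
    hence "(\<Sum>k\<le>i + j. monom (ac u k (i + j - k)) k) = P u" by (simp only: poly_eq_poly_eq_iff)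
    hence "coeff (\<Sum>k\<le>i + j. monom (ac u k (i + j - k)) k) i = coeff (P u) i" by simp
    thus ?thesis by (simp add: coeff_sum coeff_monom)
  qed
  thus ?thesis using P(1) by simp
qed

lemma ac_i_0: "ac u i 0 = (if i = 1 then 1 else 0)" and ac_0_j: "ac u 0 j = (if j = 1 then 1 else 0)"
proof -
  have z: "(\<Sum>j\<le>N. ac u i j*(h*0^j)$N) = ac u i 0*h$N" for i h N
  proof -
    have "(\<Sum>j\<le>N. ac u i j*(h*0^j)$N) = (\<Sum>j\<in>{0}. ac u i j*(h*0^j)$N)"
      by (rule sum.mono_neutral_right) (auto simp: power_0_left)
    thus ?thesis by simp
  qed
  have z': "(\<Sum>i\<le>N. ac u i j*(0^i*h)$N) = ac u 0 j*h$N" for j h N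
  proof -
    have "(\<Sum>i\<le>N. ac u i j*(0^i*h)$N) = (\<Sum>i\<in>{0}. ac u i j*(0^i*h)$N)"
      by (rule sum.mono_neutral_right) (auto simp: power_0_left)
    thus ?thesis by simp
  qed
  have "fadd u fps_X 0 = fps_X" "fadd u 0 fps_X = fps_X" using lg_inv_left[of fps_X u] by (simp_all add: fadd_def)
  hence "fps_X$i = (\<Sum>k\<le>i. ac u k 0*(fps_X^k)$i)" using fadd_nth[of fps_X 0 u i] by (simp add: z)
  thus "ac u i 0 = (if i = 1 then 1 else 0)" by (simp add: if_distrib[of "(*) _"] eq_commute cong: if_cong)
  have "fps_X$j = (\<Sum>l\<le>j. \<Sum>k\<le>j. ac u k l*(0^k*fps_X^l)$j)"
    using fadd_nth[of 0 fps_X u j] \<open>fadd u 0 fps_X = fps_X\<close> by (subst sum.swap) simp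
  hence "fps_X$j = (\<Sum>l\<le>j. ac u 0 l*(fps_X^l)$j)" by (simp only: z')
  thus "ac u 0 j = (if j = 1 then 1 else 0)" by (simp add: if_distrib[of "(*) _"] eq_commute cong: if_cong)
qed

text \<open>Up to degree q the logarithm is X + (u/\<pi>) X^q, so the group law there is X + Y -
  (u/\<pi>)((X + Y)^q - X^q - Y^q). The factor u in degree q is essential for the estimate
  \<open>Fil_fa\<close>.\<close>

lemma ac_low: assumes "1 <= i" "1 <= j" "i + j <= q" shows "ac u i j = (if i + j < q then 0 else - (bq i*u))"
proof -
  define N where "N = i + j"
  have N: "2 <= N" "N <= q" "i <= N" "i ~= 0" "i ~= N" using assms by (auto simp: N_def)
  have q2: "q < q^Suc (Suc k)" for k
  proof -
    have "q^1 < q^Suc (Suc k)" using q_gt_1 by (intro power_strict_increasing) auto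
    thus ?thesis by simp
  qed
  have lgN: "(lg u oo h)$M = h$M + u/\<pi>*(h^q)$M" if "h$0 = 0" "M <= q" for h M
  proof -
    have "(lg u oo h)$M = (\<Sum>k\<le>Suc M. lb u k*(h^(q^k))$M)"
      by (rule lg_compose_nth) (use that in auto)
    also have "... = (\<Sum>k\<in>{0,1}. lb u k*(h^(q^k))$M)"
    proof (rule sum.mono_neutral_right)
      show "ALL k:{..Suc M} - {0, 1}. lb u k*(h^(q^k))$M = 0"
      proof
        fix k assume "k : {..Suc M} - {0, 1}"
        then obtain l where "k = Suc (Suc l)" by (metis DiffE One_nat_def insertI1 insertI2 not0_implies_Suc)
        hence "M < q^k" using q2[of l] that(2) by (simp only: le_less_trans)
        thus "lb u k*(h^(q^k))$M = 0" using startsby_zero_power_prefix[OF that(1)] by simp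
      qed
    qed auto
    finally show ?thesis by simp
  qed
  have "ac u k (N - k) = (if k = 0 \<or> k = N \<or> N < q then 0 else - (bq k*u))" if "k <= N" for k
  proof (rule poly_sum_unique[OF _ that])
    fix x
    define g where "g = fadd u (fps_const x*fps_X) fps_X"
    have g0: "g$0 = 0" by (simp add: g_def)
    have geq: "g$M + u/\<pi>*(g^q)$M = (if M = 1 then x + 1 else 0) + (if M = q then u/\<pi>*(x^q + 1) else 0)" if "M <= q" for M
    proof -
      have "(lg u oo g)$M = (lg u oo fps_const x*fps_X)$M + (lg u oo fps_X)$M"
        unfolding g_def by (subst lg_fadd) simp_all
      moreover have "(lg u oo fps_const x*fps_X)$M = (if M = 1 then x else 0) + u/\<pi>*(if M = q then x^q else 0)"
        using that by (subst lgN) (auto simp: power_mult_distrib)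
      moreover have "(lg u oo fps_X)$M = (if M = 1 then 1 else 0) + u/\<pi>*(if M = q then 1 else 0)"
        using that by (subst lgN) auto
      ultimately have "g$M + u/\<pi>*(g^q)$M = ((if M = 1 then x else 0) + u/\<pi>*(if M = q then x^q else 0))
        + ((if M = 1 then 1 else 0) + u/\<pi>*(if M = q then 1 else 0))" unfolding lgN[OF g0 that] by simp
      thus ?thesis by (cases "M = 1"; cases "M = q") (simp_all add: distrib_left)
    qed
    have g1: "g$1 = x + 1" using geq[of 1] q_gt_1 startsby_zero_power_prefix[OF g0, of q] by auto
    have "g$N = (if N < q then 0 else u/\<pi>*(x^q + 1 - (x + 1)^q))"
    proof (cases "N < q")
      case True
      thus ?thesis using geq[of N] N startsby_zero_power_prefix[OF g0, of q] by auto
    next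
      case False
      hence "N = q" using N by simp
      thus ?thesis using geq[of q] q_gt_1 startsby_zero_power_nth_same[OF g0, of q] g1 by (simp add: algebra_simps)
    qed
    also have "... = (\<Sum>k\<le>N. (if k = 0 \<or> k = N \<or> N < q then 0 else - (bq k*u))*x^k)"
    proof (cases "N < q")
      case False
      hence "N = q" using N by simp
      have "(x + 1)^q = x^q + 1 + \<pi>*(\<Sum>i\<in>{0<..<q}. bq i*x^i*1^(q - i))" using q_power_sum[of "%x. x" x 1] by simp
      moreover have "(\<Sum>k\<le>N. (if k = 0 \<or> k = N \<or> N < q then 0 else - (bq k*u))*x^k)
         = (\<Sum>k\<in>{0<..<q}. (if k = 0 \<or> k = N \<or> N < q then 0 else - (bq k*u))*x^k)"
        using \<open>N = q\<close> by (intro sum.mono_neutral_right) auto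
      moreover have "... = - u*(\<Sum>i\<in>{0<..<q}. bq i*x^i)"
        using \<open>N = q\<close> by (simp add: sum_distrib_left mult.assoc ac_simps sum_negf)
      ultimately show ?thesis using False by simp
    qed simp
    finally show "(\<Sum>k\<le>N. ac u k (N - k)*x^k) = (\<Sum>k\<le>N. (if k = 0 \<or> k = N \<or> N < q then 0 else - (bq k*u))*x^k)"
      by (simp add: g_def fadd_linear_nth)
  qed
  from this[OF N(3)] show ?thesis using N by (simp add: N_def)
qed

abbreviation sf :: "'c => 'c => 'c fps" where "sf \<equiv> lt_smult_fps \<pi> q"

lemma sf_PU: assumes "a : F" "na a <= 1" shows "(%u. sf u a$n) : PU"
proof -
  let ?s = "%u. u^q"
  let ?g = "%u. fps_const a*lg u"
  let ?G = "{%u. u} :: ('c => 'c) set"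
  have q: "0 < q" "0 < q^2" using q_gt_1 by auto
  have "AF ?G (%u. fps_compose (fps_inv (lg u)) (?g u))"
  proof (rule functional_equation_integrality[where s = ?s])
    show "frobenius_on ?G ?s" by (auto simp: frobenius_on_def)
    have "AF ?G (%w. fps_const a*fps_X)" by (intro AF_mult AF_const AF_X PA.const assms)
    moreover have "?g u - fps_const (u/\<pi>)*fps_compose (?g (?s u)) (fps_X^q)
        - fps_const (1/\<pi>)*fps_compose (?g (?s (?s u))) (fps_X^q^2) = fps_const a*fps_X" for u
    proof -
      have "?s (?s u) = u^q^2" by (simp add: power_mult[symmetric] power2_eq_square)
      moreover have "(?g c) oo fps_X^m = fps_const a*fps_compose (lg c) (fps_X^m)" if "0 < m" for c m
        using that by (simp add: fps_compose_mult_distrib)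
      moreover have "lg u = fps_X + fps_const (u/\<pi>)*fps_compose (lg (u^q)) (fps_X^q)
     + fps_const (1/\<pi>)*fps_compose (lg (u^q^2)) (fps_X^q^2)" using lg_functional_eq[of fps_X u] by simp
      moreover have "A*(B + c*P + d*Q) - c*(A*P) - d*(A*Q) = A*B" for A B c d P Q :: "'c fps" by (simp add: algebra_simps)
      ultimately show ?thesis using q by presburger
    qed
    ultimately show "AF ?G (%u. ?g u - fps_const (u/\<pi>)*fps_compose (?g (?s u)) (fps_X^q)
        - fps_const (1/\<pi>)*fps_compose (?g (?s (?s u))) (fps_X^q^2))" by presburger
  qed (auto intro: PA.gen)
  thus ?thesis by (simp add: AF_def PU_def lt_smult_fps_def)
qed

lemma sf_0 [simp]: "sf u a$0 = 0" by (simp add: lt_smult_fps_def)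

lemma lg_sf: "lg u oo sf u a = fps_const a*lg u" unfolding lt_smult_fps_def by (rule lg_inv_right) simp

lemma sf_1: "sf u a$1 = a"
proof -
  have "(lg u oo sf u a)$1 = lg u$1 * sf u a$1" by (simp add: fps_compose_nth)
  thus ?thesis unfolding lg_sf by simp
qed

text \<open>The inverse logarithm of \<open>\<pi>\<close> X. Multiplication by \<open>\<pi>\<close>
  is the formal sum of this series, of u X^q and of X^(q^2).\<close>

definition ef :: "'c => 'c fps" where "ef u = fps_compose (fps_inv (lg u)) (fps_const \<pi>*fps_X)"

lemma ef_0 [simp]: "ef u$0 = 0" by (simp add: ef_def)

lemma lg_ef: "lg u oo ef u = fps_const \<pi>*fps_X" unfolding ef_def by (rule lg_inv_right) simp

text \<open>Compare coefficients in f(E) = \<open>\<pi>\<close> X. For k >= 1 the term b_k E^(q^k)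
  carries \<open>\<pi>^(q^k)\<close> against a denominator at most \<open>\<pi>^k\<close>, and q^k
  >= k + 2 because q >= 3.\<close>

lemma ef_coeffs: shows ef_1: "ef u$1 = \<pi>" and ef_PU: "2 <= n ==> EX m:PU. ALL u. ef u$n = \<pi>^2*m u"
proof -
  have "(lg u oo ef u)$1 = lg u$1*ef u$1" for u by (simp add: fps_compose_nth)
  thus e1: "ef u$1 = \<pi>" for u unfolding lg_ef by simp
  have "EX m:PU. ALL u. ef u$n = \<pi>^(if 2 <= n then 2 else 1)*m u" for n
  proof (induction n rule: less_induct)
    case (less n)
    show ?case
    proof (cases "2 <= n")
      case False
      then consider "n = 0" | "n = 1" by linarith
      thus ?thesis
      proof cases
        case 1
        thus ?thesis by (intro bexI[of _ "%_. 0"]) (auto simp: PU_def PA_0)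
      next
        case 2
        thus ?thesis using e1 by (intro bexI[of _ "%_. 1"]) (auto simp: PU_def PA_1)
      qed
    next
      case n: True
      have "EX m:PU. ALL u. ef u$i = \<pi>*m u" if i: "i < n" for i
      proof -
        obtain m where m: "m : PU" "!!u. ef u$i = \<pi>^(if 2 <= i then 2 else 1)*m u" using less[OF i] by blast
        show ?thesis
        proof (cases "2 <= i")
          case True
          thus ?thesis using m PA_pi[of m] by (intro bexI[of _ "%u. \<pi>*m u"]) (auto simp: power2_eq_square PU_def)
        qed (use m in auto)
      qed
      then obtain m where m: "!!i. i < n ==> m i : PU" "!!i u. i < n ==> (ef u$i) = \<pi>*m i u" by metis
      define M where "M u = Abs_fps (%i. if i < n & i ~= 0 then m i u else 0)" for u
      have AM: "AF {%u. u} M" unfolding AF_def M_def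
      proof
        fix i show "(%w. (Abs_fps (%i. if i < n & i ~= 0 then m i w else 0))$i) : PA {%u. u}"
          using m(1) by (cases "i < n & i ~= 0") (auto simp: PU_def PA_0)
      qed
      have M0: "M u$0 = 0" for u by (simp add: M_def)
      have pw: "(ef u^(q^Suc k))$n = \<pi>^(q^Suc k)*(M u^(q^Suc k))$n" for u k
      proof -
        have "2 <= q^Suc k" using q_ge_3 less_q_power[of "Suc k"] by linarith
        hence "(ef u^(q^Suc k))$n = ((fps_const \<pi>*M u)^(q^Suc k))$n"
          using m(2) ef_0[of u] n by (intro fps_power_nth_cong) (auto simp: M_def simp del: ef_0)
        thus ?thesis by (simp add: power_mult_distrib)
      qed
      have ex: "2 + Suc k <= q^Suc k" for k
      proof -
        have "2 + k <= 3*Suc k" "q^Suc k \<ge> 3^Suc k" using q_ge_3 by (auto simp del: power_Suc intro: power_mono)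
        moreover have "2 + Suc k <= 3^Suc k" by (induction k) auto
        ultimately show ?thesis by linarith
      qed
      define r where "r u = (\<Sum>k\<le>n. \<pi>^(q^Suc k - Suc k - 2)*(\<pi>^Suc k*lb u (Suc k)*(M u^(q^Suc k))$n))" for u
      have "r : PU" unfolding r_def PU_def
        using AF_power[OF AM] by (intro PA_sum PA_pi_power PA.mult lb_integral) (auto simp: AF_def intro: PA.gen)
      moreover have "ef u$n = \<pi>^2 * - r u" for u
      proof -
        have "0 = (lg u oo ef u)$n" using n by (simp add: lg_ef)
        also have "... = (\<Sum>k\<le>Suc n. lb u k*(ef u^(q^k))$n)" by (rule lg_compose_nth) auto
        also have "... = ef u$n + (\<Sum>k\<le>n. lb u (Suc k)*(ef u^(q^Suc k))$n)"
          by (subst sum.atMost_Suc_shift) simp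
        also have "(\<Sum>k\<le>n. lb u (Suc k)*(ef u^(q^Suc k))$n) = \<pi>^2 * r u"
          unfolding r_def sum_distrib_left pw
        proof (rule sum.cong[OF refl])
          fix k
          have "\<pi>^(q^Suc k) = \<pi>^2*\<pi>^(q^Suc k - Suc k - 2)*\<pi>^Suc k"
            using ex[of k] by (simp only: power_add[symmetric]) (rule arg_cong[where f = "(^) \<pi>"], linarith)
          thus "lb u (Suc k)*(\<pi>^(q^Suc k)*(M u^(q^Suc k))$n) =
             \<pi>^2*(\<pi>^(q^Suc k - Suc k - 2)*(\<pi>^Suc k*lb u (Suc k)*(M u^(q^Suc k))$n))"
            by (simp only: ac_simps)
        qed
        finally show ?thesis by (simp add: add_eq_0_iff2)
      qed
      ultimately show ?thesis using n by (auto simp: PU_def intro!: bexI[of _ "%u. - r u"] PA_minus)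
    qed
  qed
  from this[of n] show "2 <= n ==> EX m:PU. ALL u. ef u$n = \<pi>^2*m u" by simp
qed

subsection \<open>Evaluation of power series\<close>

lemma PU_bound: assumes "g : PU" "na u <= 1" shows "na (g u) <= 1"
  using assms(1) unfolding PU_def by induction (auto intro: na_add_le na_mult_le1 assms(2))

lemma na_ac: "na u <= 1 ==> na (ac u i j) <= 1" using PU_bound[OF ac_PU] .

lemma na_sf: "a : F ==> na a <= 1 ==> na u <= 1 ==> na (sf u a$n) <= 1" using PU_bound[OF sf_PU] .

lemma na_ef: assumes "na u <= 1" shows "na (ef u$n) <= 1"
proof -
  consider "n = 0" | "n = 1" | "2 <= n" by linarith
  thus ?thesis
  proof cases
    case 3
    then obtain m where "m : PU" "ef u$n = \<pi>^2*m u" using ef_PU by blast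
    thus ?thesis using PU_bound[of m u] assms by (auto intro!: na_mult_le1 na_power_le1 pi_F)
  qed (use ef_1 pi_F in auto)
qed

text \<open>Growth condition for evaluation at X = 1. A point x is represented by the series xX,
  which satisfies \<open>Lr r\<close> when |x| <= r; \<open>ev\<close> adds up the
  coefficients.\<close>

definition L0 :: "real => 'c fps => bool" where "L0 r h \<longleftrightarrow> (ALL n. na (h$n) <= r^n)"
definition Lr :: "real => 'c fps => bool" where "Lr r h \<longleftrightarrow> L0 r h & (h$0) = 0"
definition ev :: "'c fps => 'c" where "ev h = infsum (fps_nth h) UNIV"

lemma L0_1: "0 <= r ==> L0 r 1" by (simp add: L0_def fps_one_nth)

lemma L0_mult: assumes "L0 r h" "L0 r k" "0 <= r" shows "L0 r (h*k)" unfolding L0_def fps_mult_nth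
proof (intro allI na_sum_le)
  fix n i :: nat assume "i : {0..n}"
  hence "r^n = r^i * r^(n - i)" by (simp add: power_add[symmetric])
  thus "na (h$i*k$(n - i)) <= r^n" using assms by (auto simp: L0_def na_mult intro!: mult_mono)
qed (use assms in auto)

lemma L0_power: "L0 r h ==> 0 <= r ==> L0 r (h^n)" by (induction n) (auto intro: L0_1 L0_mult)

lemma Lr_compose: assumes "!!n. na (c$n) <= 1" "c$0 = 0" "Lr r h" "0 <= r" shows "Lr r (c oo h)"
  unfolding Lr_def L0_def fps_compose_nth
proof (intro conjI allI na_sum_le)
  fix n i :: nat
  have "na ((h^i)$n) <= r^n" using L0_power assms(3,4) by (auto simp: Lr_def L0_def)
  thus "na (c$i*(h^i)$n) <= r^n" using assms(1) by (intro na_mult_le1)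
qed (use assms in auto)

lemma Lr_fadd: assumes "Lr r h" "Lr r k" "0 <= r" "na u <= 1" shows "Lr r (fadd u h k)" unfolding Lr_def L0_def
proof (intro conjI allI)
  fix n
  have "na ((h^i*k^j)$n) <= r^n" for i j using L0_mult[OF L0_power L0_power] assms by (auto simp: Lr_def L0_def)
  thus "na (fadd u h k$n) <= r^n"
    using assms by (subst fadd_nth) (auto simp: Lr_def intro!: na_sum_le na_mult_le1 na_ac)
qed simp

lemma Lr_monom: assumes "na x <= r" "na a <= 1" "0 < m" "0 <= r" shows "Lr r (fps_const a*(fps_const x*fps_X)^m)"
proof -
  have c: "(fps_const a*(fps_const x*fps_X)^m)$n = (if n = m then a*x^m else 0)" for n
    by (simp add: power_mult_distrib)
  have "na (x^m) <= r^m" using assms by (auto simp: na_power intro: power_mono)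
  hence "na (a*x^m) <= r^m" by (rule na_mult_le1[OF assms(2)])
  thus ?thesis unfolding Lr_def L0_def c using assms by auto
qed

lemma Lr_linear: assumes "na x <= r" shows "Lr r (fps_const x*fps_X)"
  using Lr_monom[of x r 1 1] assms order_trans[OF na_nonneg assms] by simp

lemma ev_has_sum: assumes "L0 r h" "0 <= r" "r < 1" shows "(fps_nth h has_sum ev h) UNIV"
proof -
  have "vanish (fps_nth h) UNIV"
    by (rule vanish_geometric[where M = 1 and r = r and g = "%i. i"]) (use assms in \<open>auto simp: L0_def\<close>)
  then obtain s where "(fps_nth h has_sum s) UNIV" using vanish_has_sum by blast
  thus ?thesis unfolding ev_def using infsumI by blast
qed

lemma ev_eqI: "(fps_nth h has_sum s) UNIV ==> ev h = s" unfolding ev_def by (rule infsumI)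

lemma ev_mult: assumes "L0 r h" "L0 r k" "0 <= r" "r < 1" shows "ev (h*k) = ev h*ev k"
proof (rule ev_eqI)
  let ?S = "Sigma UNIV (%n::nat. {0..n})"
  have "((%(i, j). (h$i)*k$j) has_sum (ev h*ev k)) (UNIV \<times> UNIV)"
    by (intro has_sum_times ev_has_sum[of r] assms)
  moreover have "bij_betw (%(n, i). (i, n - i)) ?S (UNIV \<times> UNIV)"
    by (rule bij_betwI[where g = "%(i, j). (i + j, i)"]) auto
  ultimately have "((%x. (%(i, j). (h$i)*k$j) ((%(n, i). (i, n - i)) x)) has_sum (ev h*ev k)) ?S"
    by (subst has_sum_reindex_bij_betw[of "%(n, i). (i, n - i)" ?S "UNIV \<times> UNIV"]) auto
  thus "(fps_nth (h*k) has_sum (ev h*ev k)) UNIV" by (rule has_sum_Fubini) (auto simp: fps_mult_nth)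
qed

lemma ev_1: "ev 1 = 1"
proof (rule ev_eqI)
  have "(fps_nth (1::'c fps) has_sum (\<Sum>i\<in>{0}. (1$i))) UNIV" by (rule has_sum_finite_support) (auto simp: fps_one_nth)
  thus "(fps_nth 1 has_sum (1::'c)) UNIV" by simp
qed

lemma ev_power: assumes "L0 r h" "0 <= r" "r < 1" shows "ev (h^n) = ev h^n"
  by (induction n) (auto simp: ev_1 ev_mult[OF assms(1) L0_power[OF assms(1,2)] assms(2,3)])

lemma na_ev: assumes "Lr r h" "0 <= r" "r < 1" shows "na (ev h) <= r"
proof (rule has_sum_na_le[OF ev_has_sum[of r]])
  fix n
  show "na (h$n) <= r"
  proof (cases n)
    case (Suc m)
    have "r^n <= r^1" using assms Suc by (intro power_decreasing) auto
    thus ?thesis using assms by (auto simp: Lr_def L0_def intro: order_trans)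
  qed (use assms in \<open>auto simp: Lr_def\<close>)
qed (use assms in \<open>auto simp: Lr_def\<close>)

lemma ev_linear: "ev (fps_const x*fps_X) = x"
proof (rule ev_eqI)
  have "(fps_nth (fps_const x*fps_X) has_sum (\<Sum>i\<in>{1}. ((fps_const x*fps_X)$i))) UNIV"
    by (rule has_sum_finite_support) auto
  thus "(fps_nth (fps_const x*fps_X) has_sum x) UNIV" by simp
qed

lemma ev_monom: "ev (fps_const a*(fps_const x*fps_X)^m) = a*x^m"
proof (rule ev_eqI)
  have "(fps_nth (fps_const a*(fps_const x*fps_X)^m) has_sum (\<Sum>i\<in>{m}. ((fps_const a*(fps_const x*fps_X)^m)$i))) UNIV"
    by (rule has_sum_finite_support) (auto simp: power_mult_distrib)
  thus "(fps_nth (fps_const a*(fps_const x*fps_X)^m) has_sum (a*x^m)) UNIV" by (simp add: power_mult_distrib)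
qed

lemma vanish_geometric':
  assumes "!!i. f i = 0 \<or> i : B & na (f i) <= r^(g i)" "r < 1" "0 <= r" "!!n::nat. finite {i : B. g i <= n}"
  shows "vanish f UNIV"
proof -
  have "na (f i) <= 1 * r^g i" for i using assms(1)[of i] assms(3) by auto
  hence "vanish f B" by (intro vanish_geometric[where M = 1 and r = r and g = g] assms(2-4))
  moreover have "{i : UNIV. e <= na (f i)} = {i : B. e <= na (f i)}" if "0 < e" for e using assms(1) that by force
  ultimately show ?thesis by (simp add: vanish_def)
qed

text \<open>The double series over (N, n) is zero for N < n and at most r^N otherwise. Summed over n
  first it gives the composed series, summed over N first the substituted one.\<close>

lemma ev_compose: assumes c: "!!n. na (c$n) <= 1" and h: "Lr r h" "0 <= r" "r < 1"
  shows "((%n. c$n*ev h^n) has_sum ev (c oo h)) UNIV"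
proof -
  have h0: "h$0 = 0" "L0 r h" using h by (auto simp: Lr_def)
  let ?a = "%(N, n). (c$n)*(h^n)$N"
  have "vanish ?a UNIV"
  proof (rule vanish_geometric'[where B = "{(N, n). n <= N}" and g = fst and r = r])
    fix x :: "nat \<times> nat"
    obtain N n where x: "x = (N, n)" by force
    show "?a x = 0 \<or> x : {(N, n). n <= N} & na (?a x) <= r^fst x"
      using L0_power[OF h0(2) h(2), of n] startsby_zero_power_prefix[OF h0(1), of n]
      by (cases "n <= N") (auto simp: x L0_def intro!: na_mult_le1 c)
  next
    fix n :: nat show "finite {i : {(N, n). n <= N}. fst i <= n}"
      by (rule finite_subset[of _ "{..n} \<times> {..n}"]) (use le_trans in auto)
  qed (use h in auto)
  then obtain s where s: "(?a has_sum s) (UNIV \<times> UNIV)" using vanish_has_sum by auto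
  have "(fps_nth (c oo h) has_sum s) UNIV"
  proof (rule has_sum_Fubini[OF s])
    fix N
    have "((%n. ?a (N, n)) has_sum (\<Sum>n\<in>{0..N}. ?a (N, n))) UNIV"
      using startsby_zero_power_prefix[OF h0(1)] by (intro has_sum_finite_support) auto
    thus "((%n. ?a (N, n)) has_sum ((c oo h)$N)) UNIV" by (simp add: fps_compose_nth)
  qed
  hence "s = ev (c oo h)" using ev_eqI by simp
  moreover have "((%n. c$n*ev h^n) has_sum s) UNIV"
  proof (rule has_sum_Fubini)
    have "((%x. ?a (prod.swap x)) has_sum s) (UNIV \<times> UNIV)"
      using s by (subst has_sum_reindex_bij_betw[of prod.swap "UNIV \<times> UNIV" "UNIV \<times> UNIV"]) auto
    thus "((%x. ?a (prod.swap x)) has_sum s) (Sigma UNIV (%_. UNIV))" .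
    show "((%N. ?a (prod.swap (n, N))) has_sum (c$n*ev h^n)) UNIV" for n
      using has_sum_cmult[OF ev_has_sum[OF L0_power[OF h0(2) h(2), of n] h(2,3)], of "c$n"]
      by (simp add: ev_power[OF h0(2) h(2,3)])
  qed
  ultimately show ?thesis by simp
qed

lemma ev_fadd: assumes u: "na u <= 1" and h: "Lr r h" "Lr r k" "0 <= r" "r < 1"
  shows "((%(i, j). ac u i j*ev h^i*ev k^j) has_sum ev (fadd u h k)) UNIV"
proof -
  have h0: "h$0 = 0" "L0 r h" "k$0 = 0" "L0 r k" using h by (auto simp: Lr_def)
  let ?a = "%(N, ij). ac u (fst ij) (snd ij)*(h^fst ij*k^snd ij)$N"
  have z: "(h^i*k^j)$N = 0" if "N < i + j" for i j N
  proof -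
    have "(h^i)$l*(k^j)$(N - l) = 0" if "l : {0..N}" for l
    proof -
      have "l < i \<or> N - l < j" using \<open>N < i + j\<close> that by auto
      thus ?thesis using startsby_zero_power_prefix h0 by (metis mult_eq_0_iff)
    qed
    thus ?thesis unfolding fps_mult_nth by (rule sum.neutral[OF ballI])
  qed
  have "vanish ?a UNIV"
  proof (rule vanish_geometric'[where B = "{(N, ij). fst ij + snd ij <= N}" and g = fst and r = r])
    fix x :: "nat \<times> nat \<times> nat"
    obtain N i j where x: "x = (N, i, j)" by (metis surj_pair)
    have "na ((h^i*k^j)$N) <= r^N" using L0_mult[OF L0_power L0_power] h0 h by (auto simp: L0_def)
    thus "?a x = 0 \<or> x : {(N, ij). fst ij + snd ij <= N} & na (?a x) <= r^fst x"
      using z[of N i j] by (cases "i + j <= N") (auto simp: x intro!: na_mult_le1 na_ac u)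
  next
    fix n :: nat show "finite {i : {(N, ij). fst ij + snd ij <= N}. fst i <= n}"
      by (rule finite_subset[of _ "{..n} \<times> {..n} \<times> {..n}"]) auto
  qed (use h in auto)
  then obtain s where s: "(?a has_sum s) (UNIV \<times> UNIV)" using vanish_has_sum by auto
  have "(fps_nth (fadd u h k) has_sum s) UNIV"
  proof (rule has_sum_Fubini[OF s])
    fix N
    have "((%ij. ?a (N, ij)) has_sum (\<Sum>ij\<in>{..N} \<times> {..N}. ?a (N, ij))) UNIV"
    proof (rule has_sum_finite_support)
      fix ij assume "ij : UNIV - {..N} \<times> {..N}"
      hence "N < fst ij + snd ij" by (cases ij) auto
      thus "?a (N, ij) = 0" using z by simp
    qed auto
    thus "((%ij. ?a (N, ij)) has_sum (fadd u h k$N)) UNIV"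
      using h0 by (simp add: fadd_nth sum.cartesian_product case_prod_beta)
  qed
  hence "s = ev (fadd u h k)" using ev_eqI by simp
  moreover have "((%(i, j). ac u i j*ev h^i*ev k^j) has_sum s) UNIV"
  proof (rule has_sum_Fubini)
    have "((%x. ?a (prod.swap x)) has_sum s) (UNIV \<times> UNIV)"
      using s by (subst has_sum_reindex_bij_betw[of prod.swap "UNIV \<times> UNIV" "UNIV \<times> UNIV"]) auto
    thus "((%x. ?a (prod.swap x)) has_sum s) (Sigma UNIV (%_. UNIV))" .
    fix ij :: "nat \<times> nat"
    show "((%N. ?a (prod.swap (ij, N))) has_sum (case ij of (i, j) => ac u i j*ev h^i*ev k^j)) UNIV"
    proof (cases ij)
      case (Pair i j)
      have "L0 r (h^i)" "L0 r (k^j)" "L0 r (h^i*k^j)" using h0 h by (auto intro: L0_mult L0_power)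
      hence "((%N. ac u i j*(h^i*k^j)$N) has_sum (ac u i j*(ev h^i*ev k^j))) UNIV"
        using has_sum_cmult[OF ev_has_sum[of r "h^i*k^j"], of "ac u i j"] h h0 by (simp add: ev_mult[of r] ev_power[of r])
      thus ?thesis by (simp add: Pair mult.assoc)
    qed
  qed
  ultimately show ?thesis by simp
qed

section \<open>The formal module on points of the open disc\<close>

abbreviation fa :: "'c => 'c => 'c => 'c" where "fa \<equiv> lt_add \<pi> q"
abbreviation sm :: "'c => 'c => 'c => 'c" where "sm \<equiv> lt_smult \<pi> q"

lemma fa_ev: "na u <= 1 ==> Lr r h ==> Lr r k ==> 0 <= r ==> r < 1 ==> fa u (ev h) (ev k) = ev (fadd u h k)"
  unfolding lt_add_def using infsumI[OF ev_fadd[of u r h k]] by simp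

definition fsm :: "'c => 'c => 'c fps => 'c fps" where "fsm u a h = fps_compose (sf u a) h"

lemma sm_ev: "a : F ==> na a <= 1 ==> na u <= 1 ==> Lr r h ==> 0 <= r ==> r < 1 ==> sm u a (ev h) = ev (fsm u a h)"
  unfolding lt_smult_def fsm_def using has_sum_suminf[OF ev_compose[of "sf u a" r h]] na_sf[of a u] by simp

lemma fsm_0 [simp]: "fsm u a h$0 = 0" by (simp add: fsm_def)

lemma Lr_fsm: "a : F ==> na a <= 1 ==> na u <= 1 ==> Lr r h ==> 0 <= r ==> Lr r (fsm u a h)"
  unfolding fsm_def by (rule Lr_compose) (auto intro: na_sf)

lemma lg_fsm: "h$0 = 0 ==> fps_compose (lg u) (fsm u a h) = fps_const a*fps_compose (lg u) h"
  unfolding fsm_def by (subst fps_compose_assoc) (auto simp: lg_sf fps_compose_mult_distrib)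

text \<open>The source of all identities in the formal module: series are compared through their
  logarithms, and \<open>ev\<close> carries the result to points.\<close>

lemma lg_inj: assumes "g$0 = 0" "h$0 = 0" "lg u oo g = fps_compose (lg u) h" shows "g = h"
  using lg_inv_left[OF assms(1), of u] lg_inv_left[OF assms(2), of u] assms(3) by metis

lemma Lr_nth_0: "Lr r h ==> (h$0) = 0" by (simp add: Lr_def)

abbreviation lx :: "'c => 'c fps" where "lx x \<equiv> fps_const x*fps_X"

lemma lx_witness: assumes "na x < 1" "na y < 1" "na z < 1"
  obtains r where "0 <= r" "r < 1" "Lr r (lx x)" "Lr r (lx y)" "Lr r (lx z)"
  by (rule that[of "max (na x) (max (na y) (na z))"]) (use assms in \<open>auto intro!: Lr_linear simp: le_max_iff_disj\<close>)

lemma fa_commute: assumes "na u <= 1" "na x < 1" "na y < 1" shows "fa u x y = fa u y x"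
proof -
  obtain r where r: "0 <= r" "r < 1" "Lr r (lx x)" "Lr r (lx y)" by (rule lx_witness[OF assms(2,3) assms(2)])
  have "fadd u (lx x) (lx y) = fadd u (lx y) (lx x)" by (simp add: fadd_def add.commute)
  thus ?thesis using fa_ev[OF assms(1) r(3,4,1,2)] fa_ev[OF assms(1) r(4,3,1,2)] by (simp add: ev_linear)
qed

lemma fa_assoc: assumes "na u <= 1" "na x < 1" "na y < 1" "na z < 1" shows "fa u (fa u x y) z = fa u x (fa u y z)"
proof -
  obtain r where r: "0 <= r" "r < 1" "Lr r (lx x)" "Lr r (lx y)" "Lr r (lx z)" by (rule lx_witness[OF assms(2-4)])
  have L: "Lr r (fadd u (lx x) (lx y))" "Lr r (fadd u (lx y) (lx z))" by (intro Lr_fadd r assms)+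
  have "fadd u (fadd u (lx x) (lx y)) (lx z) = fadd u (lx x) (fadd u (lx y) (lx z))"
    by (rule lg_inj[of _ _ u]) (simp_all add: lg_fadd add.assoc)
  thus ?thesis
    using fa_ev[OF assms(1) r(3,4,1,2)] fa_ev[OF assms(1) r(4,5,1,2)] fa_ev[OF assms(1) L(1) r(5,1,2)] fa_ev[OF assms(1) r(3) L(2) r(1,2)]
    by (simp add: ev_linear)
qed

lemma fa_0: assumes "na u <= 1" "na x < 1" shows "fa u x 0 = x"
proof -
  obtain r where r: "0 <= r" "r < 1" "Lr r (lx x)" "Lr r (lx 0)" by (rule lx_witness[OF assms(2), of 0 0]) auto
  have "fadd u (lx x) (lx 0) = lx x" using lg_inv_left[of "lx x" u] by (simp add: fadd_def)
  thus ?thesis using fa_ev[OF assms(1) r(3,4,1,2)] by (simp add: ev_linear del: fps_const_0_eq_0)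
qed

lemma na_fa: assumes "na u <= 1" "na x <= r" "na y <= r" "r < 1" shows "na (fa u x y) <= r"
proof -
  have r: "0 <= r" using assms(2) na_nonneg order_trans by blast
  have L: "Lr r (lx x)" "Lr r (lx y)" using assms by (auto intro: Lr_linear)
  show ?thesis using na_ev[OF Lr_fadd[OF L r assms(1)] r assms(4)] fa_ev[OF assms(1) L r assms(4)] by (simp add: ev_linear)
qed

lemma na_sm: assumes "a : F" "na a <= 1" "na u <= 1" "na x < 1" shows "na (sm u a x) <= na x"
proof -
  have L: "Lr (na x) (lx x)" by (auto intro: Lr_linear)
  show ?thesis
    using na_ev[OF Lr_fsm[OF assms(1-3) L na_nonneg] na_nonneg assms(4)] sm_ev[OF assms(1-3) L na_nonneg assms(4)] by (simp add: ev_linear)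
qed

lemma sm_fa: assumes "a : F" "na a <= 1" "na u <= 1" "na x < 1" "na y < 1"
  shows "sm u a (fa u x y) = fa u (sm u a x) (sm u a y)"
proof -
  obtain r where r: "0 <= r" "r < 1" "Lr r (lx x)" "Lr r (lx y)" by (rule lx_witness[OF assms(4,5,4)])
  have L: "Lr r (fadd u (lx x) (lx y))" "Lr r (fsm u a (lx x))" "Lr r (fsm u a (lx y))" by (intro Lr_fadd Lr_fsm r assms)+
  have "fsm u a (fadd u (lx x) (lx y)) = fadd u (fsm u a (lx x)) (fsm u a (lx y))"
    by (rule lg_inj[of _ _ u]) (simp_all add: lg_fadd lg_fsm distrib_left)
  thus ?thesis using fa_ev[OF assms(3) r(3,4,1,2)] sm_ev[OF assms(1-3) r(3,1,2)] sm_ev[OF assms(1-3) r(4,1,2)]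
      sm_ev[OF assms(1-3) L(1) r(1,2)] fa_ev[OF assms(3) L(2,3) r(1,2)] by (simp add: ev_linear)
qed

lemma sm_sm: assumes "a : F" "na a <= 1" "b : F" "na b <= 1" "na u <= 1" "na x < 1" shows "sm u a (sm u b x) = sm u (a*b) x"
proof -
  obtain r where r: "0 <= r" "r < 1" "Lr r (lx x)" by (rule lx_witness[OF assms(6,6,6)])
  have L: "Lr r (fsm u b (lx x))" by (intro Lr_fsm r assms)
  have ab: "a*b : F" "na (a*b) <= 1" using assms by (auto intro: F_mult na_mult_le1)
  have "fsm u a (fsm u b (lx x)) = fsm u (a*b) (lx x)"
    by (rule lg_inj[of _ _ u]) (simp_all add: lg_fsm mult.assoc[symmetric])
  thus ?thesis using sm_ev[OF assms(3-5) r(3,1,2)] sm_ev[OF assms(1,2,5) L r(1,2)] sm_ev[OF ab assms(5) r(3,1,2)]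
    by (simp add: ev_linear)
qed

lemma sm_add: assumes "a : F" "na a <= 1" "b : F" "na b <= 1" "na u <= 1" "na x < 1"
  shows "sm u (a + b) x = fa u (sm u a x) (sm u b x)"
proof -
  obtain r where r: "0 <= r" "r < 1" "Lr r (lx x)" by (rule lx_witness[OF assms(6,6,6)])
  have L: "Lr r (fsm u a (lx x))" "Lr r (fsm u b (lx x))" by (intro Lr_fsm r assms)+
  have ab: "a + b : F" "na (a + b) <= 1" using assms by (auto intro: F_add na_add_le)
  have "fsm u (a + b) (lx x) = fadd u (fsm u a (lx x)) (fsm u b (lx x))"
    by (rule lg_inj[of _ _ u]) (simp_all add: lg_fsm lg_fadd distrib_right fps_const_add[symmetric] del: fps_const_add)
  thus ?thesis
    using sm_ev[OF assms(1,2,5) r(3,1,2)] sm_ev[OF assms(3-5) r(3,1,2)] sm_ev[OF ab assms(5) r(3,1,2)] fa_ev[OF assms(5) L r(1,2)]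
    by (simp add: ev_linear)
qed

lemma sm_monomial: assumes "!!n. n ~= 1 ==> (sf u a$n) = 0" "na x < 1" shows "sm u a x = a*x"
proof -
  have "((%n. sf u a$n*x^n) has_sum (\<Sum>n\<in>{1}. (sf u a$n)*x^n)) UNIV"
    using assms by (intro has_sum_finite_support) auto
  thus ?thesis unfolding lt_smult_def by (subst has_sum_suminf) (auto simp: sf_1[simplified])
qed

lemma sm_1: assumes "na x < 1" shows "sm u 1 x = x"
proof -
  have "sf u 1 = fps_X" using lg_inv_left[of fps_X u] by (simp add: lt_smult_fps_def)
  thus ?thesis using sm_monomial[OF _ assms, of u 1] by simp
qed

lemma sm_0: assumes "na x < 1" shows "sm u 0 x = 0"
proof -
  have "sf u 0 = 0" by (simp add: lt_smult_fps_def fps_compose_0_right)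
  thus ?thesis using sm_monomial[OF _ assms, of u 0] by simp
qed

text \<open>f contains only the exponents q^k, and a^(q^k) = a, so f(ah) = a f(h).\<close>

lemma sf_teichmuller: assumes "a^q = a" and that: "h$0 = 0" shows "fsm u a h = fps_const a*h"
proof (rule lg_inj[of _ _ u])
  have aq: "a^(q^k) = a" for k by (induction k) (auto simp: power_mult assms)
  show "lg u oo fsm u a h = fps_compose (lg u) (fps_const a*h)"
  proof (rule fps_ext)
    fix n
    have "(lg u oo fps_const a*h)$n = (\<Sum>k\<le>n. lb u k*((fps_const a*h)^(q^k))$n)"
      by (rule lg_compose_nth) (use that in auto)
    also have "... = a*(lg u oo h)$n"
      by (subst lg_compose_nth[OF that order_refl]) (simp add: power_mult_distrib aq sum_distrib_left ac_simps)
    finally show "(lg u oo fsm u a h)$n = (lg u oo fps_const a*h)$n"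
      using that by (simp add: lg_fsm)
  qed
qed (use that in auto)

lemma sm_teichmuller: assumes "a^q = a" "na u <= 1" "na x < 1" "b : F" "na b <= 1"
  shows "sm u b (a*x) = a * sm u b x" "na y < 1 ==> fa u (a*x) (a*y) = a*fa u x y"
proof -
  have a: "na a <= 1"
  proof (rule ccontr)
    assume "\<not> na a <= 1"
    hence "na a < na a^q" using power_strict_increasing[of 1 q "na a"] q_gt_1 by simp
    thus False using assms(1) by (metis na_power less_irrefl)
  qed
  have ax: "na (a*x) < 1" by (rule na_mult_less1[OF a assms(3)])
  have cm: "ev (fps_const a*h) = a*ev h" if "Lr r h" "0 <= r" "r < 1" for h r
  proof (rule ev_eqI)
    have "((%n. a*h$n) has_sum (a*ev h)) UNIV"
      using that by (intro has_sum_cmult ev_has_sum[of r]) (auto simp: Lr_def)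
    moreover have "fps_nth (fps_const a*h) = (%n. a*h$n)" by auto
    ultimately show "(fps_nth (fps_const a*h) has_sum (a*ev h)) UNIV" by simp
  qed
  obtain r where r: "0 <= r" "r < 1" "Lr r (lx x)" "Lr r (lx (a*x))" by (rule lx_witness[OF assms(3) ax assms(3)])
  have la: "lx (a*x) = fsm u a (lx x)" for x using sf_teichmuller[OF assms(1)] by (simp add: mult.assoc[symmetric])
  have L: "Lr r (fsm u b (lx x))" by (intro Lr_fsm r assms)
  have "fsm u b (lx (a*x)) = fsm u a (fsm u b (lx x))" unfolding la
    by (rule lg_inj[of _ _ u]) (simp_all add: lg_fsm ac_simps)
  also have "... = fps_const a*fsm u b (lx x)" by (rule sf_teichmuller[OF assms(1)]) simp
  finally show "sm u b (a*x) = a * sm u b x"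
    using sm_ev[OF assms(4,5,2) r(3,1,2)] sm_ev[OF assms(4,5,2) r(4,1,2)] cm[OF L r(1,2)] by (simp add: ev_linear del: fps_const_mult)
  assume y: "na y < 1"
  have ay: "na (a*y) < 1" by (rule na_mult_less1[OF a y])
  define s where "s = max (na x) (na y)"
  have s: "0 <= s" "s < 1" using assms(3) y by (auto simp: s_def le_max_iff_disj)
  have M: "Lr s (lx x)" "Lr s (lx y)" "Lr s (lx (a*x))" "Lr s (lx (a*y))"
    by (auto intro!: Lr_linear na_mult_le1 a simp: s_def)
  have "fadd u (lx (a*x)) (lx (a*y)) = fsm u a (fadd u (lx x) (lx y))" unfolding la
    by (rule lg_inj[of _ _ u]) (simp_all add: lg_fsm lg_fadd distrib_left)
  also have "... = fps_const a*fadd u (lx x) (lx y)" by (rule sf_teichmuller[OF assms(1)]) simp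
  finally show "fa u (a*x) (a*y) = a*fa u x y"
    using fa_ev[OF assms(2) M(1,2) s] fa_ev[OF assms(2) M(3,4) s] cm[OF Lr_fadd[OF M(1,2) s(1) assms(2)] s]
    by (simp add: ev_linear del: fps_const_mult)
qed

definition fe :: "'c => 'c => 'c" where "fe u x = infsum (%n. ef u$n*x^n) UNIV"

lemma fe_has_sum: assumes "na u <= 1" "na x < 1" shows "((%n. ef u$n*x^n) has_sum fe u x) UNIV"
proof -
  have "((%n. ef u$n*ev (lx x)^n) has_sum ev (ef u oo lx x)) UNIV"
    by (rule ev_compose[OF na_ef[OF assms(1)], of "na x"]) (use assms in \<open>auto intro: Lr_linear\<close>)
  from this infsumI[OF this] show ?thesis by (simp add: fe_def ev_linear)
qed

text \<open>After applying f this is \<open>lg_pi_eq\<close>. All later estimates of multiplication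
  by \<open>\<pi>\<close> start from this decomposition.\<close>

lemma sm_pi: assumes "na u <= 1" "na x < 1" shows "sm u \<pi> x = fa u (fe u x) (fa u (u*x^q) (x^q^2))"
proof -
  define r where "r = na x"
  have r: "0 <= r" "r < 1" "Lr r (lx x)" using assms by (auto simp: r_def intro: Lr_linear)
  have q: "0 < q" "0 < q^2" using q_gt_1 by auto
  let ?b = "fps_const u*lx x^q" and ?c = "lx x^q^2" and ?e = "ef u oo lx x"
  have L: "Lr r ?b" "Lr r ?c" "Lr r ?e"
    using Lr_monom[of x r u q] Lr_monom[of x r 1 "q^2"] assms q r Lr_compose[OF na_ef[OF assms(1)] ef_0 r(3,1)] by (auto simp: r_def)
  have L2: "Lr r (fadd u ?b ?c)" by (intro Lr_fadd L r assms)
  have "fsm u \<pi> (lx x) = fadd u ?e (fadd u ?b ?c)"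
  proof (rule lg_inj[of _ _ u])
    have "lg u oo ?e = fps_const \<pi>*lx x"
      by (subst fps_compose_assoc) (simp_all add: lg_ef fps_compose_mult_distrib)
    thus "lg u oo (fsm u \<pi> (lx x)) = fps_compose (lg u) (fadd u ?e (fadd u ?b ?c))"
      using lg_pi_eq[of "lx x" u] Lr_nth_0[OF L(1)] Lr_nth_0[OF L(2)] Lr_nth_0[OF L(3)]
      by (simp add: lg_fadd lg_fsm del: fps_const_mult)
  qed (use Lr_nth_0[OF L2] in simp_all)
  hence "sm u \<pi> (ev (lx x)) = ev (fadd u ?e (fadd u ?b ?c))" using sm_ev[OF pi_F assms(1) r(3,1,2)] by simp
  also have "... = fa u (ev ?e) (fa u (ev ?b) (ev ?c))"
    using fa_ev[OF assms(1) L(1,2) r(1,2)] fa_ev[OF assms(1) L(3) L2 r(1,2)] by simp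
  also have "ev ?e = fe u x" using infsumI[OF ev_compose[OF na_ef[OF assms(1)] r(3,1,2)]] by (simp add: fe_def ev_linear)
  also have "ev ?b = u*x^q" by (rule ev_monom)
  also have "ev ?c = x^q^2" using ev_monom[of 1 x "q^2"] by simp
  finally show ?thesis by (simp only: ev_linear)
qed

lemma fa_has_sum: assumes "na u <= 1" "na x < 1" "na y < 1" shows "((%(i, j). ac u i j*x^i*y^j) has_sum fa u x y) UNIV"
proof -
  obtain r where r: "0 <= r" "r < 1" "Lr r (lx x)" "Lr r (lx y)" by (rule lx_witness[OF assms(2,3,2)])
  show ?thesis using ev_fadd[OF assms(1) r(3,4,1,2)] fa_ev[OF assms(1) r(3,4,1,2)] by (simp add: ev_linear)
qed

lemma sm_has_sum: assumes "a : F" "na a <= 1" "na u <= 1" "na x < 1"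
  shows "((%n. sf u a$n*x^n) has_sum sm u a x) UNIV"
proof -
  have L: "Lr (na x) (lx x)" by (auto intro: Lr_linear)
  have c: "na (sf u a$n) <= 1" for n using na_sf assms by blast
  show ?thesis using ev_compose[OF c L na_nonneg assms(4)] sm_ev[OF assms(1-3) L na_nonneg assms(4)] by (simp add: ev_linear fsm_def)
qed

subsection \<open>Torsion points\<close>

lemma na_le_0 [simp]: "na x <= 0 \<longleftrightarrow> x = 0" and na_less_0 [simp]: "\<not> na x < 0"
  using na_nonneg[of x] by (auto simp: order_antisym_conv not_less simp del: na_nonneg)

text \<open>Strassmann's bound in the open unit disc. Division by X - y at a zero y lowers the index
  of the unit coefficient by one; a unit constant term leaves no zero.\<close>

lemma strassmann: assumes "!!n. na (c n) <= 1" "na (c N) = 1" "finite Z"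
    "!!z. z : Z ==> na z < 1 & (%M. \<Sum>n<M. c n*z^n) \<longlonglongrightarrow> 0" shows "card Z <= N" using assms
proof (induction N arbitrary: c Z)
  case 0
  have False if "z : Z" for z
  proof -
    have z: "na z < 1" "(%M. \<Sum>n<M. c n*z^n) \<longlonglongrightarrow> 0" using 0 that by auto
    from z(2) have lim: "(%M. na (\<Sum>n<M. c n*z^n)) \<longlonglongrightarrow> 0" using lim_na[of "%M. \<Sum>n<M. c n*z^n" 0] by simp
    have "na (\<Sum>n<Suc M. c n*z^n) = 1" for M
    proof -
      have "na (\<Sum>n<M. c (Suc n)*z^Suc n) <= na z"
        using z 0(1) by (intro na_sum_le) (auto simp: na_mult na_power intro!: mult_le_one power_le_one mult_left_le mult_le_cancel_left1
            order_trans[OF mult_mono[of _ 1 "na z*na z^_" "na z"]])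
      hence "na (\<Sum>n<M. c (Suc n)*z^Suc n) < na (c 0)" using z(1) 0(2) by simp
      from na_add_eq[OF this] show ?thesis using 0(2) by (subst sum.lessThan_Suc_shift) simp
    qed
    hence "(%M. na (\<Sum>n<Suc M. c n*z^n)) \<longlonglongrightarrow> 1" by simp
    with LIMSEQ_Suc[OF lim] show False using LIMSEQ_unique by fastforce
  qed
  hence "Z = {}" by auto
  thus ?case by simp
next
  case (Suc N)
  show ?case
  proof (cases "Z = {}")
    case False
    then obtain y where y: "y : Z" by auto
    hence y1: "na y < 1" and S0: "(%M. \<Sum>n<M. c n*y^n) \<longlonglongrightarrow> 0" using Suc.prems by auto
    define S where "S M = (\<Sum>n<M. c n*y^n)" for M
    have Sb: "na (S M) <= na y^M" for M
    proof -
      have "(%k. S (k + M) - S M) \<longlonglongrightarrow> - S M" using LIMSEQ_ignore_initial_segment[OF S0, of M]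
        unfolding lim_na S_def by (simp add: algebra_simps)
      moreover have "na (S (k + M) - S M) <= na y^M" for k
      proof (induction k)
        case (Suc k)
        have "na (c (k + M)*y^(k + M)) <= na y^M" using Suc.prems y1 \<open>!!n. na (c n) <= 1\<close>
          by (intro na_mult_le1) (auto simp: na_power intro!: power_decreasing)
        from na_add_le[OF Suc this] show ?case by (simp add: S_def algebra_simps)
      qed simp
      ultimately have "na (- S M) <= na y^M" by (rule na_lim_le[of _ _ 0])
      thus ?thesis by simp
    qed
    obtain d where d: "!!n. na (d n) <= 1" "na (d N) = 1" "c 0 = - (y*d 0)" "!!n. c (Suc n) = d n - y*d (Suc n)"
    proof (cases "y = 0")
      case True
      have "c 0 = 0" using Sb[of 1] True by (simp add: S_def)
      thus ?thesis using that[of "%n. c (Suc n)"] Suc.prems True by simp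
    next
      case ny: False
      show ?thesis
      \<comment> \<open>The coefficients of the quotient by X - y. They are integral because a
        partial sum at a zero is minus a tail, which is at most the corresponding power of
        |y|.\<close>
      proof (rule that[of "%n. - S (Suc n)/y^Suc n"])
        show "na (- S (Suc n)/y^Suc n) <= 1" for n
          using Sb[of "Suc n"] ny by (simp only: na_divide na_power na_minus) (simp add: divide_le_eq)
        have "c (Suc N) + (- S (Suc (Suc N))/y^Suc N) = - S (Suc N)/y^Suc N" using ny by (simp add: S_def field_simps)
        moreover have "na (- S (Suc (Suc N))/y^Suc N) < na (c (Suc N))"
        proof -
          have "na (- S (Suc (Suc N))/y^Suc N) <= na y^Suc (Suc N)/na y^Suc N"
            using Sb[of "Suc (Suc N)"] by (simp only: na_divide na_power na_minus) (intro divide_right_mono, auto)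
          also have "... = na y" using ny by (simp add: field_simps)
          finally show ?thesis using y1 Suc.prems by simp
        qed
        ultimately show "na (- S (Suc N)/y^Suc N) = 1" using na_add_eq Suc.prems(2) by metis
        show "c 0 = - (y*(- S (Suc 0)/y^Suc 0))" using ny by (simp add: S_def)
        show "c (Suc n) = - S (Suc n)/y^Suc n - y*(- S (Suc (Suc n))/y^Suc (Suc n))" for n
          using ny by (simp add: S_def field_simps)
      qed
    qed
    have "card (Z - {y}) <= N"
    proof (rule Suc.IH[of d])
      fix z assume z: "z : Z - {y}"
      hence z1: "na z < 1" and Z0: "(%M. \<Sum>n<M. c n*z^n) \<longlonglongrightarrow> 0" using Suc.prems by auto
      have tel: "(\<Sum>n<Suc M. c n*z^n) + d M*z^Suc M = (z - y)*(\<Sum>n<Suc M. d n*z^n)" for M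
        by (induction M) (simp_all add: d algebra_simps)
      have "(%M. na z^M) \<longlonglongrightarrow> 0" using z1 by (intro LIMSEQ_power_zero) auto
      hence "(%M. na z^Suc M) \<longlonglongrightarrow> 0" by (rule LIMSEQ_Suc)
      hence "(%M. d M*z^Suc M) \<longlonglongrightarrow> 0"
        unfolding lim_na by (rule Lim_null_comparison[rotated]) (use d(1) in \<open>auto simp del: power_Suc simp: na_mult na_power mult_left_le_one_le\<close>)
      hence 1: "(%M. max (na (\<Sum>n<Suc M. c n*z^n)) (na (d M*z^Suc M))) \<longlonglongrightarrow> max 0 0"
        using LIMSEQ_Suc[OF Z0] unfolding lim_na by (intro tendsto_max) (auto simp del: sum.lessThan_Suc power_Suc)
      have "(%M. na ((z - y)*(\<Sum>n<Suc M. d n*z^n))) \<longlonglongrightarrow> 0"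
        by (rule Lim_null_comparison[OF _ 1[simplified max.idem]]) (simp only: tel[symmetric] real_norm_def abs_of_nonneg[OF na_nonneg] na_add eventually_True)
      hence "(%M. na ((z - y)*(\<Sum>n<Suc M. d n*z^n))/na (z - y)) \<longlonglongrightarrow> 0/na (z - y)"
        using z by (intro tendsto_divide) auto
      moreover have "na ((z - y)*A)/na (z - y) = na A" for A using z by (simp add: na_mult)
      ultimately have "(%M. na ((\<Sum>n<Suc M. d n*z^n) - 0)) \<longlonglongrightarrow> 0" by (simp del: sum.lessThan_Suc)
      hence "(%M. \<Sum>n<Suc M. d n*z^n) \<longlonglongrightarrow> 0" unfolding lim_na .
      hence "(%M. \<Sum>n<M. d n*z^n) \<longlonglongrightarrow> 0" by (rule LIMSEQ_imp_Suc)
      thus "na z < 1 & (%M. \<Sum>n<M. d n*z^n) \<longlonglongrightarrow> 0" using z1 by simp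
    qed (use d Suc.prems in auto)
    thus ?thesis using y Suc.prems(3) by simp
  qed simp
qed

lemma has_sum_LIMSEQ: assumes "(f has_sum (s::'c)) (UNIV :: nat set)" shows "(%n. sum f {..<n}) \<longlonglongrightarrow> s"
  using assms unfolding has_sum_def by (rule filterlim_compose[OF _ filterlim_lessThan_at_top])

text \<open>In the decomposition of multiplication by \<open>\<pi>\<close>, the series
  \<open>ef u\<close> and u X^q have small coefficients, and the formal addition of such a series
  changes nothing modulo the maximal ideal.\<close>

lemma sf_pi_coeffs: assumes "na u < 1" shows "na ((sf u \<pi>)$n - (if n = q^2 then 1 else 0)) < 1"
proof -
  have u: "na u <= 1" using assms by simp
  have q: "0 < q" "0 < q^2" using q_gt_1 by auto
  have small: "na (fadd u h k$n - (k$n)) < 1"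
    if h: "!!n. na (h$n) < 1" "h$0 = 0" "!!n. na (k$n) <= 1" "k$0 = 0" for h k n
  proof -
    have b: "na ((h^i*k^j)$n) <= 1" for i j n
    proof -
      have "L0 1 h" "L0 1 k" using h by (auto simp: L0_def intro: less_imp_le)
      thus ?thesis using L0_mult[OF L0_power L0_power, of 1 h k i j] by (simp add: L0_def)
    qed
    have s: "na ((h^Suc i*k^j)$n) < 1" for i j
    proof -
      have "(h^Suc i*k^j)$n = (\<Sum>l\<in>{0..n}. (h$l)*(h^i*k^j)$(n - l))"
        by (simp add: fps_mult_nth[symmetric] mult.assoc)
      also have "na ... < 1" using na_mult_less1[OF b h(1)] by (intro na_sum_less) (auto simp: mult.commute)
      finally show ?thesis .
    qed
    have k1: "(\<Sum>j\<le>n. ac u 0 j*(k^j)$n) = k$n"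
    proof -
      have "(\<Sum>j\<le>n. ac u 0 j*(k^j)$n) = (\<Sum>j\<le>n. if j = 1 then (k$n) else 0)"
        by (intro sum.cong) (auto simp: ac_0_j)
      also have "... = k$n" using h(4) by (cases n) auto
      finally show ?thesis .
    qed
    have "fadd u h k$n = (\<Sum>j\<le>n. ac u 0 j*(h^0*k^j)$n)
        + (\<Sum>i<n. \<Sum>j\<le>n. ac u (Suc i) j*(h^Suc i*k^j)$n)"
      using h by (simp only: fadd_nth sum.atMost_shift)
    hence "fadd u h k$n - (k$n) = (\<Sum>i<n. \<Sum>j\<le>n. ac u (Suc i) j*(h^Suc i*k^j)$n)"
      by (simp only: power_0 mult_1 k1 add_diff_cancel_left')
    also have "na ... < 1" using na_mult_less1[OF na_ac[OF u] s] by (intro na_sum_less) auto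
    finally show ?thesis .
  qed
  let ?b = "fps_const u*fps_X^q :: 'c fps" and ?c = "fps_X^q^2 :: 'c fps"
  have c: "na ((fadd u ?b ?c)$n - (if n = q^2 then 1 else 0)) < 1" for n using small[of ?b ?c n] assms q by simp
  have c1: "na ((fadd u ?b ?c)$n) <= 1" for n
    using na_add_le[OF less_imp_le[OF c[of n]], of "if n = q^2 then 1 else 0"] by simp
  have e: "na (ef u$n) < 1" for n
  proof -
    consider "n = 0" | "n = 1" | "2 <= n" by linarith
    thus ?thesis
    proof cases
      case 3
      then obtain m where "m : PU" "ef u$n = \<pi>^2*m u" using ef_PU by blast
      thus ?thesis using na_mult_less1[OF PU_bound[of m u], of "\<pi>^2" 1] u na_pi_less
        by (simp add: mult.commute na_power power_less_one_iff)
    qed (use ef_1 na_pi_less in auto)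
  qed
  have "sf u \<pi> = fadd u (ef u) (fadd u ?b ?c)"
    by (rule lg_inj[of _ _ u]) (use lg_pi_eq[of fps_X u] q in \<open>simp_all add: lg_fadd lg_sf lg_ef\<close>)
  hence "na ((sf u \<pi>)$n - ((fadd u ?b ?c)$n)) < 1" using small[OF e ef_0 c1, of n] by simp
  from na_add_less[OF this c[of n]] show ?thesis by simp
qed

definition piker :: "'c => 'c set" where "piker u = {z. na z < 1 & sm u \<pi> z = 0}"

lemma card_piker: assumes "na u < 1" "finite Z" "Z <= piker u" shows "card Z <= q^2"
proof (rule strassmann[where c = "fps_nth (sf u \<pi>)"])
  show "na ((sf u \<pi>)$n) <= 1" for n using na_sf[OF pi_F] assms by simp
  show "na ((sf u \<pi>)$(q^2)) = 1" using na_eqI[of "(sf u \<pi>)$(q^2)" 1] sf_pi_coeffs[OF assms(1), of "q^2"] by simp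
  fix z assume "z : Z"
  hence z: "na z < 1" "sm u \<pi> z = 0" using assms by (auto simp: piker_def)
  thus "na z < 1 & (%M. \<Sum>n<M. ((sf u \<pi>)$n)*z^n) \<longlonglongrightarrow> 0"
    using has_sum_LIMSEQ[OF sm_has_sum[OF pi_F _ z(1)], of u] assms(1) by simp
qed fact

lemma na_fa_diff: assumes "na u <= 1" "na x < 1" "na y < 1" shows "na (fa u x y - (x + y)) <= na x*na y"
proof -
  have "na (fa u x y - (\<Sum>(i,j)\<in>{(0,1),(1,0)}. ac u i j*x^i*y^j)) <= na x*na y"
  proof (rule has_sum_approx[OF fa_has_sum[OF assms]])
    fix ij assume "ij : UNIV - {(0, 1), (1::nat, 0::nat)}"
    then obtain i j where ij: "ij = (i, j)" "(i, j) ~= (0, 1)" "(i, j) ~= (1, 0)" by (cases ij) auto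
    show "na (case ij of (i, j) => ac u i j*x^i*y^j) <= na x*na y"
    proof (cases "i = 0 \<or> j = 0")
      case True
      hence "ac u i j = 0" using ij ac_i_0 ac_0_j by auto
      thus ?thesis by (simp add: ij)
    next
      case False
      have "na x^i <= na x^1" "na y^j <= na y^1" using False assms by (intro power_decreasing; simp)+
      hence "na (x^i*y^j) <= na x*na y" by (auto simp: na_mult na_power intro!: mult_mono)
      thus ?thesis using na_mult_le1[OF na_ac[OF assms(1)]] by (simp add: ij mult.assoc)
    qed
  qed auto
  thus ?thesis by (simp add: ac_i_0 ac_0_j add.commute)
qed

text \<open>The formal sum differs from x + y by at most |x||y|, which is less than the larger
  absolute value.\<close>

lemma na_fa_distinct: assumes "na u <= 1" "na x < 1" "na y < 1" "na x ~= na y" shows "na (fa u x y) = max (na x) (na y)"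
proof -
  have m: "na (x + y) = max (na x) (na y)"
    using na_add_eq[of x y] na_add_eq[of y x] assms(4) by (auto simp: max_def add.commute)
  have "na x*na y < max (na x) (na y)"
  proof (cases "na x < na y")
    case True
    have "na x*na y < 1*na y" using assms True by (intro mult_strict_right_mono) (auto intro: le_less_trans[OF na_nonneg])
    thus ?thesis by simp
  next
    case False
    hence "na y < na x" using assms by simp
    hence "na x*na y < na x*1" using assms by (intro mult_strict_left_mono) (auto intro: le_less_trans[OF na_nonneg])
    thus ?thesis by simp
  qed
  thus ?thesis using na_eqI[of "fa u x y" "x + y"] na_fa_diff[OF assms(1-3)] m by simp
qed

lemma na_sm_unit: assumes "a : F" "na a = 1" "na u <= 1" "na x < 1" shows "na (sm u a x) = na x"
proof (cases "x = 0")
  case False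
  have "na (sm u a x - (\<Sum>n\<in>{0,1}. (sf u a$n)*x^n)) <= na x*na x"
  proof (rule has_sum_approx[OF sm_has_sum[of a u x]])
    fix n :: nat assume "n : UNIV - {0, 1}"
    hence n: "2 <= n" by auto
    have "na (x^n) <= na x^2" unfolding na_power using n assms by (intro power_decreasing) auto
    thus "na (sf u a$n*x^n) <= na x*na x" using assms na_sf[of a u n]
      by (intro na_mult_le1) (auto simp: power2_eq_square)
  qed (use assms in auto)
  hence "na (sm u a x - a*x) <= na x*na x" using sf_1 by simp
  also have "... < na x" using assms False by simp
  also have "... = na (a*x)" using assms by (simp add: na_mult)
  finally have "na (sm u a x) = na (a*x)" by (rule na_eqI)
  thus ?thesis using assms(2) by (simp add: na_mult)
next
  case True
  have "na (sm u a x) <= na x" by (rule na_sm) (use assms in auto)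
  thus ?thesis using True na_nonneg[of "sm u a x"] by simp
qed

lemma sm_zero: assumes "a : F" "na a <= 1" "na u <= 1" shows "sm u a 0 = 0"
  using na_sm[OF assms, of 0] na_nonneg[of "sm u a 0"] by simp

lemma na_sm_less: "a : F ==> na a <= 1 ==> na u <= 1 ==> na x < 1 ==> na (sm u a x) < 1" using na_sm le_less_trans by blast

lemma na_fa_less: assumes "na u <= 1" "na x < 1" "na y < 1" shows "na (fa u x y) < 1"
  using na_fa[OF assms(1), of x "max (na x) (na y)" y] assms by simp

definition comb :: "'c => 'c => 'c => 'c => 'c => 'c"
  where "comb u x y a b = fa u (sm u a x) (sm u b y)"

definition OF :: "'c set" where "OF = {a : F. na a <= 1}"

lemma OF_ops: "a : OF ==> b : OF ==> a + b : OF" "a : OF ==> b : OF ==> a - b : OF"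
  "a : OF ==> b : OF ==> a*b : OF" "a : OF ==> - a : OF" "1 : OF" "0 : OF" "\<pi> \<in> OF"
  using pi_F by (auto simp: OF_def F_add F_diff F_mult F_minus F_1 F_0 intro: na_add_le na_diff_le na_mult_le1)

lemma OF_D: "a : OF ==> a : F" "a : OF ==> na a <= 1" by (auto simp: OF_def)

lemma OF_not_unit: assumes "a : OF" "na a ~= 1" shows "EX c:OF. a = \<pi>*c"
proof (rule bexI[of _ "a/\<pi>"])
  have "na a <= na \<pi>" using assms by (intro na_F_le_pi) (auto simp: OF_def)
  thus "a/\<pi> \<in> OF" using assms by (auto simp: OF_def na_divide F_divide pi_F)
qed simp

lemma na_comb: "na u <= 1 ==> na x < 1 ==> na y < 1 ==> a : OF ==> b : OF ==> na (comb u x y a b) < 1"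
  unfolding comb_def by (intro na_fa_less na_sm_less) (auto simp: OF_D)

lemma comb_add: assumes "na u <= 1" "na x < 1" "na y < 1" "a : OF" "b : OF" "c : OF" "d : OF"
  shows "fa u (comb u x y a b) (comb u x y c d) = comb u x y (a + c) (b + d)"
proof -
  have l: "na (sm u a x) < 1" "na (sm u b y) < 1" "na (sm u c x) < 1" "na (sm u d y) < 1" "na (fa u (sm u c x) (sm u d y)) < 1"
    "na (fa u (sm u b y) (sm u d y)) < 1" using assms by (auto intro!: na_sm_less na_fa_less OF_D)
  have "fa u (comb u x y a b) (comb u x y c d) = fa u (sm u a x) (fa u (sm u b y) (fa u (sm u c x) (sm u d y)))"
    unfolding comb_def using fa_assoc[OF assms(1) l(1,2,5)] .
  also have "fa u (sm u b y) (fa u (sm u c x) (sm u d y)) = fa u (sm u c x) (fa u (sm u b y) (sm u d y))"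
    using fa_assoc[OF assms(1) l(2,3,4)] fa_assoc[OF assms(1) l(3,2,4)] fa_commute[OF assms(1) l(2,3)] by simp
  also have "fa u (sm u a x) (fa u (sm u c x) (fa u (sm u b y) (sm u d y))) = comb u x y (a + c) (b + d)"
    unfolding comb_def using fa_assoc[OF assms(1) l(1,3,6)] assms by (simp add: sm_add OF_D)
  finally show ?thesis .
qed

lemma comb_mult: assumes "na u <= 1" "na x < 1" "na y < 1" "a : OF" "b : OF" "c : OF"
  shows "sm u c (comb u x y a b) = comb u x y (c*a) (c*b)"
  unfolding comb_def using assms by (simp add: sm_fa sm_sm na_sm_less OF_D)

lemma fa_inverse: assumes "na u <= 1" "na x < 1" shows "fa u x (sm u (-1) x) = 0"
proof -
  have "sm u (1 + -1) x = fa u (sm u 1 x) (sm u (-1) x)"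
    by (rule sm_add) (use assms in \<open>auto simp: F_1 F_minus\<close>)
  thus ?thesis by (simp add: sm_1 sm_0 assms)
qed

text \<open>X_1 and Y_1 are independent modulo \<open>\<pi>\<close> since their absolute values
  differ and units preserve them. Their q^2 combinations over residue representatives exhaust the
  \<open>\<pi>\<close>-torsion by \<open>card_piker\<close>. For level two, \<open>\<pi>\<close> z
  is matched first, and the difference is \<open>\<pi>\<close>-torsion again.\<close>

lemma torsion_basisI: assumes u: "na u < 1" and x: "na x < 1" and y: "na y < 1"
    and X1: "sm u \<pi> (sm u \<pi> x) = 0" "sm u \<pi> x ~= 0" and Y1: "sm u \<pi> (sm u \<pi> y) = 0" "sm u \<pi> y ~= 0"
    and ne: "na (sm u \<pi> x) ~= na (sm u \<pi> y)" shows "torsion_basis F v \<pi> q u x y"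
proof -
  define Xa where "Xa = sm u \<pi> x"
  define Ya where "Ya = sm u \<pi> y"
  have u1: "na u <= 1" using u by simp
  have Xa: "na Xa < 1" "sm u \<pi> Xa = 0" "Xa ~= 0" and Ya: "na Ya < 1" "sm u \<pi> Ya = 0" "Ya ~= 0" and XY: "na Xa ~= na Ya"
    using X1 Y1 ne x y u1 pi_F by (auto simp: Xa_def Ya_def intro: na_sm_less)
  note OFs = OF_ops
  have kill: "sm u (\<pi>*c) Z = 0" if "c : OF" "na Z < 1" "sm u \<pi> Z = 0" for c Z
    using that u1 pi_F sm_sm[of c \<pi> u Z] by (simp add: mult.commute OF_D sm_zero)
  have indep: "EX c:OF. EX d:OF. a = \<pi>*c & b = \<pi>*d" if ab: "a : OF" "b : OF" "comb u Xa Ya a b = 0" for a b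
  proof -
    have val: "na (sm u a Z) = (if na a = 1 then na Z else 0)" if aZ: "a : OF" "na Z < 1" "sm u \<pi> Z = 0" for a Z
    proof (cases "na a = 1")
      case True
      thus ?thesis using na_sm_unit[OF OF_D(1)[OF aZ(1)] True u1 aZ(2)] by simp
    next
      case False
      obtain c where c: "c : OF" "a = \<pi>*c" using OF_not_unit[OF aZ(1) False] by blast
      have "sm u a Z = 0" unfolding c(2) by (rule kill[OF c(1) aZ(2,3)])
      thus ?thesis using False by simp
    qed
    have *: "na (sm u a Xa) = na (sm u b Ya)"
    proof (rule ccontr)
      assume "na (sm u a Xa) ~= na (sm u b Ya)"
      hence "max (na (sm u a Xa)) (na (sm u b Ya)) = 0"
        using na_fa_distinct[OF u1, of "sm u a Xa" "sm u b Ya"] ab Xa Ya u1 by (simp add: comb_def na_sm_less OF_D)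
      thus False using \<open>na (sm u a Xa) ~= na (sm u b Ya)\<close> na_nonneg[of "sm u a Xa"] na_nonneg[of "sm u b Ya"] by linarith
    qed
    hence "na a ~= 1 & na b ~= 1" using val[OF ab(1) Xa(1,2)] val[OF ab(2) Ya(1,2)] Xa(3) Ya(3) XY by (auto split: if_splits)
    thus ?thesis using OF_not_unit[OF ab(1)] OF_not_unit[OF ab(2)] by simp
  qed
  have span: "EX a:OF. EX b:OF. z = comb u Xa Ya a b" if z: "z : piker u" for z
  proof -
    obtain B where B: "finite B" "card B = q" "B <= F" "!!b. b : B ==> na b <= 1"
      "!!b c. b : B ==> c : B ==> b ~= c ==> na (b - c) = 1" using residue_reps by metis
    have BO: "b : OF" if "b : B" for b using B that by (auto simp: OF_def)
    let ?f = "%(a, b). comb u Xa Ya a b"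
    have inj: "inj_on ?f (B \<times> B)"
    proof (rule inj_onI, clarify)
      fix a b c d assume abcd: "a : B" "b : B" "c : B" "d : B" "comb u Xa Ya a b = comb u Xa Ya c d"
      have "comb u Xa Ya (a + -1*c) (b + -1*d) = fa u (comb u Xa Ya a b) (sm u (-1) (comb u Xa Ya c d))"
        using comb_mult[OF u1 Xa(1) Ya(1) BO[OF abcd(3)] BO[OF abcd(4)] OFs(4)[OF OFs(5)]]
          comb_add[OF u1 Xa(1) Ya(1) BO[OF abcd(1)] BO[OF abcd(2)], of "-1*c" "-1*d"]
          OFs(4)[OF BO[OF abcd(3)]] OFs(4)[OF BO[OF abcd(4)]] by simp
      also have "... = 0" unfolding abcd(5)[symmetric] using abcd BO u1 Xa Ya by (intro fa_inverse na_comb) auto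
      finally have "comb u Xa Ya (a - c) (b - d) = 0" by simp
      then obtain e f where "e : OF" "f : OF" "a - c = \<pi>*e" "b - d = \<pi>*f"
        using indep[of "a - c" "b - d"] OFs(2) abcd BO by metis
      hence "na (a - c) < 1" "na (b - d) < 1"
        using na_mult_less1[OF OF_D(2) na_pi_less] by (auto simp: mult.commute[of \<pi>])
      thus "a = c & b = d" using B(5) abcd by force
    qed
    let ?I = "?f ` (B \<times> B)"
    have "card ?I = q^2" using card_image[OF inj] B by (simp add: card_cartesian_product power2_eq_square)
    have "?I <= piker u"
    proof clarify
      fix a b assume "a : B" "b : B"
      hence ab: "a : OF" "b : OF" using BO by auto
      have "sm u \<pi> (comb u Xa Ya a b) = fa u 0 0"
        using comb_mult[OF u1 Xa(1) Ya(1) ab OFs(7)] kill[OF ab(1) Xa(1,2)] kill[OF ab(2) Ya(1,2)] by (simp add: comb_def)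
      thus "comb u Xa Ya a b : piker u" using na_comb[OF u1 Xa(1) Ya(1) ab] fa_0[OF u1, of 0] by (simp add: piker_def)
    qed
    have "z : ?I"
    proof (rule ccontr)
      assume "z \<notin> ?I"
      moreover have "finite ?I" using B by simp
      ultimately have "card (insert z ?I) = Suc (q^2)" using \<open>card ?I = q^2\<close> by simp
      moreover have "card (insert z ?I) <= q^2"
        by (rule card_piker[OF u]) (use \<open>finite ?I\<close> \<open>?I <= piker u\<close> z in auto)
      ultimately show False by simp
    qed
    thus ?thesis using BO by auto
  qed
  have tor: "lt_torsion v \<pi> q u (\<pi>^2) = {z. na z < 1 & sm u \<pi> (sm u \<pi> z) = 0}"
    unfolding lt_torsion_def using u1 pi_F by (auto simp: v_pos_na sm_sm power2_eq_square)
  have C: "carrier (val_ring v F) = OF" by (auto simp: carrier_val_ring OF_def v_nonneg_na)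
  have up: "comb u Xa Ya a b = sm u \<pi> (comb u x y a b)" if "a : OF" "b : OF" for a b
    using that u1 x y pi_F by (simp add: comb_def Xa_def Ya_def sm_fa sm_sm na_sm_less OF_D mult.commute)
  show ?thesis unfolding torsion_basis_def Let_def tor C comb_def[symmetric]
  proof (intro conjI ballI impI)
    fix z assume "z : {z. na z < 1 & sm u \<pi> (sm u \<pi> z) = 0}"
    hence z: "na z < 1" "sm u \<pi> (sm u \<pi> z) = 0" by auto
    hence "sm u \<pi> z : piker u" using u1 pi_F by (auto simp: piker_def na_sm_less)
    then obtain a b where ab: "a : OF" "b : OF" "sm u \<pi> z = comb u Xa Ya a b" using span by blast
    define w where "w = comb u x y a b"
    have w: "na w < 1" "sm u \<pi> w = sm u \<pi> z" using na_comb[OF u1 x y ab(1,2)] up ab by (auto simp: w_def)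
    have mw: "na (sm u (-1) w) < 1" using w u1 by (intro na_sm_less) (auto simp: F_minus F_1)
    have "sm u \<pi> (fa u z (sm u (-1) w)) = fa u (sm u \<pi> z) (sm u (-1) (sm u \<pi> w))"
    proof -
      have "sm u \<pi> (sm u (-1) w) = sm u (-1) (sm u \<pi> w)"
        using sm_sm[of \<pi> "-1" u w] sm_sm[of "-1" \<pi> u w] w u1 pi_F by (simp add: F_minus F_1)
      thus ?thesis using sm_fa[OF pi_F u1 z(1) mw] by simp
    qed
    also have "... = 0" unfolding w(2) using z u1 pi_F by (intro fa_inverse na_sm_less)
    finally have "fa u z (sm u (-1) w) : piker u" using z mw u1 by (auto simp: piker_def na_fa_less)
    then obtain c d where cd: "c : OF" "d : OF" "fa u z (sm u (-1) w) = comb u Xa Ya c d" using span by blast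
    have "comb u Xa Ya c d = comb u x y (\<pi>*c) (\<pi>*d)" using up[OF cd(1,2)] comb_mult[OF u1 x y cd(1,2) OFs(7)] by simp
    hence "fa u (fa u z (sm u (-1) w)) w = comb u x y (\<pi>*c + a) (\<pi>*d + b)"
      using cd(3) ab cd(1,2) comb_add[OF u1 x y OFs(3)[OF OFs(7) cd(1)] OFs(3)[OF OFs(7) cd(2)] ab(1,2)] by (simp add: w_def)
    moreover have "fa u (fa u z (sm u (-1) w)) w = z"
      using fa_assoc[OF u1 z(1) mw w(1)] fa_commute[OF u1 mw w(1)] fa_inverse[OF u1 w(1)] fa_0[OF u1 z(1)] by simp
    ultimately show "EX a:OF. EX b:OF. z = comb u x y a b" using ab cd OFs by metis
  next
    fix a b assume ab: "a : OF" "b : OF" "comb u x y a b = 0"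
    hence "comb u Xa Ya a b = 0" using up u1 pi_F by (simp add: sm_zero)
    then obtain c d where cd: "c : OF" "d : OF" "a = \<pi>*c" "b = \<pi>*d" using indep ab by blast
    have "comb u Xa Ya c d = comb u x y a b" using up[OF cd(1,2)] comb_mult[OF u1 x y cd(1,2) OFs(7)] cd by simp
    then obtain e f where "e : OF" "f : OF" "c = \<pi>*e" "d = \<pi>*f" using indep[OF cd(1,2)] ab by auto
    thus "EX c:OF. a = \<pi>^2*c" "EX d:OF. b = \<pi>^2*d" using cd by (auto simp: power2_eq_square mult.assoc)
  qed (use x y X1 Y1 in auto)
qed

subsection \<open>Functions filtered by powers of \<open>\<lambda>\<close>\<close>

text \<open>Since \<open>\<lambda>\<close> has valuation \<open>1/(2q\<^sup>3(q - 1))\<close>, the valuations of \<open>u\<close>, \<open>X\<^sub>1\<close>, \<open>X\<^sub>2\<close>, \<open>Y\<^sub>1\<close>, \<open>Y\<^sub>2\<close> on the affinoid are those of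
  \<open>\<lambda>\<close> to the powers \<open>q\<^sup>3(q - 1)\<close>, \<open>q\<^sup>3\<close>, \<open>q\<close>, \<open>q\<^sup>2\<close>, \<open>1\<close>. The root \<open>\<nu>\<close> is needed to normalize \<open>Z\<close>.\<close>

definition nu :: 'c where "nu = (SOME x. x^(2*q^4*(q - 1)) = \<pi>)"
definition lam :: 'c where "lam = nu^q"
definition wt :: nat where "wt = q^3*(q - 1)"

lemma nu_power: "nu^(2*q^4*(q - 1)) = \<pi>"
proof -
  have "0 < 2*q^4*(q - 1)" using q_gt_1 by simp
  hence "EX x. x^(2*q^4*(q - 1)) = \<pi>" using nth_root by metis
  thus ?thesis unfolding nu_def by (rule someI_ex)
qed

lemma lam_power: "lam^(2*wt) = \<pi>"
proof -
  have "q*(2*wt) = 2*q^4*(q - 1)" by (simp add: wt_def power4_eq_xxxx power3_eq_cube)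
  thus ?thesis unfolding lam_def power_mult[symmetric] by (simp only: nu_power)
qed

lemma nu_nz [simp]: "nu ~= 0"
  using nu_power q_gt_1 by (metis pi_nz power_0_left power_eq_0_iff mult_is_0 nat_less_le not_less0 zero_less_diff zero_neq_numeral)

lemma na_nu_less: "na nu < 1"
proof (rule ccontr)
  assume "\<not> na nu < 1"
  hence "1 <= na (nu^(2*q^4*(q - 1)))" by (simp add: na_power one_le_power)
  thus False unfolding nu_power using na_pi_less by simp
qed

lemma lam_nz [simp]: "lam ~= 0" by (simp add: lam_def)

lemma na_lam_less: "na lam < 1" using na_nu_less q_gt_1 by (simp add: lam_def na_power power_less_one_iff)

lemma na_lam_power_le: "m <= n ==> na lam^n <= na lam^m" using na_lam_less by (intro power_decreasing) auto

text \<open>The comparisons of exponents below are linear in the powers of q, taken as atoms; these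
  relations are their input.\<close>

lemma q_powers: "3*q <= q^2" "3*q^2 <= q^3" "3*q^3 <= q^4" "3*q^4 <= q^5" "wt + q^3 = q^4" "q*wt + q^4 = q^5"
proof -
  have *: "3*q^n <= q^Suc n" for n using mult_le_mono1[OF q_ge_3, of "q^n"] by simp
  show "3*q <= q^2" using *[of 1] by (simp add: power2_eq_square)
  show "3*q^2 <= q^3" using *[of 2] by (simp only: Suc_numeral semiring_norm)
  show "3*q^3 <= q^4" using *[of 3] by (simp only: Suc_numeral semiring_norm)
  show "3*q^4 <= q^5" using *[of 4] by (simp only: Suc_numeral semiring_norm)
  have "wt + q^3 = q^3*(q - 1 + 1)" by (simp only: wt_def distrib_left mult_1_right)
  also have "... = q^4" using q_gt_1 by (simp add: eval_nat_numeral)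
  finally show 1: "wt + q^3 = q^4" .
  have "q*wt + q^4 = q*(wt + q^3)" by (simp add: distrib_left eval_nat_numeral)
  also have "... = q^5" unfolding 1 by (simp add: eval_nat_numeral)
  finally show "q*wt + q^4 = q^5" .
qed

end

text \<open>Instances: all functions bounded by 1 on \<open>S\<close> (\<open>galg_bdd\<close>),
  uniform limits of integral polynomials on the closed unit disc (\<open>galg_pa\<close>), and the
  closed algebra \<open>Gcl\<close> on one piece. The functions are total, but \<open>G_lim\<close>
  tests approximation on \<open>S\<close> only, so membership depends on the values there.\<close>

locale galg = lubin_tate_setting F v \<pi> q p for F :: "'c::{field_char_0,complete_space} set" and v \<pi> q p +
  fixes S :: "'p set" and G :: "('p => 'c) set" assumes G_const: "na c <= 1 ==> (%_. c) : G"
    and G_add: "g : G ==> h : G ==> g + h : G" and G_mult: "g : G ==> h : G ==> g*h : G"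
    and G_lim: "(!!n. EX h:G. ALL P:S. na (g P - h P) <= na lam^n) ==> g : G"
    and G_bound: "g : G ==> P : S ==> na (g P) <= 1"
begin

text \<open>Divisibility by \<open>lam^n\<close> inside \<open>G\<close>, in general stronger than
  the bound |a| <= |lam|^n on \<open>S\<close>.\<close>

definition Fil :: "nat => ('p => 'c) => bool" where "Fil n a \<longleftrightarrow> (%P. a P/lam^n) : G"

definition kc :: "'c => 'p => 'c" where "kc c = (%_. c)"

lemma kc_simps: "kc (a + b) = kc a + kc b" "kc (a*b) = kc a*kc b" "kc (- a) = - kc a" "kc (a - b) = kc a - kc b"
   "kc 0 = 0" "kc 1 = 1" "kc (a^n) = kc a^n"
proof -
  show 1: "kc 1 = 1" and 2: "!!a b. kc (a*b) = kc a*kc b" by (auto simp: kc_def fun_eq_iff)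
  show "kc (a^n) = kc a^n" by (induction n) (simp_all add: 1 2)
qed (auto simp: kc_def fun_eq_iff)

lemma Fil_add: "Fil n a ==> Fil n b ==> Fil n (a + b)"
  using G_add[of "%P. a P/lam^n" "%P. b P/lam^n"] by (simp add: Fil_def plus_fun_def add_divide_distrib)

lemma Fil_mult: "Fil m a ==> Fil n b ==> Fil (m + n) (a*b)"
  using G_mult[of "%P. a P/lam^m" "%P. b P/lam^n"] by (simp add: Fil_def times_fun_def power_add)

lemma Fil_const: "na c <= na lam^n ==> Fil n (kc c)"
  unfolding Fil_def kc_def by (rule G_const) (simp add: na_divide na_power)

lemma Fil_lam: "Fil n (kc (lam^n))" by (rule Fil_const) (simp add: na_power)

lemma Fil_pi: "Fil (2*wt) (kc \<pi>)" using Fil_lam[of "2*wt"] by (simp add: lam_power)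

lemma Fil_0 [simp]: "Fil n 0" using Fil_const[of 0 n] by (simp add: kc_simps)

lemma Fil_1: "Fil 0 1" using Fil_const[of 1 0] by (simp add: kc_simps)

lemma Fil_cmult: "na c <= 1 ==> Fil n a ==> Fil n (kc c*a)" using Fil_mult[OF Fil_const[of c 0], of n a] by simp

lemma Fil_minus: "Fil n a ==> Fil n (- a)" using Fil_cmult[of "-1" n a] by (simp add: kc_simps)

lemma Fil_diff: "Fil n a ==> Fil n b ==> Fil n (a - b)" using Fil_add[OF _ Fil_minus] by fastforce

lemma Fil_mono: assumes "Fil n a" "m <= n" shows "Fil m a"
proof -
  have "Fil (m + (n - m)) (kc (lam^(n - m))*(%P. a P/lam^(n - m)))" using assms by (simp add: Fil_def kc_def times_fun_def)
  have "kc (lam^(n - m))*(%P. a P/lam^n) : G"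
    using assms na_lam_power_le[of 0 "n - m"] by (intro G_mult) (auto simp: kc_def Fil_def na_power intro: G_const)
  moreover have "kc (lam^(n - m))*(%P. a P/lam^n) = (%P. a P/lam^m)"
    using assms(2) by (auto simp: kc_def times_fun_def fun_eq_iff power_diff)
  ultimately show ?thesis by (simp add: Fil_def)
qed

lemma Fil_mult': "Fil m a ==> Fil n b ==> r <= m + n ==> Fil r (a*b)" using Fil_mult Fil_mono by blast

lemma Fil_power: "Fil m a ==> Fil (m*n) (a^n)"
proof (induction n)
  case (Suc n)
  thus ?case using Fil_mult[of m a "m*n" "a^n"] by (simp only: power_Suc mult_Suc_right)
qed (simp add: Fil_1)

lemma Fil_power': "Fil m a ==> r <= m*n ==> Fil r (a^n)" using Fil_power Fil_mono by blast

lemma Fil_sum: "(!!i. i : A ==> Fil n (f i)) ==> Fil n (sum f A)"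
  by (induction A rule: infinite_finite_induct) (auto intro: Fil_add)

lemma Fil_bound: "Fil n a ==> P : S ==> na (a P) <= na lam^n"
  using G_bound[of "%P. a P/lam^n" P] by (simp add: Fil_def na_divide na_power divide_le_eq)

lemma Fil_lim: assumes "!!k. EX h. Fil n h & (ALL P:S. na (g P - h P) <= na lam^k)" shows "Fil n g" unfolding Fil_def
proof (rule G_lim)
  fix k
  obtain h where h: "Fil n h" "!!P. P : S ==> na (g P - h P) <= na lam^(n + k)" using assms[of "n + k"] by blast
  have "na (g P/lam^n - h P/lam^n) <= na lam^k" if "P : S" for P
    using h(2)[OF that] by (simp add: diff_divide_distrib[symmetric] na_divide na_power power_add pos_divide_le_eq mult.commute)
  thus "EX h:G. ALL P:S. na (g P/lam^n - h P) <= na lam^k" using h(1) by (intro bexI[of _ "%P. h P/lam^n"]) (auto simp: Fil_def)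
qed

lemma Fil_cong: "Fil n g ==> (!!P. P : S ==> g P = h P) ==> Fil n h" by (rule Fil_lim) auto

lemma sum_fun_apply: "sum f A P = (\<Sum>i\<in>A. (f i P :: 'c))" by (induction A rule: infinite_finite_induct) auto

lemma Fil_has_sum: assumes "!!i. Fil n (t i)" "!!P. P : S ==> ((%i. t i P) has_sum s P) UNIV"
    "!!k. finite {i. \<not> (ALL P:S. na (t i P) <= na lam^k)}" shows "Fil n s"
proof (rule Fil_lim)
  fix k
  define E where "E = {i. \<not> (ALL P:S. na (t i P) <= na lam^k)}"
  have "na (s P - sum t E P) <= na lam^k" if "P : S" for P unfolding sum_fun_apply using that assms(3)[of k]
    by (intro has_sum_approx[OF assms(2)]) (auto simp: E_def)
  thus "EX h. Fil n h & (ALL P:S. na (s P - h P) <= na lam^k)"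
    using assms(1) by (intro exI[of _ "sum t E"]) (auto intro: Fil_sum)
qed

lemma Fil_PU: assumes "g : PU" "Fil 0 u" shows "Fil 0 (%P. g (u P))" using assms(1) unfolding PU_def
proof induction
  case (const a)
  thus ?case using Fil_const[of a 0] by (simp add: kc_def)
next
  case (add g h)
  thus ?case using Fil_add by (simp add: plus_fun_def)
next
  case (mult g h)
  thus ?case using Fil_mult[of 0 _ 0] by (simp add: times_fun_def)
qed (use assms in auto)

lemma power_fun_apply: "(x^n) P = (x P^n :: 'c)" for x :: "'p => 'c" by (induction n) auto

text \<open>By \<open>ac_low\<close> mixed terms of total degree below q vanish and those of degree
  q carry a factor u, of order \<open>wt\<close>. With k a common lower bound of all orders, every
  remaining term exceeds i + j by q - 1 further steps of size k.\<close>

lemma Fil_fa: assumes u: "Fil wt u" and x: "Fil i x" and y: "Fil j y" and k: "1 <= k" "k <= i" "k <= j" "k <= wt"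
    and r: "r <= i + j + (q - 1)*k" shows "Fil r (%P. fa (u P) (x P) (y P) - (x P + y P))"
proof -
  define t where "t ab = (%P. if fst ab = 0 \<or> snd ab = 0 then 0 else ac (u P) (fst ab) (snd ab)*x P^fst ab*y P^snd ab)"
    for ab :: "nat \<times> nat"
  have u1: "na (u P) <= 1" and x1: "na (x P) <= na lam" "na (x P) < 1" and y1: "na (y P) <= na lam" "na (y P) < 1" if "P : S" for P
  proof -
    show "na (x P) <= na lam" using Fil_bound[OF Fil_mono[OF x, of 1] that] k by simp
    thus "na (x P) < 1" using na_lam_less by simp
    show "na (y P) <= na lam" using Fil_bound[OF Fil_mono[OF y, of 1] that] k by simp
    thus "na (y P) < 1" using na_lam_less by simp
    show "na (u P) <= 1" using Fil_bound[OF Fil_mono[OF u, of 0] that] by simp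
  qed
  show ?thesis
  proof (rule Fil_has_sum[where t = t])
    fix ab :: "nat \<times> nat"
    obtain a b where ab: "ab = (a, b)" by force
    show "Fil r (t ab)"
    proof (cases "a = 0 \<or> b = 0")
      case True
      hence "t ab = 0" by (auto simp: t_def ab)
      thus ?thesis by simp
    next
      case False
      have t: "t ab = (%P. ac (u P) a b)*(x^a*y^b)" using False by (auto simp: t_def ab fun_eq_iff power_fun_apply)
      have xy: "Fil (i*a + j*b) (x^a*y^b)" by (intro Fil_mult Fil_power x y)
      have e: "i + j + (a + b - 2)*k <= i*a + j*b"
      proof -
        obtain a' b' where "a = Suc a'" "b = Suc b'" using False by (metis not0_implies_Suc)
        hence "i + j + (a + b - 2)*k = i + j + (a'*k + b'*k)" "i*a + j*b = i + j + (a'*i + b'*j)"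
          by (simp_all add: distrib_right algebra_simps)
        moreover have "a'*k + b'*k <= a'*i + b'*j" using k by (intro add_mono mult_le_mono2)
        ultimately show ?thesis by linarith
      qed
      consider "a + b < q" | "a + b = q" | "q < a + b" by linarith
      thus ?thesis
      proof cases
        case 1
        hence "ac u' a b = 0" for u' using ac_low[of a b u'] False by auto
        hence "t ab = 0" by (auto simp: t fun_eq_iff)
        thus ?thesis by simp
      next
        case 2
        hence "(%P. ac (u P) a b) = kc (- bq a)*u" using ac_low[of a b] False by (auto simp: fun_eq_iff kc_def)
        moreover have "na (- bq a) <= 1" using na_bq[of a] 2 False by simp
        ultimately have "Fil wt (%P. ac (u P) a b)" using Fil_cmult[OF _ u] by simp
        moreover have "r <= wt + (i*a + j*b)"
        proof -
          have "q - 1 = Suc (a + b - 2)" using 2 q_ge_3 by simp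
          hence "(q - 1)*k = k + (a + b - 2)*k" by simp
          thus ?thesis using e k r by linarith
        qed
        ultimately show ?thesis unfolding t using Fil_mult'[OF _ xy] by blast
      next
        case 3
        have "Fil 0 (%P. ac (u P) a b)" by (rule Fil_PU[OF ac_PU Fil_mono[OF u]]) simp
        moreover have "r <= 0 + (i*a + j*b)"
        proof -
          have "(q - 1)*k <= (a + b - 2)*k" using 3 by (intro mult_le_mono1) simp
          thus ?thesis using e r by linarith
        qed
        ultimately show ?thesis unfolding t using Fil_mult'[OF _ xy] by blast
      qed
    qed
  next
    fix P assume P: "P : S"
    let ?f = "%(a, b). ac (u P) a b*x P^a*y P^b"
    let ?g = "%ab. if ab : {(0, 1), (1::nat, 0::nat)} then - ?f ab else 0"
    have "(?g has_sum (\<Sum>ab\<in>{(0, 1), (1, 0)}. ?g ab)) UNIV" by (rule has_sum_finite_support) auto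
    from has_sum_plus[OF fa_has_sum[OF u1[OF P] x1(2)[OF P] y1(2)[OF P]] this]
    have "((%ab. ?f ab + ?g ab) has_sum (fa (u P) (x P) (y P) - (x P + y P))) UNIV"
      by (simp add: ac_i_0 ac_0_j algebra_simps)
    moreover have "?f ab + ?g ab = t ab P" for ab by (cases ab) (auto simp: t_def ac_i_0 ac_0_j)
    ultimately show "((%ab. t ab P) has_sum (fa (u P) (x P) (y P) - (x P + y P))) UNIV" by simp
  next
    fix k :: nat
    have "na (t (a, b) P) <= na lam^k" if "k <= a + b" "P : S" for a b P
    proof -
      have "na (x P^a*y P^b) <= na lam^a*na lam^b"
        unfolding na_mult na_power using x1 y1 that by (intro mult_mono power_mono) auto
      also have "... <= na lam^k" unfolding power_add[symmetric] by (rule na_lam_power_le[OF that(1)])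
      finally show ?thesis using na_ac[OF u1[OF that(2)]] na_mult_le1 by (auto simp: t_def mult.assoc)
    qed
    hence "{ab. \<not> (ALL P:S. na (t ab P) <= na lam^k)} <= {..k} \<times> {..k}"
      by clarify (metis atMost_iff SigmaI le_add1 le_add2 nat_le_linear order_trans)
    thus "finite {ab. \<not> (ALL P:S. na (t ab P) <= na lam^k)}" by (rule finite_subset) simp
  qed
qed

text \<open>Beyond the linear term, the coefficients are divisible by \<open>\<pi>^2\<close>, which
  has order \<open>4*wt\<close>.\<close>

lemma Fil_fe: assumes u: "Fil 0 u" and x: "Fil a x" "1 <= a" shows "Fil (4*wt + 2*a) (%P. fe (u P) (x P) - \<pi>*x P)"
proof -
  define t where "t n = (%P. if n < 2 then 0 else ((ef (u P))$n)*x P^n)" for n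
  have u1: "na (u P) <= 1" and x1: "na (x P) <= na lam" "na (x P) < 1" if "P : S" for P
  proof -
    show "na (x P) <= na lam" using Fil_bound[OF Fil_mono[OF x(1), of 1] that] x by simp
    thus "na (x P) < 1" using na_lam_less by simp
    show "na (u P) <= 1" using Fil_bound[OF u that] by simp
  qed
  show ?thesis
  proof (rule Fil_has_sum[where t = t])
    fix n
    show "Fil (4*wt + 2*a) (t n)"
    proof (cases "n < 2")
      case True
      hence "t n = 0" by (auto simp: t_def fun_eq_iff)
      thus ?thesis by simp
    next
      case False
      then obtain m where m: "m : PU" "!!u. ef u$n = \<pi>^2*m u" using ef_PU[of n] by auto
      have "t n = kc \<pi>*kc \<pi>*(%P. m (u P))*x^n"
        using False m by (auto simp: t_def fun_eq_iff power_fun_apply kc_def power2_eq_square)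
      moreover have "Fil (2*wt + 2*wt + 0 + a*n) (kc \<pi>*kc \<pi>*(%P. m (u P))*x^n)"
        by (intro Fil_mult Fil_power Fil_pi Fil_PU[OF m(1) u] x(1))
      moreover have "2*a <= a*n" using False by (simp add: mult.commute)
      ultimately show ?thesis by (auto elim: Fil_mono)
    qed
  next
    fix P assume P: "P : S"
    let ?f = "%n. (ef (u P))$n*x P^n"
    let ?g = "%n. if n = 1 then - ?f n else 0"
    have "(?g has_sum (\<Sum>n\<in>{1}. ?g n)) UNIV" by (rule has_sum_finite_support) auto
    from has_sum_plus[OF fe_has_sum[OF u1[OF P] x1(2)[OF P]] this]
    have "((%n. ?f n + ?g n) has_sum (fe (u P) (x P) - \<pi>*x P)) UNIV" using ef_1 by simp
    moreover have "?f n + ?g n = t n P" for n by (cases "n = 0") (auto simp: t_def)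
    ultimately show "((%n. t n P) has_sum (fe (u P) (x P) - \<pi>*x P)) UNIV" by simp
  next
    fix k :: nat
    have "na (t n P) <= na lam^k" if "k <= n" "P : S" for n P
    proof -
      have "na (x P^n) <= na lam^n" unfolding na_power using x1 that by (intro power_mono) auto
      also have "... <= na lam^k" by (rule na_lam_power_le[OF that(1)])
      finally show ?thesis using na_ef[OF u1[OF that(2)]] na_mult_le1 by (auto simp: t_def)
    qed
    hence "{n. \<not> (ALL P:S. na (t n P) <= na lam^k)} <= {..k}" by clarify (metis atMost_iff nat_le_linear)
    thus "finite {n. \<not> (ALL P:S. na (t n P) <= na lam^k)}" by (rule finite_subset) simp
  qed
qed

definition SM :: "('p => 'c) => ('p => 'c) => 'p => 'c" where "SM u x = (%P. sm (u P) \<pi> (x P))"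

text \<open>The three bounds on r are the errors of the series \<open>ef\<close>, of the inner
  formal sum of u x^q and x^(q^2), and of the outer formal sum.\<close>

lemma Fil_SM: assumes u: "Fil wt u" and x: "Fil a x" "1 <= a"
    and k: "1 <= k" "k <= 2*wt + a" "k <= wt + q*a" "k <= q^2*a" "k <= wt"
    and r: "r <= 4*wt + 2*a" "r <= wt + q*a + q^2*a + (q - 1)*k" "r <= 2*wt + a + q*k"
  shows "Fil r (SM u x - (kc \<pi>*x + u*x^q + x^q^2))"
proof -
  define e where "e = (%P. fe (u P) (x P))"
  define b where "b = u*x^q"
  define c where "c = x^q^2"
  define s where "s = (%P. fa (u P) (b P) (c P))"
  have b: "Fil (wt + q*a) b" unfolding b_def using Fil_mult[OF u Fil_power[OF x(1), of q]] by (simp only: mult.commute)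
  have c: "Fil (q^2*a) c" unfolding c_def using Fil_power[OF x(1), of "q^2"] by (simp only: mult.commute)
  have e1: "Fil (4*wt + 2*a) (e - kc \<pi>*x)"
    using Fil_fe[OF Fil_mono[OF u] x] by (simp add: e_def kc_def fun_diff_def times_fun_def)
  have "Fil (2*wt + a) ((e - kc \<pi>*x) + kc \<pi>*x)" by (intro Fil_add Fil_mult Fil_pi x Fil_mono[OF e1]) auto
  hence e: "Fil (2*wt + a) e" by simp
  have s1: "Fil r (s - (b + c))" using Fil_fa[OF u b c k(1,3,4,5) r(2)] by (simp add: s_def fun_diff_def plus_fun_def)
  have "Fil (min (wt + q*a) (q^2*a)) ((s - (b + c)) + (b + c))"
    using Fil_fa[OF u b c k(1,3,4,5), of "min (wt + q*a) (q^2*a)"]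
    by (intro Fil_add Fil_mono[OF b] Fil_mono[OF c]) (auto simp: s_def fun_diff_def plus_fun_def min_le_iff_disj)
  hence s: "Fil k s" using k by (auto elim!: Fil_mono)
  have "k + (q - 1)*k = q*k" using q_gt_1 by (simp add: algebra_simps diff_mult_distrib)
  hence "Fil r (%P. fa (u P) (e P) (s P) - (e P + s P))" using Fil_fa[OF u e s k(1,2) order_refl k(5), of r] r(3) by simp
  hence fs: "Fil r ((%P. fa (u P) (e P) (s P)) - (e + s))" by (simp add: fun_diff_def plus_fun_def)
  have "Fil r (((%P. fa (u P) (e P) (s P)) - (e + s)) + (s - (b + c)) + (e - kc \<pi>*x))"
    by (intro Fil_add fs s1 Fil_mono[OF e1] r)
  hence "Fil r ((%P. fa (u P) (e P) (s P)) - (kc \<pi>*x + b + c))" by (simp add: algebra_simps)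
  thus ?thesis
  proof (rule Fil_cong)
    fix P assume P: "P : S"
    have "na (u P) <= 1" "na (x P) < 1"
      using Fil_bound[OF Fil_mono[OF u, of 0] P] le_less_trans[OF Fil_bound[OF Fil_mono[OF x(1), of 1] P]] x na_lam_less by auto
    thus "((%P. fa (u P) (e P) (s P)) - (kc \<pi>*x + b + c)) P = (SM u x - (kc \<pi>*x + u*x^q + x^q^2)) P"
      by (simp add: SM_def sm_pi e_def s_def b_def c_def power_fun_apply)
  qed
qed

text \<open>The factor \<open>\<pi>\<close> contributes \<open>2*wt\<close>, and since i <= j the
  mixed product of least order is a^(q - 1) b.\<close>

lemma Fil_q_power: assumes a: "Fil i a" and b: "Fil j b" and ij: "i <= j" and r: "r <= 2*wt + (q - 1)*i + j"
  shows "Fil r ((a + b)^q - (a^q + b^q))"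
proof -
  have kn: "kc (of_nat n) = of_nat n" for n by (induction n) (simp_all add: kc_simps)
  have "(a + b)^q - (a^q + b^q) = kc \<pi>*(\<Sum>l\<in>{0<..<q}. kc (bq l)*a^l*b^(q - l))"
    using q_power_sum[of kc a b, OF kn kc_simps(2)] by (simp only: add_diff_cancel_left')
  moreover have "Fil ((q - 1)*i + j) (kc (bq l)*a^l*b^(q - l))" if l: "l : {0<..<q}" for l
  proof -
    have "Fil (0 + i*l + j*(q - l)) (kc (bq l)*a^l*b^(q - l))"
      using l na_bq[of l] by (intro Fil_mult Fil_power a b Fil_const) auto
    moreover have "(q - 1)*i + j <= i*l + j*(q - l)"
    proof -
      obtain d where d: "q = Suc (l + d)" using l by (metis add_Suc_right greaterThanLessThan_iff less_iff_Suc_add)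
      have "d*i <= d*j" using ij by simp
      thus ?thesis by (simp add: d algebra_simps)
    qed
    ultimately show ?thesis by (auto elim: Fil_mono)
  qed
  hence "Fil ((q - 1)*i + j) (\<Sum>l\<in>{0<..<q}. kc (bq l)*a^l*b^(q - l))" by (rule Fil_sum)
  ultimately show ?thesis using Fil_mult'[OF Fil_pi] r by (simp add: add.assoc)
qed

end

context lubin_tate_setting
begin

subsection \<open>Determinants\<close>

lemma q_pred_mult: "(q - 1)*t + t = q*t" using q_gt_1 by (simp add: diff_mult_distrib)

lemma q_products: "q*q = q^2" "q^2*q = q^3" "q*q^2 = q^3" "q^3*q = q^4" "q*q^3 = q^4" "q^4*q = q^5" "q*q^4 = q^5"
    "q^2*q^2 = q^4" "q^3*q^2 = q^5" "q^2*q^3 = q^5" "(q - 1)*q^3 = wt" "q^4*q^2 = q^5*q"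
  by (simp_all add: power2_eq_square power3_eq_cube power4_eq_xxxx wt_def eval_nat_numeral)

lemma q_pred_products: "(q - 1)*q^2 + q^2 = q^3" "(q - 1)*(2*q^2) + 2*q^2 = 2*q^3"
    "(q - 1)*(q^3 + q) + (q^3 + q) = q^4 + q^2" "(q - 1)*(2*q^3) = 2*wt" "(q - 1)*wt + wt = q*wt"
proof -
  show "(q - 1)*q^2 + q^2 = q^3" using q_pred_mult[of "q^2"] by (simp only: q_products)
  have "q*(2*q^2) = 2*(q*q^2)" by simp
  thus "(q - 1)*(2*q^2) + 2*q^2 = 2*q^3" using q_pred_mult[of "2*q^2"] by (simp only: q_products)
  show "(q - 1)*(q^3 + q) + (q^3 + q) = q^4 + q^2" using q_pred_mult[of "q^3 + q"] by (simp only: q_products distrib_left)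
  show "(q - 1)*(2*q^3) = 2*wt" by (simp add: wt_def)
  show "(q - 1)*wt + wt = q*wt" by (rule q_pred_mult)
qed

lemmas qs = q_ge_3 q_powers

end

text \<open>The torsion equations are kept out until \<open>galg_torsion\<close>, so that these
  estimates also serve in \<open>Zs_fiber\<close>, where the equations are still to be
  solved.\<close>

locale galg_triple = galg +
  fixes u x y :: "'b => 'a" assumes u: "Fil wt u" and x: "Fil q x" and y: "Fil 1 y"
begin

abbreviation A1 where "A1 \<equiv> SM u x"
abbreviation B1 where "B1 \<equiv> SM u y"

text \<open>Here and in \<open>B1_est\<close>, k is the order of the last summand x^(q^2) or
  y^(q^2); at the next level, in \<open>A2_est\<close> and \<open>B2_est\<close>, it is
  \<open>wt\<close>.\<close>

lemma A1_est: "Fil (2*wt + q^3 + 1) (A1 - (kc \<pi>*x + u*x^q + x^q^2))"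
proof (rule Fil_SM[OF u x, of "q^3"])
  show "2*wt + q^3 + 1 <= wt + q*q + q^2*q + (q - 1)*q^3" unfolding q_products using qs by linarith
  show "2*wt + q^3 + 1 <= 2*wt + q + q*q^3" unfolding q_products using qs by linarith
qed ((unfold q_products)?, use qs in linarith)+

lemma B1_est: "Fil (q^4 + 1) (B1 - (kc \<pi>*y + u*y^q + y^q^2))"
proof (rule Fil_SM[OF u y, of "q^2"])
  show "q^4 + 1 <= wt + q*1 + q^2*1 + (q - 1)*q^2" unfolding q_products using qs q_pred_products(1) by linarith
qed ((unfold q_products)?, use qs in linarith)+

lemma Fil_x_power: "Fil (q^2) (x^q)" "Fil (q^3) (x^q^2)" "Fil (q^4) (x^(q^3))"
  using Fil_power[OF x, of q] Fil_power[OF x, of "q^2"] Fil_power[OF x, of "q^3"] unfolding q_products by simp_all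

lemma Fil_y_power: "Fil n (y^n)" using Fil_power[OF y, of n] by simp

lemma A1_x: "Fil (wt + q^2) (A1 - x^q^2)"
proof -
  have "Fil (wt + q^2) ((A1 - (kc \<pi>*x + u*x^q + x^q^2)) + kc \<pi>*x + u*x^q)"
    using qs by (intro Fil_add Fil_mono[OF A1_est] Fil_mult'[OF Fil_pi x] Fil_mult u Fil_x_power) linarith+
  thus ?thesis by (simp add: algebra_simps)
qed

lemma B1_y: "Fil (wt + q) (B1 - y^q^2)"
proof -
  have "Fil (wt + q) ((B1 - (kc \<pi>*y + u*y^q + y^q^2)) + kc \<pi>*y + u*y^q)"
    using qs by (intro Fil_add Fil_mono[OF B1_est] Fil_mult'[OF Fil_pi y] Fil_mult u Fil_y_power) linarith+
  thus ?thesis by (simp add: algebra_simps)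
qed

lemma Fil_A1: "Fil (q^3) A1"
proof -
  have "Fil (q^3) ((A1 - x^q^2) + x^q^2)" using qs by (intro Fil_add Fil_mono[OF A1_x] Fil_x_power) linarith+
  thus ?thesis by simp
qed

lemma Fil_B1: "Fil (q^2) B1"
proof -
  have "Fil (q^2) ((B1 - y^q^2) + y^q^2)" using qs by (intro Fil_add Fil_mono[OF B1_y] Fil_y_power) linarith+
  thus ?thesis by simp
qed

lemma A2_est: "Fil (4*wt + q^3 + 1) (SM u A1 - (kc \<pi>*A1 + u*A1^q + A1^q^2))"
proof (rule Fil_SM[OF u Fil_A1, of wt])
  show "4*wt + q^3 + 1 <= wt + q*q^3 + q^2*q^3 + (q - 1)*wt" unfolding q_products using qs q_pred_products(5) by linarith
qed ((unfold q_products)?, use qs in linarith)+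

lemma B2_est: "Fil (3*wt + q^3 + 1) (SM u B1 - (kc \<pi>*B1 + u*B1^q + B1^q^2))"
proof (rule Fil_SM[OF u Fil_B1, of wt])
  show "3*wt + q^3 + 1 <= wt + q*q^2 + q^2*q^2 + (q - 1)*wt" unfolding q_products using qs q_pred_products(5) by linarith
qed ((unfold q_products)?, use qs in linarith)+

lemma B1_q: "Fil (2*wt + q^3 + 1) (B1^q - y^(q^3))"
proof -
  define b where "b = B1 - y^q^2"
  have b: "Fil (wt + q) b" unfolding b_def by (rule B1_y)
  have "Fil (2*wt + q^3 + 1) ((y^q^2 + b)^q - ((y^q^2)^q + b^q))"
    by (rule Fil_q_power[OF Fil_y_power b]) (use qs q_pred_products(1) in linarith)+
  moreover have "Fil (2*wt + q^3 + 1) (b^q)"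
    by (rule Fil_power'[OF b]) (unfold distrib_right mult.commute[of wt] q_products, use qs in linarith)
  ultimately have "Fil (2*wt + q^3 + 1) ((y^q^2 + b)^q - ((y^q^2)^q + b^q) + b^q)" by (rule Fil_add)
  thus ?thesis by (simp add: b_def power_mult[symmetric] q_products)
qed

lemma A1_q: "Fil (2*wt + 2*q^3) (A1^q - x^(q^3))"
proof -
  define b where "b = A1 - x^q^2"
  have b: "Fil (wt + q^2) b" unfolding b_def by (rule A1_x)
  have "Fil (2*wt + 2*q^3) ((x^q^2 + b)^q - ((x^q^2)^q + b^q))"
    by (rule Fil_q_power[OF Fil_x_power(2) b]; (unfold q_products)?; use qs in linarith)
  moreover have "Fil (2*wt + 2*q^3) (b^q)"
    by (rule Fil_power'[OF b]) (unfold distrib_right mult.commute[of wt] q_products, use qs in linarith)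
  ultimately have "Fil (2*wt + 2*q^3) ((x^q^2 + b)^q - ((x^q^2)^q + b^q) + b^q)" by (rule Fil_add)
  thus ?thesis by (simp add: b_def power_mult[symmetric] q_products)
qed

lemma B1_q2: "Fil (2*wt + 2*q^3 + 1) (B1^q^2 - y^(q^4))"
proof -
  define b where "b = B1^q - y^(q^3)"
  have b: "Fil (2*wt + q^3 + 1) b" unfolding b_def by (rule B1_q)
  have "Fil (2*wt + 2*q^3 + 1) ((y^(q^3) + b)^q - ((y^(q^3))^q + b^q))"
    by (rule Fil_q_power[OF Fil_y_power b]; (unfold q_products)?; use qs in linarith)
  moreover have "Fil (2*wt + 2*q^3 + 1) (b^q)"
    by (rule Fil_power'[OF b]) (unfold distrib_right mult.assoc mult.commute[of wt] q_products mult_1, use qs in linarith)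
  ultimately have "Fil (2*wt + 2*q^3 + 1) ((y^(q^3) + b)^q - ((y^(q^3))^q + b^q) + b^q)" by (rule Fil_add)
  thus ?thesis by (simp add: b_def power_mult[symmetric] q_products)
qed

text \<open>Truncated determinants of the torsion points of level two and one.\<close>

definition DD where "DD = x^q*y^q^2 - x^q^2*y^q - x*y^(q^3)"
definition De where "De = A1*B1^q - A1^q*B1"

lemma uminus_q_power: "(- a)^q = - (a^q)" for a :: "'r::comm_ring_1" using odd_q by simp

text \<open>The q-th power is taken term by term; the signs survive because q is odd.\<close>

lemma DD_q: "Fil (2*wt + 2*q^3 + 1) (DD^q - (x^q^2*y^(q^3) - x^(q^3)*y^q^2 - x^q*y^(q^4)))"
proof -
  define a where "a = x^q*y^q^2"
  define b where "b = - (x^q^2*y^q)"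
  define c where "c = - (x*y^(q^3))"
  have a: "Fil (2*q^2) a" unfolding a_def using Fil_mult[OF Fil_x_power(1) Fil_y_power[of "q^2"]] by (simp add: mult_2)
  have b: "Fil (q^3 + q) b" unfolding b_def by (intro Fil_minus Fil_mult Fil_x_power Fil_y_power)
  have c: "Fil (q^3 + q) c" unfolding c_def by (intro Fil_minus Fil_mult'[OF x Fil_y_power]) simp
  have "Fil (2*wt + 2*q^3 + 1) (((a + (b + c))^q - (a^q + (b + c)^q)) + ((b + c)^q - (b^q + c^q)))"
    by (intro Fil_add Fil_q_power[OF a Fil_add[OF b c]] Fil_q_power[OF b c])
      (use qs q_pred_products(2,3) in linarith)+
  moreover have "((a + (b + c))^q - (a^q + (b + c)^q)) + ((b + c)^q - (b^q + c^q)) = (a + b + c)^q - (a^q + b^q + c^q)"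
    by (simp add: add.assoc)
  moreover have "a + b + c = DD" by (simp add: a_def b_def c_def DD_def)
  moreover have "a^q + b^q + c^q = x^q^2*y^(q^3) - x^(q^3)*y^q^2 - x^q*y^(q^4)"
    unfolding a_def b_def c_def uminus_q_power power_mult_distrib power_mult[symmetric] q_products by simp
  ultimately show ?thesis by simp
qed

end

locale galg_torsion = galg_triple + assumes torsion: "!!P. P : S ==> SM u A1 P = 0" "!!P. P : S ==> SM u B1 P = 0"
begin

lemma A2: "Fil (4*wt + q^3 + 1) (kc \<pi>*A1 + u*A1^q + A1^q^2)"
proof -
  have "Fil (4*wt + q^3 + 1) (- (SM u A1 - (kc \<pi>*A1 + u*A1^q + A1^q^2)))" by (rule Fil_minus[OF A2_est])
  thus ?thesis by (rule Fil_cong) (simp add: torsion)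
qed

lemma B2: "Fil (3*wt + q^3 + 1) (kc \<pi>*B1 + u*B1^q + B1^q^2)"
proof -
  have "Fil (3*wt + q^3 + 1) (- (SM u B1 - (kc \<pi>*B1 + u*B1^q + B1^q^2)))" by (rule Fil_minus[OF B2_est])
  thus ?thesis by (rule Fil_cong) (simp add: torsion)
qed

text \<open>\<open>De\<close> is a Moore determinant. In its q-th power the torsion relations
  replace the q^2-th powers of \<open>A1\<close> and \<open>B1\<close>; the terms with u cancel and
  \<open>\<pi>\<close> times \<open>De\<close> remains.\<close>

lemma De_q: "Fil (4*wt + 2*q^3 + 1) (De^q - kc \<pi>*De)"
proof -
  define a where "a = A1*B1^q"
  define b where "b = - (A1^q*B1)"
  have Aq: "Fil (q^4) (A1^q)" using Fil_power[OF Fil_A1, of q] unfolding q_products .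
  have Bq: "Fil (q^3) (B1^q)" using Fil_power[OF Fil_B1, of q] unfolding q_products .
  have a: "Fil (2*q^3) a" unfolding a_def by (intro Fil_mult'[OF Fil_A1 Bq]) simp
  have b: "Fil (q^4 + q^2) b" unfolding b_def by (intro Fil_minus Fil_mult Aq Fil_B1)
  have 1: "Fil (4*wt + 2*q^3 + 1) ((a + b)^q - (a^q + b^q))"
    by (rule Fil_q_power[OF a b]) (use qs q_pred_products(4) in linarith)+
  have 2: "Fil (4*wt + 2*q^3 + 1) (A1^q*(kc \<pi>*B1 + u*B1^q + B1^q^2))" by (rule Fil_mult'[OF Aq B2]) (use qs in linarith)
  have 3: "Fil (4*wt + 2*q^3 + 1) (B1^q*(kc \<pi>*A1 + u*A1^q + A1^q^2))" by (rule Fil_mult'[OF Bq A2]) (use qs in linarith)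
  have e: "a^q + b^q = A1^q*B1^q^2 - A1^q^2*B1^q"
    unfolding a_def b_def uminus_q_power power_mult_distrib power_mult[symmetric] q_products by simp
  have ab: "a + b = De" by (simp add: a_def b_def De_def)
  have "(De^q - (A1^q*B1^q^2 - A1^q^2*B1^q)) + A1^q*(kc \<pi>*B1 + u*B1^q + B1^q^2)
      - B1^q*(kc \<pi>*A1 + u*A1^q + A1^q^2) = De^q - kc \<pi>*(A1*B1^q - A1^q*B1)" by (simp add: algebra_simps)
  thus ?thesis using Fil_diff[OF Fil_add[OF 1 2] 3] unfolding e ab De_def[symmetric] by (simp only:)
qed

text \<open>In \<open>DD^q\<close> the factors x^(q^2) and y^(q^2) are expressed through
  \<open>A1\<close> and \<open>B1\<close>, the factor y^(q^4) through the torsion relation of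
  \<open>B1\<close>; the terms u x^q y^(q^3) cancel. The leftover u x^(q^3) y^q becomes
  -\<open>\<pi>\<close> x^(q^2) y^q by the torsion relation of \<open>A1\<close>. What remains is
  \<open>De\<close> and \<open>\<pi>\<close> times \<open>DD\<close>.\<close>

lemma DD_De: "Fil (2*wt + 2*q^3 + 1) (DD^q - kc \<pi>*DD - De)"
proof -
  let ?N = "2*wt + 2*q^3 + 1"
  define x1 x2 x3 y1 y2 y3 y4 where xy: "x1 = x^q" "x2 = x^q^2" "x3 = x^(q^3)" "y1 = y^q" "y2 = y^q^2" "y3 = y^(q^3)" "y4 = y^(q^4)"
  define Aq Aqq Bq Bqq where AB: "Aq = A1^q" "Aqq = A1^q^2" "Bq = B1^q" "Bqq = B1^q^2"
  have X: "Fil (q^2) x1" "Fil (q^3) x2" "Fil (q^4) x3" and Y: "Fil q y1" "Fil (q^3) y3"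
    unfolding xy by (intro Fil_x_power Fil_y_power)+
  note b1 = B1_q[folded xy AB] and a1 = A1_q[folded xy AB] and b2 = B1_q2[folded xy AB]
  have Aqq: "Fil (q^5) Aqq" unfolding AB using Fil_power[OF Fil_A1, of "q^2"] unfolding q_products .
  have e1: "Fil ?N (A1*(Bq - y3))" by (rule Fil_mult'[OF Fil_A1 b1]) (use qs in linarith)
  have e2: "Fil ?N ((Aq - x3)*B1)" by (rule Fil_mult'[OF a1 Fil_B1]) (use qs in linarith)
  have e4: "Fil ?N ((A1 - (kc \<pi>*x + u*x1 + x2))*y3)" unfolding xy(1,2) by (rule Fil_mult'[OF A1_est Y(2)]) (use qs in linarith)
  have e5: "Fil ?N (x3*(B1 - (kc \<pi>*y + u*y1 + y2)))" unfolding xy(4,5) by (rule Fil_mult'[OF X(3) B1_est]) (use qs in linarith)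
  have e6: "Fil ?N (x3*(kc \<pi>*y))" by (rule Fil_mult'[OF X(3) Fil_mult[OF Fil_pi y]]) (use qs in linarith)
  have e7: "Fil ?N (u*(x1*(Bq - y3)))" by (rule Fil_mult'[OF u Fil_mult[OF X(1) b1]]) (use qs in linarith)
  have e8: "Fil ?N (x1*(kc \<pi>*B1 + u*Bq + Bqq))" unfolding AB(3,4) by (rule Fil_mult'[OF X(1) B2]) (use qs in linarith)
  have e9: "Fil ?N (x1*(Bqq - y4))" by (rule Fil_mult'[OF X(1) b2]) (use qs in linarith)
  have e10: "Fil ?N (x1*(kc \<pi>*(B1 - y2)))" unfolding xy(5) by (rule Fil_mult'[OF X(1) Fil_mult[OF Fil_pi B1_y]]) (use qs in linarith)
  have e11: "Fil ?N (y1*(u*(Aq - x3)))" by (rule Fil_mult'[OF Y(1) Fil_mult[OF u a1]]) (use qs in linarith)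
  have e11': "Fil ?N (y1*(kc \<pi>*(A1 - x2)))" unfolding xy(2) by (rule Fil_mult'[OF Y(1) Fil_mult[OF Fil_pi A1_x]]) (use qs in linarith)
  have e12: "Fil ?N (y1*(kc \<pi>*A1 + u*Aq + Aqq))" unfolding AB(1,2) by (rule Fil_mult'[OF Y(1) A2]) (use qs in linarith)
  have e12': "Fil ?N (y1*Aqq)" by (rule Fil_mult'[OF Y(1) Aqq]) (use qs in linarith)
  have e13: "Fil ?N (DD^q - (x2*y3 - x3*y2 - x1*y4))" unfolding xy by (rule DD_q)
  \<comment> \<open>An exact identity: the errors estimated above add up to the difference that is
    claimed to be small.\<close>
  have eq: "(DD^q - (x2*y3 - x3*y2 - x1*y4)) - A1*(Bq - y3) + (Aq - x3)*B1
      - (A1 - (kc \<pi>*x + u*x1 + x2))*y3 + x3*(B1 - (kc \<pi>*y + u*y1 + y2)) + x3*(kc \<pi>*y)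
      + u*(x1*(Bq - y3)) - x1*(kc \<pi>*B1 + u*Bq + Bqq) + x1*(Bqq - y4) + x1*(kc \<pi>*(B1 - y2))
      - y1*(u*(Aq - x3)) - y1*(kc \<pi>*(A1 - x2)) + y1*(kc \<pi>*A1 + u*Aq + Aqq) - y1*Aqq
    = DD^q - kc \<pi>*(x1*y2 - x2*y1 - x*y3) - (A1*Bq - Aq*B1)" by (simp add: algebra_simps)
  have "Fil ?N (DD^q - kc \<pi>*(x1*y2 - x2*y1 - x*y3) - (A1*Bq - Aq*B1))" unfolding eq[symmetric]
    by (intro Fil_add Fil_diff e1 e2 e4 e5 e6 e7 e8 e9 e10 e11 e11' e12 e12' e13)
  thus ?thesis unfolding xy AB DD_def[symmetric] De_def[symmetric] .
qed

end

section \<open>The constants in the relation between the two determinants\<close>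

context lubin_tate_setting
begin

text \<open>A constant solution D of D^q - \<open>\<pi>\<close> D = \<Delta> for \<Delta> =
  \<open>lam^(2*q^3)\<close>, which corresponds to W = 1. For W with W^q close to W, the product
  \<open>kap\<close> W nearly solves the equation for \<Delta> = \<open>De\<close>.\<close>

definition kap :: 'c where "kap = (SOME k. k^q = \<pi>*k + lam^(2*q^3))"
text \<open>The order of the two leading terms of \<open>UU^q\<close>, namely q(q^2 - 1) + q^2 + 1.
  It is 1 modulo q.\<close>

definition e0 :: nat where "e0 = q^3 + q^2 - q + 1"
definition mm :: nat where "mm = q^2 - 1"

lemma kap_eq: "kap^q = \<pi>*kap + lam^(2*q^3)"
proof -
  define P where "P = monom 1 q - [:lam^(2*q^3), \<pi>:]"
  have c: "coeff P i = (if i = q then 1 else 0) - (if i = 0 then lam^(2*q^3) else if i = 1 then \<pi> else 0)" for i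
    by (auto simp: P_def coeff_pCons split: nat.splits)
  have "degree P = q" using q_gt_1 by (intro antisym[OF degree_le le_degree]) (auto simp: c)
  then obtain k where "poly P k = 0" using C_root[of P] q_gt_1 by auto
  hence "k^q = \<pi>*k + lam^(2*q^3)" by (simp add: P_def poly_monom algebra_simps)
  thus ?thesis unfolding kap_def by (rule someI)
qed

lemma na_pi_lam: "na \<pi> = na lam^(2*wt)" by (metis lam_power na_power)

lemma na_lam_pos: "0 < na lam" by simp

lemma na_lam_power_less: "m < n ==> na lam^n < na lam^m" using na_lam_less na_lam_pos by (intro power_strict_decreasing) auto

lemma root_le: assumes "na a^k <= na lam^(n*k)" "0 < k" shows "na a <= na lam^n"
  using assms by (simp add: power_mult power_mono_iff)

text \<open>The Newton polygon of \<open>X\<^sup>q - \<pi> X\<close>: the exponent \<open>2 q\<^sup>3\<close> is the valuation of its nonzero roots.\<close>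

lemma as_bound: assumes "na d^q <= max (na \<pi>*na d) (na lam^(2*q^4))" shows "na d <= na lam^(2*q^3)"
proof (cases "na d^q <= na lam^(2*q^4)")
  case True
  thus ?thesis by (intro root_le[of _ q]) (use q_gt_1 q_products in \<open>auto simp: mult.assoc\<close>)
next
  case False
  hence le: "na d^q <= na \<pi>*na d" using assms by linarith
  show ?thesis
  proof (cases "d = 0")
    case nz: False
    have "na d^q = na d^(q - 1)*na d" using q_gt_1 by (metis One_nat_def Suc_diff_1 less_imp_Suc_add power_Suc2 zero_less_Suc)
    hence "na d^(q - 1) <= na \<pi>" using le nz by simp
    also have "na \<pi> = na lam^(2*q^3*(q - 1))" unfolding na_pi_lam wt_def by (simp add: mult.assoc)
    finally show ?thesis by (rule root_le) (use q_gt_1 in simp)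
  qed simp
qed

text \<open>If \<open>\<pi>*kap\<close> were at least as large as the constant term,
  \<open>as_bound\<close> would make \<open>kap\<close> too small for that. So the constant term
  determines |kap|.\<close>

lemma na_kap: "na kap = na lam^(2*q^2)"
proof -
  have l: "na lam^(2*wt + 2*q^3) < na lam^(2*q^3)" using q_gt_1 by (intro na_lam_power_less) (simp add: wt_def)
  have "na (\<pi>*kap) < na lam^(2*q^3)"
  proof (rule ccontr)
    assume n: "\<not> ?thesis"
    have "na (kap^q) <= max (na (\<pi>*kap)) (na (lam^(2*q^3)))" unfolding kap_eq by (rule na_add)
    hence "na kap^q <= max (na \<pi>*na kap) (na lam^(2*q^4))" using n by (simp add: na_power na_mult max_def split: if_splits)
    hence "na \<pi>*na kap <= na \<pi>*na lam^(2*q^3)" by (intro mult_left_mono as_bound) auto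
    also have "... = na lam^(2*wt + 2*q^3)" by (simp add: na_pi_lam power_add)
    finally show False using n l by (simp add: na_mult)
  qed
  hence "na (kap^q) = na (lam^(2*q^3))"
    unfolding kap_eq using na_add_eq[of "\<pi>*kap" "lam^(2*q^3)"] by (simp add: add.commute na_power)
  also have "... = (na lam^(2*q^2))^q" unfolding na_power power_mult[symmetric] by (simp add: mult.assoc q_products)
  finally show ?thesis using q_gt_1 by (simp add: na_power power_eq_iff_eq_base)
qed

lemma e0_eq: "e0 + q = q^3 + q^2 + 1" using qs by (simp add: e0_def)

lemma mm_eq: "mm + 1 = q^2" "q*mm + q = q^3" "q*mm + q^2 + 1 = e0"
proof -
  show 1: "mm + 1 = q^2" using q_gt_1 by (simp add: mm_def)
  have "q*(mm + 1) = q^3" unfolding 1 by (rule q_products)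
  thus 2: "q*mm + q = q^3" by simp
  thus "q*mm + q^2 + 1 = e0" using e0_eq by linarith
qed

text \<open>To leading order \<open>kap\<close> is the q-th root \<open>lam^(2*q^2)\<close> of the
  constant term. The error lies beyond \<open>e0\<close>, the order at which the equation of the
  curve appears.\<close>

lemma kap_lam: "na (kap - lam^(2*q^2)) <= na lam^(e0 + 1)"
proof -
  define l where "l = lam^(2*q^2)"
  define s where "s = (\<Sum>i\<in>{0<..<q}. bq i*kap^i*(- l)^(q - i))"
  have nl: "na l <= na lam^(2*q^2)" "na kap <= na lam^(2*q^2)" by (auto simp: l_def na_power na_kap)
  have lq: "(- l)^q = - (lam^(2*q^3))" using odd_q by (simp add: l_def power_mult[symmetric] mult.assoc q_products)
  have "(kap + - l)^q = kap^q + (- l)^q + \<pi> * s" unfolding s_def using q_power_sum[of "%x. x" kap "- l"] by simp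
  hence eq: "(kap - l)^q = \<pi>*(kap + s)" by (simp add: kap_eq lq algebra_simps)
  have "na s <= na lam^(2*q^2)" unfolding s_def
  proof (rule na_sum_le)
    fix i assume i: "i : {0<..<q}"
    have "na (kap^i) <= na lam^(2*q^2)"
    proof -
      have "na kap^i <= na kap^1" using i na_kap na_lam_power_le[of 0 "2*q^2"] by (intro power_decreasing) auto
      thus ?thesis using nl by (simp add: na_power)
    qed
    moreover have "na ((- l)^(q - i)) <= 1" "na (bq i) <= 1"
      using i nl na_lam_power_le[of 0 "2*q^2"] na_bq by (auto intro!: na_power_le1)
    ultimately show "na (bq i*kap^i*(- l)^(q - i)) <= na lam^(2*q^2)" by (metis mult.commute na_mult_le1)
  qed auto
  hence "na (kap + s) <= na lam^(2*q^2)" using nl by (intro na_add_le)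
  hence "na (kap - l)^q <= na lam^(2*wt + 2*q^2)"
    unfolding na_power[symmetric] eq na_mult na_pi_lam power_add by (intro mult_left_mono) auto
  also have "... <= na lam^((e0 + 1)*q)"
  proof (rule na_lam_power_le)
    have "(e0 + 1)*q + q*q = (e0 + q + 1)*q" by (simp add: algebra_simps)
    also have "... = q^4 + q^3 + 2*q" unfolding e0_eq by (simp add: distrib_right q_products)
    finally show "(e0 + 1)*q <= 2*wt + 2*q^2" using qs unfolding q_products by linarith
  qed
  finally show ?thesis unfolding l_def by (rule root_le) (use q_gt_1 in simp)
qed

end

section \<open>The labels and the function that becomes Z\<close>

context galg_torsion
begin

text \<open>\<open>W\<close> and \<open>tt\<close> reduce to \<open>F\<^sub>q\<close>-valued functions, which label the components.\<close>

definition W where "W = kc (1/lam^(2*q^3))*De"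
definition tt where "tt = kc (1/lam^(2*q^3))*(DD - kc kap*W)"
definition TT where "TT = x*y^q"
text \<open>\<open>TT^q\<close> is x^q y^(q^2), the first term of \<open>DD\<close>. Each subtracted
  term acts through its q-th power: \<open>lam^(2*q)*W\<close> removes the main part of
  \<open>DD\<close>, x^q y removes x^(q^2) y^q, and \<open>lam^2*W*y^mm\<close> removes the main
  part of x y^(q^3), which is \<open>TT*y^(q*mm)\<close>.\<close>

definition UU where "UU = TT - kc (lam^(2*q))*W - x^q*y - kc (lam^2)*W*y^mm"

lemma kc_cancel: "kc (lam^n)*(kc (1/lam^n)*a) = a" by (simp add: kc_def fun_eq_iff)

lemma De_W: "De = kc (lam^(2*q^3))*W" unfolding W_def kc_cancel ..

lemma DD_tt: "DD = kc kap*W + kc (lam^(2*q^3))*tt" unfolding tt_def kc_cancel by simp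

lemma Fil_divide: assumes "Fil (n + k) (kc (lam^n)*a)" shows "Fil k a"
proof -
  have "(%P. (kc (lam^n)*a) P/lam^(n + k)) = (%P. a P/lam^k)" by (simp add: kc_def fun_eq_iff power_add)
  thus ?thesis using assms by (simp add: Fil_def)
qed

lemma Fil_De: "Fil (2*q^3) De"
proof -
  have Bq: "Fil (q^3) (B1^q)" using Fil_power[OF Fil_B1, of q] unfolding q_products .
  have Aq: "Fil (q^4) (A1^q)" using Fil_power[OF Fil_A1, of q] unfolding q_products .
  show ?thesis unfolding De_def by (rule Fil_diff[OF Fil_mult'[OF Fil_A1 Bq] Fil_mult'[OF Aq Fil_B1]]) (use qs in linarith)+
qed

lemma Fil_W: "Fil 0 W"
proof (rule Fil_divide)
  show "Fil (2*q^3 + 0) (kc (lam^(2*q^3))*W)" using Fil_De by (simp add: De_W[symmetric])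
qed

lemma W_q: "Fil (2*wt + 1) (W^q - W)"
proof (rule Fil_divide[of "2*q^4"])
  have l: "(lam^(2*q^3))^q = lam^(2*q^4)" "\<pi>*lam^(2*q^3) = lam^(2*q^4)"
  proof -
    show "(lam^(2*q^3))^q = lam^(2*q^4)" by (simp add: power_mult[symmetric] mult.assoc q_products)
    have "2*wt + 2*q^3 = 2*q^4" using qs by linarith
    thus "\<pi>*lam^(2*q^3) = lam^(2*q^4)" using lam_power power_add[of lam "2*wt" "2*q^3"] by simp
  qed
  have "De^q - kc \<pi>*De = kc (lam^(2*q^4))*(W^q - W)"
    unfolding De_W power_mult_distrib kc_simps(7)[symmetric] mult.assoc[symmetric] kc_simps(2)[symmetric] l by (simp add: algebra_simps)
  thus "Fil (2*q^4 + (2*wt + 1)) (kc (lam^(2*q^4))*(W^q - W))" using De_q qs by (auto elim!: Fil_mono)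
qed

lemma Fil_kap: "Fil (2*q^2) (kc kap)" by (rule Fil_const) (simp add: na_kap)

lemma kap_W: "Fil (2*wt + 2*q^3 + 1) (kc (kap^q)*(W - W^q))"
proof -
  have "Fil (2*q^3) (kc (kap^q))" by (rule Fil_const) (simp add: na_power na_kap power_mult[symmetric] mult.assoc q_products)
  moreover have "Fil (2*wt + 1) (W - W^q)" using Fil_minus[OF W_q] by simp
  ultimately show ?thesis by (rule Fil_mult') simp
qed

text \<open>The additive form of \<open>D\<^sup>q - \<pi> D = \<Delta>\<close> for the difference \<open>d\<close> of \<open>D\<close> and the constant \<open>\<kappa> W\<close>.\<close>

lemma d_eq:
  defines "d \<equiv> DD - kc kap*W"
  defines "s \<equiv> (\<Sum>i\<in>{0<..<q}. kc (bq i)*d^i*(kc kap*W)^(q - i))"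
  shows "Fil (2*wt + 2*q^3 + 1) (d^q - kc \<pi>*d + kc \<pi> * s)"
proof -
  have kn: "kc (of_nat n) = of_nat n" for n by (induction n) (simp_all add: kc_simps)
  have "(d + kc kap*W)^q = d^q + (kc kap*W)^q + kc \<pi> * s" unfolding s_def by (rule q_power_sum[OF kn kc_simps(2)])
  hence 1: "DD^q = d^q + kc (kap^q)*W^q + kc \<pi> * s" by (simp add: d_def power_mult_distrib kc_simps)
  have "kc (kap^q) = kc \<pi>*kc kap + kc (lam^(2*q^3))" unfolding kap_eq by (simp add: kc_simps)
  hence "(DD^q - kc \<pi>*DD - De) + kc (kap^q)*(W - W^q) = d^q - kc \<pi>*d + kc \<pi> * s"
    unfolding 1 De_W by (simp add: d_def algebra_simps)
  thus ?thesis using Fil_add[OF DD_De kap_W] by simp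
qed

lemma Fil_DD: "Fil (2*q^2) DD" unfolding DD_def
  by (intro Fil_diff Fil_mult'[OF Fil_x_power(1) Fil_y_power] Fil_mult'[OF Fil_x_power(2) Fil_y_power] Fil_mult'[OF x Fil_y_power])
    (use qs in linarith)+

text \<open>At each point d satisfies d^q = \<open>\<pi>\<close> d up to terms that
  \<open>as_bound\<close> tolerates. This bounds values only; that \<open>tt\<close> belongs to
  \<open>G\<close> is an assumption of \<open>galg_full\<close>.\<close>

lemma tt_bounded: assumes P: "P : S" shows "na (tt P) <= 1"
proof -
  define d where "d = DD - kc kap*W"
  define s where "s = (\<Sum>i\<in>{0<..<q}. kc (bq i)*d^i*(kc kap*W)^(q - i))"
  have kW: "Fil 0 (kc kap*W)" by (rule Fil_mult'[OF Fil_kap Fil_W]) simp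
  have d: "Fil 0 d" unfolding d_def by (intro Fil_diff kW Fil_mono[OF Fil_DD]) simp
  have nd: "na (d P) <= 1" "na ((kc kap*W) P) <= 1" using Fil_bound[OF d P] Fil_bound[OF kW P] by simp_all
  \<comment> \<open>Every mixed term contains a factor d with integral cofactor, so
    \<open>\<pi>\<close> s is no larger than \<open>\<pi>\<close> d.\<close>
  have "na (s P) <= na (d P)" unfolding s_def sum_fun_apply
  proof (rule na_sum_le)
    fix i assume i: "i : {0<..<q}"
    then obtain j where "i = Suc j" by (metis greaterThanLessThan_iff less_imp_Suc_add)
    hence "(kc (bq i)*d^i*(kc kap*W)^(q - i)) P = (bq i*(d P^j*(kc kap*W) P^(q - i)))*d P"
      by (simp add: kc_def power_fun_apply)
    moreover have "na (bq i*(d P^j*(kc kap*W) P^(q - i))) <= 1" using i nd by (intro na_mult_le1 na_bq na_power_le1) auto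
    ultimately show "na ((kc (bq i)*d^i*(kc kap*W)^(q - i)) P) <= na (d P)" by (simp add: na_mult_le1)
  qed simp
  hence ps: "na (\<pi> * s P) <= na \<pi>*na (d P)" by (simp add: na_mult mult_left_mono)
  have "na ((d^q - kc \<pi>*d + kc \<pi> * s) P) <= na lam^(2*wt + 2*q^3 + 1)"
    using Fil_bound[OF d_eq P] by (simp only: d_def s_def)
  also have "... <= na lam^(2*q^4)" by (rule na_lam_power_le) (use qs in linarith)
  finally have e: "na (d P^q - \<pi>*d P + \<pi> * s P) <= na lam^(2*q^4)" by (simp add: kc_def power_fun_apply)
  have "na ((d P^q - \<pi>*d P + \<pi> * s P) + (\<pi>*d P - \<pi> * s P)) <= max (na \<pi>*na (d P)) (na lam^(2*q^4))"
    using e ps by (intro na_add_le[OF _ na_diff_le]) (auto simp: na_mult le_max_iff_disj)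
  hence "na (d P) <= na lam^(2*q^3)" by (intro as_bound) (simp add: na_power)
  thus ?thesis by (simp add: tt_def d_def kc_def na_mult na_divide na_power divide_le_eq)
qed

text \<open>Once d is known to be divisible by \<open>lam^(2*q^3)\<close> in \<open>G\<close>, the
  mixed terms are negligible, and \<open>d_eq\<close> divided by \<open>lam^(2*q^4)\<close> is the
  claim.\<close>

lemma tt_q: assumes t: "Fil 0 tt" shows "Fil 1 (tt^q - tt)"
proof (rule Fil_divide[of "2*q^4"])
  define d where "d = DD - kc kap*W"
  define s where "s = (\<Sum>i\<in>{0<..<q}. kc (bq i)*d^i*(kc kap*W)^(q - i))"
  have d: "d = kc (lam^(2*q^3))*tt" unfolding d_def tt_def kc_cancel ..
  have Fd: "Fil (2*q^3) d" unfolding d by (rule Fil_mult'[OF Fil_lam t]) simp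
  have kW: "Fil 1 (kc kap*W)" by (rule Fil_mult'[OF Fil_kap Fil_W]) (use qs in simp)
  have "Fil (2*q^3 + 1) s" unfolding s_def
  proof (rule Fil_sum)
    fix i assume i: "i : {0<..<q}"
    have "Fil (0 + 2*q^3*i + 1*(q - i)) (kc (bq i)*d^i*(kc kap*W)^(q - i))"
      using i by (intro Fil_mult Fil_power Fd kW Fil_const) (auto simp: na_bq)
    moreover have "2*q^3*1 <= 2*q^3*i" using i by (intro mult_le_mono2) auto
    ultimately show "Fil (2*q^3 + 1) (kc (bq i)*d^i*(kc kap*W)^(q - i))"
      by (elim Fil_mono) (use i in \<open>simp only: greaterThanLessThan_iff, linarith\<close>)
  qed
  hence "Fil (2*wt + 2*q^3 + 1) (kc \<pi> * s)" by (rule Fil_mult'[OF Fil_pi]) simp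
  from Fil_diff[OF d_eq[folded d_def, folded s_def] this]
  have 1: "Fil (2*wt + 2*q^3 + 1) (d^q - kc \<pi>*d)" by simp
  have l: "(lam^(2*q^3))^q = lam^(2*q^4)" "\<pi>*lam^(2*q^3) = lam^(2*q^4)"
  proof -
    show "(lam^(2*q^3))^q = lam^(2*q^4)" by (simp add: power_mult[symmetric] mult.assoc q_products)
    have "2*wt + 2*q^3 = 2*q^4" using qs by linarith
    thus "\<pi>*lam^(2*q^3) = lam^(2*q^4)" using lam_power power_add[of lam "2*wt" "2*q^3"] by simp
  qed
  have "d^q - kc \<pi>*d = kc (lam^(2*q^4))*(tt^q - tt)"
    unfolding d power_mult_distrib kc_simps(7)[symmetric] mult.assoc[symmetric] kc_simps(2)[symmetric] l by (simp add: algebra_simps)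
  thus "Fil (2*q^4 + 1) (kc (lam^(2*q^4))*(tt^q - tt))" using 1 qs by (auto elim!: Fil_mono)
qed

text \<open>After the cancellations \<open>TT - kc (lam^(2*q))*W\<close> is left over with the
  factor \<open>y^(q*mm)\<close>; it is rewritten through \<open>UU\<close> itself, so
  \<open>UU\<close> occurs on both sides.\<close>

lemma UU_q: "Fil (2*wt) (UU^q - (kc (kap - lam^(2*q^2))*W + kc (lam^(2*q^3))*tt
     + (UU + x^q*y + kc (lam^2)*W*y^mm)*y^(q*mm)))"
proof -
  define a where "a = TT"
  define b where "b = - (kc (lam^(2*q))*W)"
  define c where "c = - (x^q*y)"
  define d where "d = - (kc (lam^2)*W*y^mm)"
  have Fa: "Fil 0 a" unfolding a_def TT_def by (rule Fil_mult'[OF x Fil_y_power]) simp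
  have "Fil 0 (kc (lam^(2*q))*W)" by (rule Fil_mult'[OF Fil_lam Fil_W]) simp
  hence Fb: "Fil 0 b" unfolding b_def by (rule Fil_minus)
  have "Fil 0 (x^q*y)" by (rule Fil_mult'[OF Fil_x_power(1) y]) simp
  hence Fc: "Fil 0 c" unfolding c_def by (rule Fil_minus)
  have "Fil 0 (kc (lam^2)*W*y^mm)" by (rule Fil_mult'[OF Fil_mult[OF Fil_lam Fil_W] Fil_y_power]) simp
  hence Fd: "Fil 0 d" unfolding d_def by (rule Fil_minus)
  have p: "Fil (2*wt) ((g + h)^q - (g^q + h^q))" if "Fil 0 g" "Fil 0 h" for g h by (rule Fil_q_power[OF that]) simp_all
  have 1: "Fil (2*wt) (((a + (b + (c + d)))^q - (a^q + (b + (c + d))^q)) + ((b + (c + d))^q - (b^q + (c + d)^q))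
       + ((c + d)^q - (c^q + d^q)))" by (intro Fil_add p Fa Fb Fc Fd)
  have 2: "a + (b + (c + d)) = UU" by (simp add: a_def b_def c_def d_def UU_def)
  have aq: "a^q = DD + x^q^2*y^q + TT*y^(q*mm)"
  proof -
    have "y^(q^3) = y^q*y^(q*mm)" using mm_eq(2) by (metis add.commute power_add)
    thus ?thesis by (simp add: a_def TT_def DD_def power_mult_distrib power_mult[symmetric] q_products mult.assoc)
  qed
  have bq': "b^q = - (kc (lam^(2*q^2))*W^q)"
    unfolding b_def uminus_q_power power_mult_distrib kc_simps(7)[symmetric] power_mult[symmetric] mult.assoc q_products ..
  have cq: "c^q = - (x^q^2*y^q)" unfolding c_def uminus_q_power power_mult_distrib power_mult[symmetric] q_products ..
  have dq: "d^q = - (kc (lam^(2*q))*W^q*y^(q*mm))"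
    unfolding d_def uminus_q_power power_mult_distrib kc_simps(7)[symmetric] power_mult[symmetric] mult.commute[of mm] ..
  have 3: "Fil (2*wt) (kc (lam^(2*q^2))*(W^q - W))" "Fil (2*wt) (kc (lam^(2*q))*((W^q - W)*y^(q*mm)))"
    by (intro Fil_mult'[OF Fil_lam W_q] Fil_mult'[OF Fil_lam Fil_mult[OF W_q Fil_y_power]]; simp)+
  have "((a + (b + (c + d)))^q - (a^q + (b + (c + d))^q)) + ((b + (c + d))^q - (b^q + (c + d)^q))
       + ((c + d)^q - (c^q + d^q)) = UU^q - (a^q + b^q + c^q + d^q)" unfolding 2 by simp
  also have "... = UU^q - (DD - kc (lam^(2*q^2))*W^q + (TT - kc (lam^(2*q))*W^q)*y^(q*mm))"
    unfolding aq bq' cq dq by (simp add: algebra_simps)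
  finally have 4: "Fil (2*wt) (UU^q - (DD - kc (lam^(2*q^2))*W^q + (TT - kc (lam^(2*q))*W^q)*y^(q*mm)))" using 1 by simp
  have TT: "TT = UU + x^q*y + kc (lam^2)*W*y^mm + kc (lam^(2*q))*W" by (simp add: UU_def)
  have "UU^q - (DD - kc (lam^(2*q^2))*W^q + (TT - kc (lam^(2*q))*W^q)*y^(q*mm))
     - kc (lam^(2*q^2))*(W^q - W) - kc (lam^(2*q))*((W^q - W)*y^(q*mm))
    = UU^q - (kc (kap - lam^(2*q^2))*W + kc (lam^(2*q^3))*tt
     + (UU + x^q*y + kc (lam^2)*W*y^mm)*y^(q*mm))" by (subst TT, subst DD_tt) (simp add: kc_simps algebra_simps)
  thus ?thesis using Fil_diff[OF Fil_diff[OF 4 3(1)] 3(2)] by (simp only:)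
qed

lemma e0_le: "e0 + 1 <= 2*wt" "e0 + 1 <= 2*q^3" using e0_eq qs by linarith+

text \<open>Either the explicit terms of order at least \<open>e0\<close> dominate, or the term with
  \<open>UU\<close> on the right does; the latter gives |UU| <= |lam|^(q^2 + q), which is an even
  better bound.\<close>

lemma UU_bounded: assumes P: "P : S" shows "na (UU P)^q <= na lam^e0"
proof -
  have w: "na (W P) <= 1" using Fil_bound[OF Fil_W P] by simp
  have y1: "na (y P) <= na lam" using Fil_bound[OF y P] by simp
  have yn: "na (y P^n) <= na lam^n" for n using y1 by (auto simp: na_power intro: power_mono)
  have xq: "na (x P^q) <= na lam^q^2" using Fil_bound[OF Fil_x_power(1) P] by (simp add: power_fun_apply)
  define R where "R = max (na lam^e0) (na (UU P)*na lam^(q*mm))"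
  have mul: "na (a*b) <= na lam^(i + j)" if "na a <= na lam^i" "na b <= na lam^j" for a b i j
    using that by (auto simp: na_mult power_add intro: mult_mono)
  have eR: "na c <= R" if "na c <= na lam^k" "e0 <= k" for c k
    using order_trans[OF that(1) na_lam_power_le[OF that(2)]] by (simp add: R_def le_max_iff_disj)
  have t1: "na ((kap - lam^(2*q^2))*W P) <= R" by (rule eR[OF mul[OF kap_lam, of _ 0]]) (use w in simp_all)
  have t2: "na (lam^(2*q^3)*tt P) <= R"
    by (rule eR[OF mul[of _ "2*q^3" _ 0]]) (use tt_bounded[OF P] e0_le in \<open>simp_all add: na_power\<close>)
  have t3: "na (UU P*y P^(q*mm)) <= R"
    using mult_left_mono[OF yn[of "q*mm"], of "na (UU P)"] by (simp add: na_mult R_def le_max_iff_disj)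
  have t4: "na (x P^q*y P*y P^(q*mm)) <= R" by (rule eR[OF mul[OF mul[OF xq, of _ 1] yn]]) (use y1 mm_eq(3) in simp_all)
  have t5: "na (lam^2*W P*y P^mm*y P^(q*mm)) <= R"
    by (rule eR[OF mul[OF mul[OF mul[of _ 2 _ 0] yn] yn]]) (use w mm_eq in \<open>simp_all add: na_power\<close>)
  define v where "v = (kap - lam^(2*q^2))*W P + lam^(2*q^3)*tt P
     + (UU P*y P^(q*mm) + x P^q*y P*y P^(q*mm) + lam^2*W P*y P^mm*y P^(q*mm))"
  have "na v <= R" unfolding v_def by (intro na_add_le t1 t2 t3 t4 t5)
  moreover have "na (UU P^q - v) <= R"
    by (rule eR[of _ "2*wt"]) (use Fil_bound[OF UU_q P] e0_le in \<open>simp_all add: power_fun_apply kc_def v_def algebra_simps\<close>)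
  ultimately have "na ((UU P^q - v) + v) <= R" by (intro na_add_le)
  hence *: "na (UU P)^q <= R" by (simp add: na_power)
  show ?thesis
  proof (cases "na (UU P)^q <= na lam^e0")
    case False
    hence le: "na (UU P)^q <= na (UU P)*na lam^(q*mm)" and nz: "UU P ~= 0"
      using*q_gt_1 by (auto simp: R_def le_max_iff_disj power_0_left)
    have "na (UU P)^q = na (UU P)*na (UU P)^(q - 1)" using q_gt_1 by (metis One_nat_def Suc_diff_1 less_imp_Suc_add power_Suc zero_less_Suc)
    hence "na (UU P)^(q - 1) <= na lam^(q*mm)" using le nz by simp
    also have "q*mm = (q^2 + q)*(q - 1)"
    proof -
      have "(q + 1)*(q - 1) + 1 = q^2" using q_gt_1 by (simp add: power2_eq_square algebra_simps diff_mult_distrib2)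
      hence "mm = (q + 1)*(q - 1)" using mm_eq(1) by linarith
      thus ?thesis by (simp add: power2_eq_square algebra_simps)
    qed
    finally have "na (UU P) <= na lam^(q^2 + q)" by (rule root_le) (use q_gt_1 in simp)
    hence "na (UU P)^q <= (na lam^(q^2 + q))^q" by (intro power_mono) auto
    also have "... <= na lam^e0" unfolding power_mult[symmetric]
      by (rule na_lam_power_le) (unfold distrib_right q_products, use e0_eq qs in linarith)
    finally show ?thesis .
  qed
qed

end

context galg
begin

subsection \<open>Congruences modulo small functions\<close>

text \<open>Divisibility by \<open>nu\<close> rather than by \<open>lam = nu^q\<close>: after
  normalization by \<open>nu^e0\<close>, some errors are merely powers of \<open>nu\<close>.\<close>

definition sml :: "('p => 'c) => bool" where "sml a \<longleftrightarrow> Fil 0 (%P. a P/nu)"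

lemma sml_add: "sml a ==> sml b ==> sml (a + b)"
  using Fil_add[of 0 "%P. a P/nu" "%P. b P/nu"] by (simp add: sml_def plus_fun_def add_divide_distrib)

lemma sml_mult: "Fil 0 b ==> sml a ==> sml (b*a)" using Fil_mult[of 0 b 0 "%P. a P/nu"] by (simp add: sml_def times_fun_def)

lemma sml_mult2: "sml a ==> Fil 0 b ==> sml (a*b)" using sml_mult[of b a] by (simp add: mult.commute)

lemma sml_minus: "sml a ==> sml (- a)" using Fil_minus[of 0 "%P. a P/nu"] by (simp add: sml_def fun_Compl_def)

lemma sml_cong: "sml g ==> (!!P. P : S ==> g P = h P) ==> sml h" unfolding sml_def by (erule Fil_cong) simp

lemma sml_nu_power: "0 < n ==> sml (kc (nu^n))" unfolding sml_def
proof -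
  assume "0 < n"
  hence "(%P. kc (nu^n) P/nu) = kc (nu^(n - 1))" by (cases n) (auto simp: kc_def)
  moreover have "Fil 0 (kc (nu^(n - 1)))" by (rule Fil_const) (use na_nu_less in \<open>simp add: na_power power_le_one\<close>)
  ultimately show "Fil 0 (%P. kc (nu^n) P/nu)" by simp
qed

lemma sml_Fil: assumes "Fil 1 a" shows "sml a"
proof -
  have "a = kc (nu^q)*(%P. a P/lam)" by (simp add: kc_def times_fun_def lam_def[symmetric])
  moreover have "Fil 0 (%P. a P/lam)" using assms by (simp add: Fil_def)
  ultimately show ?thesis using sml_mult2[OF sml_nu_power] q_gt_1 by (metis less_trans zero_less_one)
qed

definition eqv :: "('p => 'c) => ('p => 'c) => bool" where "eqv a b \<longleftrightarrow> Fil 0 a & Fil 0 b & sml (a - b)"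

lemma sml_0: "sml 0" using Fil_0[of 0] by (simp add: sml_def zero_fun_def)

lemma eqv_refl: "Fil 0 a ==> eqv a a" by (simp add: eqv_def sml_0)

lemma eqv_sym: "eqv a b ==> eqv b a" using sml_minus[of "a - b"] by (simp add: eqv_def)

lemma eqv_trans: "eqv a b ==> eqv b c ==> eqv a c" using sml_add[of "a - b" "b - c"] by (simp add: eqv_def)

lemma eqv_add: "eqv a b ==> eqv c d ==> eqv (a + c) (b + d)"
  using sml_add[of "a - b" "c - d"] by (simp add: eqv_def Fil_add algebra_simps)

lemma eqv_minus: "eqv a b ==> eqv (- a) (- b)" using sml_minus[of "a - b"] by (simp add: eqv_def Fil_minus)

lemma eqv_mult: assumes "eqv a b" "eqv c d" shows "eqv (a*c) (b*d)"
proof -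
  have "sml (c*(a - b) + b*(c - d))" using assms by (intro sml_add sml_mult) (auto simp: eqv_def)
  moreover have "c*(a - b) + b*(c - d) = a*c - b*d" by (simp add: algebra_simps)
  ultimately show ?thesis using assms Fil_mult[of 0 a 0 c] Fil_mult[of 0 b 0 d] by (simp add: eqv_def)
qed

lemma eqv_power: assumes "eqv a b" shows "eqv (a^n) (b^n)"
proof (induction n)
  case 0
  show ?case using eqv_refl[OF Fil_1] by (simp only: power_0)
next
  case (Suc n)
  thus ?case using eqv_mult[OF assms Suc] by (simp only: power_Suc)
qed

lemma eqv_Fil: "Fil 0 a ==> Fil 0 b ==> Fil 1 (a - b) ==> eqv a b" using sml_Fil by (simp add: eqv_def)

lemma eqv_cong: "eqv a b ==> (!!P. P : S ==> a P = c P) ==> (!!P. P : S ==> b P = d P) ==> eqv c d"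
  unfolding eqv_def using Fil_cong[of 0 a c] Fil_cong[of 0 b d] sml_cong[of "a - b" "c - d"] by auto

lemma eqv_inverse: assumes "Fil 0 a" "Fil 0 ai" "!!P. P : S ==> a P*ai P = 1" "eqv a b" "eqv (b*bi) 1" "Fil 0 bi"
  shows "eqv ai bi"
proof -
  have 1: "eqv (ai*(b*bi)) (ai*1)" by (intro eqv_mult eqv_refl assms)
  have "eqv ((ai*a)*bi) ((ai*b)*bi)" by (intro eqv_mult eqv_refl assms)
  hence "eqv bi (ai*(b*bi))" by (rule eqv_cong) (simp_all add: mult.commute[of "ai _"] assms(3) mult.assoc mult.left_commute[of "ai _"])
  thus ?thesis using 1 by (metis eqv_trans eqv_sym mult_1_right)
qed

end

section \<open>Normalized coordinates and their relations\<close>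

context galg_torsion
begin

definition et where "et = kc (1/lam)*y"
definition ei where "ei = (%P. lam/y P)"
definition xi where "xi = kc (1/lam^q)*x"
definition an where "an = kc (1/lam^(q^3))*A1"
definition bn where "bn = kc (1/lam^q^2)*B1"
definition om where "om = kc (1/lam^wt)*u"
text \<open>This is \<open>UU\<close> divided by \<open>nu^e0*et^mm\<close>. The q-th power of the
  denominator is \<open>lam^e0*et^(q*mm)\<close>, the common factor of the leading terms of
  \<open>UU^q\<close>.\<close>

definition ZZ where "ZZ = (%P. UU P*lam^mm/(nu^e0*y P^mm))"

lemma normalized: "y = kc lam*et" "x = kc (lam^q)*xi" "A1 = kc (lam^(q^3))*an" "B1 = kc (lam^q^2)*bn" "u = kc (lam^wt) * om"
  unfolding et_def xi_def an_def bn_def om_def kc_cancel using kc_cancel[of 1] by simp_all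

lemma Fil_normalized: "Fil 0 et" "Fil 0 xi" "Fil 0 an" "Fil 0 bn" "Fil 0 om"
proof -
  show "Fil 0 et" using y normalized(1) by (intro Fil_divide[of 1 0]) simp
  show "Fil 0 xi" using x normalized(2) by (intro Fil_divide[of q 0]) simp
  show "Fil 0 an" using Fil_A1 normalized(3) by (intro Fil_divide[of "q^3" 0]) simp
  show "Fil 0 bn" using Fil_B1 normalized(4) by (intro Fil_divide[of "q^2" 0]) simp
  show "Fil 0 om" using u normalized(5) by (intro Fil_divide[of wt 0]) simp
qed

end

text \<open>Membership in \<open>G\<close> is automatic when \<open>G\<close> consists of all
  bounded functions; on a piece it is built in by taking these functions as generators.\<close>

locale galg_full = galg_torsion + assumes y_nz: "!!P. P : S ==> y P ~= 0" and W_nz: "!!P. P : S ==> W P ~= 0"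
    and Fil_ei: "Fil 0 ei" and Fil_tt: "Fil 0 tt" and Fil_ZZ: "Fil 0 ZZ" and Fil_Wi: "Fil 0 (%P. 1/W P)"
begin

lemma et_ei: "P : S ==> et P*ei P = 1" using y_nz by (simp add: et_def ei_def kc_def)

lemma et_ei_power: "P : S ==> et P^n*ei P^n = 1" using et_ei by (simp add: power_mult_distrib[symmetric])

lemma UU_ZZ: assumes "P : S" shows "UU P = nu^e0*(et P^mm*ZZ P)"
  using y_nz[OF assms] by (simp add: ZZ_def et_def kc_def power_divide)

lemma F0_mult: "Fil 0 a ==> Fil 0 b ==> Fil 0 (a*b)" using Fil_mult[of 0 a 0 b] by simp

lemma F0_power: "Fil 0 a ==> Fil 0 (a^n)" using Fil_power[of 0 a n] by simp

lemmas F0 = F0_mult F0_power Fil_normalized Fil_ei Fil_tt Fil_ZZ Fil_W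

lemma W_q_eqv: "eqv (W^q) W" by (rule eqv_Fil) (auto intro: F0 Fil_mono[OF W_q])

lemma tt_q_eqv: "eqv (tt^q) tt" by (rule eqv_Fil[OF _ _ tt_q]) (auto intro: F0)

text \<open>\<open>UU\<close> and the other two corrections are of higher order than
  \<open>lam^(2*q)\<close>, so x y^q is \<open>lam^(2*q)*W\<close> to leading order.\<close>

lemma xi_eqv: "eqv xi (ei^q*W)"
proof -
  have k2: "2*q + 1 <= q^2" using qs by linarith
  have Fd: "Fil k (kc (1/lam^n)*a)" if "Fil (n + k) a" for n k a by (rule Fil_divide[of n]) (simp only: kc_cancel that)
  have 1: "Fil 1 (kc (1/lam^(2*q))*(x^q*y + kc (lam^2)*W*y^mm))"
  proof (intro Fd Fil_add)
    show "Fil (2*q + 1) (x^q*y)" by (rule Fil_mult'[OF Fil_x_power(1) y]) (use k2 in simp)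
    show "Fil (2*q + 1) (kc (lam^2)*W*y^mm)"
      by (rule Fil_mult'[OF Fil_mult[OF Fil_lam Fil_W] Fil_y_power]) (use k2 mm_eq(1) in simp)
  qed
  have e: "2*q^2 + 1 <= e0" using e0_eq qs by linarith
  have "sml (kc (nu^(e0 - 2*q^2))*(et^mm*ZZ))" by (rule sml_mult2[OF sml_nu_power]) (use e in \<open>auto intro: F0\<close>)
  hence 2: "sml (kc (1/lam^(2*q))*UU)"
  proof (rule sml_cong)
    fix P assume P: "P : S"
    have "nu^e0 = nu^(e0 - 2*q^2)*lam^(2*q)"
      using e by (simp add: lam_def power_mult[symmetric] power_add[symmetric] power2_eq_square algebra_simps)
    thus "(kc (nu^(e0 - 2*q^2))*(et^mm*ZZ)) P = (kc (1/lam^(2*q))*UU) P"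
      using UU_ZZ[OF P] by (simp add: kc_def power_fun_apply)
  qed
  have "sml (ei^q*(kc (1/lam^(2*q))*(x^q*y + kc (lam^2)*W*y^mm) + kc (1/lam^(2*q))*UU))"
    by (intro sml_mult sml_add sml_Fil[OF 1] 2 F0)
  hence "sml (xi - ei^q*W)"
  proof (rule sml_cong)
    fix P assume P: "P : S"
    have "kc (1/lam^(2*q))*(x^q*y + kc (lam^2)*W*y^mm) + kc (1/lam^(2*q))*UU
       = kc (1/lam^(2*q))*(TT - kc (lam^(2*q))*W)" by (simp add: UU_def algebra_simps)
    also have "... = xi*et^q - W"
      by (simp add: fun_eq_iff TT_def kc_def xi_def et_def power_fun_apply power_divide mult_2 power_add right_diff_distrib[symmetric] left_diff_distrib diff_divide_distrib)
    finally have "(ei^q*(kc (1/lam^(2*q))*(x^q*y + kc (lam^2)*W*y^mm) + kc (1/lam^(2*q))*UU)) P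
        = (ei^q*(xi*et^q - W)) P" by simp
    also have "... = xi P*(et P^q*ei P^q) - ei P^q*W P" by (simp add: power_fun_apply algebra_simps)
    finally show "(ei^q*(kc (1/lam^(2*q))*(x^q*y + kc (lam^2)*W*y^mm) + kc (1/lam^(2*q))*UU)) P
        = (xi - ei^q*W) P" by (simp add: et_ei_power[OF P] power_fun_apply)
  qed
  thus ?thesis by (simp add: eqv_def F0)
qed

text \<open>At order \<open>e0\<close> only x^q y and \<open>lam^2*W*y^mm\<close>, both times
  \<open>y^(q*mm)\<close>, survive in \<open>UU_q\<close>. They become \<open>xi^q*et\<close> and
  \<open>W*et^mm\<close>, and \<open>xi_eqv\<close> with \<open>W_q_eqv\<close> turns the first into
  \<open>W*ei^mm\<close>.\<close>

lemma ZZ_q_eqv: "eqv (ZZ^q) (W*(et^mm + ei^mm))"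
proof -
  have e: "q*(q^2 + 1) + 1 <= e0" using e0_eq qs unfolding distrib_left q_products by linarith
  let ?d = "e0 - q*(q^2 + 1)"
  have "Fil (e0 + 1) (kc (kap - lam^(2*q^2))*W)" by (rule Fil_mult'[OF Fil_const[of _ "e0 + 1"] Fil_W]) (use kap_lam in auto)
  moreover have "Fil (e0 + 1) (kc (lam^(2*q^3))*tt)" by (rule Fil_mult'[OF Fil_lam Fil_tt]) (use e0_le in simp)
  ultimately have "Fil (e0 + 1) ((UU^q - (kc (kap - lam^(2*q^2))*W + kc (lam^(2*q^3))*tt
     + (UU + x^q*y + kc (lam^2)*W*y^mm)*y^(q*mm))) + (kc (kap - lam^(2*q^2))*W + kc (lam^(2*q^3))*tt))"
    by (intro Fil_add Fil_mono[OF UU_q] e0_le)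
  hence 1: "Fil (e0 + 1) (UU^q - (UU + x^q*y + kc (lam^2)*W*y^mm)*y^(q*mm))" by (simp add: algebra_simps)
  have "Fil 1 (et^(q*mm)*(ZZ^q - kc (nu^?d)*(et^mm*ZZ) - xi^q*et - W*et^mm))"
  proof (rule Fil_divide[of e0], rule Fil_cong[OF 1])
    fix P assume P: "P : S"
    have y: "y P = lam*et P" "x P = lam^q*xi P" by (simp_all add: et_def xi_def kc_def)
    have u1: "UU P^q = lam^e0*(et P^(q*mm)*ZZ P^q)"
      unfolding UU_ZZ[OF P] by (simp add: lam_def power_mult_distrib power_mult[symmetric] mult.commute)
    have nd: "nu^e0 = nu^?d*lam^(q^2 + 1)" using e by (simp only: lam_def power_mult[symmetric] power_add[symmetric]) simp
    have le: "lam^e0 = lam^(q*mm)*lam^(q^2 + 1)" using mm_eq(3) by (simp only: power_add[symmetric] add.assoc[symmetric])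
    have l3: "lam^(q^2 + 1) = lam^2*lam^mm"
      using mm_eq(1) by (simp only: power_add[symmetric]) (rule arg_cong[where f = "(^) lam"], linarith)
    have u2: "UU P*y P^(q*mm) = lam^e0*(et P^(q*mm)*(nu^?d*(et P^mm*ZZ P)))"
      unfolding UU_ZZ[OF P] nd le y power_mult_distrib by (simp only: ac_simps)
    have u3: "x P^q*y P*y P^(q*mm) = lam^e0*(et P^(q*mm)*(xi P^q*et P))"
      unfolding le y power_mult_distrib power_mult[symmetric] q_products power_add power_one_right by (simp only: ac_simps)
    have u4: "lam^2*W P*y P^mm*y P^(q*mm) = lam^e0*(et P^(q*mm)*(W P*et P^mm))"
      unfolding le l3 y power_mult_distrib by (simp only: ac_simps)
    have "(UU^q - (UU + x^q*y + kc (lam^2)*W*y^mm)*y^(q*mm)) P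
       = UU P^q - (UU P*y P^(q*mm) + x P^q*y P*y P^(q*mm) + lam^2*W P*y P^mm*y P^(q*mm))"
      by (simp add: power_fun_apply kc_def distrib_right)
    also have "... = lam^e0*(et P^(q*mm)*(ZZ P^q - nu^?d*(et P^mm*ZZ P) - xi P^q*et P - W P*et P^mm))"
      unfolding u1 u2 u3 u4 by (simp only: right_diff_distrib diff_diff_eq distrib_left)
    finally show "(UU^q - (UU + x^q*y + kc (lam^2)*W*y^mm)*y^(q*mm)) P
       = (kc (lam^e0)*(et^(q*mm)*(ZZ^q - kc (nu^?d)*(et^mm*ZZ) - xi^q*et - W*et^mm))) P"
      by (simp add: power_fun_apply kc_def)
  qed
  hence "sml (ei^(q*mm)*(et^(q*mm)*(ZZ^q - kc (nu^?d)*(et^mm*ZZ) - xi^q*et - W*et^mm)))" by (intro sml_mult sml_Fil F0)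
  hence "sml (ZZ^q - kc (nu^?d)*(et^mm*ZZ) - xi^q*et - W*et^mm)"
    by (rule sml_cong) (simp add: mult.assoc[symmetric] mult.commute[of "ei _^_"] power_fun_apply et_ei_power)
  moreover have "sml (kc (nu^?d)*(et^mm*ZZ))" by (rule sml_mult2[OF sml_nu_power]) (use e in \<open>auto intro: F0\<close>)
  ultimately have "sml ((ZZ^q - kc (nu^?d)*(et^mm*ZZ) - xi^q*et - W*et^mm) + kc (nu^?d)*(et^mm*ZZ))" by (rule sml_add)
  hence "sml (ZZ^q - (xi^q*et + W*et^mm))" by (simp add: algebra_simps)
  hence 2: "eqv (ZZ^q) (xi^q*et + W*et^mm)" by (auto simp: eqv_def intro: F0 Fil_add)
  have "eqv (xi^q*et) ((ei^q*W)^q*et)" by (intro eqv_mult eqv_power xi_eqv eqv_refl F0)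
  hence "eqv (xi^q*et) (ei^mm*W^q)"
  proof (rule eqv_cong)
    fix P assume P: "P : S"
    have "ei P^q^2 = ei P^mm*ei P" unfolding mm_eq(1)[symmetric] by simp
    thus "((ei^q*W)^q*et) P = (ei^mm*W^q) P"
      using et_ei[OF P] by (simp add: power_fun_apply power_mult_distrib power_mult[symmetric] q_products mult.assoc[symmetric] mult.commute[of "et P"])

  qed simp
  moreover have "eqv (ei^mm*W^q) (ei^mm*W)" by (intro eqv_mult W_q_eqv eqv_refl F0)
  ultimately have "eqv (xi^q*et) (ei^mm*W)" by (rule eqv_trans)
  hence "eqv (xi^q*et + W*et^mm) (ei^mm*W + W*et^mm)" by (intro eqv_add eqv_refl F0)
  with 2 have "eqv (ZZ^q) (ei^mm*W + W*et^mm)" by (rule eqv_trans)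
  thus ?thesis by (simp add: distrib_left add.commute mult.commute)
qed

lemma bn_eqv: "eqv bn (et^q^2)"
proof (rule eqv_Fil)
  have "Fil (q^2 + 1) (B1 - y^q^2)" by (rule Fil_mono[OF B1_y]) (use qs in linarith)
  thus "Fil 1 (bn - et^q^2)"
  proof (intro Fil_divide[of "q^2" 1], elim Fil_cong)
    fix P show "(B1 - y^q^2) P = (kc (lam^q^2)*(bn - et^q^2)) P"
      by (simp add: bn_def et_def kc_def power_fun_apply power_divide right_diff_distrib)
  qed
qed (auto intro: F0)

lemma an_eqv: "eqv an (xi^q^2)"
proof (rule eqv_Fil)
  have "Fil (q^3 + 1) (A1 - x^q^2)" by (rule Fil_mono[OF A1_x]) (use qs in linarith)
  thus "Fil 1 (an - xi^q^2)"
  proof (intro Fil_divide[of "q^3" 1], elim Fil_cong)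
    fix P show "(A1 - x^q^2) P = (kc (lam^(q^3))*(an - xi^q^2)) P"
      by (simp add: an_def xi_def kc_def power_fun_apply power_divide right_diff_distrib power_mult[symmetric] q_products)
  qed
qed (auto intro: F0)

text \<open>In the torsion equation of Y_1 the linear term has higher order than the other two, so u
  Y_1^q and -Y_1^(q^2) agree to leading order; this determines u.\<close>

lemma om_eqv: "eqv om (- (et^(q^2*(q^2 - q))))"
proof -
  have qq: "q^2*q + q^2*(q^2 - q) = q^4"
  proof -
    have "q^2*q + q^2*(q^2 - q) = q^2*(q + (q^2 - q))" by (simp only: distrib_left)
    also have "q + (q^2 - q) = q^2" using qs by linarith
    finally show ?thesis by (simp only: q_products)
  qed
  have "Fil (q^4 + 1) ((kc \<pi>*B1 + u*B1^q + B1^q^2) - kc \<pi>*B1)"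
  proof (rule Fil_diff)
    show "Fil (q^4 + 1) (kc \<pi>*B1 + u*B1^q + B1^q^2)" by (rule Fil_mono[OF B2]) (use qs in linarith)
    show "Fil (q^4 + 1) (kc \<pi>*B1)" by (rule Fil_mult'[OF Fil_pi Fil_B1]) (use qs in linarith)
  qed
  hence "Fil (q^4 + 1) (u*B1^q + B1^q^2)" by simp
  hence "Fil 1 (om*bn^q - - (bn^q^2))"
  proof (intro Fil_divide[of "q^4" 1], elim Fil_cong)
    fix P
    have "lam^(q^4) = lam^wt*lam^(q^3)" using qs by (simp only: power_add[symmetric])
    moreover have "B1 P = lam^q^2*bn P" "u P = lam^wt * om P" by (simp_all add: bn_def om_def kc_def)
    ultimately show "(u*B1^q + B1^q^2) P = (kc (lam^(q^4))*(om*bn^q - - (bn^q^2))) P"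
      by (simp add: kc_def power_fun_apply power_mult_distrib power_mult[symmetric] q_products distrib_left)
  qed
  hence 1: "eqv (om*bn^q) (- (bn^q^2))" by (intro eqv_Fil) (auto intro: F0 Fil_minus)
  have "eqv (om*(et^q^2)^q) (om*bn^q)" by (intro eqv_mult eqv_power eqv_sym[OF bn_eqv] eqv_refl F0)
  have "eqv (om*(et^q^2)^q) (- ((et^q^2)^q^2))"
    by (rule eqv_trans[OF \<open>eqv (om*(et^q^2)^q) (om*bn^q)\<close> eqv_trans[OF 1]]) (intro eqv_minus eqv_power bn_eqv)
  hence "eqv ((om*(et^q^2)^q)*ei^(q^2*q)) (- ((et^q^2)^q^2)*ei^(q^2*q))" by (intro eqv_mult eqv_refl F0)
  thus ?thesis
  proof (rule eqv_cong)
    fix P assume P: "P : S"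
    show "((om*(et^q^2)^q)*ei^(q^2*q)) P = om P"
      using et_ei_power[OF P, of "q^2*q"] by (simp add: power_fun_apply power_mult[symmetric] mult.assoc)
    have "et P^(q^4) = et P^(q^2*(q^2 - q))*et P^(q^2*q)" unfolding qq[symmetric] power_add by simp
    thus "(- ((et^q^2)^q^2)*ei^(q^2*q)) P = (- (et^(q^2*(q^2 - q)))) P"
      using et_ei_power[OF P, of "q^2*q"] by (simp add: power_fun_apply power_mult[symmetric] q_products(8) mult.assoc)
  qed
qed

end

section \<open>The affinoid as a set of torsion points with prescribed absolute values\<close>

context lubin_tate_setting
begin

definition cx :: "'c triple => 'c" where "cx P = fst P"
definition cy :: "'c triple => 'c" where "cy P = fst (snd P)"
definition cu :: "'c triple => 'c" where "cu P = snd (snd P)"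

text \<open>The basis condition is replaced by two torsion equations: X_1 and Y_1 have different
  nonzero absolute values, so \<open>torsion_basisI\<close> recovers it.\<close>

definition Zs :: "'c triple set" where
  "Zs = {(x, y, u). na u = na lam^wt & na x = na lam^q & na y = na lam
     & na (sm u \<pi> x) = na lam^(q^3) & na (sm u \<pi> y) = na lam^q^2
     & sm u \<pi> (sm u \<pi> x) = 0 & sm u \<pi> (sm u \<pi> y) = 0}"

lemma wt_pos: "0 < wt" using q_gt_1 by (simp add: wt_def)

lemma v_lam: "v z = ereal (real n/real (2*wt)) \<longleftrightarrow> na z = na lam^n"
proof (cases "z = 0")
  case False
  have w: "0 < 2*wt" using wt_pos by simp
  have "na lam^(2*wt) = real q powr (- 1)"
    using na_pi q_gt_1 unfolding na_pi_lam[symmetric] by (simp add: powr_minus field_simps)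
  also have "... = (real q powr (- (1/real (2*wt))))^(2*wt)" using wt_pos q_gt_1 by (simp add: powr_power)
  finally have l: "na lam = real q powr (- (1/real (2*wt)))" by (rule power_eq_imp_eq_base) (use w in simp_all)
  have "na lam^n = real q powr (- (real n/real (2*wt)))" unfolding l using q_gt_1 by (simp add: powr_power mult.commute)
  moreover have "na z = real q powr (- real_of_ereal (v z))" by (rule na_v[OF False])
  ultimately have "na z = na lam^n \<longleftrightarrow> real_of_ereal (v z) = real n/real (2*wt)"
    using q_gt_1 by (simp add: powr_inj)
  also have "... \<longleftrightarrow> v z = ereal (real n/real (2*wt))"
    using v_real[OF False] by (metis real_of_ereal.simps(1))
  finally show ?thesis by simp
qed (simp add: v_0)

lemma Z110_Zs: "Z110 F v \<pi> q = Zs"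
proof -
  have q1: "real q - 1 = real (q - 1)" using q_gt_1 by simp
  have e: "1/2 = real wt/real (2*wt)" "1/(2*(real q - 1)) = real (q^3)/real (2*wt)"
    "1/(2 * real q^2*(real q - 1)) = real q/real (2*wt)"
    "1/(2 * real q*(real q - 1)) = real (q^2)/real (2*wt)"
    "1/(2 * real q^3*(real q - 1)) = real 1/real (2*wt)" unfolding q1 using q_gt_1 wt_pos
    by (simp_all add: wt_def power2_eq_square power3_eq_cube)
  have lt: "na lam^n < 1" if "0 < n" for n using na_lam_power_less[OF that] by simp
  have "(x, y, u) : Z110 F v \<pi> q \<longleftrightarrow> (x, y, u) : Zs" for x y u
  proof
    assume "(x, y, u) : Z110 F v \<pi> q"
    hence t: "torsion_basis F v \<pi> q u x y" and n: "na u = na lam^wt" "na (sm u \<pi> x) = na lam^(q^3)" "na x = na lam^q"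
        "na (sm u \<pi> y) = na lam^q^2" "na y = na lam^1" unfolding Z110_def lt_space_def e v_lam by auto
    have l: "na u <= 1" "na x < 1" "na y < 1" using n lt[of wt] lt[of q] lt[of 1] wt_pos q_pos by auto
    have "sm u (\<pi>^2) x = 0" "sm u (\<pi>^2) y = 0" using t by (auto simp: torsion_basis_def lt_torsion_def Let_def)
    hence "sm u \<pi> (sm u \<pi> x) = 0" "sm u \<pi> (sm u \<pi> y) = 0"
      using sm_sm[of \<pi> \<pi> u x] sm_sm[of \<pi> \<pi> u y] l pi_F by (auto simp: power2_eq_square na_pi_less less_imp_le)
    thus "(x, y, u) : Zs" using n by (simp add: Zs_def)
  next
    assume "(x, y, u) : Zs"
    hence n: "na u = na lam^wt" "na (sm u \<pi> x) = na lam^(q^3)" "na x = na lam^q" "na (sm u \<pi> y) = na lam^q^2" "na y = na lam^1"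
        and t: "sm u \<pi> (sm u \<pi> x) = 0" "sm u \<pi> (sm u \<pi> y) = 0" by (auto simp: Zs_def)
    have l: "na u < 1" "na x < 1" "na y < 1" using n lt[of wt] lt[of q] lt[of 1] wt_pos q_pos by auto
    have "na lam^(q^3) < na lam^q^2" by (rule na_lam_power_less) (use qs in linarith)
    moreover have "0 < na lam^(q^3)" "0 < na lam^q^2" by simp_all
    moreover have "sm u \<pi> x ~= 0" "sm u \<pi> y ~= 0" using n(2,4) by (metis na_pos calculation(2), metis na_pos calculation(3))
    ultimately have "torsion_basis F v \<pi> q u x y" using n(2,4) by (intro torsion_basisI l t) simp_all
    thus "(x, y, u) : Z110 F v \<pi> q" unfolding Z110_def lt_space_def e v_lam using n l by (simp add: v_pos_na)
  qed
  thus ?thesis by auto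
qed

abbreviation bdd :: "'p set => ('p => 'c) set" where "bdd S \<equiv> {g. ALL P:S. na (g P) <= 1}"

lemma galg_bdd: fixes S :: "'p set" shows "galg F v \<pi> q p S (bdd S)"
proof unfold_locales
  fix g :: "'p => 'c" assume *: "!!n. EX h:bdd S. ALL P:S. na (g P - h P) <= na lam^n"
  obtain h where h: "h : bdd S" "ALL P:S. na (g P - h P) <= na lam^0" using*by blast
  have "na ((g P - h P) + h P) <= 1" if "P : S" for P using h that by (intro na_add_le) auto
  thus "g : bdd S" by simp
qed (auto intro: na_add_le na_mult_le1)

lemma galg_triple_bdd:
  fixes u x y :: "'p => 'c"
  assumes "!!P. P : S ==> na (u P) <= na lam^wt" "!!P. P : S ==> na (x P) <= na lam^q" "!!P. P : S ==> na (y P) <= na lam"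
  shows "galg_triple F v \<pi> q p S (bdd S) u x y"
proof -
  interpret galg F v \<pi> q p S "bdd S" by (rule galg_bdd)
  show ?thesis by unfold_locales (use assms in \<open>auto simp: Fil_def na_divide na_power divide_le_eq\<close>)
qed

lemma galg_torsion_Zs: "galg_torsion F v \<pi> q p Zs (bdd Zs) cu cx cy"
proof -
  interpret galg_triple F v \<pi> q p Zs "bdd Zs" cu cx cy by (rule galg_triple_bdd) (auto simp: Zs_def cu_def cx_def cy_def)
  show ?thesis by unfold_locales (auto simp: Zs_def SM_def cu_def cx_def cy_def)
qed

subsection \<open>Roots of unity\<close>

lemma q_pred_power: "(t::'r::comm_ring_1)^q = t^(q - 1)*t"
  using q_gt_1 by (metis One_nat_def Suc_diff_1 less_imp_Suc_add power_Suc2 zero_less_Suc)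

text \<open>The Teichmueller elements. They represent the q residue classes of F
  (\<open>card_fq\<close>, \<open>fq_unit_diff\<close>) and act on the formal module by plain
  multiplication (\<open>sm_teichmuller\<close>).\<close>

definition fq :: "'c set" where "fq = {t. t^q = t}"
definition mu :: "'c set" where "mu = {a. a^(q - 1) = 1}"

lemma fq_mu: "fq = insert 0 mu" "0 \<notin> mu" using q_gt_1 by (auto simp: fq_def mu_def q_pred_power power_0_left)

lemma na_fq: "t : fq ==> na t <= 1" and na_mu: "a : mu ==> na a = 1"
proof -
  show m: "na a = 1" if "a : mu" for a
  proof -
    have "na a^(q - 1) = 1^(q - 1)" using that by (simp add: mu_def na_power[symmetric])
    thus ?thesis using q_gt_1 power_eq_iff_eq_base[of "q - 1" "na a" 1] by simp
  qed
  thus "t : fq ==> na t <= 1" using fq_mu by auto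
qed

lemma mu_mult: "a : mu ==> b : mu ==> a*b : mu" and mu_inverse: "a : mu ==> inverse a : mu"
  by (simp_all add: mu_def power_mult_distrib power_inverse)

text \<open>Within a residue class the q-th power contracts strictly: for d = a - b both d^q and
  \<open>\<pi>\<close> d are smaller than d.\<close>

lemma na_q_diff: assumes "na a <= 1" "na b <= 1" "na (a - b) < 1" shows "na (a^q - b^q) < na (a - b) \<or> a = b"
proof (cases "a = b")
  case False
  define d where "d = a - b"
  have d: "0 < na d" "na d < 1" using False assms by (auto simp: d_def)
  have dl: "na (d^Suc n) <= na d" for n using d by (simp add: na_mult na_power power_le_one mult_left_le)
  have "a^q - b^q = d^q + \<pi>*(\<Sum>i\<in>{0<..<q}. bq i*d^i*b^(q - i))"
    using q_power_sum[of "%x. x" d b] by (simp add: d_def)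
  moreover have "na (d^q) < na d" using d q_gt_1 power_strict_decreasing[of 1 q "na d"] by (simp add: na_power)
  moreover have "na (\<Sum>i\<in>{0<..<q}. bq i*d^i*b^(q - i)) <= na d"
  proof (rule na_sum_le)
    fix i assume i: "i : {0<..<q}"
    then obtain j where "i = Suc j" using gr0_conv_Suc by auto
    hence "na (d^i) <= na d" using dl by simp
    hence "na ((bq i*b^(q - i))*d^i) <= na d" using i assms na_bq by (intro na_mult_le1 na_power_le1) auto
    thus "na (bq i*d^i*b^(q - i)) <= na d" by (simp add: ac_simps)
  qed simp
  hence "na (\<pi>*(\<Sum>i\<in>{0<..<q}. bq i*d^i*b^(q - i))) <= na \<pi>*na d" by (simp add: na_mult mult_left_mono)
  hence "na (\<pi>*(\<Sum>i\<in>{0<..<q}. bq i*d^i*b^(q - i))) < na d" using d(1) na_pi_less mult_strict_right_mono[of "na \<pi>" 1 "na d"] by linarith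
  ultimately show ?thesis unfolding d_def[symmetric] by (metis na_add_less)
qed simp

lemma fq_unit_diff: assumes "s : fq" "t : fq" "s ~= t" shows "na (s - t) = 1"
proof (rule ccontr)
  assume "\<not> ?thesis"
  moreover have "na (s - t) <= 1" using assms na_fq by (intro na_diff_le) auto
  ultimately have "na (s - t) < 1" by simp
  thus False using na_q_diff[of s t] assms na_fq by (auto simp: fq_def)
qed

lemma fq_nearest: assumes "na z <= 1" "na (z^q - z) < 1" obtains t where "t : fq" "na (z - t) < 1"
proof -
  define P where "P = monom 1 q - [:0, 1::'c:]"
  have c: "coeff P i = (if i = q then 1 else 0) - (if i = 1 then 1 else 0)" for i
    by (auto simp: P_def coeff_pCons split: nat.splits)
  have d: "degree P = q" using q_gt_1 by (intro antisym[OF degree_le le_degree]) (auto simp: c)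
  have p: "poly P w = w^q - w" for w by (simp add: P_def poly_monom)
  obtain t where t: "poly P t = 0" "na (z - t)^q <= na (poly P z)" using C_nearest_root[of P q z] d q_gt_1 by (auto simp: c)
  hence "na (z - t)^q < 1" using assms by (simp add: p)
  hence "na (z - t) < 1" by (metis one_le_power not_less)
  thus ?thesis using that t by (simp add: p fq_def)
qed

text \<open>X^q - X has at most q roots, and by Fermat each of the q residue representatives has one
  near it.\<close>

lemma card_fq: "finite fq" "card fq = q"
proof -
  define P where "P = monom 1 q - [:0, 1::'c:]"
  have c: "coeff P i = (if i = q then 1 else 0) - (if i = 1 then 1 else 0)" for i
    by (auto simp: P_def coeff_pCons split: nat.splits)
  have d: "degree P = q" using q_gt_1 by (intro antisym[OF degree_le le_degree]) (auto simp: c)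
  have P: "P ~= 0" using d q_gt_1 by auto
  have f: "fq = {w. poly P w = 0}" by (auto simp: P_def poly_monom fq_def)
  show fin: "finite fq" unfolding f using poly_roots_finite[OF P] .
  have le: "card fq <= q" unfolding f using card_poly_roots_bound[OF P] d by simp
  obtain B where B: "finite B" "card B = q" "B <= F" "!!b. b : B ==> na b <= 1"
    "!!b c. b : B ==> c : B ==> b ~= c ==> na (b - c) = 1" using residue_reps by metis
  have "EX t. t : fq & na (b - t) < 1" if "b : B" for b using fq_nearest[of b] fermat[of b] B that by (metis subsetD)
  then obtain f where f: "!!b. b : B ==> f b : fq" "!!b. b : B ==> na (b - f b) < 1" by metis
  have "inj_on f B"
  proof (rule inj_onI, rule ccontr)
    fix b c assume *: "b : B" "c : B" "f b = f c" "b ~= c"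
    hence "na ((b - f b) - (c - f b)) < 1" using f(2)[of b] f(2)[of c] by (intro na_diff_less[of "b - f b"]) auto
    thus False using B(5)[of b c]*by simp
  qed
  hence "card B <= card fq" using f(1) fin by (intro card_inj_on_le) auto
  thus "card fq = q" using le B(2) by simp
qed

lemma card_mu: "finite mu" "card mu = q - 1" using card_fq fq_mu by auto

text \<open>The residue field of C is infinite, by Euclid's argument: a root of 1 plus the product
  of X - a over A and 0 has unit distance from 0 and from every point of A.\<close>

lemma unit_points: "EX A. finite A & card A = n & (ALL a:A. na a = 1) & (ALL a:A. ALL b:A. a ~= b --> na (a - b) = 1)"
proof (induction n)
  case (Suc n)
  then obtain A where A: "finite A" "card A = n" "!!a. a : A ==> na a = 1" "!!a b. a : A ==> b : A ==> a ~= b ==> na (a - b) = 1"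
    by auto
  define P where "P = (\<Prod>a\<in>insert 0 A. [:- a, 1:]) + 1"
  have d: "degree (\<Prod>a\<in>insert 0 A. [:- a, 1:]) = card (insert 0 A)" by (simp add: degree_prod_eq_sum_degree)
  have 0: "0 \<notin> A" using A(3)[of 0] by auto
  hence c: "card (insert 0 A) = Suc n" using A by simp
  have dP: "degree P = Suc n" unfolding P_def using d c by (subst degree_add_eq_left) auto
  have lP: "lead_coeff P = 1"
  proof -
    have "lead_coeff (\<Prod>a\<in>insert 0 A. [:- a, 1:]) = (1::'c)" by (simp add: lead_coeff_prod)
    hence "coeff (\<Prod>a\<in>insert 0 A. [:- a, 1:]) (Suc n) = (1::'c)" unfolding d c .
    thus ?thesis unfolding dP unfolding P_def by (simp add: coeff_1)
  qed
  have pP: "poly P z = (\<Prod>a\<in>insert 0 A. (z - a)) + 1" for z by (simp add: P_def poly_prod)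
  obtain r where r: "poly P r = 0" "na (0 - r)^Suc n <= na (poly P 0)" using C_nearest_root[OF lP dP, of 0] by auto
  have "na r^Suc n <= 1^Suc n" using r(2) A(1) 0 unfolding pP by (simp del: power_Suc)
  hence r1: "na r <= 1" by (meson na_nonneg power_le_imp_le_base zero_le_one)
  have le: "na (r - a) <= 1" if "a : insert 0 A" for a using that r1 A(3) by (intro na_diff_le) auto
  have "(\<Prod>a\<in>insert 0 A. (r - a)) = - 1" using r(1) by (simp only: pP add_eq_0_iff2)
  hence one: "(\<Prod>a\<in>insert 0 A. na (r - a)) = 1" by (simp only: na_prod[symmetric]) simp
  have eq: "na (r - a) = 1" if a: "a : insert 0 A" for a
  proof -
    have "(\<Prod>a\<in>insert 0 A. na (r - a)) = na (r - a)*(\<Prod>a\<in>insert 0 A - {a}. na (r - a))"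
      using a A(1) by (intro prod.remove) auto
    moreover have "(\<Prod>a\<in>insert 0 A - {a}. na (r - a)) <= 1" using le by (intro prod_le_1) auto
    ultimately have "1 <= na (r - a)" using one mult_left_mono[of "\<Prod>a\<in>insert 0 A - {a}. na (r - a)" 1 "na (r - a)"] by simp
    thus ?thesis using le[OF a] by simp
  qed
  have "r \<notin> A" using eq[of r] by auto
  thus ?case using A eq eq[of 0] na_diff_commute by (intro exI[of _ "insert r A"]) auto
qed auto

text \<open>The Gauss norm is the supremum on the disc: divided by its largest coefficient, a
  counterexample would have small values at more unit points than its degree.\<close>

lemma coeffs_le: assumes "!!s. na s <= 1 ==> na (poly P s) <= r" shows "na (coeff P i) <= r"
proof (rule ccontr)
  assume i: "\<not> ?thesis"
  have r: "0 <= r" using order_trans[OF na_nonneg assms[of 0]] by simp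
  define M where "M = Max ((%i. na (coeff P i)) ` {..degree P})"
  have "M : (%i. na (coeff P i)) ` {..degree P}" unfolding M_def by (rule Max_in) auto
  then obtain k where k: "M = na (coeff P k)" by auto
  have M: "na (coeff P j) <= M" for j
  proof (cases "j <= degree P")
    case False
    thus ?thesis using k by (simp add: coeff_eq_0)
  qed (simp add: M_def)
  have rM: "r < M" using i M[of i] by simp
  have cnz: "coeff P k ~= 0" using k rM r by (metis na_0 not_le)
  obtain A where A: "finite A" "card A = Suc (degree P)" "!!a. a : A ==> na a = 1"
      "!!a b. a : A ==> b : A ==> a ~= b ==> na (a - b) = 1" using unit_points[of "Suc (degree P)"] by metis
  define Q where "Q = smult (inverse (coeff P k)) P"
  have nQ: "na (coeff Q j) = na (coeff P j)/M" "na (poly Q a) = na (poly P a)/M" for j a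
    by (simp_all add: Q_def na_mult na_inverse k divide_inverse mult.commute)
  have "na (coeff Q k) < 1"
  proof (rule poly_small_coeffs[of _ A])
    show "ip Q" unfolding ip_def nQ using M r rM by (simp add: divide_le_eq)
    show "degree Q < card A" using A(2) cnz by (simp add: Q_def)
    have "na (poly Q a) < 1" if "a : A" for a
      unfolding nQ using le_less_trans[OF assms[OF eq_refl[OF A(3)[OF that]]] rM] rM r by (simp add: pos_divide_less_eq)
    thus "na a <= 1 & na (poly Q a) < 1" if "a : A" for a using that A(3) by auto
  qed (use A in auto)
  thus False using cnz by (simp add: Q_def)
qed

lemma na_lam_eq_0: assumes "!!N. na a <= na lam^N" shows "a = 0"
proof -
  have "(%N. na lam^N) \<longlonglongrightarrow> 0" using na_lam_less by (intro LIMSEQ_power_zero) simp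
  hence "na a <= 0" using assms by (intro LIMSEQ_le_const) auto
  thus ?thesis by simp
qed

text \<open>The integral elements of the Tate algebra of the closed unit disc, described through
  approximation by integral polynomials.\<close>

definition pa :: "('c => 'c) => bool"
  where "pa h \<longleftrightarrow> (ALL N. EX H. ip H & (ALL s. na s <= 1 --> na (h s - poly H s) <= na lam^N))"

text \<open>Expand around s. Modulo \<open>lam\<close> the function is a polynomial of degree n with
  unit leading coefficient, so the coefficients beyond n are small. The root t nearest to 0 of the
  truncated expansion has |t|^n at most |lam|^(k+1), and the discarded terms gain one factor
  \<open>lam\<close>.\<close>

lemma pa_root_step: assumes h: "pa h" and P: "ip P" "degree P = n" "0 < n" "na (lead_coeff P) = 1"
    and hP: "!!s. na s <= 1 ==> na (h s - poly P s) <= na lam" and s: "na s <= 1" "na (h s) <= na lam^Suc k"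
  shows "\<exists>s'. na s' <= 1 & na (s' - s)^n <= na lam^Suc k & na (h s') <= na lam^Suc (Suc k)"
proof -
  have l1: "na lam^j <= 1" for j using na_lam_power_le[of 0 j] by simp
  obtain H where H: "ip H" "!!s. na s <= 1 ==> na (h s - poly H s) <= na lam^Suc (Suc k)" using h unfolding pa_def by metis
  define Q where "Q = pcompose H [:s, 1:]"
  define R where "R = pcompose P [:s, 1:]"
  have st: "na (s + t) <= 1" if "na t <= 1" for t using s that by (intro na_add_le)
  have Q: "poly Q t = poly H (s + t)" and R: "poly R t = poly P (s + t)" for t by (simp_all add: Q_def R_def poly_pcompose add.commute)
  have ipQ: "na (coeff Q i) <= 1" for i by (rule coeffs_le) (simp add: Q ip_poly H st)
  have QR: "na (coeff (Q - R) i) <= na lam" for i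
  proof (rule coeffs_le)
    fix t assume "na t <= 1"
    hence t: "na (s + t) <= 1" by (rule st)
    have "na lam^Suc (Suc k) <= na lam" using na_lam_power_le[of 1 "Suc (Suc k)"] by (simp del: power_Suc)
    hence "na (h (s + t) - poly H (s + t)) <= na lam" using H(2)[OF t] by linarith
    from na_diff_le[OF hP[OF t] this] show "na (poly (Q - R) t) <= na lam" by (simp add: Q R)
  qed
  have R1: "degree R = n" "coeff R n = lead_coeff P"
  proof -
    show d: "degree R = n" using P(2) by (simp add: R_def degree_pcompose)
    have "lead_coeff R = lead_coeff P" unfolding R_def by (subst lead_coeff_comp) simp_all
    thus "coeff R n = lead_coeff P" by (simp add: d)
  qed
  have c1: "na (coeff Q n) = 1" using na_eqI[of "coeff Q n" "coeff R n"] QR[of n] R1(2) P(4) na_lam_less by simp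
  hence cnz: "coeff Q n ~= 0" by auto
  have c2: "na (coeff Q i) <= na lam" if "n < i" for i using QR[of i] R1(1) that by (simp add: coeff_eq_0)
  define c where "c = coeff Q n"
  define T where "T = smult (inverse c) (poly_cutoff (Suc n) Q)"
  have cT: "coeff T i = (if i <= n then coeff Q i/c else 0)" for i
    by (simp add: T_def coeff_poly_cutoff less_Suc_eq_le divide_inverse mult.commute)
  have dT: "degree T = n" "lead_coeff T = 1"
  proof -
    show "degree T = n" by (rule antisym[OF degree_le le_degree]) (auto simp: cT c_def cnz)
    thus "lead_coeff T = 1" by (simp add: cT c_def cnz)
  qed
  obtain t where t: "poly T t = 0" "na (0 - t)^n <= na (poly T 0)" using C_nearest_root[OF dT(2,1) P(3), of 0] by auto
  have "na (poly T 0) = na (poly Q 0)" using c1 by (simp add: poly_0_coeff_0 cT na_divide c_def)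
  also have "poly Q 0 = h s - (h s - poly H s)" by (simp add: Q)
  also have "na ... <= na lam^Suc k" by (rule na_diff_le[OF s(2) order_trans[OF H(2)[OF s(1)] na_lam_power_le]]) simp
  finally have tn: "na t^n <= na lam^Suc k" using t(2) by simp
  have t1: "na t <= 1"
  proof (rule ccontr)
    assume "\<not> ?thesis"
    hence "1 < na t^n" using P(3) by (simp add: one_less_power)
    thus False using tn l1[of "Suc k"] by linarith
  qed
  have small: "na (coeff Q i*t^i) <= na lam^Suc (Suc k)" if "n < i" for i
  proof -
    have "na (t^i) <= na t^n" unfolding na_power using that t1 by (intro power_decreasing) auto
    hence "na (t^i) <= na lam^Suc k" using tn by linarith
    hence "na (coeff Q i)*na (t^i) <= na lam*na lam^Suc k" using c2[OF that] by (intro mult_mono) auto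
    thus ?thesis by (simp add: na_mult)
  qed
  have "poly Q t = (\<Sum>i\<le>degree Q. if n < i then coeff Q i*t^i else 0) + (\<Sum>i\<le>degree Q. if i <= n then coeff Q i*t^i else 0)"
    by (simp add: poly_altdef sum.distrib[symmetric]) (rule sum.cong, auto)
  also have "(\<Sum>i\<le>degree Q. if i <= n then coeff Q i*t^i else 0) = c*poly T t"
  proof -
    have "n <= degree Q" using cnz by (rule le_degree)
    hence "(\<Sum>i\<le>degree Q. if i <= n then coeff Q i*t^i else 0) = (\<Sum>i\<le>n. coeff Q i*t^i)"
      by (intro sum.mono_neutral_cong_right) auto
    also have "... = c*poly T t" unfolding poly_altdef dT(1) sum_distrib_left by (rule sum.cong) (auto simp: cT c_def cnz)
    finally show ?thesis .
  qed
  finally have "na (poly Q t) <= na lam^Suc (Suc k)" using small t(1) by (auto intro!: na_sum_le)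
  hence "na (poly Q t + (h (s + t) - poly H (s + t))) <= na lam^Suc (Suc k)" using H(2)[OF st[OF t1]] by (intro na_add_le)
  thus ?thesis using st[OF t1] tn by (intro exI[of _ "s + t"]) (simp add: Q)
qed

text \<open>The steps are bounded by powers of the n-th root of |lam|, so the approximate zeros
  converge without leaving the residue class of \<open>s0\<close>.\<close>

lemma pa_root: assumes h: "pa h" and P: "ip P" "degree P = n" "0 < n" "na (lead_coeff P) = 1"
    and hP: "!!s. na s <= 1 ==> na (h s - poly P s) <= na lam" and s0: "na s0 = 1" "poly P s0 = 0"
  obtains s where "na s = 1" "h s = 0"
proof -
  have "na (h s0) <= na lam^Suc 0" using hP[of s0] s0 by simp
  hence "EX f. ALL k. (na (f k) <= 1 & na (h (f k)) <= na lam^Suc k & (k = 0 --> f k = s0)) & na (f (Suc k) - f k)^n <= na lam^Suc k"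
    using pa_root_step[OF h P hP] s0 by (intro dependent_nat_choice) auto
  then obtain f where f: "!!k. na (f k) <= 1" "!!k. na (h (f k)) <= na lam^Suc k" "f 0 = s0" "!!k. na (f (Suc k) - f k)^n <= na lam^Suc k"
    by auto
  define r where "r = root n (na lam)"
  have r: "0 < r" "r < 1" "r^n = na lam" using P(3) na_lam_less by (auto simp: r_def)
  have step: "na (f (Suc k) - f k) <= r^Suc k" for k
  proof (rule power_le_imp_le_base)
    have "na (f (Suc k) - f k)^n <= (r^n)^Suc k" using f(4)[of k] r(3) by simp
    thus "na (f (Suc k) - f k)^Suc (n - 1) <= (r^Suc k)^Suc (n - 1)" using P(3) by (simp add: power_commutes power_mult[symmetric] power_mult_distrib mult.commute)
  qed (use r in auto)
  have "(%k. r^Suc k) \<longlonglongrightarrow> 0" using r by (intro LIMSEQ_Suc LIMSEQ_power_zero) auto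
  hence "(%k. na (f (Suc k) - f k)) \<longlonglongrightarrow> 0"
    by (rule tendsto_sandwich[OF _ _ tendsto_const, rotated -1]) (use step in auto)
  then obtain s where s: "f \<longlonglongrightarrow> s" using na_convergent by blast
  have fr: "na (f k - s0) <= r" for k
  proof (induction k)
    case (Suc k)
    have "r^Suc k <= r^1" using r by (intro power_decreasing) auto
    hence "na ((f (Suc k) - f k) + (f k - s0)) <= r" using step[of k] Suc by (intro na_add_le) auto
    thus ?case by simp
  qed (use f r in auto)
  have "(%k. f k - s0) \<longlonglongrightarrow> s - s0" using s by (simp add: lim_na)
  hence "na (s - s0) <= r" by (rule na_lim_le) (rule fr)
  hence n1: "na s = 1" using na_eqI[of s s0] r s0 by simp
  have "na (h s) <= na lam^N" for N
  proof -
    obtain H where H: "ip H" "!!s. na s <= 1 ==> na (h s - poly H s) <= na lam^N" using h unfolding pa_def by metis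
    have "(%k. na (f k - s)) \<longlonglongrightarrow> 0" using s by (simp add: lim_na)
    hence "\<forall>\<^sub>F k in sequentially. na (f k - s) < na lam^N" by (rule order_tendstoD) simp
    then obtain K where "!!k. K <= k ==> na (f k - s) < na lam^N" by (auto simp: eventually_sequentially)
    then obtain k where k: "N <= k" "na (f k - s) < na lam^N" by (meson max.cobounded1 max.cobounded2)
    have "na (poly H s - poly H (f k)) <= na (s - f k)*(1*1^degree H)"
      by (rule na_poly_diff) (use H(1) n1 f(1) in \<open>auto simp: ip_def\<close>)
    hence a: "na (poly H s - poly H (f k)) <= na lam^N" using k(2) na_diff_commute[of s "f k"] by simp
    have b: "na (h (f k)) <= na lam^N" using f(2)[of k] na_lam_power_le[of N "Suc k"] k(1) by linarith
    have "na ((h s - poly H s) + ((poly H s - poly H (f k)) + (h (f k) - (h (f k) - poly H (f k))))) <= na lam^N"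
      by (rule na_add_le[OF _ na_add_le[OF a na_diff_le[OF b]]]) (use H(2)[of s] H(2)[of "f k"] n1 f(1) in simp_all)
    thus ?thesis by simp
  qed
  hence "h s = 0" by (rule na_lam_eq_0)
  thus thesis using that n1 by blast
qed

lemma galg_closure: assumes const: "!!c. na c <= 1 ==> (%_. c) : A" and add: "!!g h. g : A ==> h : A ==> g + h : A"
    and mult: "!!g h. g : A ==> h : A ==> g*h : A" and bound: "!!g P. g : A ==> P : S ==> na (g P) <= 1"
  shows "galg F v \<pi> q p S {g. ALL n. EX h:A. ALL P:S. na (g P - h P) <= na lam^n}" (is "galg _ _ _ _ _ _ ?G")
proof unfold_locales
  show "(%_. a) : ?G" if "na a <= 1" for a using const[OF that] by (auto intro!: bexI)
  show G: "na (g P) <= 1" if g: "g : ?G" and P: "P : S" for g P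
  proof -
    obtain h where h: "h : A" "na (g P - h P) <= na lam^0" using g P by blast
    have "na ((g P - h P) + h P) <= 1" by (rule na_add_le[OF _ bound]) (use h P in auto)
    thus ?thesis by simp
  qed
  fix g
  show "g : ?G" if *: "!!n. EX h:?G. ALL P:S. na (g P - h P) <= na lam^n"
  proof (intro CollectI allI)
    fix n
    obtain h k where h: "!!P. P : S ==> na (g P - h P) <= na lam^n" "k : A" "!!P. P : S ==> na (h P - k P) <= na lam^n" using*by blast
    have "na ((g P - h P) + (h P - k P)) <= na lam^n" if "P : S" for P using h that by (intro na_add_le)
    thus "EX k:A. ALL P:S. na (g P - k P) <= na lam^n" using h(2) by (intro bexI[of _ k]) auto
  qed
  fix h assume gh: "g : ?G" "h : ?G"
  have "(EX k:A. ALL P:S. na ((g + h) P - k P) <= na lam^n) & (EX k:A. ALL P:S. na ((g*h) P - k P) <= na lam^n)" for n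
  proof -
    obtain g' h' where *: "g' : A" "!!P. P : S ==> na (g P - g' P) <= na lam^n" "h' : A" "!!P. P : S ==> na (h P - h' P) <= na lam^n"
      using gh by blast
    have "na ((g P - g' P) + (h P - h' P)) <= na lam^n" "na (h P*(g P - g' P) + g' P*(h P - h' P)) <= na lam^n" if P: "P : S" for P
      by (intro na_add_le na_mult_le1 bound[OF *(1) P] G[OF gh(2) P] *(2,4)[OF P])+
    thus ?thesis using add[OF *(1,3)] mult[OF *(1,3)]
      by (intro conjI bexI[of _ "g' + h'"] bexI[of _ "g'*h'"]) (auto simp: algebra_simps)
  qed
  thus "g + h : ?G" "g*h : ?G" by blast+
qed

lemma galg_pa: "galg F v \<pi> q p {s. na s <= 1} (Collect pa)"
proof -
  have e: "Collect pa = {g. ALL n. EX h:poly ` Collect ip. ALL s:{s. na s <= 1}. na (g s - h s) <= na lam^n}"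
    by (auto simp: pa_def)
  show ?thesis unfolding e
  proof (rule galg_closure)
    show "(%_. c) : poly ` Collect ip" if "na c <= 1" for c
      using that by (intro image_eqI[of _ _ "[:c:]"]) (auto simp: ip_pCons)
    show "g + h : poly ` Collect ip" "g*h : poly ` Collect ip" if "g : poly ` Collect ip" "h : poly ` Collect ip" for g h
    proof -
      from that obtain H K where H: "g = poly H" "h = poly K" "ip H" "ip K" by blast
      hence "g + h = poly (H + K)" "g*h = poly (H*K)" by (auto simp: fun_eq_iff)
      thus "g + h : poly ` Collect ip" "g*h : poly ` Collect ip" using ip_add[OF H(3,4)] ip_mult[OF H(3,4)] by blast+
    qed
  qed (auto intro: ip_poly)
qed

subsection \<open>Points with prescribed coordinates\<close>

text \<open>The unknowns are unit zeros of functions of one variable, found in turn: u from the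
  torsion equation of Y_2, a nonzero \<open>\<pi>\<close>-torsion point as X_1, and X_2 above X_1.
  Normalized, the leading parts are a linear polynomial, w s^q + s, and s^(q^2) - b.\<close>

lemma Zs_fiber: assumes e: "na e = 1" obtains x u where "(x, lam*e, u) : Zs"
proof -
  let ?O = "{s. na s <= 1}"
  have en: "na (e^n) = 1" for n using e by (simp add: na_power)
  interpret G: galg F v \<pi> q p ?O "Collect pa" by (rule galg_pa)
  have id: "G.Fil n (G.kc (lam^n*a)*(%s. s))" if "na a <= 1" for n a
  proof -
    have "pa (%s. s)" unfolding pa_def by (intro allI exI[of _ "[:0, 1:]"]) (simp add: ip_pCons)
    hence "G.Fil 0 (%s. s)" by (simp add: G.Fil_def)
    hence "G.Fil 0 (G.kc a*(%s. s))" using that by (rule G.Fil_cmult[rotated])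
    thus ?thesis using G.Fil_mult[OF G.Fil_lam[of n], of 0 "G.kc a*(%s. s)"] by (simp add: G.kc_simps mult.assoc)
  qed
  have kc: "G.Fil n (G.kc (lam^n*a))" if "na a <= 1" for n a
    using that by (intro G.Fil_const) (simp add: na_mult na_power mult_left_le)
  have pa: "pa (%s. g s/lam^n)" if "G.Fil n g" for g n using that by (simp add: G.Fil_def)
  have main: "na (g s/lam^n - a) <= na lam" if "G.Fil (n + 1) (g - h)" "na s <= 1" "h s = lam^n*a" for g h :: "'c => 'c" and s n a
  proof -
    have "na (g s - lam^n*a) <= na lam^(n + 1)" using G.Fil_bound[OF that(1), of s] that(2,3) by simp
    moreover have "g s/lam^n - a = (g s - lam^n*a)/lam^n" by (simp add: diff_divide_distrib)
    ultimately show ?thesis by (simp add: na_divide na_power divide_le_eq mult.commute)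
  qed

  obtain w where w: "na w = 1" "sm (lam^wt*w) \<pi> (sm (lam^wt*w) \<pi> (lam*e)) = 0" "na (sm (lam^wt*w) \<pi> (lam*e)) = na lam^q^2"
  proof -
    \<comment> \<open>The variable s stands for u divided by \<open>lam^wt\<close>; only y matters
      here, and the x-coordinate is filled with 0.\<close>
    interpret T: galg_triple F v \<pi> q p ?O "Collect pa" "G.kc (lam^wt*1)*(%s. s)" 0 "G.kc (lam^1*e)"
      by unfold_locales (use id[of 1] kc[of e 1] e in auto)
    let ?u = "G.kc (lam^wt*1)*(%s. s)"
    let ?y = "G.kc (lam^1*e)"
    let ?s = "G.SM ?u T.B1"
    have "G.Fil (q^4 + 1) ((?s - (G.kc \<pi>*T.B1 + ?u*T.B1^q + T.B1^q^2)) + G.kc \<pi>*T.B1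
        + ?u*(T.B1^q - ?y^(q^3)) + (T.B1^q^2 - ?y^(q^4)))"
      by (intro G.Fil_add G.Fil_mono[OF T.B2_est] G.Fil_mult'[OF G.Fil_pi T.Fil_B1] G.Fil_mult'[OF T.u T.B1_q] G.Fil_mono[OF T.B1_q2])
        (use qs in linarith)+
    moreover have "(?s - (G.kc \<pi>*T.B1 + ?u*T.B1^q + T.B1^q^2)) + G.kc \<pi>*T.B1
        + ?u*(T.B1^q - ?y^(q^3)) + (T.B1^q^2 - ?y^(q^4)) = ?s - (?u * ?y^(q^3) + ?y^(q^4))"
      unfolding right_diff_distrib by simp
    ultimately have est: "G.Fil (q^4 + 1) (?s - (?u * ?y^(q^3) + ?y^(q^4)))" by (simp only:)
    have Fy: "G.Fil (q^4) (?u * ?y^(q^3) + ?y^(q^4))"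
      by (intro G.Fil_add G.Fil_mult'[OF T.u T.Fil_y_power] T.Fil_y_power) (use qs in linarith)
    have Fs: "G.Fil (q^4) ?s" using G.Fil_add[OF G.Fil_mono[OF est, of "q^4"] Fy] by simp
    define P where "P = [:e^(q^4), e^(q^3):]"
    have hP: "na (?s s/lam^(q^4) - poly P s) <= na lam" if "na s <= 1" for s
    proof (rule main[OF est that])
      have "lam^(q^4) = lam^wt*lam^(q^3)" using qs by (simp only: power_add[symmetric])
      thus "(?u * ?y^(q^3) + ?y^(q^4)) s = lam^(q^4)*poly P s"
        by (simp add: P_def G.kc_def G.power_fun_apply power_mult_distrib algebra_simps)
    qed
    obtain w where w: "na w = 1" "?s w/lam^(q^4) = 0"
    proof (rule pa_root[OF pa[OF Fs], of P 1 "- (e^(q^4)/e^(q^3))"])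
      have "e ~= 0" using e by auto
      thus "degree P = 1" by (simp add: P_def)
      thus "na (lead_coeff P) = 1" by (simp add: P_def en)
      show "poly P (- (e^(q^4)/e^(q^3))) = 0" using e by (auto simp: P_def)
    qed (use en hP in \<open>auto simp: P_def ip_pCons na_divide\<close>)
    have "na ((T.B1 - ?y^q^2) w) <= na lam^(wt + q)" by (rule G.Fil_bound[OF T.B1_y]) (use w in simp)
    moreover have "na lam^(wt + q) < na lam^q^2" by (rule na_lam_power_less) (use qs in linarith)
    moreover have "na ((?y^q^2) w) = na lam^q^2" using e by (simp add: G.kc_def G.power_fun_apply na_power na_mult)
    ultimately have "na (T.B1 w) = na lam^q^2" using na_eqI[of "T.B1 w" "(?y^q^2) w"] by simp
    thus thesis using that[of w] w by (simp add: G.SM_def G.kc_def)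
  qed
  define u where "u = lam^wt*w"
  obtain b where b: "na b = 1" "sm u \<pi> (lam^(q^3)*b) = 0"
  proof -
    let ?u = "G.kc (lam^wt*w)"
    let ?z = "G.kc (lam^(q^3)*1)*(%s. s)"
    let ?n = "2*wt + q^3"
    have Fu: "G.Fil wt ?u" and Fz: "G.Fil (q^3) ?z" using w kc[of w] id[of 1] by auto
    have "G.Fil (4*wt + q^3 + 1) (G.SM ?u ?z - (G.kc \<pi> * ?z + ?u * ?z^q + ?z^q^2))"
    proof (rule G.Fil_SM[OF Fu Fz, of wt])
      show "4*wt + q^3 + 1 <= wt + q*q^3 + q^2*q^3 + (q - 1)*wt" unfolding q_products using qs q_pred_products(5) by linarith
    qed ((unfold q_products)?, use qs in linarith)+
    hence "G.Fil (?n + 1) ((G.SM ?u ?z - (G.kc \<pi> * ?z + ?u * ?z^q + ?z^q^2)) + ?z^q^2)"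
      by (intro G.Fil_add G.Fil_power'[OF Fz]; (elim G.Fil_mono)?; (unfold q_products)?; use qs in linarith)
    hence est: "G.Fil (?n + 1) (G.SM ?u ?z - (G.kc \<pi> * ?z + ?u * ?z^q))" by (simp only: diff_diff_eq[symmetric] diff_add_cancel)
    have nn: "wt + q^4 = ?n" using qs by linarith
    have Fm: "G.Fil ?n (G.kc \<pi> * ?z + ?u * ?z^q)"
      by (intro G.Fil_add G.Fil_mult'[OF G.Fil_pi Fz] G.Fil_mult'[OF Fu G.Fil_power[OF Fz]]) (unfold q_products, use nn in simp_all)
    have Fs: "G.Fil ?n (G.SM ?u ?z)" using G.Fil_add[OF G.Fil_mono[OF est, of ?n] Fm] by simp
    define P where "P = monom w q + [:0, 1:]"
    have c: "coeff P i = (if i = q then w else 0) + (if i = 1 then 1 else 0)" for i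
      by (auto simp: P_def coeff_pCons split: nat.splits)
    have d: "degree P = q" using q_gt_1 w by (intro antisym[OF degree_le le_degree]) (auto simp: c)
    have wn: "w ~= 0" using w by auto
    obtain b0 where b0: "b0^(q - 1) = - 1/w" using nth_root[of "q - 1"] q_gt_1 by auto
    have "na (b0^(q - 1)) = 1" unfolding b0 using w by (simp add: na_divide)
    hence "na b0^(q - 1) = 1^(q - 1)" by (simp add: na_power)
    hence nb0: "na b0 = 1" using q_gt_1 power_eq_iff_eq_base[of "q - 1" "na b0" 1] by simp
    have hP: "na (G.SM ?u ?z s/lam^?n - poly P s) <= na lam" if "na s <= 1" for s
    proof (rule main[OF est that])
      have "lam^?n = lam^wt*lam^(q^4)" "lam^?n = \<pi>*lam^(q^3)"
        unfolding power_add[symmetric] nn by (simp_all add: power_add lam_power)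
      thus "(G.kc \<pi> * ?z + ?u * ?z^q) s = lam^?n*poly P s"
        by (simp add: P_def poly_monom G.kc_def G.power_fun_apply power_mult_distrib power_mult[symmetric] q_products distrib_left)
    qed
    obtain b where b: "na b = 1" "G.SM ?u ?z b/lam^?n = 0"
    proof (rule pa_root[OF pa[OF Fs], of P q b0])
      show "poly P b0 = 0" using wn b0 by (simp add: P_def poly_monom q_pred_power)
    qed (use w q_gt_1 nb0 hP d in \<open>auto simp: ip_def c\<close>)
    show thesis using that[of b] b by (simp add: G.SM_def G.kc_def u_def)
  qed
  obtain c where c: "na c = 1" "sm u \<pi> (lam^q*c) = lam^(q^3)*b"
  proof -
    interpret T: galg_triple F v \<pi> q p ?O "Collect pa" "G.kc (lam^wt*w)" "G.kc (lam^q*1)*(%s. s)" 0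
      by unfold_locales (use id[of 1] kc[of w] w in auto)
    let ?x = "G.kc (lam^q*1)*(%s. s)"
    let ?b = "G.kc (lam^(q^3)*b)"
    have "G.Fil (q^3 + 1) (T.A1 - ?x^q^2)" by (rule G.Fil_mono[OF T.A1_x]) (use qs in linarith)
    hence est: "G.Fil (q^3 + 1) ((T.A1 - ?b) - (?x^q^2 - ?b))" by simp
    have Fs: "G.Fil (q^3) (T.A1 - ?b)" using b by (intro G.Fil_diff T.Fil_A1 kc) simp
    define P where "P = monom 1 (q^2) - [:b:]"
    have q2: "0 < q^2" using q_gt_1 by simp
    have co: "coeff P i = (if i = q^2 then 1 else 0) - (if i = 0 then b else 0)" for i
      by (auto simp: P_def coeff_pCons split: nat.splits)
    have d: "degree P = q^2" using q2 by (intro antisym[OF degree_le le_degree]) (auto simp: co)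
    obtain c0 where c0: "c0^q^2 = b" using nth_root[OF q2] by metis
    have "na (c0^q^2) = 1" unfolding c0 by (rule b)
    hence "na c0^q^2 = 1^q^2" by (simp add: na_power)
    hence nc0: "na c0 = 1" using q2 power_eq_iff_eq_base[of "q^2" "na c0" 1] by simp
    have hP: "na ((T.A1 - ?b) s/lam^(q^3) - poly P s) <= na lam" if "na s <= 1" for s
      by (rule main[OF est that]) (simp add: P_def poly_monom G.kc_def G.power_fun_apply power_mult_distrib power_mult[symmetric] q_products right_diff_distrib)
    obtain c where "na c = 1" "(T.A1 - ?b) c/lam^(q^3) = 0"
    proof (rule pa_root[OF pa[OF Fs], of P "q^2" c0])
      show "poly P c0 = 0" by (simp add: P_def poly_monom c0)
    qed (use b q2 nc0 hP d in \<open>auto simp: ip_def co\<close>)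
    thus thesis using that[of c] by (simp add: G.SM_def G.kc_def u_def)
  qed
  have "(lam^q*c, lam*e, u) : Zs" using w b c e by (simp add: Zs_def u_def na_mult na_power)
  thus thesis by (rule that)
qed

subsection \<open>The pieces of the affinoid\<close>

lemma galg_full_Zs: "galg_full F v \<pi> q p Zs (bdd Zs) cu cx cy"
proof -
  interpret B: galg_torsion F v \<pi> q p Zs "bdd Zs" cu cx cy by (rule galg_torsion_Zs)
  have y: "na (cy P) = na lam" if "P : Zs" for P using that by (auto simp: Zs_def cy_def)
  \<comment> \<open>By the prescribed absolute values the product \<open>A1*B1^q\<close> dominates
    the determinant.\<close>
  have W: "na (B.W P) = 1" if P: "P : Zs" for P
  proof -
    have a: "na (B.A1 P) = na lam^(q^3)" and b: "na (B.B1 P) = na lam^q^2"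
      using P by (auto simp: Zs_def B.SM_def cu_def cx_def cy_def)
    have l: "na (B.A1 P*B.B1 P^q) = na lam^(q^3 + q^3)" "na (B.A1 P^q*B.B1 P) = na lam^(q^4 + q^2)"
      unfolding na_mult na_power a b power_mult[symmetric] power_add q_products by simp_all
    have "na lam^(q^4 + q^2) < na lam^(q^3 + q^3)" by (rule na_lam_power_less) (use qs in linarith)
    hence "na (B.A1 P*B.B1 P^q + - (B.A1 P^q*B.B1 P)) = na lam^(q^3 + q^3)"
      using na_add_eq[of "- (B.A1 P^q*B.B1 P)" "B.A1 P*B.B1 P^q"] l by simp
    thus ?thesis by (simp add: B.W_def B.De_def B.kc_def B.power_fun_apply na_mult na_divide na_power mult_2)
  qed
  show ?thesis
  proof unfold_locales
    show "cy P ~= 0" "B.W P ~= 0" if "P : Zs" for P using y[OF that] W[OF that] by auto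
    show "B.Fil 0 B.ei" "B.Fil 0 (%P. 1/B.W P)" "B.Fil 0 B.tt"
      using y W B.tt_bounded by (auto simp: B.Fil_def B.ei_def na_divide)
    have "na (B.ZZ P) <= 1" if P: "P : Zs" for P
    proof -
      have "na (B.UU P)^q <= (na nu^e0)^q" using B.UU_bounded[OF P] by (simp add: lam_def na_power power_mult[symmetric] mult.commute)
      hence "na (B.UU P) <= na nu^e0" using q_gt_1 by (simp add: power_mono_iff)
      thus ?thesis using y[OF P] by (simp add: B.ZZ_def na_divide na_mult na_power divide_le_eq)
    qed
    thus "B.Fil 0 B.ZZ" by (simp add: B.Fil_def)
  qed
qed

lemma mu_fq: "a : mu ==> a : fq" by (simp add: fq_mu)

lemma mu_nz: "a : mu ==> a ~= 0" using fq_mu(2) by metis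

lemma na_q_add: assumes "na a <= 1" "na b <= 1" shows "na ((a + b)^q - (a^q + b^q)) <= na \<pi>"
proof -
  have "(a + b)^q - (a^q + b^q) = \<pi>*(\<Sum>i\<in>{0<..<q}. bq i*a^i*b^(q - i))" using q_power_sum[of "%x. x" a b] by simp
  moreover have "na (\<Sum>i\<in>{0<..<q}. bq i*a^i*b^(q - i)) <= 1"
    using assms na_bq by (intro na_sum_le na_mult_le1 na_power_le1) auto
  ultimately show ?thesis by (simp add: na_mult mult_left_le)
qed

lemma na_q_diff_lam: assumes "na a <= 1" "na b <= 1" "na (a - b) <= na lam^(q^3)" shows "na (a^q - b^q) <= na lam^(q^4)"
proof -
  have "na (a - b) <= 1" using assms by (intro na_diff_le)
  hence "na (((a - b) + b)^q - ((a - b)^q + b^q)) <= na \<pi>" using assms by (intro na_q_add)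
  moreover have "na \<pi> <= na lam^(q^4)" unfolding na_pi_lam by (rule na_lam_power_le) (use qs in linarith)
  ultimately have 1: "na (((a - b) + b)^q - ((a - b)^q + b^q)) <= na lam^(q^4)" by linarith
  have 2: "na ((a - b)^q) <= na lam^(q^4)"
    using power_mono[OF assms(3), of q] by (simp add: na_power power_mult[symmetric] q_products)
  show ?thesis using na_add_le[OF 1 2] by simp
qed

end

locale lt_affinoid = lubin_tate_setting F v \<pi> q p for F :: "'c::{field_char_0,complete_space} set" and v \<pi> q p

sublocale lt_affinoid < B: galg_full F v \<pi> q p Zs "bdd Zs" cu cx cy by (rule galg_full_Zs)

context lt_affinoid
begin

lemma na_coords: assumes "P : Zs"
  shows "na (B.et P) = 1" "na (B.ei P) = 1" "na (B.xi P) = 1" "na (B.an P) = 1" "na (B.bn P) = 1" "na (B.om P) = 1"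
  using assms by (auto simp: Zs_def B.et_def B.ei_def B.xi_def B.an_def B.bn_def B.om_def B.SM_def cu_def cx_def cy_def B.kc_def na_mult na_divide na_power)

lemma Fil0_na: "B.Fil 0 g ==> P : Zs ==> na (g P) <= 1" by (simp add: B.Fil_def)

lemma eqv_na: "B.eqv g h ==> P : Zs ==> na (g P - h P) <= na nu"
  by (simp add: B.eqv_def B.sml_def B.Fil_def na_divide divide_le_eq)

lemma na_W: assumes "P : Zs" shows "na (B.W P) = 1"
proof -
  have "na (B.W P) <= 1" "na (1/B.W P) <= 1" using Fil0_na[OF B.Fil_W assms] Fil0_na[OF B.Fil_Wi assms] by simp_all
  thus ?thesis using B.W_nz[OF assms] by (simp add: na_divide)
qed

definition Zc :: "'c \<times> 'c => 'c triple set"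
  where "Zc c = {P : Zs. na (B.W P - fst c) < 1 & na (B.tt P - snd c) < 1}"

definition Lam :: "('c \<times> 'c) set" where "Lam = mu \<times> fq"

lemma card_Lam: "finite Lam" "card Lam = q*(q - 1)" using card_fq card_mu by (simp_all add: Lam_def card_cartesian_product)

lemma Zc_cover: assumes "P : Zs" obtains c where "c : Lam" "P : Zc c"
proof -
  have n: "na (g P^q - g P) < 1" if "B.eqv (g^q) g" for g
    using eqv_na[OF that assms] na_nu_less by (simp add: B.power_fun_apply)
  obtain a where a: "a : fq" "na (B.W P - a) < 1" using fq_nearest[of "B.W P"] n[OF B.W_q_eqv] na_W[OF assms] by auto
  obtain t where t: "t : fq" "na (B.tt P - t) < 1" using fq_nearest[of "B.tt P"] n[OF B.tt_q_eqv] Fil0_na[OF B.Fil_tt assms] by auto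
  have "a ~= 0" using a na_W[OF assms] by auto
  thus thesis using that[of "(a, t)"] a t assms by (simp add: Lam_def Zc_def fq_mu(1))
qed

text \<open>Adding a multiple of \<open>X\<^sub>1\<close> to \<open>X\<^sub>2\<close> moves the label \<open>t\<close>.\<close>

lemma translate: assumes P: "(x, y, u) : Zs" and b: "b : fq"
  defines "A \<equiv> sm u \<pi> x" shows "(fa u x (b*A), y, u) : Zs" "B.W (fa u x (b*A), y, u) = B.W (x, y, u)"
    "na (B.tt (fa u x (b*A), y, u) - (B.tt (x, y, u) - b*B.W (x, y, u))) < 1"
proof -
  let ?P = "(x, y, u)"
  define x' where "x' = fa u x (b*A)"
  have nx: "na x = na lam^q" and nu': "na u = na lam^wt" and nA: "na A = na lam^(q^3)" and A0: "sm u \<pi> A = 0" and ny: "na y = na lam"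
    using P by (auto simp: Zs_def A_def)
  have lt: "na lam^n < 1" if "0 < n" for n using na_lam_power_less[OF that] by simp
  have l: "na u <= 1" "na x < 1" "na A < 1" using nx nu' nA lt[of wt] lt[of q] lt[of "q^3"] wt_pos q_pos by auto
  have bA: "na (b*A) <= na lam^(q^3)" using na_fq[OF b] nA by (intro na_mult_le1) auto
  have bA1: "na (b*A) < 1" using bA nA l(3) by linarith
  have fab: "B.Fil (q^3 + q^2) (%P. fa (cu P) (cx P) ((B.kc b*B.A1) P) - (cx P + (B.kc b*B.A1) P))"
  proof (rule B.Fil_fa[OF B.u B.x, of "q^3"])
    show "B.Fil (q^3) (B.kc b*B.A1)" by (rule B.Fil_cmult[OF na_fq[OF b] B.Fil_A1])
    show "q^3 + q^2 <= q + q^3 + (q - 1)*q" using q_pred_mult[of q] unfolding q_products by linarith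
  qed (use qs in linarith)+
  have e: "na (x' - (x + b*A)) <= na lam^(q^3 + q^2)"
    using B.Fil_bound[OF fab P] by (simp add: cu_def cx_def B.kc_def B.SM_def x'_def A_def)
  hence e': "na (x' - (x + b*A)) <= na lam^(q^3)" using na_lam_power_le[of "q^3" "q^3 + q^2"] by simp
  have d: "na (x' - x) <= na lam^(q^3)" using na_add_le[OF e' bA] by (simp add: algebra_simps)
  have "na lam^(q^3) < na lam^q" by (rule na_lam_power_less) (use qs in linarith)
  hence nx': "na x' = na lam^q" using na_eqI[of x' x] d nx by simp
  have "sm u \<pi> x' = fa u (sm u \<pi> x) (sm u \<pi> (b*A))"
    unfolding x'_def by (rule sm_fa) (use l bA1 pi_F na_pi_less in auto)
  also have "sm u \<pi> (b*A) = b * sm u \<pi> A"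
    by (rule sm_teichmuller(1)) (use b l pi_F na_pi_less in \<open>auto simp: fq_def\<close>)
  finally have X1: "sm u \<pi> x' = A" using fa_0[OF l(1,3)] by (simp add: A0 A_def[symmetric])
  show Q: "(fa u x (b*A), y, u) : Zs" using P nx' X1 unfolding x'_def[symmetric] by (auto simp: Zs_def A_def)
  let ?Q = "(x', y, u)"
  have De: "B.De ?Q = B.De ?P" using X1 by (simp add: B.De_def B.SM_def B.power_fun_apply cu_def cx_def cy_def A_def)
  thus W: "B.W (fa u x (b*A), y, u) = B.W (x, y, u)" by (simp add: B.W_def B.kc_def x'_def)
  have l1: "na x <= 1" "na x' <= 1" "na y <= 1" using l nx nx' ny na_lam_less by auto
  let ?r = "na lam^(2*q^3 + 1)"
  have q4: "na lam^(q^4) <= ?r" "na lam^(q^4) <= na lam^(q^3)" by (rule na_lam_power_le, use qs in linarith)+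
  have d1: "na (x'^q - x^q) <= na lam^(q^4)" by (rule na_q_diff_lam[OF l1(2,1) d])
  have d2: "na ((x'^q)^q - (x^q)^q) <= na lam^(q^4)"
    by (rule na_q_diff_lam[OF na_power_le1[OF l1(2)] na_power_le1[OF l1(1)] order_trans[OF d1 q4(2)]])
  have t1: "na ((x'^q - x^q)*y^q^2) <= ?r" "na ((x'^q^2 - x^q^2)*y^q) <= ?r"
    using d1 d2 q4 l1(3) by (subst mult.commute, intro na_mult_le1 na_power_le1, simp_all add: power_mult[symmetric] q_products)+
  have t2: "na ((x' - (x + b*A))*y^(q^3)) <= ?r"
  proof -
    have "na ((x' - (x + b*A))*y^(q^3)) <= na lam^(q^3 + q^2)*na lam^(q^3)"
      unfolding na_mult na_power ny by (rule mult_right_mono[OF e]) simp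
    also have "... <= ?r" unfolding power_add[symmetric] by (rule na_lam_power_le) (use qs in linarith)
    finally show ?thesis .
  qed
  have "B.Fil (2*q^3 + 1) (B.De - B.A1*cy^(q^3))"
  proof -
    have Aq: "B.Fil (q^4) (B.A1^q)" using B.Fil_power[OF B.Fil_A1, of q] unfolding q_products .
    have "B.Fil (2*q^3 + 1) (B.A1*(B.B1^q - cy^(q^3)) - B.A1^q*B.B1)"
      by (intro B.Fil_diff B.Fil_mult'[OF B.Fil_A1 B.B1_q] B.Fil_mult'[OF Aq B.Fil_B1]) (use qs in linarith)+
    thus ?thesis by (simp add: B.De_def algebra_simps)
  qed
  from B.Fil_bound[OF this P] have "na (B.De ?P - A*y^(q^3)) <= ?r"
    by (simp add: B.SM_def B.power_fun_apply cu_def cx_def cy_def A_def)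
  hence t3: "na (b*(B.De ?P - A*y^(q^3))) <= ?r" using na_fq[OF b] by (intro na_mult_le1)
  \<comment> \<open>The first two terms of \<open>DD\<close> contain only q-th powers of x, which
    hardly feel a change of order q^3. The last term changes by -b A y^(q^3), and A y^(q^3) is
    \<open>De\<close> to leading order.\<close>
  have "B.DD ?Q - B.DD ?P + b*B.De ?P = (x'^q - x^q)*y^q^2 - (x'^q^2 - x^q^2)*y^q
      - (x' - (x + b*A))*y^(q^3) + b*(B.De ?P - A*y^(q^3))"
    by (simp add: B.DD_def B.power_fun_apply cx_def cy_def algebra_simps)
  hence DD: "na (B.DD ?Q - B.DD ?P + b*B.De ?P) <= ?r" using t1 t2 t3 by (simp only:) (intro na_add_le na_diff_le)
  have "B.tt ?Q - (B.tt ?P - b*B.W ?P) = (B.DD ?Q - B.DD ?P + b*B.De ?P)/lam^(2*q^3)"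
    using W unfolding x'_def[symmetric] by (simp add: B.tt_def B.W_def B.kc_def diff_divide_distrib add_divide_distrib)
  hence "na (B.tt ?Q - (B.tt ?P - b*B.W ?P)) <= na lam" using DD by (simp add: na_divide na_power divide_le_eq)
  thus "na (B.tt (fa u x (b*A), y, u) - (B.tt (x, y, u) - b*B.W (x, y, u))) < 1"
    using na_lam_less unfolding x'_def by linarith
qed

lemma rotate: assumes P: "(x, y, u) : Zs" and a: "a : mu" shows "(a*x, y, u) : Zs" "B.W (a*x, y, u) = a*B.W (x, y, u)"
proof -
  have aq: "a^q = a" using mu_fq[OF a] by (simp add: fq_def)
  have l: "na u <= 1" "na x < 1" using P na_lam_power_less[of 0 wt] na_lam_power_less[of 0 q] wt_pos q_pos by (auto simp: Zs_def)
  have s: "sm u \<pi> (a*z) = a * sm u \<pi> z" if "na z < 1" for z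
    by (rule sm_teichmuller(1)) (use aq l that pi_F na_pi_less in auto)
  have X1: "sm u \<pi> (a*x) = a * sm u \<pi> x" by (rule s[OF l(2)])
  have "na (sm u \<pi> x) < 1" by (rule na_sm_less[OF pi_F l])
  thus "(a*x, y, u) : Zs" using P s na_mu[OF a] by (simp add: Zs_def X1 na_mult)
  show "B.W (a*x, y, u) = a*B.W (x, y, u)"
    by (simp add: B.W_def B.De_def B.SM_def B.kc_def B.power_fun_apply cu_def cx_def cy_def X1 power_mult_distrib aq algebra_simps)
qed

text \<open>Starting from any point with the given Y_2, scaling X_2 corrects \<open>W\<close> and
  then translating X_2 corrects \<open>tt\<close>. Neither changes Y_2, and the translation keeps
  \<open>W\<close>.\<close>

lemma Zc_point: assumes c: "c : Lam" and s: "na s = 1" obtains P where "P : Zc c" "B.et P = s"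
proof -
  obtain x u where P0: "(x, lam * s, u) : Zs" by (rule Zs_fiber[OF s])
  have c': "fst c : mu" "snd c : fq" using c by (auto simp: Lam_def)
  obtain d where d: "d : Lam" "(x, lam * s, u) : Zc d" using Zc_cover[OF P0] .
  define a where "a = fst c*inverse (fst d)"
  have a: "a : mu" unfolding a_def using c d by (intro mu_mult mu_inverse) (auto simp: Lam_def)
  let ?P = "(a*x, lam * s, u)"
  note P = rotate[OF P0 a]
  have "fst d ~= 0" using d mu_nz by (auto simp: Lam_def)
  hence "B.W ?P - fst c = a*(B.W (x, lam * s, u) - fst d)" unfolding P(2) by (simp add: a_def algebra_simps)
  hence W: "na (B.W ?P - fst c) < 1" using d na_mu[OF a] by (simp add: Zc_def na_mult)
  obtain e where e: "e : Lam" "?P : Zc e" using Zc_cover[OF P(1)] .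
  \<comment> \<open>Translation by b subtracts b W from the label, and W is near
    \<open>fst c\<close>; this is the b that would move \<open>snd e\<close> to
    \<open>snd c\<close>, before it is replaced by a Teichmueller element.\<close>
  define z where "z = (snd e - snd c)*inverse (fst c)"
  have e': "snd e : fq" "na (B.tt ?P - snd e) < 1" using e by (auto simp: Lam_def Zc_def)
  have z1: "na (snd e - snd c) <= 1" using e' c' na_fq by (intro na_diff_le) auto
  have nic: "na (inverse (fst c)) = 1" "inverse (fst c)^q = inverse (fst c)"
    using na_mu[OF mu_inverse[OF c'(1)]] mu_fq[OF mu_inverse[OF c'(1)]] by (auto simp: fq_def)
  have "na ((snd e + - snd c)^q - (snd e^q + (- snd c)^q)) <= na \<pi>" using e' c' na_fq by (intro na_q_add) auto
  hence "na ((snd e - snd c)^q - (snd e - snd c)) < 1" using na_pi_less e' c' by (simp add: B.uminus_q_power fq_def)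
  moreover have "z^q - z = ((snd e - snd c)^q - (snd e - snd c))*inverse (fst c)"
    unfolding z_def power_mult_distrib nic(2) by (simp only: left_diff_distrib)
  ultimately have "na (z^q - z) < 1" by (simp add: na_mult nic)
  moreover have "na z <= 1" using z1 by (simp add: z_def na_mult nic)
  ultimately obtain b where b: "b : fq" "na (z - b) < 1" using fq_nearest by blast
  let ?Q = "(fa u (a*x) (b * sm u \<pi> (a*x)), lam * s, u)"
  note Q = translate[OF P(1) b(1)]
  have W': "na (B.W ?Q - fst c) < 1" using W by (simp add: Q)
  have fc: "fst c ~= 0" by (rule mu_nz[OF c'(1)])
  have "B.tt ?Q - snd c = (B.tt ?Q - (B.tt ?P - b*B.W ?P)) + (B.tt ?P - snd e) + (- b*(B.W ?P - fst c)) + (z - b)*fst c"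
  proof -
    have "z*fst c = snd e - snd c" using fc by (simp add: z_def mult.assoc)
    hence "(z - b)*fst c = snd e - snd c - b*fst c" by (simp add: left_diff_distrib)
    thus ?thesis by (simp only: right_diff_distrib) simp
  qed
  moreover have "na (- b*(B.W ?P - fst c)) < 1" using W na_fq[OF b(1)] by (intro na_mult_less1) auto
  moreover have "na ((z - b)*fst c) < 1" using b na_mu[OF c'(1)] by (simp add: na_mult)
  ultimately have "na (B.tt ?Q - snd c) < 1" using Q(3) e'(2) by (simp only:) (intro na_add_less)
  hence "?Q : Zc c" using Q(1) W' by (simp add: Zc_def)
  moreover have "B.et ?Q = s" by (simp add: B.et_def B.kc_def cy_def)
  ultimately show thesis by (rule that)
qed

lemma ZZ_rel: assumes "P : Zc c" "c : Lam" shows "na (B.ZZ P^q - fst c*(B.et P^mm + B.ei P^mm)) < 1"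
proof -
  have P: "P : Zs" using assms by (simp add: Zc_def)
  have "na ((B.ZZ P^q - B.W P*(B.et P^mm + B.ei P^mm)) + (B.et P^mm + B.ei P^mm)*(B.W P - fst c)) < 1"
  proof (rule na_add_less)
    show "na (B.ZZ P^q - B.W P*(B.et P^mm + B.ei P^mm)) < 1"
      using eqv_na[OF B.ZZ_q_eqv P] na_nu_less by (simp add: B.power_fun_apply)
    show "na ((B.et P^mm + B.ei P^mm)*(B.W P - fst c)) < 1"
      using assms na_coords[OF P] by (intro na_mult_less1 na_add_le na_power_le1) (auto simp: Zc_def)
  qed
  thus ?thesis by (simp add: algebra_simps)
qed

end

section \<open>Functions on one piece\<close>

context galg
begin

lemma Fil_q_diff: assumes "Fil 0 a" "Fil 0 b" "Fil 1 (a - b)" shows "Fil 1 (a^q - b^q)"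
proof -
  have w: "1 <= 2*wt" using wt_pos by simp
  have "Fil 1 ((b + (a - b))^q - (b^q + (a - b)^q))" by (rule Fil_q_power[OF assms(2,3)]) (use w in auto)
  moreover have "Fil 1 ((a - b)^q)" by (rule Fil_power'[OF assms(3)]) (use q_pos in simp)
  ultimately have "Fil 1 ((b + (a - b))^q - (b^q + (a - b)^q) + (a - b)^q)" by (rule Fil_add)
  thus ?thesis by simp
qed

text \<open>The powers \<open>g\<^sup>q\<^sup>^\<^sup>n\<close> tend to \<open>0\<close> uniformly and all agree with \<open>g\<close> modulo \<open>\<lambda>\<close>.\<close>

lemma Fil_small_fixed: assumes g: "Fil 0 g" "Fil 1 (g^q - g)" "!!P. P : S ==> na (g P) <= na nu" shows "Fil 1 g"
proof (rule Fil_lim)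
  fix k
  have p: "Fil 0 (g^q^n)" for n using Fil_power[OF g(1), of "q^n"] by simp
  have d: "Fil 1 (g^q^n - g)" for n
  proof (induction n)
    case (Suc n)
    have "Fil 1 (((g^q^n)^q - g^q) + (g^q - g))" by (intro Fil_add Fil_q_diff p g Suc)
    moreover have "(g^q^n)^q = g^q^Suc n" by (simp only: power_mult[symmetric] power_Suc2)
    ultimately show ?case by (simp only: diff_add_cancel add_diff_eq)
  qed (simp only: power_0 power_one_right diff_self Fil_0)
  let ?n = "q*k"
  have "na (g P^q^?n) <= na lam^k" if P: "P : S" for P
  proof -
    have "na (g P^q^?n) <= na nu^q^?n" unfolding na_power by (intro power_mono g P) simp
    also have "... <= na nu^?n" using na_nu_less self_le_ge2_pow[of q ?n] q_ge_3 by (intro power_decreasing) auto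
    also have "... = na lam^k" by (simp add: lam_def na_power power_mult)
    finally show ?thesis .
  qed
  hence "ALL P:S. na (g P - (- (g^q^?n - g)) P) <= na lam^k" by (simp add: power_fun_apply)
  thus "EX h. Fil 1 h & (ALL P:S. na (g P - h P) <= na lam^k)" using Fil_minus[OF d[of ?n]] by blast
qed

end

locale lt_component = lt_affinoid F v \<pi> q p for F :: "'c::{field_char_0,complete_space} set" and v \<pi> q p +
  fixes c :: "'c \<times> 'c" assumes c: "c : Lam"
begin

text \<open>Coordinates with their inverses, together with \<open>W\<close>, \<open>tt\<close> and
  \<open>ZZ\<close>: all that \<open>galg_full\<close> and the Laurent monomials require.\<close>

definition Gen :: "('c triple => 'c) set" where
  "Gen = {B.et, B.ei, B.xi, %P. 1/B.xi P, B.an, %P. 1/B.an P, B.bn, %P. 1/B.bn P, B.om, %P. 1/B.om P,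
     B.W, %P. 1/B.W P, B.tt, B.ZZ}"

inductive_set Gf :: "('c triple => 'c) set" where
  const: "na a <= 1 ==> (%_. a) : Gf"
| gen: "g : Gen ==> g : Gf"
| add: "g : Gf ==> h : Gf ==> g + h : Gf"
| mult: "g : Gf ==> h : Gf ==> g*h : Gf"

definition Gcl :: "('c triple => 'c) set" where
  "Gcl = {g. ALL n. EX h:Gf. ALL P:Zc c. na (g P - h P) <= na lam^n}"

lemma Zc_Zs: "P : Zc c ==> P : Zs" by (simp add: Zc_def)

lemma Gen_bound: "g : Gen ==> P : Zc c ==> na (g P) <= 1"
  using na_coords[OF Zc_Zs, of P] na_W[OF Zc_Zs, of P] Fil0_na[OF B.Fil_tt Zc_Zs, of P] Fil0_na[OF B.Fil_ZZ Zc_Zs, of P]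
  by (auto simp: Gen_def na_divide)

lemma Gf_bound: "g : Gf ==> P : Zc c ==> na (g P) <= 1"
  by (induction rule: Gf.induct) (auto intro: na_add_le na_mult_le1 Gen_bound)

lemma Gf_Gcl: "g : Gf ==> g : Gcl" by (auto simp: Gcl_def intro!: bexI[of _ g])

end

sublocale lt_component < G: galg F v \<pi> q p "Zc c" Gcl
  unfolding Gcl_def by (rule galg_closure) (fact Gf.const Gf.add Gf.mult Gf_bound)+

context lt_component
begin

lemma Fil_Gen: "g : Gen ==> G.Fil 0 g" using Gf_Gcl[OF Gf.gen] by (simp add: G.Fil_def)

text \<open>With this, the relations proved in the abstract algebra become congruences modulo
  \<open>nu\<close> times \<open>Gcl\<close>, hence statements about approximation by the
  generators.\<close>

lemma galg_full_Zc: "galg_full F v \<pi> q p (Zc c) Gcl cu cx cy"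
proof -
  have s: "G.Fil n g" if "g = B.kc (lam^n)*h" "h : Gen" for g h n
    unfolding that(1) using G.Fil_mult[OF G.Fil_lam Fil_Gen[OF that(2)], of n] by simp
  have "galg_torsion F v \<pi> q p (Zc c) Gcl cu cx cy"
  proof (unfold_locales)
    show "G.Fil wt cu" "G.Fil q cx" "G.Fil 1 cy" using B.normalized by (auto intro!: s simp: Gen_def)
  qed (use B.torsion Zc_Zs in \<open>auto simp: G.SM_def B.SM_def\<close>)
  then interpret T: galg_torsion F v \<pi> q p "Zc c" Gcl cu cx cy .
  show ?thesis by unfold_locales (use B.y_nz B.W_nz Zc_Zs in \<open>auto intro!: Fil_Gen simp: Gen_def\<close>)
qed

end

sublocale lt_component < G: galg_full F v \<pi> q p "Zc c" Gcl cu cx cy by (rule galg_full_Zc)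

context lt_component
begin

text \<open>By the contraction \<open>na_q_diff\<close>, |g - a| is at most |g^q - g|, hence at most
  |nu| at every point; \<open>Fil_small_fixed\<close> upgrades this bound to a congruence inside
  \<open>Gcl\<close>.\<close>

lemma eqv_const: assumes "g : Gen" "G.Fil 1 (g^q - g)" "a : fq" "!!P. P : Zc c ==> na (g P - a) < 1" and eg: "B.eqv (g^q) g"
  shows "G.eqv g (G.kc a)"
proof (rule G.eqv_Fil)
  have a: "na a <= 1" "a^q = a" using assms(3) na_fq by (auto simp: fq_def)
  show g: "G.Fil 0 g" by (rule Fil_Gen[OF assms(1)])
  show k: "G.Fil 0 (G.kc a)" by (rule G.Fil_const) (use a in simp)
  have w: "1 <= 2*wt" using wt_pos by simp
  show "G.Fil 1 (g - G.kc a)"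
  proof (rule G.Fil_small_fixed)
    show "G.Fil 0 (g - G.kc a)" by (intro G.Fil_diff g k)
    have "G.Fil 1 ((g + - G.kc a)^q - (g^q + (- G.kc a)^q))" by (rule G.Fil_q_power[OF g G.Fil_minus[OF k]]) (use w in auto)
    from G.Fil_add[OF this assms(2)] show "G.Fil 1 ((g - G.kc a)^q - (g - G.kc a))"
      by (simp add: G.uminus_q_power G.kc_simps(7)[symmetric] a algebra_simps)
    show "na ((g - G.kc a) P) <= na nu" if P: "P : Zc c" for P
    proof -
      have "na (g P^q - a^q) < na (g P - a) \<or> g P = a"
        using na_q_diff[of "g P" a] Gen_bound[OF assms(1) P] a assms(4)[OF P] by simp
      hence "na (g P - a) <= na (g P^q - g P)"
      proof
        assume *: "na (g P^q - a^q) < na (g P - a)"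
        have "na ((g P - a) + - (g P^q - a^q)) = na (g P - a)" using*by (intro na_add_eq) (simp only: na_minus)
        thus ?thesis using na_diff_commute[of "g P"] by (simp add: a)
      qed simp
      also have "... <= na nu" using eqv_na[OF eg Zc_Zs[OF P]] by (simp add: B.power_fun_apply)
      finally show ?thesis by (simp add: G.kc_def)
    qed
  qed
qed

lemma c_props: "fst c : mu" "snd c : fq" using c by (auto simp: Lam_def)

lemma W_const: "G.eqv B.W (G.kc (fst c))"
proof (rule eqv_const)
  show "B.W : Gen" by (simp add: Gen_def)
  show "G.Fil 1 (B.W^q - B.W)" by (rule G.Fil_mono[OF G.W_q]) simp
qed (use c_props mu_fq B.W_q_eqv in \<open>auto simp: Zc_def\<close>)

lemma tt_const: "G.eqv B.tt (G.kc (snd c))"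
proof (rule eqv_const)
  show "B.tt : Gen" by (simp add: Gen_def)
  show "G.Fil 1 (B.tt^q - B.tt)" by (rule G.tt_q[OF G.Fil_tt])
qed (use c_props B.tt_q_eqv in \<open>auto simp: Zc_def\<close>)

end

context lt_affinoid
begin

subsection \<open>Normal forms of functions\<close>

definition nsum :: "(int \<times> nat => 'c) => (int \<times> nat) set => 'c triple => 'c"
  where "nsum b A = (%P. \<Sum>t\<in>A. b t*(B.et P powi fst t*B.ZZ P^snd t))"

text \<open>Exponents of Z stay below q: these powers form a basis of the coordinate ring of the
  curve over the Laurent polynomials in y.\<close>

definition ncoef :: "(int \<times> nat => 'c) => (int \<times> nat) set => bool"
  where "ncoef b A \<longleftrightarrow> finite A & A <= UNIV \<times> {..<q} & (ALL t. t \<notin> A --> b t = 0)"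

lemma nsum_extend: assumes "ncoef b A" "ncoef d B" shows "nsum b A = nsum b (A \<union> B)"
  using assms unfolding nsum_def ncoef_def by (intro ext sum.mono_neutral_left) auto

lemma nsum_add: assumes "ncoef b A" "ncoef d B"
  shows "nsum b A P + e*nsum d B P = nsum (%t. b t + e*d t) (A \<union> B) P" "ncoef (%t. b t + e*d t) (A \<union> B)"
proof -
  have "nsum d B = nsum d (A \<union> B)" using nsum_extend[OF assms(2,1)] by (simp add: Un_commute)
  hence "nsum b A P + e*nsum d B P = nsum b (A \<union> B) P + e*nsum d (A \<union> B) P" using nsum_extend[OF assms] by simp
  thus "nsum b A P + e*nsum d B P = nsum (%t. b t + e*d t) (A \<union> B) P"
    by (simp add: nsum_def sum.distrib sum_distrib_left distrib_right mult.assoc)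
qed (use assms in \<open>auto simp: ncoef_def\<close>)

lemma et_nz: "P : Zs ==> B.et P ~= 0" using na_coords(1) by fastforce

lemma ei_et: "P : Zs ==> B.ei P = inverse (B.et P)" using B.et_ei[of P] by (simp add: inverse_unique)

end

context lt_component
begin

definition trm :: "'c => int => nat => 'c triple => 'c"
  where "trm b i l = (%P. b*(B.et P powi i*B.ZZ P^l))"

lemma Fil_trm: assumes "na b <= 1" shows "G.Fil 0 (trm b i l)"
proof -
  have "G.Fil 0 (G.kc b*((if 0 <= i then B.et^nat i else B.ei^nat (- i))*B.ZZ^l))"
    by (intro G.Fil_cmult[OF assms] G.F0_mult) (auto intro: G.F0)
  thus ?thesis by (rule G.Fil_cong) (auto simp: trm_def G.kc_def G.power_fun_apply power_int_def ei_et[OF Zc_Zs])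
qed

definition nf :: "('c triple => 'c) => bool"
  where "nf g \<longleftrightarrow> (EX b A. ncoef b A & (ALL t. na (b t) <= 1) & G.eqv g (nsum b A))"

lemma nf_eqv: "nf h ==> G.eqv g h ==> nf g" unfolding nf_def using G.eqv_trans by blast

lemma nf_Fil: "nf g ==> G.Fil 0 g" unfolding nf_def G.eqv_def by blast

lemma nf_cong: "nf g ==> (!!P. P : Zc c ==> g P = h P) ==> nf h"
  using G.eqv_cong[OF G.eqv_refl[OF nf_Fil[of g]], of h g] nf_eqv[of g h] by blast

lemma nf_add: assumes "nf g" "nf h" shows "nf (g + h)"
proof -
  obtain b A d B where *: "ncoef b A" "ALL t. na (b t) <= 1" "G.eqv g (nsum b A)" "ncoef d B" "ALL t. na (d t) <= 1" "G.eqv h (nsum d B)"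
    using assms unfolding nf_def by blast
  have "G.eqv (g + h) (nsum b A + nsum d B)" using*by (intro G.eqv_add)
  hence "G.eqv (g + h) (nsum (%t. b t + 1*d t) (A \<union> B))"
    using nsum_add(1)[OF *(1,4), of _ 1] by (simp add: fun_eq_iff plus_fun_def)
  moreover have "ALL t. na (b t + 1*d t) <= 1" using *(2,5) na_add_le[of "b _" 1 "d _"] by simp
  ultimately show ?thesis using nsum_add(2)[OF *(1,4), of 1] unfolding nf_def by blast
qed

lemma nf_single: assumes "na b <= 1" "l < q" shows "nf (trm b i l)" unfolding nf_def
proof (intro exI conjI)
  show "ncoef (%t. if t = (i, l) then b else 0) {(i, l)}" using assms by (auto simp: ncoef_def)
  show "G.eqv (trm b i l) (nsum (%t. if t = (i, l) then b else 0) {(i, l)})"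
    using G.eqv_refl[OF Fil_trm[OF assms(1)]] by (simp add: nsum_def trm_def)
qed (use assms in auto)

lemma nf_sum: "finite I ==> (!!i. i : I ==> nf (f i)) ==> nf (%P. \<Sum>i\<in>I. f i P)"
proof (induction I rule: finite_induct)
  case empty
  show ?case using nf_single[of 0 0 0] q_pos by (simp add: trm_def)
next
  case (insert i I)
  hence "nf (f i + (%P. \<Sum>i\<in>I. f i P))" by (intro nf_add) auto
  thus ?case using insert by (simp add: plus_fun_def)
qed

lemma trm_mult: "P : Zc c ==> trm b i l P*trm d j n P = trm (b*d) (i + j) (l + n) P"
  using et_nz[OF Zc_Zs] by (simp add: trm_def power_int_add power_add)

lemma ZZ_q: "G.eqv (B.ZZ^q) (trm (fst c) (int mm) 0 + trm (fst c) (- int mm) 0)"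
proof -
  have "G.eqv (B.W*(B.et^mm + B.ei^mm)) (G.kc (fst c)*(B.et^mm + B.ei^mm))"
    by (intro G.eqv_mult G.eqv_refl W_const G.Fil_add G.F0)
  from G.eqv_trans[OF G.ZZ_q_eqv this] show ?thesis
    by (rule G.eqv_cong) (auto simp: trm_def G.kc_def G.power_fun_apply ei_et[OF Zc_Zs] power_int_minus power_inverse distrib_left)
qed

text \<open>The relation \<open>ZZ_q\<close> lowers the exponent of Z by q and keeps the
  coefficients integral.\<close>

lemma nf_trm: "na b <= 1 ==> nf (trm b i l)"
proof (induction l arbitrary: b i rule: less_induct)
  case (less l)
  show ?case
  proof (cases "l < q")
    case False
    have a: "na (fst c) <= 1" using na_mu[OF c_props(1)] by simp
    have b: "na (b*fst c) <= 1" using less.prems a by (intro na_mult_le1)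
    have "G.eqv (trm b i (l - q)*B.ZZ^q) (trm b i (l - q)*(trm (fst c) (int mm) 0 + trm (fst c) (- int mm) 0))"
      by (intro G.eqv_mult G.eqv_refl ZZ_q Fil_trm less.prems)
    hence "G.eqv (trm b i l) (trm (b*fst c) (i + int mm) (l - q) + trm (b*fst c) (i - int mm) (l - q))"
    proof (rule G.eqv_cong)
      fix P assume P: "P : Zc c"
      show "(trm b i (l - q)*B.ZZ^q) P = trm b i l P"
        using False by (simp add: trm_def G.power_fun_apply mult.assoc power_add[symmetric])
      show "(trm b i (l - q)*(trm (fst c) (int mm) 0 + trm (fst c) (- int mm) 0)) P
        = (trm (b*fst c) (i + int mm) (l - q) + trm (b*fst c) (i - int mm) (l - q)) P"
        using trm_mult[OF P] by (simp add: distrib_left)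
    qed
    moreover have "l - q < l" using False q_pos by simp
    hence "nf (trm (b*fst c) (i + int mm) (l - q) + trm (b*fst c) (i - int mm) (l - q))" by (intro nf_add less.IH b)
    ultimately show ?thesis by (rule nf_eqv[rotated])
  qed (rule nf_single[OF less.prems])
qed

lemma nf_mult: assumes "nf g" "nf h" shows "nf (g*h)"
proof -
  obtain b A d B where *: "ncoef b A" "ALL t. na (b t) <= 1" "G.eqv g (nsum b A)" "ncoef d B" "ALL t. na (d t) <= 1" "G.eqv h (nsum d B)"
    using assms unfolding nf_def by blast
  have bd: "na (b t*d s) <= 1" for s t by (rule na_mult_le1[OF spec[OF *(2)] spec[OF *(5)]])
  have "nf (%P. \<Sum>t\<in>A. (\<Sum>s\<in>B. trm (b t*d s) (fst t + fst s) (snd t + snd s) P))"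
    by (intro nf_sum nf_trm bd) (use*in \<open>auto simp: ncoef_def\<close>)
  hence "nf (nsum b A*nsum d B)"
  proof (rule nf_cong)
    fix P assume P: "P : Zc c"
    show "(\<Sum>t\<in>A. (\<Sum>s\<in>B. trm (b t*d s) (fst t + fst s) (snd t + snd s) P)) = (nsum b A*nsum d B) P"
      by (simp add: nsum_def sum_product trm_mult[OF P, symmetric]) (simp add: trm_def)
  qed
  moreover have "G.eqv (g*h) (nsum b A*nsum d B)" using*by (intro G.eqv_mult)
  ultimately show ?thesis by (rule nf_eqv)
qed

lemma nf_kc: "na a <= 1 ==> nf (G.kc a)" using nf_trm[of a 0 0] by (simp add: trm_def G.kc_def)

lemma nf_power: "nf g ==> nf (g^n)"
proof (induction n)
  case 0
  show ?case using nf_kc[of 1] by (simp only: G.kc_simps power_0 na_1 order_refl)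
qed (simp only: power_Suc nf_mult)

lemma nf_inv:
  assumes g: "g : Gen" "(%P. 1/g P) : Gen" "!!P. P : Zs ==> na (g P) = 1" "G.eqv g b" "nf b" "nf d" "!!P. P : Zc c ==> b P*d P = 1"
  shows "nf g" "nf (%P. 1/g P)"
proof -
  show "nf g" using nf_eqv[OF g(5,4)] .
  have "G.eqv (b*d) 1" by (rule G.eqv_cong[OF G.eqv_refl[OF G.Fil_1]]) (use g in auto)
  moreover have "g P*(1/g P) = 1" if "P : Zc c" for P using g(3)[OF Zc_Zs[OF that]] by auto
  ultimately have "G.eqv (%P. 1/g P) d" using g by (intro G.eqv_inverse[of g _ b d]) (auto intro: Fil_Gen nf_Fil)
  thus "nf (%P. 1/g P)" using nf_eqv[OF g(6)] by blast
qed

text \<open>Modulo \<open>nu\<close> each generator is an expression in \<open>et\<close>, its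
  inverse and Z: \<open>W\<close> and \<open>tt\<close> are constants, \<open>xi\<close> is
  \<open>ei^q*W\<close>, and \<open>an\<close>, \<open>bn\<close>, \<open>om\<close> are up to sign
  powers of \<open>xi\<close> or \<open>et\<close>.\<close>

lemma nf_Gen: assumes "g : Gen" shows "nf g"
proof -
  have e: "nf B.et" using nf_trm[of 1 1 0] by (simp add: trm_def)
  have i: "nf B.ei" by (rule nf_cong[OF nf_trm[of 1 "-1" 0]]) (auto simp: trm_def ei_et[OF Zc_Zs] power_int_minus)
  have a: "fst c ~= 0" "na (fst c) = 1" using mu_nz na_mu c_props by auto
  have kt: "na (snd c) <= 1" using na_fq c_props by auto
  have ei: "B.et P^n*B.ei P^n = 1" "B.ei P^n*B.et P^n = 1" if "P : Zc c" for P n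
    using B.et_ei_power[OF Zc_Zs[OF that]] by (simp_all add: mult.commute)
  have W: "nf B.W" "nf (%P. 1/B.W P)"
    by (rule nf_inv[of B.W "G.kc (fst c)" "G.kc (1/fst c)"]; use a W_const na_W in \<open>auto simp: Gen_def G.kc_def na_divide intro!: nf_kc[unfolded G.kc_def]\<close>)+
  have xb: "(B.ei^q*B.W) P*(B.et^q*(%P. 1/B.W P)) P = 1" if "P : Zc c" for P
    using ei[OF that, of q] B.W_nz[OF Zc_Zs[OF that]] by (simp add: G.power_fun_apply)
  have x: "nf B.xi" "nf (%P. 1/B.xi P)"
    by (rule nf_inv[of B.xi "B.ei^q*B.W" "B.et^q*(%P. 1/B.W P)", OF _ _ _ _ _ _ xb]; use G.xi_eqv na_coords(3) in \<open>auto intro!: nf_mult nf_power e i W simp: Gen_def\<close>)+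
  have xi: "B.xi P ~= 0" if "P : Zc c" for P using na_coords(3)[OF Zc_Zs[OF that]] by auto
  have an: "nf B.an" "nf (%P. 1/B.an P)"
    by (rule nf_inv[of B.an "B.xi^q^2" "(%P. 1/B.xi P)^q^2"]; use G.an_eqv na_coords xi in \<open>auto intro!: nf_power x simp: Gen_def G.power_fun_apply power_divide\<close>)+
  have bn: "nf B.bn" "nf (%P. 1/B.bn P)"
    by (rule nf_inv[of B.bn "B.et^q^2" "B.ei^q^2"]; use G.bn_eqv na_coords ei in \<open>auto intro!: nf_power e i simp: Gen_def G.power_fun_apply\<close>)+
  have om: "nf B.om" "nf (%P. 1/B.om P)"
  proof -
    let ?n = "q^2*(q^2 - q)"
    have k: "nf (G.kc (- 1)*h)" if "nf h" for h by (intro nf_mult nf_kc that) simp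
    have m: "nf (- (h^?n))" if "nf h" for h using k[OF nf_power[OF that]] by (simp add: G.kc_simps)
    show "nf B.om" "nf (%P. 1/B.om P)"
      by (rule nf_inv[of B.om "- (B.et^?n)" "- (B.ei^?n)"]; use G.om_eqv na_coords ei in \<open>auto intro!: m e i simp: Gen_def G.power_fun_apply\<close>)+
  qed
  have Z: "nf B.ZZ" using nf_trm[of 1 0 1] by (simp add: trm_def)
  have t: "nf B.tt" by (rule nf_eqv[OF nf_kc[OF kt] tt_const])
  show ?thesis using assms unfolding Gen_def by (auto intro: e i W x an bn om Z t)
qed

lemma Gf_nf: "g : Gf ==> nf g"
proof (induction rule: Gf.induct)
  case (const a)
  thus ?case using nf_kc by (simp add: G.kc_def)
qed (rule nf_Gen nf_add nf_mult; assumption)+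

text \<open>The defect of a normal form modulo \<open>nu\<close> is \<open>nu\<close> times another
  element of \<open>Gcl\<close>, so the approximation can be repeated.\<close>

lemma Gcl_approx: "g : Gcl ==> EX b A. ncoef b A & (ALL t. na (b t) <= 1) & (ALL P:Zc c. na (g P - nsum b A P) <= na nu^N)"
proof (induction N arbitrary: g)
  case 0
  have "ncoef (%_. 0) {}" by (simp add: ncoef_def)
  thus ?case using G.G_bound[OF 0] by (intro exI[of _ "%_. 0"] exI[of _ "{}"]) (simp add: nsum_def)
next
  case (Suc N)
  obtain h where h: "h : Gf" "!!P. P : Zc c ==> na (g P - h P) <= na lam^Suc N" using Suc.prems unfolding Gcl_def by blast
  have "na lam <= na nu" using na_nu_less q_gt_1 power_decreasing[of 1 q "na nu"] by (simp add: lam_def na_power)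
  hence ln: "na lam^Suc N <= na nu^Suc N" by (intro power_mono) auto
  obtain b A where b: "ncoef b A" "ALL t. na (b t) <= 1" "G.eqv h (nsum b A)" using Gf_nf[OF h(1)] unfolding nf_def by blast
  define k where "k = (%P. (h - nsum b A) P/nu)"
  have "k : Gcl" using b(3) by (simp add: k_def G.eqv_def G.sml_def G.Fil_def)
  then obtain d D where d: "ncoef d D" "ALL t. na (d t) <= 1" "!!P. P : Zc c ==> na (k P - nsum d D P) <= na nu^N"
    using Suc.IH by blast
  have "na (g P - nsum (%t. b t + nu*d t) (A \<union> D) P) <= na nu^Suc N" if P: "P : Zc c" for P
  proof -
    have "na (nu*(k P - nsum d D P)) <= na nu^Suc N" using mult_left_mono[OF d(3)[OF P], of "na nu"] by (simp add: na_mult)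
    hence "na ((g P - h P) + nu*(k P - nsum d D P)) <= na nu^Suc N" using h(2)[OF P] ln by (intro na_add_le) auto
    moreover have "nu*k P = h P - nsum b A P" by (simp add: k_def)
    hence "(g P - h P) + nu*(k P - nsum d D P) = g P - (nsum b A P + nu*nsum d D P)" by (simp add: right_diff_distrib)
    ultimately show ?thesis unfolding nsum_add(1)[OF b(1) d(1), of P nu] by (simp only:)
  qed
  moreover have "na (b t + nu*d t) <= 1" for t
    by (rule na_add_le[OF spec[OF b(2)] na_mult_le1[OF less_imp_le[OF na_nu_less] spec[OF d(2)]]])
  ultimately show ?case using nsum_add(2)[OF b(1) d(1), of nu] by (intro exI[of _ "%t. b t + nu*d t"] exI[of _ "A \<union> D"]) auto
qed

end

context lubin_tate_setting
begin

subsection \<open>Independence of the normal forms\<close>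

lemma na_q_root: assumes "na z <= 1" "na w <= 1" "na (z^q - w^q) < 1" shows "na (z - w) < 1"
proof -
  have d: "na (z - w) <= 1" using assms by (intro na_diff_le)
  have "na (((z - w) + w)^q - ((z - w)^q + w^q)) < 1" using na_q_add[OF d assms(2)] na_pi_less by linarith
  hence "na ((z^q - w^q) - (((z - w) + w)^q - ((z - w)^q + w^q))) < 1" by (rule na_diff_less[OF assms(3)])
  hence "na (z - w)^q < 1" by (simp add: na_power)
  thus ?thesis by (metis one_le_power not_less)
qed

lemma na_power_int: "na (x powi n) = na x powi n" by (simp add: power_int_def na_power na_inverse)

lemma na_mult_diff: assumes "na a <= 1" "na b <= 1" "na (z - w) < 1" "na z <= 1" "na w <= 1"
  shows "na (a*(b*z^n) - a*(b*w^n)) < 1"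
proof -
  have "na (z^n - w^n) < 1"
  proof (cases n)
    case (Suc m)
    thus ?thesis using na_diff_power[OF assms(4,5), of m] assms by simp
  qed simp
  hence "na (a*(b*(z^n - w^n))) < 1" using assms by (intro na_mult_less1)
  thus ?thesis by (simp add: right_diff_distrib)
qed

text \<open>Representatives of pairwise distinct nonzero residue classes of C.\<close>

definition usep :: "'c set => bool"
  where "usep U \<longleftrightarrow> finite U & (ALL x:U. na x = 1) & (ALL x:U. ALL y:U. x ~= y --> na (x - y) = 1)"

lemma usep_card: "EX U. usep U & card U = n"
proof -
  obtain U where "finite U & card U = n & (ALL a:U. na a = 1) & (ALL a:U. ALL b:U. a ~= b --> na (a - b) = 1)"
    using unit_points[of n] by (rule exE)
  thus ?thesis unfolding usep_def by (intro exI[of _ U]) simp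
qed

end

context lt_component
begin

definition dg :: "int \<times> nat => int" where "dg t = int q*fst t + int mm*int (snd t)"

text \<open>\<open>mm\<close> is -1 modulo q, so the exponent determines l modulo q, and then
  i.\<close>

lemma dg_inj: assumes "dg s = dg t" "snd s < q" "snd t < q" shows "s = t"
proof -
  have m: "int mm = int q*int q - 1" using mm_eq(1) by (simp add: power2_eq_square flip: of_nat_mult)
  have "int (snd s) - int (snd t) = int q*(fst s + int q*int (snd s) - fst t - int q*int (snd t))"
    using assms(1) by (simp add: dg_def m algebra_simps)
  hence "int q dvd int (snd s) - int (snd t)" by simp
  moreover have "\<bar>int (snd s) - int (snd t)\<bar> < int q" using assms(2,3) by linarith
  ultimately have 1: "snd s = snd t" using dvd_imp_le_int[of "int (snd s) - int (snd t)" "int q"] by fastforce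
  hence "fst s = fst t" using assms(1) q_pos by (simp add: dg_def)
  thus ?thesis using 1 by (simp add: prod_eq_iff)
qed

text \<open>Where \<open>\<eta> = \<sigma>\<^sup>q\<close>, the relation for \<open>Z\<close> gives \<open>Z = a (\<sigma>\<^sup>m + \<sigma>\<^sup>-\<^sup>m)\<close> modulo small elements. The top exponents
  \<open>q i + m l\<close> of the terms \<open>\<eta>\<^sup>i Z\<^sup>l\<close> as functions of \<open>\<sigma>\<close> are distinct for \<open>l < q\<close>, because \<open>m = q\<^sup>2 - 1\<close>.\<close>

lemma nsum_zeros: assumes b: "ncoef b A" "!!t. na (b t) <= 1" and t: "na (b t) = 1"
  obtains N where "!!U. usep U ==> (!!x. x : U ==> EX P:Zc c. B.et P = x^q & na (nsum b A P) < 1) ==> card U <= N"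
proof -
  have fA: "finite A" and Aq: "!!s. s : A ==> snd s < q" and bz: "!!s. s \<notin> A ==> b s = 0" using b(1) by (auto simp: ncoef_def)
  define T where "T = {s : A. na (b s) = 1}"
  have tT: "t : T" using t bz[of t] unfolding T_def by (metis (mono_tags) mem_Collect_eq na_0 zero_neq_one)
  have fT: "finite (dg ` T)" using fA by (simp add: T_def)
  have "Max (dg ` T) : dg ` T" using fT tT by (intro Max_in) auto
  then obtain r where r: "r : T" "Max (dg ` T) = dg r" by auto
  have rmax: "dg s <= dg r" if "s : T" for s using Max_ge[OF fT, of "dg s"] that r(2) by simp
  define a where "a = fst c"
  have a: "na a = 1" "a^q = a" using na_mu mu_fq c_props by (auto simp: a_def fq_def)
  \<comment> \<open>A shift that makes all exponents of \<eta> in the sum nonnegative.\<close>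
  define K where "K = Max (insert 0 ((%s. nat (- fst s)) ` A))"
  have K: "0 <= fst s + int K" if "s : A" for s
  proof -
    have "nat (- fst s) <= K" unfolding K_def using fA that by (intro Max_ge) auto
    thus ?thesis by linarith
  qed
  define e where "e s = q*nat (fst s + int K) + mm*(q - 1 - snd s)" for s
  \<comment> \<open>As a function of x, this is x^(qK + mm(q - 1)) times the term of index s with
    x^q for \<eta> and a(x^mm + x^(-mm)) for Z. The first part of the exponent clears the powers of
    \<eta>, the second those of Z.\<close>
  define Q where "Q s = monom (a^snd s) (e s)*(monom 1 (2*mm) + 1)^snd s" for s
  define D where "D s = e s + 2*mm * snd s" for s
  have mpos: "0 < mm" using mm_eq(1) qs by linarith
  have an: "a ~= 0" using a by auto
  have R: "degree (monom 1 (2*mm) + 1 :: 'c poly) = 2*mm" "lead_coeff (monom 1 (2*mm) + 1 :: 'c poly) = 1" "(monom 1 (2*mm) + 1 :: 'c poly) ~= 0"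
  proof -
    show d: "degree (monom 1 (2*mm) + 1 :: 'c poly) = 2*mm"
      using mpos by (subst degree_add_eq_left) (auto simp: degree_monom_eq)
    thus l: "lead_coeff (monom 1 (2*mm) + 1 :: 'c poly) = 1" using mpos by (simp add: coeff_1)
    thus "(monom 1 (2*mm) + 1 :: 'c poly) ~= 0" by (metis leading_coeff_0_iff zero_neq_one)
  qed
  have dQ: "degree (Q s) = D s" for s
  proof -
    have m: "degree (monom (a^snd s) (e s)) = e s" by (rule degree_monom_eq) (simp add: an)
    have "degree (Q s) = degree (monom (a^snd s) (e s)) + degree ((monom 1 (2*mm) + 1 :: 'c poly)^snd s)"
      unfolding Q_def by (rule degree_mult_eq) (simp_all add: an R(3))
    thus ?thesis unfolding m degree_power_eq[OF R(3)] R(1) by (simp add: D_def)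
  qed
  have lQ: "coeff (Q s) (D s) = a^snd s" for s
  proof -
    have "lead_coeff (Q s) = a^snd s" unfolding Q_def lead_coeff_mult lead_coeff_power R(2) by (simp only: lead_coeff_monom power_one mult_1_right)
    thus ?thesis by (simp add: dQ)
  qed
  have ipQ: "ip (Q s)" for s unfolding Q_def using a by (intro ip_mult ip_monom ip_power ip_add) (auto simp: na_power)
  have Dd: "int (D s) = dg s + int (q*K + mm*(q - 1))" if "s : A" for s
  proof -
    define j where "j = q - 1 - snd s"
    have j: "q - 1 = j + snd s" using Aq[OF that] by (simp add: j_def)
    show ?thesis unfolding D_def e_def j_def[symmetric] unfolding j dg_def using K[OF that] by (simp add: algebra_simps)
  qed
  define Bp where "Bp = (\<Sum>s\<in>A. smult (b s) (Q s))"
  have ipB: "ip Bp" unfolding Bp_def by (intro ip_sum ip_smult b ipQ)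
  \<comment> \<open>At a point with \<eta> = x^q the relation gives Z^q close to z^q, hence Z close
    to z, because the q-th power is injective modulo the maximal ideal.\<close>
  have val: "na (poly Bp x) < 1" if x: "na x = 1" and P: "P : Zc c" "B.et P = x^q" and small: "na (nsum b A P) < 1" for x P
  proof -
    have xn: "x ~= 0" using x by auto
    define z where "z = a*(x^mm + inverse (x^mm))"
    have xm: "na (x^mm) = 1" "na (inverse (x^mm)) = 1" using x by (simp_all add: na_power na_inverse)
    have s1: "na (x^mm + inverse (x^mm)) <= 1" using xm by (intro na_add_le) auto
    have z1: "na z <= 1" unfolding z_def using a s1 by (intro na_mult_le1) auto
    have ZP: "na (B.ZZ P) <= 1" by (rule Fil0_na[OF B.Fil_ZZ Zc_Zs[OF P(1)]])
    have "na ((B.ZZ P^q - a*(B.et P^mm + B.ei P^mm)) - a*((x^mm + inverse (x^mm))^q - ((x^mm)^q + inverse (x^mm)^q))) < 1"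
    proof (rule na_diff_less)
      show "na (B.ZZ P^q - a*(B.et P^mm + B.ei P^mm)) < 1" unfolding a_def by (rule ZZ_rel[OF P(1) c])
      have "na ((x^mm + inverse (x^mm))^q - ((x^mm)^q + inverse (x^mm)^q)) < 1"
        using na_q_add[of "x^mm" "inverse (x^mm)"] xm na_pi_less by linarith
      thus "na (a*((x^mm + inverse (x^mm))^q - ((x^mm)^q + inverse (x^mm)^q))) < 1" using a by (intro na_mult_less1) auto
    qed
    moreover have "B.et P^mm + B.ei P^mm = (x^mm)^q + inverse (x^mm)^q"
      unfolding ei_et[OF Zc_Zs[OF P(1)]] P(2) by (simp add: power_inverse power_mult[symmetric] mult.commute)
    ultimately have "na (B.ZZ P^q - z^q) < 1" by (simp add: z_def power_mult_distrib a right_diff_distrib)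
    hence Zz: "na (B.ZZ P - z) < 1" by (rule na_q_root[OF ZP z1])
    have "na (nsum b A P - (\<Sum>s\<in>A. b s*((x^q) powi fst s*z^snd s))) < 1"
      unfolding nsum_def P(2) sum_subtractf[symmetric]
      by (intro na_sum_less na_mult_diff b Zz ZP z1) (use x in \<open>auto simp: na_power_int na_power\<close>)
    from na_diff_less[OF small this] have sm: "na (\<Sum>s\<in>A. b s*((x^q) powi fst s*z^snd s)) < 1" by simp
    have "poly (Q s) x = x^(q*K + mm*(q - 1))*((x^q) powi fst s*z^snd s)" if s: "s : A" for s
    proof -
      have "x^(q*nat (fst s + int K)) = x^(q*K)*(x^q) powi fst s"
      proof -
        have "(x^q)^nat (fst s + int K) = (x^q) powi (fst s + int K)" using K[OF s] by (simp add: power_int_def)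
        also have "... = (x^q) powi fst s*(x^q)^K" using xn by (simp add: power_int_add)
        finally show ?thesis by (simp only: power_mult mult.commute[of "(x^q) powi _"])
      qed
      moreover have "x^(mm*(q - 1)) = x^(mm*(q - 1 - snd s))*(x^mm)^snd s"
        using Aq[OF s] by (simp add: power_mult[symmetric] power_add[symmetric] distrib_left[symmetric])
      moreover have "(x^(2*mm) + 1)^snd s = (x^mm)^snd s*(x^mm + inverse (x^mm))^snd s"
        using xn by (simp add: power_mult_distrib[symmetric] distrib_left mult_2 power_add)
      ultimately show ?thesis by (simp add: Q_def e_def z_def poly_monom power_add power_mult_distrib)
    qed
    hence "poly Bp x = x^(q*K + mm*(q - 1))*(\<Sum>s\<in>A. b s*((x^q) powi fst s*z^snd s))"
      by (simp add: Bp_def poly_sum sum_distrib_left mult.left_commute)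
    thus ?thesis using sm x by (simp add: na_mult na_power)
  qed
  have rA: "r : A" "na (b r) = 1" using r by (auto simp: T_def)
  \<comment> \<open>At the top degree of r, the other terms with unit coefficient have smaller
    degree, and the remaining terms have small coefficients; so this coefficient is a unit.\<close>
  moreover have "coeff Bp (D r) = b r*a^snd r + (\<Sum>s\<in>A - {r}. b s*coeff (Q s) (D r))"
    using fA rA by (simp add: Bp_def coeff_sum sum.remove[of A r] lQ)
  moreover have "na (\<Sum>s\<in>A - {r}. b s*coeff (Q s) (D r)) < 1"
  proof (rule na_sum_less)
    fix s assume s: "s : A - {r}"
    show "na (b s*coeff (Q s) (D r)) < 1"
    proof (cases "s : T")
      case True
      hence "dg s < dg r" using rmax[OF True] dg_inj[of s r] s Aq rA by fastforce
      hence "degree (Q s) < D r" using Dd[of s] Dd[of r] s rA by (simp add: dQ)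
      thus ?thesis by (simp add: coeff_eq_0)
    next
      case False
      hence "na (b s) < 1" using b(2)[of s] s by (auto simp: T_def)
      thus ?thesis using ipQ[of s] na_mult_less1[of "coeff (Q s) (D r)" "b s"] by (simp add: ip_def mult.commute)
    qed
  qed simp
  moreover have "na (b r*a^snd r) = 1" using rA a by (simp add: na_mult na_power)
  ultimately have lead: "na (coeff Bp (D r)) = 1"
    using na_add_eq[of "\<Sum>s\<in>A - {r}. b s*coeff (Q s) (D r)" "b r*a^snd r"] by (simp only:)
  have "card U <= degree Bp" if U: "usep U" "!!x. x : U ==> EX P:Zc c. B.et P = x^q & na (nsum b A P) < 1" for U
  proof (rule ccontr)
    assume "\<not> ?thesis"
    moreover have "na (poly Bp x) < 1" if x: "x : U" for x
    proof -
      obtain P where "P : Zc c" "B.et P = x^q" "na (nsum b A P) < 1" using U(2)[OF x] by metis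
      moreover have "na x = 1" using U(1) x by (simp add: usep_def)
      ultimately show ?thesis by (intro val)
    qed
    ultimately have "na (coeff Bp (D r)) < 1"
      using U(1) unfolding usep_def by (intro poly_small_coeffs[OF ipB, of U]) simp_all
    thus False using lead by simp
  qed
  thus thesis by (rule that)
qed

text \<open>A unit coefficient would allow small values over finitely many residue classes of x
  only, but by \<open>Zc_point\<close> every unit x^q is the value of \<eta> at a point of the
  piece.\<close>

lemma nsum_small: assumes b: "ncoef b A" "!!t. na (b t) <= 1" and small: "!!P. P : Zc c ==> na (nsum b A P) < 1"
  shows "na (b t) < 1"
proof (rule ccontr)
  assume "\<not> ?thesis"
  hence t: "na (b t) = 1" using b(2)[of t] by linarith
  obtain N where N: "!!U. usep U ==> (!!x. x : U ==> EX P:Zc c. B.et P = x^q & na (nsum b A P) < 1) ==> card U <= N"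
    using nsum_zeros[OF b t] by metis
  obtain U where U: "usep U" "card U = Suc N" using usep_card by metis
  have "EX P:Zc c. B.et P = x^q & na (nsum b A P) < 1" if "x : U" for x
  proof -
    have "na (x^q) = 1" using U(1) that by (simp add: usep_def na_power)
    then obtain P where "P : Zc c" "B.et P = x^q" by (rule Zc_point[OF c])
    thus ?thesis using small by blast
  qed
  from N[OF U(1) this] show False using U(2) by simp
qed

text \<open>After division by a largest coefficient of size above 1, all values are small while one
  coefficient is 1, against \<open>nsum_small\<close>.\<close>

lemma nsum_integral: assumes b: "ncoef b A" and le: "!!P. P : Zc c ==> na (nsum b A P) <= 1" shows "na (b t) <= 1"
proof (rule ccontr)
  assume t: "\<not> ?thesis"
  have fA: "finite A" and bz: "!!s. s \<notin> A ==> b s = 0" using b by (auto simp: ncoef_def)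
  have tA: "t : A" using t bz[of t] by (metis na_0 zero_le_one)
  define M where "M = Max ((%s. na (b s)) ` A)"
  have "M : (%s. na (b s)) ` A" unfolding M_def using fA tA by (intro Max_in) auto
  then obtain r where r: "r : A" "M = na (b r)" by auto
  have M: "na (b s) <= M" for s
  proof (cases "s : A")
    case False
    thus ?thesis using bz[of s] r(2) by simp
  qed (simp add: M_def fA)
  have M1: "1 < M" using M[of t] t by linarith
  have rn: "b r ~= 0" using M1 r by auto
  define d where "d s = b s/b r" for s
  have nd: "nsum d A P = nsum b A P/b r" for P by (simp add: nsum_def d_def sum_divide_distrib)
  have "na (d r) < 1"
  proof (rule nsum_small)
    show "ncoef d A" using b by (simp add: ncoef_def d_def)
    show "na (d s) <= 1" for s using M[of s] M1 by (simp add: d_def na_divide r(2)[symmetric])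
    show "na (nsum d A P) < 1" if "P : Zc c" for P
      unfolding nd na_divide r(2)[symmetric] using le_less_trans[OF le[OF that] M1] M1 by simp
  qed
  thus False using rn by (simp add: d_def)
qed

lemma Fil_powi: assumes "g : Gen" "G.Fil 0 (%P. 1/g P)" shows "G.Fil 0 (%P. g P powi n)"
proof -
  have "G.Fil 0 (if 0 <= n then g^nat n else (%P. 1/g P)^nat (- n))" using assms Fil_Gen by (auto intro: G.F0)
  thus ?thesis by (rule G.Fil_cong) (auto simp: G.power_fun_apply power_int_def divide_inverse)
qed

text \<open>All monomials have constant absolute value on \<open>Zs\<close>, so summability at one
  point controls the rescaled coefficients uniformly; a power of \<open>nu\<close> makes them
  integral.\<close>

lemma affinoid_Gcl: assumes "f : affinoid_functions \<pi> q Zs" shows "EX k. (%P. nu^k*f P) : Gcl"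
proof -
  obtain co where co: "!!P. P : Zs ==> ((%n. co n*lt_monomial \<pi> q n P) has_sum f P) UNIV"
    using assms by (auto simp: affinoid_functions_def)
  define mo where "mo n P = (case n of (n1, n2, n3, n4, n5) =>
      B.om P powi n1*B.an P powi n2*B.xi P powi n3*B.bn P powi n4*B.et P powi n5)" for n P
  define C where "C n = (case n of (n1, n2, n3, n4, n5) =>
      (lam^wt) powi n1*(lam^(q^3)) powi n2*(lam^q) powi n3*(lam^q^2) powi n4*lam powi n5)" for n
  have mon: "lt_monomial \<pi> q n P = C n*mo n P" for n P
  proof -
    obtain n1 n2 n3 n4 n5 where n: "n = (n1, n2, n3, n4, n5)" by (metis prod.exhaust)
    obtain x y u where P: "P = (x, y, u)" by (metis prod.exhaust)
    have e: "u = lam^wt*B.om P" "sm u \<pi> x = lam^(q^3)*B.an P" "x = lam^q*B.xi P" "sm u \<pi> y = lam^q^2*B.bn P" "y = lam*B.et P"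
      by (simp_all add: P B.om_def B.an_def B.xi_def B.bn_def B.et_def B.kc_def B.SM_def cu_def cx_def cy_def)
    have "lt_monomial \<pi> q n P = u powi n1 * sm u \<pi> x powi n2*x powi n3 * sm u \<pi> y powi n4*y powi n5"
      by (simp add: n P)
    also have "... = (lam^wt*B.om P) powi n1*(lam^(q^3)*B.an P) powi n2*(lam^q*B.xi P) powi n3*(lam^q^2*B.bn P) powi n4*(lam*B.et P) powi n5"
      using e by metis
    also have "... = C n*mo n P" by (simp add: n C_def mo_def power_int_mult_distrib ac_simps)
    finally show ?thesis .
  qed
  have nmo: "na (mo n P) = 1" if "P : Zs" for n P
    using na_coords[OF that] by (auto simp: mo_def na_mult na_power_int split: prod.splits)
  have Fmo: "G.Fil 0 (mo n)" for n
  proof -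
    obtain n1 n2 n3 n4 n5 where n: "n = (n1, n2, n3, n4, n5)" by (metis prod.exhaust)
    have "G.Fil 0 ((%P. B.om P powi n1)*(%P. B.an P powi n2)*(%P. B.xi P powi n3)*(%P. B.bn P powi n4)*(%P. B.et P powi n5))"
    proof (intro G.F0_mult Fil_powi)
      show "G.Fil 0 (%P. 1/B.et P)" by (rule G.Fil_cong[OF G.Fil_ei]) (simp add: ei_et[OF Zc_Zs] divide_inverse)
    qed (auto intro: Fil_Gen simp: Gen_def)
    thus ?thesis by (rule G.Fil_cong) (simp add: mo_def n)
  qed
  obtain P0 where P0: "P0 : Zc c" using Zc_point[OF c na_1] .
  have van: "vanish (%n. co n*C n) UNIV"
    using has_sum_vanish[OF co[OF Zc_Zs[OF P0]]] nmo[OF Zc_Zs[OF P0]] by (simp add: vanish_def mon na_mult)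
  obtain M where M: "0 < M" "!!n. na (co n*C n) <= M" using vanish_bounded[OF van] by auto
  obtain k where k: "na nu^k < 1/M" using real_arch_pow_inv[of "1/M" "na nu"] M na_nu_less by auto
  have le1: "na (nu^k*(co n*C n)) <= 1" for n
  proof -
    have "na nu^k*na (co n*C n) <= (1/M)*M" using k M by (intro mult_mono) auto
    thus ?thesis using M by (simp add: na_mult na_power)
  qed
  have "G.Fil 0 (%P. nu^k*f P)"
  proof (rule G.Fil_has_sum[where t = "%n. G.kc (nu^k*(co n*C n))*mo n"])
    show "G.Fil 0 (G.kc (nu^k*(co n*C n))*mo n)" for n by (rule G.Fil_cmult[OF le1 Fmo])
    show "((%n. (G.kc (nu^k*(co n*C n))*mo n) P) has_sum nu^k*f P) UNIV" if "P : Zc c" for P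
      using has_sum_cmult[OF co[OF Zc_Zs[OF that]], of "nu^k"] by (simp add: G.kc_def mon mult.assoc)
    fix j
    have "na (nu^k) <= 1" using na_nu_less by (intro na_power_le1) simp
    hence *: "na ((G.kc (nu^k*(co n*C n))*mo n) P) <= na (co n*C n)" if "P : Zc c" for n P
      using nmo[OF Zc_Zs[OF that], of n] by (simp add: G.kc_def na_mult mult_left_le_one_le)
    have "{n. \<not> (ALL P:Zc c. na ((G.kc (nu^k*(co n*C n))*mo n) P) <= na lam^j)} <= {n : UNIV. na lam^j <= na (co n*C n)}"
      using*by (smt (verit, ccfv_SIG) Collect_mono UNIV_I)
    moreover have "finite {n : UNIV. na lam^j <= na (co n*C n)}" using van unfolding vanish_def by simp
    ultimately show "finite {n. \<not> (ALL P:Zc c. na ((G.kc (nu^k*(co n*C n))*mo n) P) <= na lam^j)}" by (rule finite_subset)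
  qed
  thus ?thesis by (auto simp: G.Fil_def)
qed

text \<open>Approximating nu^k f modulo nu^(k+1) and dividing by nu^k may lose the integrality of
  the coefficients. The quotient still has values bounded by 1, and \<open>nsum_integral\<close>
  restores it.\<close>

lemma affinoid_nsum: assumes f: "f : affinoid_functions \<pi> q Zs" "!!P. P : Zc c ==> na (f P) <= 1"
  shows "EX b A. ncoef b A & (ALL t. na (b t) <= 1) & (ALL P:Zc c. na (f P - nsum b A P) <= na nu)"
proof -
  obtain k where "(%P. nu^k*f P) : Gcl" using affinoid_Gcl[OF f(1)] by blast
  then obtain b A where b: "ncoef b A" "!!P. P : Zc c ==> na (nu^k*f P - nsum b A P) <= na nu^Suc k"
    using Gcl_approx[of _ "Suc k"] by blast
  define d where "d t = b t/nu^k" for t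
  have nd: "nsum d A P = nsum b A P/nu^k" for P by (simp add: nsum_def d_def sum_divide_distrib)
  have d: "ncoef d A" using b by (simp add: ncoef_def d_def)
  have ap: "na (f P - nsum d A P) <= na nu" if "P : Zc c" for P
  proof -
    have "f P - nsum d A P = (nu^k*f P - nsum b A P)/nu^k" by (simp add: nd diff_divide_distrib)
    thus ?thesis using b(2)[OF that] by (simp add: na_divide na_power divide_le_eq mult.commute)
  qed
  have "na (nsum d A P) <= 1" if "P : Zc c" for P
    using na_diff_le[OF f(2)[OF that], of "f P - nsum d A P"] ap[OF that] na_nu_less by simp
  hence "na (d t) <= 1" for t by (rule nsum_integral[OF d])
  thus ?thesis using d ap by blast
qed

end

context lubin_tate_setting
begin

subsection \<open>Affinoid functions\<close>

abbreviation mon :: "int \<times> int \<times> int \<times> int \<times> int => 'c triple => 'c" where "mon \<equiv> lt_monomial \<pi> q"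
abbreviation Aff :: "'c triple set => ('c triple => 'c) set" where "Aff \<equiv> affinoid_functions \<pi> q"

definition nzp :: "'c triple => bool" where
  "nzp P \<longleftrightarrow> cu P ~= 0 & cx P ~= 0 & cy P ~= 0 & sm (cu P) \<pi> (cx P) ~= 0 & sm (cu P) \<pi> (cy P) ~= 0"

lemma mon_eq: "mon (n1, n2, n3, n4, n5) P = cu P powi n1 * sm (cu P) \<pi> (cx P) powi n2*cx P powi n3 * sm (cu P) \<pi> (cy P) powi n4*cy P powi n5"
  by (cases P) (simp add: cu_def cx_def cy_def)

lemma mon_add: assumes "nzp P" shows "mon n P*mon m P = mon (n + m) P"
proof -
  obtain n1 n2 n3 n4 n5 m1 m2 m3 m4 m5 where n: "n = (n1, n2, n3, n4, n5)" "m = (m1, m2, m3, m4, m5)" by (metis prod.exhaust)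
  show ?thesis using assms unfolding n plus_prod_def fst_conv snd_conv mon_eq nzp_def by (simp add: power_int_add)
qed

lemma mon_nz: "nzp P ==> mon n P ~= 0" by (cases n) (simp add: mon_eq nzp_def)

lemma Aff_mon: "(\<lambda>P\<in>S. mon n P) : Aff S" unfolding affinoid_functions_def
proof (intro CollectI conjI exI ballI)
  fix P assume P: "P : S"
  have "((%m. (if m = n then 1 else 0)*mon m P) has_sum (\<Sum>m\<in>{n}. (if m = n then 1 else 0)*mon m P)) UNIV"
    by (rule has_sum_finite_support) auto
  thus "((%m. (if m = n then 1 else 0)*mon m P) has_sum (\<lambda>P\<in>S. mon n P) P) UNIV" using P by simp
qed simp

lemma Aff_add: assumes "f : Aff S" "g : Aff S" shows "(\<lambda>P\<in>S. f P + g P) : Aff S"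
proof -
  obtain b d where "!!P. P : S ==> ((%n. b n*mon n P) has_sum f P) UNIV" "!!P. P : S ==> ((%n. d n*mon n P) has_sum g P) UNIV"
    using assms unfolding affinoid_functions_def by blast
  hence "ALL P:S. ((%n. (b n + d n)*mon n P) has_sum (\<lambda>P\<in>S. f P + g P) P) UNIV"
    using has_sum_plus[where f = "%n. b n*mon n _"] by (simp add: distrib_right)
  thus ?thesis unfolding affinoid_functions_def by (auto simp del: lt_monomial.simps)
qed

lemma Aff_cmult: assumes "f : Aff S" shows "(\<lambda>P\<in>S. a*f P) : Aff S"
proof -
  obtain b where "!!P. P : S ==> ((%n. b n*mon n P) has_sum f P) UNIV" using assms unfolding affinoid_functions_def by blast
  hence "ALL P:S. ((%n. (a*b n)*mon n P) has_sum (\<lambda>P\<in>S. a*f P) P) UNIV"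
    using has_sum_cmult[where f = "%n. b n*mon n _" and c = a] by (simp add: mult.assoc)
  thus ?thesis unfolding affinoid_functions_def by (auto simp del: lt_monomial.simps)
qed

lemma Aff_const: "(\<lambda>P\<in>S. a) : Aff S"
proof -
  have "mon (0, 0, 0, 0, 0) P = 1" for P by (simp add: mon_eq)
  hence "(\<lambda>P\<in>S. a*(\<lambda>P\<in>S. mon (0, 0, 0, 0, 0) P) P) = (\<lambda>P\<in>S. a)" by (auto simp: fun_eq_iff)
  thus ?thesis using Aff_cmult[OF Aff_mon, of a "(0, 0, 0, 0, 0)" S] by simp
qed

text \<open>The coefficients of the product are convolutions over all of Z^5. Their convergence is
  seen at the single point P0, after multiplication by a monomial; Fubini then sums the product at
  every point.\<close>

lemma Aff_mult: assumes fg: "f : Aff S" "g : Aff S" and S: "P0 : S" "!!P. P : S ==> nzp P"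
  shows "(\<lambda>P\<in>S. f P*g P) : Aff S"
proof -
  obtain b d where b: "!!P. P : S ==> ((%n. b n*mon n P) has_sum f P) UNIV" and d: "!!P. P : S ==> ((%n. d n*mon n P) has_sum g P) UNIV"
    using fg unfolding affinoid_functions_def by blast
  have F: "((%(i, j). (b i*mon i P)*(d j*mon j P)) has_sum f P*g P) UNIV" if "P : S" for P
    using has_sum_times[OF b[OF that] d[OF that]] by simp
  have eq: "(b m*mon m P)*(d (k - m)*mon (k - m) P) = mon k P*(b m*d (k - m))" if "P : S" for P k m
    using mon_add[OF S(2)[OF that], of m "k - m"] by (simp add: algebra_simps)
  have "EX s. ((%m. b m*d (k - m)) has_sum s) UNIV" for k
  proof -
    have v: "vanish (%(i, j). (b i*mon i P0)*(d j*mon j P0)) UNIV" by (rule has_sum_vanish[OF F[OF S(1)]])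
    have "vanish (%m. mon k P0*(b m*d (k - m))) UNIV" unfolding vanish_def
    proof (intro allI impI)
      fix e :: real assume "0 < e"
      hence fin: "finite {p : UNIV. e <= na (case p of (i, j) => (b i*mon i P0)*(d j*mon j P0))}" using v unfolding vanish_def by blast
      have "finite ((%m. (m, k - m)) -` {p : UNIV. e <= na (case p of (i, j) => (b i*mon i P0)*(d j*mon j P0))})"
        by (rule finite_vimageI[OF fin]) (auto intro: injI)
      thus "finite {m : UNIV. e <= na (mon k P0*(b m*d (k - m)))}" by (simp add: vimage_def eq[OF S(1)])
    qed
    then obtain s where "((%m. mon k P0*(b m*d (k - m))) has_sum s) UNIV" using vanish_has_sum by blast
    from has_sum_cmult[OF this, of "inverse (mon k P0)"] mon_nz[OF S(2)[OF S(1)], of k] show ?thesis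
      by (auto simp: mult.assoc[symmetric])
  qed
  then obtain e where e: "!!k. ((%m. b m*d (k - m)) has_sum e k) UNIV" by metis
  have "((%k. e k*mon k P) has_sum (\<lambda>P\<in>S. f P*g P) P) UNIV" if P: "P : S" for P
  proof -
    have bij: "bij_betw (%(k, m). (m, k - m)) UNIV (UNIV :: ((int \<times> int \<times> int \<times> int \<times> int) \<times> _) set)"
      by (rule bij_betwI[where g = "%(i, j). (i + j, i)"]) auto
    have "((%(k, m). mon k P*(b m*d (k - m))) has_sum f P*g P) UNIV"
      using iffD2[OF has_sum_reindex_bij_betw[OF bij] F[OF P]] by (simp add: case_prod_unfold eq[OF P])
    hence "((%(k, m). mon k P*(b m*d (k - m))) has_sum f P*g P) (Sigma UNIV (%_. UNIV))" by simp
    moreover have "((%m. (%(k, m). mon k P*(b m*d (k - m))) (k, m)) has_sum mon k P*e k) UNIV" for k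
      using has_sum_cmult[OF e] by simp
    ultimately have "((%k. mon k P*e k) has_sum f P*g P) UNIV" by (rule has_sum_Fubini)
    thus ?thesis using P by (simp add: mult.commute)
  qed
  thus ?thesis unfolding affinoid_functions_def by (intro CollectI conjI exI[of _ e] ballI) simp_all
qed

lemma power_bounded_iff: "power_bounded S f \<longleftrightarrow> (ALL P:S. na (f P) <= 1)"
proof
  assume "power_bounded S f"
  then obtain M where M: "!!P n. P : S ==> na (f P^n) <= M"
    unfolding power_bounded_def bounded_any_center[of _ 0] na_dist by force
  show "ALL P:S. na (f P) <= 1"
  proof (rule ccontr)
    assume "\<not> ?thesis"
    then obtain P where P: "P : S" "1 < na (f P)" by force
    obtain n where "M < na (f P)^n" using real_arch_pow[OF P(2)] by blast
    thus False using M[OF P(1), of n] by (simp add: na_power)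
  qed
next
  assume *: "ALL P:S. na (f P) <= 1"
  have "na (- (f P^n)) <= 1" if "P : S" for P n using*that na_power_le1[of "f P" n] by simp
  thus "power_bounded S f" unfolding power_bounded_def bounded_def na_dist by (intro exI[of _ 0] exI[of _ 1]) auto
qed

lemma top_nilpotent_less: assumes "top_nilpotent S f" "P : S" shows "na (f P) < 1"
proof (rule ccontr)
  assume "\<not> ?thesis"
  hence g: "1 <= na (f P^n)" for n by (simp add: na_power one_le_power)
  have "\<forall>\<^sub>F n in sequentially. ALL P:S. dist (f P^n) 0 < 1" using assms(1) unfolding top_nilpotent_def by (rule uniform_limitD) simp
  then obtain n where "ALL P:S. dist (f P^n) 0 < 1" by (auto simp: eventually_sequentially)
  thus False using g[of n] assms(2) by (auto simp: na_dist)
qed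

lemma top_nilpotentI: assumes "!!P. P : S ==> na (f P) <= r" "r < 1" "0 <= r" shows "top_nilpotent S f"
  unfolding top_nilpotent_def
proof (rule uniform_limitI)
  fix e :: real assume "0 < e"
  have "(%n. r^n) \<longlonglongrightarrow> 0" using assms by (intro LIMSEQ_power_zero) auto
  hence "\<forall>\<^sub>F n in sequentially. r^n < e" using \<open>0 < e\<close> by (rule order_tendstoD)
  thus "\<forall>\<^sub>F n in sequentially. ALL P:S. dist (f P^n) 0 < e"
  proof (rule eventually_mono)
    fix n assume n: "r^n < e"
    have "na (f P^n) <= r^n" if "P : S" for P unfolding na_power using assms that by (intro power_mono) auto
    thus "ALL P:S. dist (f P^n) 0 < e" using n by (fastforce simp: na_dist)
  qed
qed

end

section \<open>Exchange of the two basis elements, and lifts of the idempotents\<close>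

context lt_affinoid
begin

definition sw :: "'c triple => 'c triple" where "sw P = (cy P, cx P, cu P)"

lemma sw_sw [simp]: "sw (sw P) = P" by (simp add: sw_def cx_def cy_def cu_def)

definition swn :: "int \<times> int \<times> int \<times> int \<times> int => int \<times> int \<times> int \<times> int \<times> int"
  where "swn n = (case n of (n1, n2, n3, n4, n5) => (n1, n4, n5, n2, n3))"

lemma mon_sw: "mon n (sw P) = mon (swn n) P"
  by (cases n) (simp add: mon_eq swn_def sw_def cx_def cy_def cu_def del: lt_monomial.simps)

lemma Aff_sw: assumes "f : Aff T" shows "(\<lambda>P\<in>{P. sw P : T}. f (sw P)) : Aff {P. sw P : T}"
proof -
  obtain b where b: "!!P. P : T ==> ((%n. b n*mon n P) has_sum f P) UNIV" using assms unfolding affinoid_functions_def by blast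
  have bij: "bij_betw swn UNIV UNIV" by (rule bij_betwI[where g = swn]) (auto simp: swn_def)
  have ss: "swn (swn n) = n" for n by (cases n) (simp add: swn_def)
  have "((%n. b (swn n)*mon n P) has_sum f (sw P)) UNIV" if "sw P : T" for P
    using iffD2[OF has_sum_reindex_bij_betw[OF bij] b[OF that]] by (simp add: mon_sw ss)
  thus ?thesis unfolding affinoid_functions_def by (intro CollectI conjI exI[of _ "%n. b (swn n)"] ballI) simp_all
qed

lemma Zs_nzp: assumes "P : Zs" shows "nzp P" "nzp (sw P)"
proof -
  have z: "z ~= 0" if "na z = na lam^n" for z n using that by auto
  have "na (cu P) = na lam^wt" "na (cx P) = na lam^q" "na (cy P) = na lam^1" "na (sm (cu P) \<pi> (cx P)) = na lam^(q^3)"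
      "na (sm (cu P) \<pi> (cy P)) = na lam^q^2" using assms unfolding Zs_def cu_def cx_def cy_def by auto
  note this[THEN z]
  thus "nzp P" "nzp (sw P)" by (simp_all add: nzp_def sw_def cx_def cy_def cu_def)
qed

definition AZ :: "('c triple => 'c) => bool" where "AZ g \<longleftrightarrow> (\<lambda>P\<in>Zs. g P) : Aff Zs"

lemma Zs_nonempty: obtains P where "P : Zs" using Zs_fiber[OF na_1] by blast

lemma AZ_kc: "AZ (B.kc a)" using Aff_const by (simp add: AZ_def B.kc_def)

lemma AZ_add: "AZ g ==> AZ h ==> AZ (g + h)"
  using Aff_add[of "restrict g Zs" Zs "restrict h Zs"] by (simp add: AZ_def cong: restrict_cong)

lemma AZ_mult: "AZ g ==> AZ h ==> AZ (g*h)"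
proof -
  obtain P where "P : Zs" by (rule Zs_nonempty)
  thus "AZ g ==> AZ h ==> AZ (g*h)"
    using Aff_mult[of "restrict g Zs" Zs "restrict h Zs" P] Zs_nzp by (simp add: AZ_def cong: restrict_cong)
qed

lemma AZ_diff: "AZ g ==> AZ h ==> AZ (g - h)" using AZ_add[OF _ AZ_mult[OF AZ_kc[of "-1"]]] by (fastforce simp: B.kc_simps)

lemma AZ_power: "AZ g ==> AZ (g^n)"
proof (induction n)
  case 0
  show ?case using AZ_kc[of 1] by (simp only: B.kc_simps power_0)
qed (simp only: power_Suc AZ_mult)

lemma AZ_prod: "finite A ==> (!!i. i : A ==> AZ (f i)) ==> AZ (%P. \<Prod>i\<in>A. f i P)"
proof (induction A rule: finite_induct)
  case empty
  show ?case using AZ_kc[of 1] by (simp add: B.kc_def)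
next
  case (insert i A)
  hence "AZ (f i*(%P. \<Prod>i\<in>A. f i P))" by (intro AZ_mult) auto
  thus ?case using insert by (simp add: times_fun_def)
qed

lemma AZ_mon: "(!!P. g P = mon n P) ==> AZ g" using Aff_mon[of n Zs] by (simp add: AZ_def cong: restrict_cong)

lemma AZ_basic: "AZ cx" "AZ cy" "AZ (%P. inverse (cy P))" "AZ B.A1" "AZ B.B1"
proof -
  show "AZ cx" by (rule AZ_mon[of _ "(0, 0, 1, 0, 0)"]) (simp add: mon_eq)
  show "AZ cy" by (rule AZ_mon[of _ "(0, 0, 0, 0, 1)"]) (simp add: mon_eq)
  show "AZ (%P. inverse (cy P))" by (rule AZ_mon[of _ "(0, 0, 0, 0, - 1)"]) (simp add: mon_eq power_int_minus)
  show "AZ B.A1" by (rule AZ_mon[of _ "(0, 1, 0, 0, 0)"]) (simp add: mon_eq B.SM_def)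
  show "AZ B.B1" by (rule AZ_mon[of _ "(0, 0, 0, 1, 0)"]) (simp add: mon_eq B.SM_def)
qed

lemmas AZ = AZ_kc AZ_add AZ_mult AZ_diff AZ_power AZ_basic

lemma AZ_functions: "AZ B.et" "AZ B.ei" "AZ B.W" "AZ B.tt" "AZ B.ZZ"
proof -
  show "AZ B.et" unfolding B.et_def by (intro AZ)
  have "AZ (B.kc lam*(%P. inverse (cy P)))" by (intro AZ)
  thus "AZ B.ei" by (simp add: B.ei_def B.kc_def times_fun_def divide_inverse)
  show W: "AZ B.W" unfolding B.W_def B.De_def by (intro AZ)
  show "AZ B.tt" unfolding B.tt_def B.DD_def by (intro AZ W)
  have "AZ (B.kc (lam^mm/nu^e0)*B.UU*(%P. inverse (cy P))^mm)" unfolding B.UU_def B.TT_def by (intro AZ W)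
  moreover have "B.kc (lam^mm/nu^e0)*B.UU*(%P. inverse (cy P))^mm = B.ZZ"
    by (simp add: B.ZZ_def B.kc_def fun_eq_iff B.power_fun_apply divide_inverse power_inverse)
  ultimately show "AZ B.ZZ" by simp
qed

text \<open>Lagrange interpolation in the two labels: a lift of the idempotent that belongs to the
  piece c.\<close>

definition Ec :: "'c \<times> 'c => 'c triple => 'c"
  where "Ec c P = (\<Prod>a\<in>mu - {fst c}. (B.W P - a)/(fst c - a))*(\<Prod>t\<in>fq - {snd c}. (B.tt P - t)/(snd c - t))"

lemma AZ_Ec: "AZ (Ec c)"
proof -
  have d: "AZ (%P. (g P - a)/b)" if "AZ g" for g a b
  proof -
    have "AZ (B.kc (1/b)*(g - B.kc a))" by (intro AZ that)
    thus ?thesis by (simp add: B.kc_def times_fun_def)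
  qed
  have "AZ ((%P. \<Prod>a\<in>mu - {fst c}. (B.W P - a)/(fst c - a))*(%P. \<Prod>t\<in>fq - {snd c}. (B.tt P - t)/(snd c - t)))"
    using card_mu card_fq by (intro AZ_mult AZ_prod d AZ_functions) auto
  thus ?thesis by (simp add: Ec_def[abs_def] times_fun_def)
qed

text \<open>The denominators are units by \<open>fq_unit_diff\<close>. For s = t every factor is
  close to 1; otherwise the factor at t is small.\<close>

lemma lagrange: assumes A: "finite A" "A <= fq" and s: "s : A" and t: "t : A" "na (z - t) < 1"
  shows "s = t ==> na ((\<Prod>a\<in>A - {s}. (z - a)/(s - a)) - 1) < 1" "s ~= t ==> na (\<Prod>a\<in>A - {s}. (z - a)/(s - a)) < 1"
    "na (\<Prod>a\<in>A - {s}. (z - a)/(s - a)) <= 1"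
proof -
  have n: "na (s - a) = 1" if "a : A - {s}" for a using that A s fq_unit_diff[of s a] by auto
  have z: "na z <= 1" using na_add_le[of "z - t" 1 t] t A na_fq[of t] by auto
  have f: "na ((z - a)/(s - a)) <= 1" if "a : A - {s}" for a
    using na_diff_le[OF z na_fq[of a]] that A n[OF that] by (auto simp: na_divide)
  thus "na (\<Prod>a\<in>A - {s}. (z - a)/(s - a)) <= 1" unfolding na_prod by (intro prod_le_1) auto
  show "na (\<Prod>a\<in>A - {s}. (z - a)/(s - a)) < 1" if "s ~= t"
  proof -
    have "(\<Prod>a\<in>A - {s}. (z - a)/(s - a)) = (z - t)/(s - t)*(\<Prod>a\<in>A - {s} - {t}. (z - a)/(s - a))"
      using A t that by (intro prod.remove) auto
    moreover have "na (\<Prod>a\<in>A - {s} - {t}. (z - a)/(s - a)) <= 1" unfolding na_prod using f by (intro prod_le_1) auto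
    ultimately show ?thesis using na_mult_less1[of "\<Prod>a\<in>A - {s} - {t}. (z - a)/(s - a)" "(z - t)/(s - t)"] n[of t] t that
      by (simp add: na_divide mult.commute)
  qed
  show "na ((\<Prod>a\<in>A - {s}. (z - a)/(s - a)) - 1) < 1" if st: "s = t"
  proof -
    have "na ((\<Prod>a\<in>D. (z - a)/(s - a)) - 1) < 1" if "finite D" "D <= A - {s}" for D using that
    proof (induction D rule: finite_induct)
      case (insert a D)
      have a: "a : A - {s}" using insert by auto
      hence sa: "s - a ~= 0" by auto
      have "(z - a)/(s - a) - 1 = (z - s)/(s - a)" using sa by (simp add: field_simps)
      hence "na ((z - a)/(s - a) - 1) < 1" using t st n[OF a] by (simp add: na_divide)
      moreover have "na ((z - a)/(s - a)*((\<Prod>a\<in>D. (z - a)/(s - a)) - 1)) < 1"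
        using insert f[OF a] by (intro na_mult_less1) auto
      ultimately have "na ((z - a)/(s - a)*((\<Prod>a\<in>D. (z - a)/(s - a)) - 1) + ((z - a)/(s - a) - 1)) < 1" by (intro na_add_less)
      thus ?case using insert by (simp add: right_diff_distrib)
    qed simp
    thus ?thesis using A by simp
  qed
qed

lemma Ec_values: assumes c: "c : Lam" "d : Lam" "P : Zc d" shows "na (Ec c P - (if c = d then 1 else 0)) < 1"
proof -
  have s: "mu <= fq" using mu_fq by auto
  have m: "fst c : mu" "fst d : mu" "snd c : fq" "snd d : fq" "na (B.W P - fst d) < 1" "na (B.tt P - snd d) < 1"
    using c by (auto simp: Lam_def Zc_def)
  note L = lagrange[OF card_mu(1) s m(1,2,5)] and M = lagrange[OF card_fq(1) subset_refl m(3,4,6)]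
  consider "c = d" | "fst c ~= fst d" | "snd c ~= snd d" by (auto simp: prod_eq_iff)
  thus ?thesis
  proof cases
    case 1
    have "na (x*y - 1) < 1" if "na (x - 1) < 1" "na (y - 1) < 1" "na y <= 1" for x y
      using na_add_less[OF na_mult_less1[OF that(3,1)] that(2)] by (simp add: algebra_simps)
    thus ?thesis using 1 L(1,3) M(1,3) by (simp add: Ec_def)
  next
    case 2
    hence "c ~= d" by auto
    thus ?thesis using na_mult_less1[OF M(3) L(2)[OF 2]] by (simp add: Ec_def mult.commute)
  next
    case 3
    hence "c ~= d" by auto
    thus ?thesis using na_mult_less1[OF L(3) M(2)[OF 3]] by (simp add: Ec_def)
  qed
qed

end

subsection \<open>The reduction and its spectrum\<close>

text \<open>Both affinoids at once: \<open>th\<close> is the identity or the exchange, in either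
  case an involution that matches \<open>S\<close> with \<open>Zs\<close>.\<close>

locale lt_reduction = lt_affinoid F v \<pi> q p for F :: "'c::{field_char_0,complete_space} set" and v \<pi> q p +
  fixes S :: "'c triple set" and th :: "'c triple => 'c triple"
  assumes S_cases: "S = Zs & th = (%P. P) \<or> S = {P. sw P : Zs} & th = sw"
begin

definition Sc :: "'c \<times> 'c => 'c triple set" where "Sc c = {P : S. th P : Zc c}"
definition lift :: "('c triple => 'c) => 'c triple => 'c" where "lift g = (\<lambda>P\<in>S. g (th P))"
definition PBc :: "('c triple => 'c) set" where "PBc = {f : Aff S. ALL P:S. na (f P) <= 1}"
definition small :: "('c \<times> 'c) => ('c triple => 'c) => bool" where "small c f \<longleftrightarrow> (ALL P:Sc c. na (f P) < 1)"

lemma th_th [simp]: "th (th P) = P" using S_cases by auto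

lemma th_Zs: "th P : Zs \<longleftrightarrow> P : S" using S_cases by auto

lemma th_S: "th P : S \<longleftrightarrow> P : Zs" using th_Zs[of "th P"] by simp

lemma S_nzp: "P : S ==> nzp P" using S_cases Zs_nzp(1)[of P] Zs_nzp(2)[of "sw P"] by auto

lemma Aff_lift: assumes "AZ g" shows "lift g : Aff S"
proof -
  have g: "restrict g Zs : Aff Zs" using assms by (simp add: AZ_def)
  from S_cases show ?thesis
  proof
    assume "S = Zs & th = (%P. P)"
    thus ?thesis unfolding lift_def using g by simp
  next
    assume "S = {P. sw P : Zs} & th = sw"
    thus ?thesis unfolding lift_def using Aff_sw[OF g] by (simp cong: restrict_cong)
  qed
qed

lemma Aff_pull: assumes "f : Aff S" shows "(\<lambda>P\<in>Zs. f (th P)) : Aff Zs" using S_cases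
proof
  assume "S = Zs & th = (%P. P)"
  thus ?thesis using assms by (simp add: affinoid_functions_def extensional_restrict)
next
  assume "S = {P. sw P : Zs} & th = sw"
  thus ?thesis using Aff_sw[OF assms] by simp
qed

lemma Sc_cover: assumes "P : S" obtains c where "c : Lam" "P : Sc c"
  using Zc_cover[of "th P"] assms by (auto simp: th_Zs Sc_def)

lemma Sc_S: "P : Sc c ==> P : S" by (simp add: Sc_def)

lemma th_Sc: "P : Zc c ==> th P : Sc c" by (simp add: Sc_def th_S Zc_def)

lemma lift_apply: "P : S ==> lift g P = g (th P)" by (simp add: lift_def)

lemma rep: assumes c: "c : Lam" and f: "f : Aff S" "!!P. P : Sc c ==> na (f P) <= 1"
  shows "EX b A. ncoef b A & (ALL t. na (b t) <= 1) & (ALL P:Sc c. na (f P - nsum b A (th P)) <= na nu)"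
proof -
  interpret C: lt_component F v \<pi> q p c by unfold_locales (rule c)
  have r: "(\<lambda>P\<in>Zs. f (th P)) P = f (th P)" if "P : Zc c" for P using C.Zc_Zs[OF that] by simp
  have "EX b A. ncoef b A & (ALL t. na (b t) <= 1) & (ALL P:Zc c. na ((\<lambda>P\<in>Zs. f (th P)) P - nsum b A P) <= na nu)"
    by (rule C.affinoid_nsum[OF Aff_pull[OF f(1)]]) (use f(2) th_Sc in \<open>simp only: r\<close>)
  then obtain b A where b: "ncoef b A" "ALL t. na (b t) <= 1" "!!P. P : Zc c ==> na (f (th P) - nsum b A P) <= na nu" using r by metis
  have "na (f P - nsum b A (th P)) <= na nu" if "P : Sc c" for P using b(3)[of "th P"] that by (simp add: Sc_def)
  thus ?thesis using b(1,2) by blast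
qed

lemma nsum_small_Sc: assumes "c : Lam" "ncoef b A" "!!t. na (b t) <= 1" "!!P. P : Sc c ==> na (nsum b A (th P)) < 1"
  shows "na (b t) < 1"
proof -
  interpret C: lt_component F v \<pi> q p c by unfold_locales (rule assms)
  show ?thesis by (rule C.nsum_small[OF assms(2,3)]) (use assms(4) th_Sc in fastforce)
qed

lemma na_term: "P : S ==> na (B.et (th P) powi i*B.ZZ (th P)^l) <= 1"
  using na_coords(1)[of "th P"] Fil0_na[OF B.Fil_ZZ, of "th P"] by (simp add: th_Zs na_mult na_power_int na_power power_le_one)

text \<open>A maximum principle: values below 1 force coefficients below 1 in the normal form, of
  which there are only finitely many.\<close>

lemma small_uniform: assumes c: "c : Lam" and f: "f : Aff S" "small c f"
  obtains r where "0 <= r" "r < 1" "!!P. P : Sc c ==> na (f P) <= r"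
proof -
  obtain b A where b: "ncoef b A" "ALL t. na (b t) <= 1" "!!P. P : Sc c ==> na (f P - nsum b A (th P)) <= na nu"
    using rep[OF c f(1)] f(2) unfolding small_def by (metis less_imp_le)
  have bs: "na (b t) < 1" for t
  proof (rule nsum_small_Sc[OF c b(1)])
    show "na (nsum b A (th P)) < 1" if "P : Sc c" for P
      using na_diff_less[of "f P" 1 "f P - nsum b A (th P)"] b(3)[OF that] f(2) that na_nu_less by (simp add: small_def)
  qed (use b in blast)
  have fA: "finite A" using b(1) by (simp add: ncoef_def)
  define r where "r = Max (insert (na nu) ((%t. na (b t)) ` A))"
  have r: "na nu <= r" "!!t. t : A ==> na (b t) <= r" using fA by (auto simp: r_def)
  have r0: "0 <= r" using r(1) na_nonneg order_trans by blast
  have "na (f P) <= r" if P: "P : Sc c" for P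
  proof -
    have "na (b t*(B.et (th P) powi fst t*B.ZZ (th P)^snd t)) <= r" if "t : A" for t
      using na_mult_le1[OF na_term[OF Sc_S[OF P]] r(2)[OF that]] by (simp only: mult.commute)
    hence "na (nsum b A (th P)) <= r" unfolding nsum_def by (intro na_sum_le r0)
    from na_add_le[OF order_trans[OF b(3)[OF P] r(1)] this] show ?thesis by simp
  qed
  moreover have "r < 1" using fA bs na_nu_less by (simp add: r_def)
  ultimately show thesis using r0 that by blast
qed

text \<open>\<open>small_uniform\<close> on each of the finitely many pieces turns values below 1
  into a uniform bound below 1, so the powers tend to 0 uniformly.\<close>

lemma top_nilpotent_ideal_eq: "top_nilpotent_ideal \<pi> q S = {f : PBc. ALL c:Lam. small c f}"
proof -
  have "top_nilpotent S f \<longleftrightarrow> (ALL P:S. na (f P) <= 1) & (ALL c:Lam. small c f)" if f: "f : Aff S" for f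
  proof (intro iffI conjI)
    assume "top_nilpotent S f"
    hence "na (f P) < 1" if "P : S" for P using top_nilpotent_less that by blast
    thus "ALL P:S. na (f P) <= 1" "ALL c:Lam. small c f" using Sc_S by (auto simp: small_def less_imp_le)
  next
    assume *: "(ALL P:S. na (f P) <= 1) & (ALL c:Lam. small c f)"
    have "ALL c:Lam. EX r. 0 <= r & r < 1 & (ALL P:Sc c. na (f P) <= r)" using small_uniform[OF _ f]*by metis
    then obtain r where r: "!!c. c : Lam ==> 0 <= r c" "!!c. c : Lam ==> r c < 1" "!!c P. c : Lam ==> P : Sc c ==> na (f P) <= r c" by metis
    define R where "R = Max (insert 0 (r ` Lam))"
    have R: "0 <= R" "R < 1" "!!c. c : Lam ==> r c <= R" using card_Lam(1) r by (auto simp: R_def)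
    show "top_nilpotent S f"
    proof (rule top_nilpotentI[OF _ R(2,1)])
      fix P assume "P : S"
      then obtain c where "c : Lam" "P : Sc c" by (rule Sc_cover)
      thus "na (f P) <= R" using r(3) R(3) order_trans by blast
    qed
  qed
  thus ?thesis by (auto simp: top_nilpotent_ideal_def PBc_def)
qed

text \<open>If f and g are not small on the piece, \<open>nsum_zeros\<close> confines the small
  values of each to finitely many residue classes of x; some class avoids both. This makes the
  reduction of a piece an integral domain.\<close>

lemma small_prime: assumes c: "c : Lam" and f: "f : PBc" "\<not> small c f" and g: "g : PBc" "\<not> small c g"
  obtains P where "P : Sc c" "na (f P) = 1" "na (g P) = 1"
proof -
  interpret C: lt_component F v \<pi> q p c by unfold_locales (rule c)
  have *: "EX N. ALL U. usep U --> (ALL x:U. EX P:Zc c. B.et P = x^q & na (f (th P)) < 1) --> card U <= N" if f: "f : PBc" "\<not> small c f" for f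
  proof -
    obtain b A where b: "ncoef b A" "ALL t. na (b t) <= 1" "!!P. P : Sc c ==> na (f P - nsum b A (th P)) <= na nu"
      using rep[OF c, of f] f(1) Sc_S unfolding PBc_def by blast
    have "EX t. na (b t) = 1"
    proof (rule ccontr)
      assume n: "\<not> ?thesis"
      have bs: "na (b t) < 1" for t using n b(2) by (metis less_eq_real_def)
      have "na (f P) < 1" if P: "P : Sc c" for P
      proof -
        have "na (b t*(B.et (th P) powi fst t*B.ZZ (th P)^snd t)) < 1" for t
          using na_mult_less1[OF na_term[OF Sc_S[OF P]] bs] by (simp only: mult.commute)
        hence "na (nsum b A (th P)) < 1" unfolding nsum_def by (intro na_sum_less) simp_all
        from na_add_less[OF le_less_trans[OF b(3)[OF P] na_nu_less] this] show ?thesis by simp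
      qed
      thus False using f(2) by (simp add: small_def)
    qed
    then obtain t where "na (b t) = 1" by blast
    then obtain N where N: "!!U. usep U ==> (!!x. x : U ==> EX P:Zc c. B.et P = x^q & na (nsum b A P) < 1) ==> card U <= N"
      using C.nsum_zeros[OF b(1) spec[OF b(2)]] by metis
    have s: "na (nsum b A P) < 1" if "P : Zc c" "na (f (th P)) < 1" for P
      using na_diff_less[OF that(2) le_less_trans[OF b(3)[OF th_Sc[OF that(1)]] na_nu_less]] by simp
    show ?thesis
    proof (intro exI allI impI)
      fix U assume U: "usep U" "ALL x:U. EX P:Zc c. B.et P = x^q & na (f (th P)) < 1"
      show "card U <= N" by (rule N[OF U(1)]) (use U(2) s in metis)
    qed
  qed
  obtain N where N: "!!U. usep U ==> ALL x:U. EX P:Zc c. B.et P = x^q & na (f (th P)) < 1 ==> card U <= N" using *[OF f] by metis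
  obtain M where M: "!!U. usep U ==> ALL x:U. EX P:Zc c. B.et P = x^q & na (g (th P)) < 1 ==> card U <= M" using *[OF g] by metis
  obtain U where U: "usep U" "card U = Suc (N + M)" using usep_card by metis
  define U1 where "U1 = {x : U. EX P:Zc c. B.et P = x^q & na (f (th P)) < 1}"
  define U2 where "U2 = {x : U. EX P:Zc c. B.et P = x^q & na (g (th P)) < 1}"
  have u: "usep U1" "usep U2" "finite U" using U(1) by (auto simp: usep_def U1_def U2_def)
  have "card U1 <= N" by (rule N[OF u(1)]) (simp add: U1_def)
  moreover have "card U2 <= M" by (rule M[OF u(2)]) (simp add: U2_def)
  ultimately have "card (U1 \<union> U2) < card U" using card_Un_le[of U1 U2] U(2) by linarith
  hence "\<not> U <= U1 \<union> U2" using card_mono[of "U1 \<union> U2" U] u by (metis finite_Un leD usep_def)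
  then obtain x where x: "x : U" "x \<notin> U1" "x \<notin> U2" by auto
  have "na (x^q) = 1" using U(1) x(1) by (simp add: usep_def na_power)
  then obtain P where P: "P : Zc c" "B.et P = x^q" by (rule Zc_point[OF c])
  have "\<not> na (f (th P)) < 1" "\<not> na (g (th P)) < 1" using x P unfolding U1_def U2_def by blast+
  moreover have "na (f (th P)) <= 1" "na (g (th P)) <= 1" using f(1) g(1) Sc_S[OF th_Sc[OF P(1)]] by (simp_all add: PBc_def)
  ultimately show thesis using that[OF th_Sc[OF P(1)]] by linarith
qed

end

section \<open>The reduction ring, its generic primes and its connected components\<close>

context lt_reduction
begin

abbreviation PB where "PB \<equiv> power_bounded_ring \<pi> q S"
abbreviation NI where "NI \<equiv> top_nilpotent_ideal \<pi> q S"
abbreviation RR where "RR \<equiv> reduction_ring \<pi> q S"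

lemma PB_simps: "carrier PB = PBc" "mult PB = (%f g. \<lambda>P\<in>S. f P*g P)" "add PB = (%f g. \<lambda>P\<in>S. f P + g P)" "one PB = (\<lambda>P\<in>S. 1)" "zero PB = (\<lambda>P\<in>S. 0)"
  by (auto simp: power_bounded_ring_def PBc_def power_bounded_iff)

lemma PBc_const: "na a <= 1 ==> (\<lambda>P\<in>S. a) : PBc" by (simp add: PBc_def Aff_const)

lemma PBc_add: "f : PBc ==> g : PBc ==> (\<lambda>P\<in>S. f P + g P) : PBc"
  unfolding PBc_def using Aff_add by (auto intro: na_add_le)

lemma S_nonempty: obtains P where "P : S" using Zs_nonempty th_S by metis

lemma PBc_mult: "f : PBc ==> g : PBc ==> (\<lambda>P\<in>S. f P*g P) : PBc"
  by (rule S_nonempty) (auto simp: PBc_def intro: Aff_mult S_nzp na_mult_le1)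

lemma PBc_minus: "f : PBc ==> (\<lambda>P\<in>S. - f P) : PBc" unfolding PBc_def using Aff_cmult[of f S "-1"] by auto

lemma cring_PB: "cring PB"
proof (rule cringI)
  show "abelian_group PB"
  proof (rule abelian_groupI)
    show "EX y:carrier PB. y \<oplus>\<^bsub>PB\<^esub> x = \<zero>\<^bsub>PB\<^esub>" if "x : carrier PB" for x
      using PBc_minus that by (intro bexI[of _ "\<lambda>P\<in>S. - x P"]) (auto simp: PB_simps cong: restrict_cong)
    show "\<zero>\<^bsub>PB\<^esub> \<oplus>\<^bsub>PB\<^esub> x = x" if "x : carrier PB" for x
      using that by (auto simp: PB_simps PBc_def affinoid_functions_def extensional_restrict cong: restrict_cong)
  qed (auto simp: PB_simps add.assoc add.commute intro: PBc_add PBc_const cong: restrict_cong)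
  show "comm_monoid PB"
  proof (rule comm_monoidI)
    show "\<one>\<^bsub>PB\<^esub> \<otimes>\<^bsub>PB\<^esub> x = x" if "x : carrier PB" for x
      using that by (auto simp: PB_simps PBc_def affinoid_functions_def extensional_restrict cong: restrict_cong)
  qed (auto simp: PB_simps mult.assoc mult.commute intro: PBc_mult PBc_const cong: restrict_cong)
qed (auto simp: PB_simps distrib_right cong: restrict_cong)

lemma PB_minus: assumes "f : PBc" "g : PBc" shows "f \<ominus>\<^bsub>PB\<^esub> g = (\<lambda>P\<in>S. f P - g P)" "\<ominus>\<^bsub>PB\<^esub> g = (\<lambda>P\<in>S. - g P)"
proof -
  interpret cring PB by (rule cring_PB)
  show m: "\<ominus>\<^bsub>PB\<^esub> g = (\<lambda>P\<in>S. - g P)"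
    using assms PBc_minus by (intro minus_equality) (auto simp: PB_simps cong: restrict_cong)
  show "f \<ominus>\<^bsub>PB\<^esub> g = (\<lambda>P\<in>S. f P - g P)" unfolding a_minus_def m by (auto simp: PB_simps cong: restrict_cong)
qed

definition sm_ideal :: "('c \<times> 'c) set => ('c triple => 'c) set" where "sm_ideal L = {f : PBc. ALL c:L. small c f}"

lemma NI_eq: "NI = sm_ideal Lam" by (simp add: top_nilpotent_ideal_eq sm_ideal_def)

lemma ideal_sm: "ideal (sm_ideal L) PB"
proof -
  interpret cring PB by (rule cring_PB)
  have le: "na (f P) <= 1" if "f : PBc" "P : Sc c" for f P c using that Sc_S by (auto simp: PBc_def)
  have m: "(\<lambda>P\<in>S. g P*f P) : sm_ideal L" if "f : sm_ideal L" "g : PBc" for f g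
    using that Sc_S le by (auto simp: sm_ideal_def small_def PBc_mult intro!: na_mult_less1)
  show ?thesis
  proof (rule idealI)
    show "subgroup (sm_ideal L) (add_monoid PB)"
    proof (rule add.subgroupI)
      show "sm_ideal L ~= {}" using PBc_const[of 0] Sc_S by (auto simp: sm_ideal_def small_def)
      show "\<ominus>\<^bsub>PB\<^esub> a : sm_ideal L" if "a : sm_ideal L" for a
        using that Sc_S PBc_minus[of a] by (auto simp: sm_ideal_def small_def PB_minus)
      show "a \<oplus>\<^bsub>PB\<^esub> b : sm_ideal L" if "a : sm_ideal L" "b : sm_ideal L" for a b
        using that Sc_S PBc_add[of a b] by (auto simp: sm_ideal_def small_def PB_simps intro: na_add_less)
    qed (auto simp: sm_ideal_def PB_simps)
    show "a \<otimes>\<^bsub>PB\<^esub> x : sm_ideal L" if "a : sm_ideal L" "x : carrier PB" for a x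
      using m[OF that[unfolded PB_simps]] by (simp add: PB_simps mult.commute cong: restrict_cong)
  qed (auto simp: PB_simps m ring_axioms)
qed

definition cl :: "('c triple => 'c) => ('c triple => 'c) set" where "cl f = NI +>\<^bsub>PB\<^esub> f"

lemma cl_hom: "ring_hom_ring PB RR cl"
  unfolding cl_def[abs_def] reduction_ring_def NI_eq by (rule ideal.rcos_ring_hom_ring[OF ideal_sm])

lemma cring_RR: "cring RR" unfolding reduction_ring_def NI_eq by (rule ideal.quotient_is_cring[OF ideal_sm cring_PB])

lemma carrier_RR: "carrier RR = cl ` PBc" by (auto simp: reduction_ring_def FactRing_def A_RCOSETS_def' PB_simps cl_def)

lemma cl_eq: assumes "f : PBc" "g : PBc" shows "cl f = cl g \<longleftrightarrow> (ALL c:Lam. ALL P:Sc c. na (f P - g P) < 1)"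
proof -
  interpret cring PB by (rule cring_PB)
  have d: "(\<lambda>P\<in>S. f P - g P) : PBc" using assms by (metis PB_minus(1) PB_simps(1) minus_closed)
  have "cl f = cl g \<longleftrightarrow> (\<lambda>P\<in>S. f P - g P) : NI"
    unfolding cl_def NI_eq using quotient_eq_iff_same_a_r_cos[OF ideal_sm, of f g Lam] assms by (simp add: PB_simps PB_minus)
  also have "... \<longleftrightarrow> (ALL c:Lam. ALL P:Sc c. na (f P - g P) < 1)" using d Sc_S by (auto simp: NI_eq sm_ideal_def small_def)
  finally show ?thesis .
qed

text \<open>The prime of functions that are small on the piece c; it will be the generic point of a
  component.\<close>

definition Pc :: "'c \<times> 'c => ('c triple => 'c) set set" where "Pc c = cl ` sm_ideal {c}"

lemma cl_Pc: assumes "c : Lam" "f : PBc" shows "cl f : Pc c \<longleftrightarrow> small c f"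
proof
  assume "cl f : Pc c"
  then obtain g where g: "g : PBc" "small c g" "cl f = cl g" by (auto simp: Pc_def sm_ideal_def)
  hence "na (f P - g P) < 1" if "P : Sc c" for P using cl_eq[OF assms(2) g(1)] assms(1) that by blast
  hence "na ((f P - g P) + g P) < 1" if "P : Sc c" for P using g(2) that by (intro na_add_less) (auto simp: small_def)
  thus "small c f" by (simp add: small_def)
qed (use assms in \<open>auto simp: Pc_def sm_ideal_def\<close>)

lemma cl_ops: "f : PBc ==> g : PBc ==> cl f \<otimes>\<^bsub>RR\<^esub> cl g = cl (\<lambda>P\<in>S. f P*g P)" "f : PBc ==> g : PBc ==> cl f \<oplus>\<^bsub>RR\<^esub> cl g = cl (\<lambda>P\<in>S. f P + g P)"
    "\<one>\<^bsub>RR\<^esub> = cl (\<lambda>P\<in>S. 1)" "\<zero>\<^bsub>RR\<^esub> = cl (\<lambda>P\<in>S. 0)"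
proof -
  interpret ring_hom_ring PB RR cl by (rule cl_hom)
  show "f : PBc ==> g : PBc ==> cl f \<otimes>\<^bsub>RR\<^esub> cl g = cl (\<lambda>P\<in>S. f P*g P)" "f : PBc ==> g : PBc ==> cl f \<oplus>\<^bsub>RR\<^esub> cl g = cl (\<lambda>P\<in>S. f P + g P)"
    "\<one>\<^bsub>RR\<^esub> = cl (\<lambda>P\<in>S. 1)" "\<zero>\<^bsub>RR\<^esub> = cl (\<lambda>P\<in>S. 0)"
    using hom_mult[of f g] hom_add[of f g] hom_one hom_zero by (simp_all add: PB_simps)
qed

lemma Sc_nonempty: assumes "c : Lam" obtains P where "P : Sc c" using Zc_point[OF assms na_1] th_Sc by metis

lemma prime_Pc: assumes c: "c : Lam" shows "primeideal (Pc c) RR"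
proof (rule primeidealI[OF _ cring_RR])
  interpret cring PB by (rule cring_PB)
  show "ideal (Pc c) RR"
    unfolding reduction_ring_def Pc_def cl_def NI_eq by (rule ring_ideal_imp_quot_ideal[OF ideal_sm ideal_sm])
  obtain P where P: "P : Sc c" by (rule Sc_nonempty[OF c])
  have o: "(\<lambda>P\<in>S. 1) : PBc" by (rule PBc_const) simp
  hence "cl (\<lambda>P\<in>S. 1) \<notin> Pc c" using cl_Pc[OF c o] P Sc_S[OF P] by (auto simp: small_def)
  thus "carrier RR ~= Pc c" using o by (auto simp: carrier_RR)
  fix a b assume "a : carrier RR" "b : carrier RR" and ab: "a \<otimes>\<^bsub>RR\<^esub> b : Pc c"
  then obtain f g where f: "f : PBc" "a = cl f" "g : PBc" "b = cl g" by (auto simp: carrier_RR)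
  have m: "small c (\<lambda>P\<in>S. f P*g P)" using ab cl_Pc[OF c PBc_mult[OF f(1,3)]] f by (simp add: cl_ops)
  show "a : Pc c \<or> b : Pc c"
  proof (rule ccontr)
    assume "\<not> ?thesis"
    hence "\<not> small c f" "\<not> small c g" using cl_Pc[OF c] f by auto
    then obtain P where "P : Sc c" "na (f P) = 1" "na (g P) = 1" using small_prime[OF c f(1) _ f(3)] by blast
    thus False using m Sc_S[of P c] by (auto simp: small_def na_mult)
  qed
qed

definition ec :: "'c \<times> 'c => ('c triple => 'c) set" where "ec c = cl (lift (Ec c))"
definition Vc :: "'c \<times> 'c => ('c triple => 'c) set set set" where "Vc c = {P : prime_spectrum RR. ec c \<notin> P}"

lemma Ec_lift: assumes "c : Lam" "d : Lam" "P : Sc d" shows "na (lift (Ec c) P - (if c = d then 1 else 0)) < 1"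
  using Ec_values[OF assms(1,2), of "th P"] assms(3) by (simp add: Sc_def lift_apply)

lemma PBc_Ec: assumes "c : Lam" shows "lift (Ec c) : PBc"
proof -
  have "na (lift (Ec c) P) <= 1" if P: "P : S" for P
  proof -
    obtain d where d: "d : Lam" "P : Sc d" using Sc_cover[OF P] .
    from na_add_le[OF less_imp_le[OF Ec_lift[OF assms d]], of "if c = d then 1 else 0"] show ?thesis by (auto split: if_splits)
  qed
  thus ?thesis by (simp add: PBc_def Aff_lift AZ_Ec)
qed

lemma prime_cases: assumes "P : prime_spectrum RR" "f : PBc" "g : PBc" "!!c Q. c : Lam ==> Q : Sc c ==> na (f Q*g Q) < 1"
  shows "cl f : P \<or> cl g : P"
proof -
  interpret primeideal P RR using assms(1) by (simp add: prime_spectrum_def)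
  have "cl (\<lambda>P\<in>S. f P*g P) = cl (\<lambda>P\<in>S. 0)"
    using assms(4) Sc_S by (subst cl_eq) (auto intro: PBc_mult PBc_const assms)
  hence "cl f \<otimes>\<^bsub>RR\<^esub> cl g = \<zero>\<^bsub>RR\<^esub>" using assms(2,3) by (simp add: cl_ops)
  thus ?thesis using I_prime[of "cl f" "cl g"] assms(2,3) zero_closed by (simp add: carrier_RR)
qed

lemma Pc_Vc: assumes c: "c : Lam" shows "Pc c : Vc c"
proof -
  obtain P where P: "P : Sc c" by (rule Sc_nonempty[OF c])
  have "\<not> na (lift (Ec c) P) < 1" using Ec_lift[OF c c P] na_diff_less[of "lift (Ec c) P" 1 "lift (Ec c) P - 1"] by auto
  hence "ec c \<notin> Pc c" using cl_Pc[OF c PBc_Ec[OF c]] P by (auto simp: ec_def small_def)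
  thus ?thesis using prime_Pc[OF c] by (simp add: Vc_def prime_spectrum_def)
qed

text \<open>A function small on the piece c becomes small everywhere when multiplied by the
  idempotent of c, and a prime in \<open>Vc c\<close> does not contain that idempotent.\<close>

lemma Pc_least: assumes c: "c : Lam" and P: "P : Vc c" shows "Pc c <= P"
proof
  fix x assume "x : Pc c"
  then obtain g where g: "g : PBc" "small c g" "x = cl g" by (auto simp: Pc_def sm_ideal_def)
  have "na (g Q*lift (Ec c) Q) < 1" if d: "d : Lam" "Q : Sc d" for d Q
  proof (cases "c = d")
    case True
    have "na (lift (Ec c) Q) <= 1" using PBc_Ec[OF c] Sc_S[OF d(2)] by (simp add: PBc_def)
    from na_mult_less1[OF this, of "g Q"] g(2) d True show ?thesis by (simp add: small_def mult.commute)
  next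
    case False
    have "na (g Q) <= 1" using g Sc_S[OF d(2)] by (simp add: PBc_def)
    from na_mult_less1[OF this, of "lift (Ec c) Q"] Ec_lift[OF c d] False show ?thesis by simp
  qed
  hence "cl g : P \<or> ec c : P" unfolding ec_def using P PBc_Ec[OF c] g by (intro prime_cases) (auto simp: Vc_def)
  thus "x : P" using P g by (simp add: Vc_def)
qed

lemma Inter_Vc: "c : Lam ==> \<Inter>(Vc c) = Pc c" using Pc_Vc Pc_least by blast

lemma Vc_disjoint: assumes "c : Lam" "d : Lam" "P : Vc c" "P : Vc d" shows "c = d"
proof (rule ccontr)
  assume ne: "c ~= d"
  have "na (lift (Ec c) Q*lift (Ec d) Q) < 1" if e: "e : Lam" "Q : Sc e" for e Q
  proof (cases "c = e")
    case True
    have "na (lift (Ec c) Q) <= 1" using PBc_Ec[OF assms(1)] Sc_S[OF e(2)] by (simp add: PBc_def)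
    from na_mult_less1[OF this, of "lift (Ec d) Q"] Ec_lift[OF assms(2) e] ne True show ?thesis by auto
  next
    case False
    have "na (lift (Ec d) Q) <= 1" using PBc_Ec[OF assms(2)] Sc_S[OF e(2)] by (simp add: PBc_def)
    from na_mult_less1[OF this, of "lift (Ec c) Q"] Ec_lift[OF assms(1) e] False show ?thesis by (simp add: mult.commute)
  qed
  hence "ec c : P \<or> ec d : P" unfolding ec_def using assms PBc_Ec by (intro prime_cases) (auto simp: Vc_def)
  thus False using assms(3,4) by (simp add: Vc_def)
qed

text \<open>In the reduction the idempotents add up to 1, so no prime contains them all.\<close>

lemma Vc_cover: assumes P: "P : prime_spectrum RR" obtains c where "c : Lam" "P : Vc c"
proof (rule ccontr)
  assume n: "\<not> thesis"
  note t = that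
  have e: "ec c : P" if "c : Lam" for c using n t[OF that] P unfolding Vc_def by blast
  interpret primeideal P RR using P by (simp add: prime_spectrum_def)
  define f where "f L = (\<lambda>Q\<in>S. \<Sum>c\<in>L. lift (Ec c) Q)" for L
  have f: "f L : PBc & cl (f L) : P" if "finite L" "L <= Lam" for L using that
  proof (induction L rule: finite_induct)
    case empty
    have "f {} = (\<lambda>Q\<in>S. 0)" by (auto simp: f_def)
    thus ?case using PBc_const[of 0] additive_subgroup.zero_closed[OF additive_subgroup_axioms] by (simp only: cl_ops(4) na_0 zero_le_one simp_thms)
  next
    case (insert c L)
    have "f (insert c L) = (\<lambda>Q\<in>S. lift (Ec c) Q + f L Q)" using insert by (auto simp: f_def fun_eq_iff)
    moreover have "ec c \<oplus>\<^bsub>RR\<^esub> cl (f L) : P" using insert e by (intro additive_subgroup.a_closed[OF additive_subgroup_axioms]) auto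
    ultimately show ?case using insert PBc_Ec[of c] PBc_add[of "lift (Ec c)" "f L"] cl_ops(2)[of "lift (Ec c)" "f L"] unfolding ec_def by (simp only: insert_subset simp_thms)
  qed
  have F: "f Lam : PBc" "cl (f Lam) : P" using f[OF card_Lam(1)] by auto
  have "cl (f Lam) = cl (\<lambda>P\<in>S. 1)"
  proof (subst cl_eq[OF F(1) PBc_const]; (intro ballI)?)
    fix d Q assume d: "d : Lam" "Q : Sc d"
    have "f Lam Q - (\<lambda>P\<in>S. 1) Q = (\<Sum>c\<in>Lam. lift (Ec c) Q - (if c = d then 1 else 0))"
      using Sc_S[OF d(2)] d(1) card_Lam(1) by (simp add: f_def sum_subtractf)
    also have "na ... < 1" using Ec_lift[OF _ d] by (intro na_sum_less) auto
    finally show "na (f Lam Q - (\<lambda>P\<in>S. 1) Q) < 1" .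
  qed simp
  hence "\<one>\<^bsub>RR\<^esub> \<in> P" using F by (simp add: cl_ops)
  thus False using one_imp_carrier I_notcarr by auto
qed

abbreviation Spec where "Spec \<equiv> zariski_topology RR"

lemma topspace_Spec: "topspace Spec = prime_spectrum RR"
proof -
  have "EX f:carrier RR. f \<notin> P" if "P : prime_spectrum RR" for P
  proof -
    interpret primeideal P RR using that by (simp add: prime_spectrum_def)
    show ?thesis using I_notcarr a_subset by auto
  qed
  thus ?thesis unfolding zariski_topology_def topology_generated_by_topspace by blast
qed

lemma openin_Vc: "c : Lam ==> openin Spec (Vc c)" unfolding zariski_topology_def Vc_def using PBc_Ec[of c]
  by (intro topology_generated_by_Basis) (auto simp: carrier_RR ec_def)

text \<open>By \<open>Pc_least\<close> the generic prime lies in every basic open set that meets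
  \<open>Vc c\<close>; intersections and unions inherit this property.\<close>

lemma generic_Vc: assumes c: "c : Lam" and A: "openin Spec A" "P : A" "P : Vc c" shows "Pc c : A"
proof -
  have "generate_topology_on {{P : prime_spectrum RR. f \<notin> P} | f. f : carrier RR} A"
    using A(1) unfolding zariski_topology_def by (rule openin_topology_generated_by)
  hence "ALL P:A \<inter> Vc c. Pc c : A"
  proof induction
    case (Basis s)
    thus ?case using Pc_least[OF c] prime_Pc[OF c] by (auto simp: prime_spectrum_def)
  qed auto
  thus ?thesis using A by blast
qed

text \<open>\<open>Vc c\<close> is connected because its nonempty open subsets share the generic
  point, and its complement is open as the union of the other pieces.\<close>

lemma component_Vc: assumes c: "c : Lam" and P: "P : Vc c" shows "connected_component_of_set Spec P = Vc c"
proof (rule antisym)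
  have "connectedin Spec (Vc c)" unfolding connectedin topspace_Spec
  proof (intro conjI notI)
    assume "EX E1 E2. openin Spec E1 & openin Spec E2 & Vc c <= E1 \<union> E2 & E1 \<inter> E2 \<inter> Vc c = {} & E1 \<inter> Vc c ~= {} & E2 \<inter> Vc c ~= {}"
    then obtain A B where AB: "openin Spec A" "openin Spec B" "A \<inter> B \<inter> Vc c = {}" "A \<inter> Vc c ~= {}" "B \<inter> Vc c ~= {}" by metis
    hence "Pc c : A" "Pc c : B" using generic_Vc[OF c AB(1)] generic_Vc[OF c AB(2)] by blast+
    thus False using Pc_Vc[OF c] AB(3) by blast
  qed (simp add: Vc_def)
  thus "Vc c <= connected_component_of_set Spec P" using P by (rule connected_component_of_maximal)
  have "topspace Spec - Vc c = (\<Union>d\<in>Lam - {c}. Vc d)"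
  proof (intro antisym subsetI)
    fix Q assume Q: "Q : topspace Spec - Vc c"
    then obtain d where "d : Lam" "Q : Vc d" using Vc_cover[of Q] by (auto simp: topspace_Spec)
    thus "Q : (\<Union>d\<in>Lam - {c}. Vc d)" using Q by auto
  next
    fix Q assume "Q : (\<Union>d\<in>Lam - {c}. Vc d)"
    thus "Q : topspace Spec - Vc c" using Vc_disjoint[OF c] by (auto simp: topspace_Spec) (auto simp: Vc_def)
  qed
  hence "openin Spec (topspace Spec - Vc c)" using openin_Vc by auto
  hence "closedin Spec (Vc c)" unfolding closedin_def topspace_Spec by (auto simp: Vc_def)
  hence "connected_component_of_set Spec P <= Vc c \<or> disjnt (connected_component_of_set Spec P) (Vc c)"
    using openin_Vc[OF c] connectedin_connected_component_of by (intro connectedin_clopen_cases) auto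
  moreover have "P : connected_component_of_set Spec P" using P by (simp add: connected_component_of_refl topspace_Spec Vc_def)
  ultimately show "connected_component_of_set Spec P <= Vc c" using P by (auto simp: disjnt_iff)
qed

lemma components: "connected_components_of Spec = Vc ` Lam" "card (connected_components_of Spec) = q*(q - 1)"
proof -
  show e: "connected_components_of Spec = Vc ` Lam"
  proof (intro antisym subsetI)
    fix C assume "C : connected_components_of Spec"
    then obtain P where P: "P : prime_spectrum RR" "C = connected_component_of_set Spec P" by (auto simp: connected_components_of_def topspace_Spec)
    obtain c where c: "c : Lam" "P : Vc c" using Vc_cover[OF P(1)] .
    thus "C : Vc ` Lam" using component_Vc[OF c] P(2) by blast
  next
    fix C assume "C : Vc ` Lam"
    then obtain c where c: "c : Lam" "C = Vc c" by auto
    have "Pc c : topspace Spec" using Pc_Vc[OF c(1)] by (simp add: topspace_Spec Vc_def)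
    thus "C : connected_components_of Spec" using component_Vc[OF c(1) Pc_Vc[OF c(1)]] c(2) unfolding connected_components_of_def by blast
  qed
  have "inj_on Vc Lam" using Pc_Vc Vc_disjoint by (metis inj_onI)
  thus "card (connected_components_of Spec) = q*(q - 1)" unfolding e using card_image card_Lam(2) by metis
qed

end

subsection \<open>Generators of iterated polynomial rings\<close>

lemma up_const_hom: assumes "cring R" shows "up_const R : ring_hom R (UP R)"
proof -
  interpret UP_cring R "UP R" by (rule UP_cring.intro[OF assms])
  show ?thesis using const_ring_hom by (simp add: up_const_def[abs_def])
qed

lemma cring_UP: "cring R ==> cring (UP R)" using UP_cring.UP_cring UP_cring.intro by blast

lemma up_var_closed: assumes "cring R" shows "up_var R : carrier (UP R)"
proof -
  interpret UP_cring R "UP R" by (rule UP_cring.intro[OF assms])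
  show ?thesis by (simp add: up_var_def)
qed

lemma UP_induct: assumes R: "cring R" and p: "p : carrier (UP R)" and const: "!!a. a : carrier R ==> Q (up_const R a)"
    and add: "!!p r. p : carrier (UP R) ==> r : carrier (UP R) ==> Q p ==> Q r ==> Q (p \<oplus>\<^bsub>UP R\<^esub> r)"
    and var: "!!p. p : carrier (UP R) ==> Q p ==> Q (up_var R \<otimes>\<^bsub>UP R\<^esub> p)" shows "Q p"
proof -
  interpret UP_cring R "UP R" by (rule UP_cring.intro[OF R])
  have m: "Q (up_ring.monom (UP R) a n)" if a: "a : carrier R" for a n
  proof (induction n)
    case 0
    show ?case using const[OF a] by (simp add: up_const_def)
  next
    case (Suc n)
    have "up_ring.monom (UP R) (\<one>\<^bsub>R\<^esub> \<otimes>\<^bsub>R\<^esub> a) (1 + n) = up_var R \<otimes>\<^bsub>UP R\<^esub> up_ring.monom (UP R) a n"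
      unfolding up_var_def by (rule monom_mult) (use a in auto)
    thus ?case using var[OF _ Suc] a by simp
  qed
  have s: "finsum (UP R) f A : carrier (UP R) & Q (finsum (UP R) f A)"
    if "finite A" "!!i. i : A ==> f i : carrier (UP R) & Q (f i)" for f and A :: "nat set" using that
  proof (induction A rule: finite_induct)
    case empty
    have "up_const R \<zero>\<^bsub>R\<^esub> = \<zero>\<^bsub>UP R\<^esub>" by (simp add: up_const_def)
    thus ?case using const[of "\<zero>\<^bsub>R\<^esub>"] by simp
  next
    case (insert i A)
    thus ?case by (subst (1 2) P.finsum_insert) (auto intro: add)
  qed
  have "Q (finsum (UP R) (%i. up_ring.monom (UP R) (up_ring.coeff (UP R) p i) i) {..deg R p})"
    using s[of "{..deg R p}" "%i. up_ring.monom (UP R) (up_ring.coeff (UP R) p i) i"] m p by (auto simp: coeff_closed)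
  thus ?thesis by (simp only: up_repr[OF p])
qed

abbreviation "T3 k \<equiv> UP (UP (UP k))"
definition "yT k = up_const (UP (UP k)) (up_const (UP k) (up_var k))"
definition "wT k = up_const (UP (UP k)) (up_var (UP k))"
definition "zT k = up_var (UP (UP k))"

lemma T3_closed: assumes "cring k"
  shows "cring (T3 k)" "poly3_const k : ring_hom k (T3 k)" "yT k : carrier (T3 k)" "wT k : carrier (T3 k)" "zT k : carrier (T3 k)"
proof -
  note c1 = cring_UP[OF assms] and c2 = cring_UP[OF cring_UP[OF assms]]
  show "cring (T3 k)" by (rule cring_UP[OF c2])
  note h = up_const_hom[OF assms] up_const_hom[OF c1] up_const_hom[OF c2]
  have "up_const (UP (UP k)) \<circ> (up_const (UP k) \<circ> up_const k) : ring_hom k (T3 k)" by (rule ring_hom_trans[OF ring_hom_trans[OF h(1) h(2)] h(3)])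
  thus "poly3_const k : ring_hom k (T3 k)" by (simp add: poly3_const_def[abs_def] comp_def)
  show "yT k : carrier (T3 k)" "wT k : carrier (T3 k)" "zT k : carrier (T3 k)"
    unfolding yT_def wT_def zT_def by (intro ring_hom_closed[OF h(3)] ring_hom_closed[OF h(2)] up_var_closed assms c1 c2)+
qed

text \<open>It reduces the claim that every polynomial has a normal form to multiplication by a
  single variable.\<close>

lemma T3_induct: assumes k: "cring k" and p: "p : carrier (T3 k)" and const: "!!a. a : carrier k ==> Q (poly3_const k a)"
    and add: "!!p r. p : carrier (T3 k) ==> r : carrier (T3 k) ==> Q p ==> Q r ==> Q (p \<oplus>\<^bsub>T3 k\<^esub> r)"
    and var: "!!g p. g : {yT k, wT k, zT k} ==> p : carrier (T3 k) ==> Q p ==> Q (g \<otimes>\<^bsub>T3 k\<^esub> p)"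
  shows "Q p"
proof -
  note c1 = cring_UP[OF k] and c2 = cring_UP[OF cring_UP[OF k]]
  note h1 = up_const_hom[OF k] and h2 = up_const_hom[OF c1] and h3 = up_const_hom[OF c2]
  let ?C3 = "up_const (UP (UP k))" and ?C2 = "up_const (UP k)"
  note cl = ring_hom_closed[OF h3] ring_hom_closed[OF h2]
  have 1: "Q (?C3 (?C2 r))" if "r : carrier (UP k)" for r
  proof (rule UP_induct[OF k that])
    show "Q (?C3 (?C2 (up_const k a)))" if "a : carrier k" for a using const[OF that] by (simp add: poly3_const_def)
    fix p assume p: "p : carrier (UP k)" "Q (?C3 (?C2 p))"
    show "Q (?C3 (?C2 (up_var k \<otimes>\<^bsub>UP k\<^esub> p)))"
      using var[of "yT k" "?C3 (?C2 p)"] p up_var_closed[OF k] cl by (simp add: ring_hom_mult[OF h2] ring_hom_mult[OF h3] yT_def)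
    fix r assume "r : carrier (UP k)" "Q (?C3 (?C2 r))"
    thus "Q (?C3 (?C2 (p \<oplus>\<^bsub>UP k\<^esub> r)))" using add p cl by (simp add: ring_hom_add[OF h2] ring_hom_add[OF h3])
  qed
  have 2: "Q (?C3 r)" if "r : carrier (UP (UP k))" for r
  proof (rule UP_induct[OF c1 that])
    show "Q (?C3 (?C2 a))" if "a : carrier (UP k)" for a by (rule 1[OF that])
    fix p assume p: "p : carrier (UP (UP k))" "Q (?C3 p)"
    show "Q (?C3 (up_var (UP k) \<otimes>\<^bsub>UP (UP k)\<^esub> p))"
      using var[of "wT k" "?C3 p"] p up_var_closed[OF c1] cl by (simp add: ring_hom_mult[OF h3] wT_def)
    fix r assume "r : carrier (UP (UP k))" "Q (?C3 r)"
    thus "Q (?C3 (p \<oplus>\<^bsub>UP (UP k)\<^esub> r))" using add p cl by (simp add: ring_hom_add[OF h3])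
  qed
  show ?thesis by (rule UP_induct[where Q = Q, OF c2 p 2 add]) (use var in \<open>auto simp: zT_def\<close>)
qed

lemma UP_eval: assumes R: "cring R" "cring L" "h : ring_hom R L" and s: "s : carrier L"
  obtains E where "E : ring_hom (UP R) L" "ALL a:carrier R. E (up_const R a) = h a" "E (up_var R) = s"
proof -
  interpret UP_pre_univ_prop R L h "UP R" by (rule UP_pre_univ_propI[OF R])
  show thesis
    by (rule that[of "UnivPoly.eval R L h s"]) (use eval_ring_hom[OF s] eval_const[OF s] eval_monom1[OF s] in \<open>auto simp: up_const_def up_var_def\<close>)
qed

lemma T3_eval:
  assumes k: "cring k" and R: "cring R" and h: "h : ring_hom k R" and g: "y : carrier R" "w : carrier R" "z : carrier R"
  obtains E where "E : ring_hom (T3 k) R" "!!a. a : carrier k ==> E (poly3_const k a) = h a" "E (yT k) = y" "E (wT k) = w" "E (zT k) = z"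
proof -
  note c1 = cring_UP[OF k] and c2 = cring_UP[OF cring_UP[OF k]]
  note cl = ring_hom_closed[OF up_const_hom[OF k]] ring_hom_closed[OF up_const_hom[OF c1]] ring_hom_closed[OF up_const_hom[OF c2]]
  obtain E1 where 1: "E1 : ring_hom (UP k) R" "ALL a:carrier k. E1 (up_const k a) = h a" "E1 (up_var k) = y"
    by (rule UP_eval[OF k R h g(1)])
  obtain E2 where 2: "E2 : ring_hom (UP (UP k)) R" "ALL a:carrier (UP k). E2 (up_const (UP k) a) = E1 a" "E2 (up_var (UP k)) = w"
    by (rule UP_eval[OF c1 R 1(1) g(2)])
  obtain E3 where 3: "E3 : ring_hom (T3 k) R" "ALL a:carrier (UP (UP k)). E3 (up_const (UP (UP k)) a) = E2 a" "E3 (up_var (UP (UP k))) = z"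
    by (rule UP_eval[OF c2 R 2(1) g(3)])
  show thesis by (rule that[OF 3(1)]) (simp_all add: poly3_const_def yT_def wT_def zT_def 1 2 3 cl up_var_closed k c1 c2)
qed

subsection \<open>Normal forms\<close>

text \<open>The Laurent monomial y^i, with w in the role of the inverse of y.\<close>

definition mni :: "('x, 'm) ring_scheme => 'x => 'x => int => 'x"
  where "mni K y w i = (if 0 <= i then y [^]\<^bsub>K\<^esub> nat i else w [^]\<^bsub>K\<^esub> nat (- i))"

definition trmr :: "('x, 'm) ring_scheme => ('c => 'x) => 'x => 'x => 'x => 'c => int => nat => 'x"
  where "trmr K C y w z a i l = C a \<otimes>\<^bsub>K\<^esub> (mni K y w i \<otimes>\<^bsub>K\<^esub> z [^]\<^bsub>K\<^esub> l)"

text \<open>The counterpart of \<open>nsum\<close> in an arbitrary ring with a map C of constants;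
  it is used for the polynomial ring, its quotients and the ring of power-bounded functions.\<close>

definition nfr :: "('x, 'm) ring_scheme => ('c => 'x) => 'x => 'x => 'x => (int \<times> nat => 'c) => (int \<times> nat) set => 'x"
  where "nfr K C y w z b A = finsum K (%t. trmr K C y w z (b t) (fst t) (snd t)) A"

lemma hom_nfr: assumes K: "cring K" "cring L" "h : ring_hom K L" and g: "y : carrier K" "w : carrier K" "z : carrier K"
    and C: "!!t. t : A ==> C (b t) : carrier K" and D: "!!t. t : A ==> h (C (b t)) = D (b t)"
  shows "h (nfr K C y w z b A) = nfr L D (h y) (h w) (h z) b A"
proof -
  interpret ring_hom_cring K L h by (intro ring_hom_cring.intro ring_hom_cring_axioms.intro K)
  have m: "mni K y w i : carrier K" "h (mni K y w i) = mni L (h y) (h w) i" for i using g by (simp_all add: mni_def del: pow_nat)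
  have "(%t. trmr K C y w z (b t) (fst t) (snd t)) : A \<rightarrow> carrier K" using C g m by (auto simp: trmr_def)
  hence "h (nfr K C y w z b A) = finsum L (h \<circ> (%t. trmr K C y w z (b t) (fst t) (snd t))) A" unfolding nfr_def by (rule hom_finsum)
  also have "... = nfr L D (h y) (h w) (h z) b A"
  proof -
    have "D (b t) : carrier L" if "t : A" for t using hom_closed[OF C[OF that]] D[OF that] by simp
    moreover have "mni L (h y) (h w) i : carrier L" for i using hom_closed[OF m(1)] m(2) by metis
    ultimately show ?thesis unfolding nfr_def using C D g m by (intro S.finsum_cong') (auto simp: trmr_def simp del: pow_nat)
  qed
  finally show ?thesis .
qed

text \<open>A ring that satisfies the equation of the curve with \<zeta> = 1, with constants from
  the valuation ring of C. It is instantiated by the coordinate ring of the curve, whose elements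
  thereby get normal forms.\<close>

locale nf_ring = lt_affinoid F v \<pi> q p + K: cring K
  for F :: "'c::{field_char_0,complete_space} set" and v \<pi> q p and K :: "('x, 'm) ring_scheme" (structure) +
  fixes C :: "'c => 'x" and y w z :: 'x assumes C_closed: "na a <= 1 ==> C a : carrier K"
    and C_add: "na a <= 1 ==> na b <= 1 ==> C (a + b) = C a \<oplus> C b"
    and C_mult: "na a <= 1 ==> na b <= 1 ==> C (a*b) = C a \<otimes> C b" and C_1: "C 1 = \<one>"
    and gens: "y : carrier K" "w : carrier K" "z : carrier K"
    and yw: "y \<otimes> w = \<one>" and zq: "z [^] q = y [^] mm \<oplus> w [^] mm"
begin

abbreviation M where "M \<equiv> mni K y w"
abbreviation tr where "tr \<equiv> trmr K C y w z"

lemma C_0: "C 0 = \<zero>" using C_add[of 0 0] C_closed[of 0] K.add.r_cancel_one by simp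

lemma M_closed: "M i : carrier K" using gens by (simp add: mni_def del: pow_nat)

lemma M_of_nat: "M (int n) = y [^] n" "M (- int n) = w [^] n"
  by (simp add: mni_def del: pow_nat, cases "n = 0", simp_all add: mni_def del: pow_nat)

lemma M_step: "y \<otimes> M i = M (i + 1)" "w \<otimes> M i = M (i - 1)"
proof -
  have a: "x \<otimes> (x' \<otimes> x' [^] n) = x' [^] n" if "x \<otimes> x' = \<one>" "x : carrier K" "x' : carrier K" for x x' and n :: nat
    using that by (simp add: K.m_assoc[symmetric])
  have wy: "w \<otimes> y = \<one>" using yw gens K.m_comm by simp
  have "(EX n. i = int n) \<or> (EX n. i = - int (Suc n))" by (metis int_cases)
  thus "y \<otimes> M i = M (i + 1)"
  proof (elim disjE exE)
    fix n assume i: "i = int n"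
    hence "i + 1 = int (Suc n)" by simp
    thus ?thesis using i M_of_nat(1)[of "Suc n"] M_of_nat(1)[of n] gens K.nat_pow_Suc2[of y n] by metis
  next
    fix n assume i: "i = - int (Suc n)"
    hence "i + 1 = - int n" by simp
    thus ?thesis using i M_of_nat(2)[of "Suc n"] M_of_nat(2)[of n] a[OF yw, of n] gens K.nat_pow_Suc2[of w n] by metis
  qed
  have "(EX n. i = - int n) \<or> (EX n. i = int (Suc n))" by (metis int_cases add.inverse_inverse of_nat_0 minus_zero not0_implies_Suc)
  thus "w \<otimes> M i = M (i - 1)"
  proof (elim disjE exE)
    fix n assume i: "i = - int n"
    hence "i - 1 = - int (Suc n)" by simp
    thus ?thesis using i M_of_nat(2)[of "Suc n"] M_of_nat(2)[of n] gens K.nat_pow_Suc2[of w n] by metis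
  next
    fix n assume i: "i = int (Suc n)"
    hence "i - 1 = int n" by simp
    thus ?thesis using i M_of_nat(1)[of "Suc n"] M_of_nat(1)[of n] a[OF wy, of n] gens K.nat_pow_Suc2[of y n] by metis
  qed
qed

lemma M_power: "y [^] n \<otimes> M i = M (i + int n)" "w [^] n \<otimes> M i = M (i - int n)"
proof (induction n)
  case (Suc n)
  have "y \<otimes> (y [^] n \<otimes> M i) = M (i + int n + 1)" "w \<otimes> (w [^] n \<otimes> M i) = M (i - int n - 1)"
    unfolding Suc by (rule M_step)+
  thus "y [^] Suc n \<otimes> M i = M (i + int (Suc n))" "w [^] Suc n \<otimes> M i = M (i - int (Suc n))"
    unfolding K.nat_pow_Suc2[OF gens(1)] K.nat_pow_Suc2[OF gens(2)]
    by (simp_all only: K.m_assoc gens M_closed K.nat_pow_closed) (simp_all add: algebra_simps)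
qed (simp_all add: M_closed)

lemma tr_closed: "na a <= 1 ==> tr a i l : carrier K" using gens M_closed C_closed by (simp add: trmr_def)

definition Nf :: "'x set" where "Nf = {x. EX b A. ncoef b A & (ALL t. na (b t) <= 1) & x = nfr K C y w z b A}"

lemma Nf_closed: "x : Nf ==> x : carrier K" unfolding Nf_def nfr_def using tr_closed by (auto intro!: K.finsum_closed)

lemma nfr_extend: assumes "ncoef b A" "!!t. na (b t) <= 1" "A <= B" "finite B" shows "nfr K C y w z b A = nfr K C y w z b B"
proof -
  have "tr (b t) (fst t) (snd t) = \<zero>" if "t : B - A" for t
  proof -
    have "ALL t. t \<notin> A --> b t = 0" using assms(1) unfolding ncoef_def by blast
    hence "b t = 0" using that by blast
    thus ?thesis using gens M_closed by (simp add: trmr_def C_0)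
  qed
  thus ?thesis unfolding nfr_def using assms tr_closed by (intro K.add.finprod_mono_neutral_cong_left) auto
qed

lemma Nf_add: assumes "x : Nf" "x' : Nf" shows "x \<oplus> x' : Nf"
proof -
  obtain b A d B where *: "ncoef b A" "!!t. na (b t) <= 1" "x = nfr K C y w z b A" "ncoef d B" "!!t. na (d t) <= 1" "x' = nfr K C y w z d B"
    using assms unfolding Nf_def by blast
  have fin: "finite (A \<union> B)" using*by (auto simp: ncoef_def)
  have n: "ncoef (%t. b t + 1*d t) (A \<union> B)" by (rule nsum_add(2)[OF *(1,4)])
  have bd: "na (b t + 1*d t) <= 1" for t using na_add_le[OF *(2,5)] by simp
  have "x \<oplus> x' = nfr K C y w z b (A \<union> B) \<oplus> nfr K C y w z d (A \<union> B)"
    using*nfr_extend[OF *(1,2) _ fin] nfr_extend[OF *(4,5) _ fin] by simp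
  also have "... = nfr K C y w z (%t. b t + 1*d t) (A \<union> B)" unfolding nfr_def
  proof (subst K.finsum_addf[symmetric]; (intro K.add.finprod_cong')?)
    fix t show "tr (b t) (fst t) (snd t) \<oplus> tr (d t) (fst t) (snd t) = tr (b t + 1*d t) (fst t) (snd t)"
      using *(2,5) C_closed gens M_closed by (simp add: trmr_def C_add K.l_distr)
  qed (use*tr_closed bd in auto)
  finally show ?thesis using n bd unfolding Nf_def by blast
qed

lemma Nf_tr: assumes "na a <= 1" "l < q" shows "tr a i l : Nf"
proof -
  define b where "b t = (if t = (i, l) then a else 0)" for t
  have "ncoef b {(i, l)}" using assms by (auto simp: ncoef_def b_def)
  moreover have "nfr K C y w z b {(i, l)} = tr a i l"
    using tr_closed[OF assms(1)] by (simp add: nfr_def b_def K.finsum_insert[of "{}", simplified])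
  moreover have "na (b t) <= 1" for t using assms by (simp add: b_def)
  ultimately show ?thesis unfolding Nf_def by (intro CollectI exI[of _ b] exI[of _ "{(i, l)}"]) simp
qed

lemma Nf_sum: "finite A ==> (!!t. t : A ==> f t : Nf) ==> finsum K f A : Nf"
proof (induction A rule: finite_induct)
  case empty
  have "tr 0 0 0 = \<zero>" using gens M_closed by (simp add: trmr_def C_0)
  thus ?case using Nf_tr[of 0 0 0] q_pos by simp
next
  case (insert t A)
  thus ?case using Nf_closed by (subst K.finsum_insert) (auto intro: Nf_add)
qed

lemma Nf_linear:
  assumes x: "x : Nf" and g: "g : carrier K" and gt: "!!a i l. na a <= 1 ==> l < q ==> g \<otimes> tr a i l : Nf"
  shows "g \<otimes> x : Nf"
proof -
  obtain b A where *: "ncoef b A" "!!t. na (b t) <= 1" "x = nfr K C y w z b A" using x unfolding Nf_def by blast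
  have "g \<otimes> x = finsum K (%t. g \<otimes> tr (b t) (fst t) (snd t)) A"
    unfolding *(3) nfr_def using*g tr_closed by (intro K.finsum_rdistr) (auto simp: ncoef_def)
  also have "... \<in> Nf" using*by (intro Nf_sum gt) (auto simp: ncoef_def)
  finally show ?thesis .
qed

lemma Nf_gens: assumes x: "x : Nf" shows "y \<otimes> x : Nf" "w \<otimes> x : Nf" "z \<otimes> x : Nf"
proof -
  have s: "g \<otimes> tr a i l = C a \<otimes> ((g \<otimes> M i) \<otimes> z [^] l)" if "na a <= 1" "g : carrier K" for a i l g
    using that C_closed M_closed gens by (simp add: trmr_def K.m_ac)
  show "y \<otimes> x : Nf"
    by (rule Nf_linear[OF x gens(1)]) (simp add: s gens M_step Nf_tr trmr_def[of K C y w z, symmetric])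
  show "w \<otimes> x : Nf"
    by (rule Nf_linear[OF x gens(2)]) (simp add: s gens M_step Nf_tr trmr_def[of K C y w z, symmetric])
  show "z \<otimes> x : Nf"
  proof (rule Nf_linear[OF x gens(3)])
    fix a i l assume a: "na a <= 1" "l < q"
    have e: "z \<otimes> tr a i l = tr a i (Suc l)"
      using a C_closed M_closed gens by (simp add: trmr_def K.nat_pow_Suc2 K.m_ac)
    show "z \<otimes> tr a i l : Nf"
    proof (cases "Suc l < q")
      case True
      thus ?thesis unfolding e by (intro Nf_tr a)
    next
      case False
      hence "Suc l = q" using a by simp
      hence "tr a i (Suc l) = C a \<otimes> (M i \<otimes> (y [^] mm \<oplus> w [^] mm))" by (simp add: trmr_def zq del: K.nat_pow_Suc)
      also have "M i \<otimes> (y [^] mm \<oplus> w [^] mm) = y [^] mm \<otimes> M i \<oplus> w [^] mm \<otimes> M i"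
        using M_closed gens by (simp add: K.r_distr K.m_comm)
      also have "C a \<otimes> ... = tr a (i + int mm) 0 \<oplus> tr a (i - int mm) 0"
        unfolding M_power using a C_closed M_closed by (simp add: trmr_def K.r_distr)
      finally show ?thesis unfolding e using Nf_tr[of a 0] a q_pos by (simp add: Nf_add)
    qed
  qed
qed

lemma Nf_C: assumes "na a <= 1" shows "C a : Nf"
proof -
  have "tr a 0 0 = C a" using C_closed[OF assms] by (simp add: trmr_def mni_def del: pow_nat)
  thus ?thesis using Nf_tr[OF assms q_pos, of 0] by simp
qed

end

context lubin_tate_setting
begin

subsection \<open>Coordinate rings of the components\<close>

lemma residue_hom: "residue v : ring_hom (val_ring v UNIV) (residue_field v UNIV)"
  using residue_ring_hom[OF subf_UNIV] by (simp add: residue_def[abs_def])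

lemma residue_eq: "na a <= 1 ==> na b <= 1 ==> residue v a = residue v b \<longleftrightarrow> na (a - b) < 1"
  using residue_eq_iff[OF subf_UNIV, of a b] by (simp add: residue_def v_nonneg_na v_pos_na)

lemma carrier_V: "carrier (val_ring v UNIV) = {a. na a <= 1}" by (simp add: carrier_val_ring v_nonneg_na)

lemma carrier_k: "carrier (residue_field v UNIV) = residue v ` {a. na a <= 1}"
  using carrier_residue_field[of UNIV] by (simp add: carrier_V residue_def[abs_def])

lemma cring_k: "cring (residue_field v UNIV)" by (rule fieldE(1)[OF field_residue_field[OF subf_UNIV]])

lemma residue_ops: assumes "na a <= 1" "na b <= 1" shows "residue v a : carrier (residue_field v UNIV)"
    "residue v (a + b) = residue v a \<oplus>\<^bsub>residue_field v UNIV\<^esub> residue v b"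
    "residue v (a*b) = residue v a \<otimes>\<^bsub>residue_field v UNIV\<^esub> residue v b"
    "residue v 1 = \<one>\<^bsub>residue_field v UNIV\<^esub>"
  using assms ring_hom_add[OF residue_hom, of a b] ring_hom_mult[OF residue_hom, of a b] ring_hom_one[OF residue_hom]
  by (auto simp: carrier_k carrier_V val_ring_ops)

end

context lt_reduction
begin

abbreviation kk where "kk \<equiv> residue_field v UNIV"
abbreviation cst where "cst a \<equiv> (\<lambda>P\<in>S. a)"
definition "yy = lift B.et"
definition "ww = lift B.ei"
text \<open>Division by a = \<open>fst c\<close> absorbs the factor W: since a^q = a, the q-th power
  of Z/a is close to \<eta>^mm + \<eta>^(-mm).\<close>

definition "zz c = lift (%P. B.ZZ P/fst c)"
definition "Qc c = RR Quot Pc c"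
definition kq :: "'c \<times> 'c => ('c triple => 'c) => ('c triple => 'c) set set" where "kq c f = Pc c +>\<^bsub>RR\<^esub> cl f"

lemma fst_Lam: assumes "c : Lam" shows "na (fst c) = 1" "fst c ~= 0" "fst c^q = fst c"
  using assms na_mu mu_nz mu_fq by (auto simp: Lam_def fq_def)

lemma PBc_gens: "yy : PBc" "ww : PBc" "c : Lam ==> zz c : PBc"
proof -
  have l: "lift g : PBc" if "AZ g" "!!P. P : Zs ==> na (g P) <= 1" for g
    using Aff_lift[OF that(1)] that(2) by (simp add: PBc_def lift_apply th_Zs)
  show "yy : PBc" "ww : PBc" unfolding yy_def ww_def by (rule l; simp add: AZ_functions na_coords)+
  assume c: "c : Lam"
  have "AZ (B.kc (1/fst c)*B.ZZ)" by (intro AZ AZ_functions)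
  thus "zz c : PBc"
    unfolding zz_def using fst_Lam[OF c] Fil0_na[OF B.Fil_ZZ] by (intro l) (simp_all add: B.kc_def times_fun_def na_divide)
qed

lemma PB_pow: "f [^]\<^bsub>PB\<^esub> (n::nat) = (\<lambda>P\<in>S. f P^n)"
proof (induction n)
  case (Suc n)
  interpret cring PB by (rule cring_PB)
  show ?case unfolding nat_pow_Suc Suc by (auto simp: PB_simps fun_eq_iff mult.commute)
qed (simp add: PB_simps)

text \<open>The rescaling of Z by \<open>fst c\<close> appears as powers of its inverse in the
  coefficients; they are units and do not affect smallness.\<close>

lemma nfr_PB: assumes c: "c : Lam" and A: "finite A" and b: "!!t. na (b t) <= 1" and P: "P : S"
  shows "nfr PB cst yy ww (zz c) b A P = nsum (%t. b t*inverse (fst c)^snd t) A (th P)" "nfr PB cst yy ww (zz c) b A : PBc"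
proof -
  interpret cring PB by (rule cring_PB)
  have cl: "trmr PB cst yy ww (zz c) (b t) i l : carrier PB" for t i l
  proof -
    have "yy : carrier PB" "ww : carrier PB" "zz c : carrier PB" "cst (b t) : carrier PB"
      using PBc_gens c PBc_const[OF b] by (simp_all add: PB_simps)
    thus ?thesis by (simp add: trmr_def mni_def del: pow_nat)
  qed
  have v: "trmr PB cst yy ww (zz c) (b t) i l P = b t*inverse (fst c)^l*(B.et (th P) powi i*B.ZZ (th P)^l)" for t i l
    using P ei_et[of "th P"] fst_Lam[OF c]
    by (auto simp: trmr_def mni_def PB_simps PB_pow yy_def ww_def zz_def lift_apply th_Zs power_int_def power_divide divide_inverse power_inverse power_mult_distrib mult.commute simp del: pow_nat)
  define n where "n = nfr PB cst yy ww (zz c) b"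
  have "n A : PBc & n A P = nsum (%t. b t*inverse (fst c)^snd t) A (th P)" using A
  proof (induction A rule: finite_induct)
    case empty
    have e: "n {} = cst 0" unfolding n_def nfr_def finsum_empty PB_simps ..
    show ?case unfolding e by (rule conjI[OF PBc_const]) (use P in \<open>simp_all add: nsum_def\<close>)
  next
    case (insert t A)
    have "n (insert t A) = trmr PB cst yy ww (zz c) (b t) (fst t) (snd t) \<oplus>\<^bsub>PB\<^esub> n A"
      unfolding n_def nfr_def using insert cl by (intro finsum_insert) auto
    hence e: "n (insert t A) = (\<lambda>P\<in>S. trmr PB cst yy ww (zz c) (b t) (fst t) (snd t) P + n A P)" by (simp only: PB_simps)
    show ?case unfolding e using insert cl P v[of t "fst t" "snd t"] by (intro conjI PBc_add) (simp_all add: PB_simps nsum_def)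
  qed
  thus "nfr PB cst yy ww (zz c) b A P = nsum (%t. b t*inverse (fst c)^snd t) A (th P)" "nfr PB cst yy ww (zz c) b A : PBc"
    unfolding n_def by blast+
qed

lemma kq_hom: assumes c: "c : Lam" shows "cring (Qc c)" "kq c : ring_hom PB (Qc c)" "carrier (Qc c) = kq c ` PBc"
proof -
  interpret primeideal "Pc c" RR by (rule prime_Pc[OF c])
  show "cring (Qc c)" unfolding Qc_def by (rule quotient_is_cring[OF cring_RR])
  have "cl : ring_hom PB RR" using cl_hom by (simp add: ring_hom_ring_def ring_hom_ring_axioms_def)
  thus "kq c : ring_hom PB (Qc c)" using ring_hom_trans[OF _ rcos_ring_hom] by (simp add: kq_def[abs_def] Qc_def comp_def)
  show "carrier (Qc c) = kq c ` PBc" by (auto simp: Qc_def FactRing_def A_RCOSETS_def' kq_def carrier_RR)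
qed

lemma kq_eq: assumes c: "c : Lam" and "f : PBc" "g : PBc" shows "kq c f = kq c g \<longleftrightarrow> (ALL P:Sc c. na (f P - g P) < 1)"
proof -
  interpret R: cring RR by (rule cring_RR)
  interpret P: cring PB by (rule cring_PB)
  interpret h: ring_hom_ring PB RR cl by (rule cl_hom)
  have d: "(\<lambda>P\<in>S. f P - g P) : PBc" using assms by (metis PB_minus(1) PB_simps(1) P.minus_closed)
  have "cl f \<ominus>\<^bsub>RR\<^esub> cl g = cl (f \<ominus>\<^bsub>PB\<^esub> g)"
    using assms h.hom_add[of f "\<ominus>\<^bsub>PB\<^esub> g"] h.hom_a_inv[of g] P.a_inv_closed[of g] by (simp add: a_minus_def PB_simps)
  hence "kq c f = kq c g \<longleftrightarrow> cl (\<lambda>P\<in>S. f P - g P) : Pc c"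
    unfolding kq_def using R.quotient_eq_iff_same_a_r_cos[OF primeideal.axioms(1)[OF prime_Pc[OF c]], of "cl f" "cl g"] assms
    by (simp add: PB_minus carrier_RR)
  thus ?thesis using cl_Pc[OF c d] Sc_S by (auto simp: small_def)
qed

lemma kq_ops: assumes c: "c : Lam" and f: "f : PBc" "g : PBc"
  shows "kq c f : carrier (Qc c)" "kq c (\<lambda>P\<in>S. f P + g P) = kq c f \<oplus>\<^bsub>Qc c\<^esub> kq c g" "kq c (\<lambda>P\<in>S. f P*g P) = kq c f \<otimes>\<^bsub>Qc c\<^esub> kq c g"
    "kq c (\<lambda>P\<in>S. f P^n) = kq c f [^]\<^bsub>Qc c\<^esub> n" "kq c (cst 1) = \<one>\<^bsub>Qc c\<^esub>" "kq c (cst 0) = \<zero>\<^bsub>Qc c\<^esub>"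
proof -
  interpret P: cring PB by (rule cring_PB)
  interpret Q: cring "Qc c" by (rule kq_hom[OF c])
  interpret ring_hom_cring PB "Qc c" "kq c" by (intro ring_hom_cring.intro ring_hom_cring_axioms.intro kq_hom c P.is_cring Q.is_cring)
  show "kq c f : carrier (Qc c)" "kq c (\<lambda>P\<in>S. f P + g P) = kq c f \<oplus>\<^bsub>Qc c\<^esub> kq c g" "kq c (\<lambda>P\<in>S. f P*g P) = kq c f \<otimes>\<^bsub>Qc c\<^esub> kq c g"
    "kq c (\<lambda>P\<in>S. f P^n) = kq c f [^]\<^bsub>Qc c\<^esub> n" "kq c (cst 1) = \<one>\<^bsub>Qc c\<^esub>" "kq c (cst 0) = \<zero>\<^bsub>Qc c\<^esub>"
    using f hom_closed[of f] hom_add[of f g] hom_mult[of f g] hom_pow[of f n] hom_one hom_zero by (simp_all add: PB_simps PB_pow)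
qed

text \<open>Constants with the same residue have the same class, so the choice of a representative
  does not matter.\<close>

lemma k_to_Q: assumes c: "c : Lam" obtains h where "h : ring_hom kk (Qc c)" "!!a. na a <= 1 ==> h (residue v a) = kq c (cst a)"
proof -
  define h where "h r = kq c (cst (SOME a. na a <= 1 & residue v a = r))" for r
  have h: "h (residue v a) = kq c (cst a)" if a: "na a <= 1" for a
  proof -
    define b where "b = (SOME b. na b <= 1 & residue v b = residue v a)"
    have b: "na b <= 1 & residue v b = residue v a" unfolding b_def by (rule someI[of _ a]) (use a in simp)
    hence "na (b - a) < 1" using residue_eq a by blast
    thus ?thesis unfolding h_def b_def[symmetric] using a b kq_eq[OF c PBc_const PBc_const] Sc_S by auto
  qed
  have "h : ring_hom kk (Qc c)"
  proof (rule ring_hom_memI)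
    fix r s assume "r : carrier kk" "s : carrier kk"
    then obtain a b where ab: "r = residue v a" "na a <= 1" "s = residue v b" "na b <= 1" by (auto simp: carrier_k)
    have e: "na (a + b) <= 1" "na (a*b) <= 1" using ab by (auto intro: na_add_le na_mult_le1)
    have r: "(\<lambda>P\<in>S. cst a P + cst b P) = cst (a + b)" "(\<lambda>P\<in>S. cst a P*cst b P) = cst (a*b)" by auto
    show "h r : carrier (Qc c)" "h (r \<otimes>\<^bsub>kk\<^esub> s) = h r \<otimes>\<^bsub>Qc c\<^esub> h s" "h (r \<oplus>\<^bsub>kk\<^esub> s) = h r \<oplus>\<^bsub>Qc c\<^esub> h s"
      using kq_ops[OF c PBc_const[OF ab(2)] PBc_const[OF ab(4)]] unfolding ab(1,3) residue_ops(2,3)[OF ab(2,4), symmetric] h[OF ab(2)] h[OF ab(4)] h[OF e(1)] h[OF e(2)] r by simp_all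
  next
    show "h \<one>\<^bsub>kk\<^esub> = \<one>\<^bsub>Qc c\<^esub>"
      using h[of 1] residue_ops(4)[of 1 1] kq_ops(5)[OF c PBc_gens(1,1)] by simp
  qed
  thus thesis using that h by blast
qed

text \<open>\<open>E\<close> evaluates k[y][w][Z] at the classes of \<eta>, its inverse and
  Z/\<open>fst c\<close>. It is onto by the approximation \<open>rep\<close>. Its kernel contains
  the curve ideal by \<open>ZZ_rel\<close>, and equals it because modulo that ideal everything is a
  normal form, and a normal form with image 0 has zero coefficients by
  \<open>nsum_small_Sc\<close>.\<close>

lemma component_iso: assumes c: "c : Lam" shows "isomorphic_to_curve v \<pi> q S (Vc c) (residue v 1)"
proof -
  let ?Q = "Qc c" and ?T = "T3 kk" and ?\<zeta> = "residue v 1"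
  define pc where "pc a = poly3_const kk (residue v a)" for a
  interpret T: cring ?T by (rule T3_closed(1)[OF cring_k])
  interpret Q: cring ?Q by (rule kq_hom[OF c])
  note gT = T3_closed(3-5)[OF cring_k]
  have pc: "pc a : carrier ?T" "pc (a + b) = pc a \<oplus>\<^bsub>?T\<^esub> pc b" "pc (a*b) = pc a \<otimes>\<^bsub>?T\<^esub> pc b" "pc 1 = \<one>\<^bsub>?T\<^esub>"
    if "na a <= 1" "na b <= 1" for a b
    using residue_ops[OF that] residue_ops(1)[OF that(2,2)] ring_hom_closed[OF T3_closed(2)[OF cring_k]] ring_hom_add[OF T3_closed(2)[OF cring_k]]
      ring_hom_mult[OF T3_closed(2)[OF cring_k]] ring_hom_one[OF T3_closed(2)[OF cring_k]] by (simp_all add: pc_def)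
  obtain h where h: "h : ring_hom kk ?Q" "!!a. na a <= 1 ==> h (residue v a) = kq c (cst a)" by (rule k_to_Q[OF c]) blast
  note kg = kq_ops(1)[OF c PBc_gens(1,1)] kq_ops(1)[OF c PBc_gens(2,2)] kq_ops(1)[OF c PBc_gens(3)[OF c] PBc_gens(1)]
  obtain E where E: "E : ring_hom ?T ?Q" "!!a. a : carrier kk ==> E (poly3_const kk a) = h a" "E (yT kk) = kq c yy" "E (wT kk) = kq c ww" "E (zT kk) = kq c (zz c)"
    by (rule T3_eval[OF cring_k Q.is_cring h(1) kg]) blast
  interpret E: ring_hom_cring ?T ?Q E by (intro ring_hom_cring.intro ring_hom_cring_axioms.intro T.is_cring Q.is_cring E(1))
  have hr: "ring_hom_ring ?T ?Q E" by (rule ring_hom_ringI2[OF T.ring_axioms Q.ring_axioms E(1)])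
  have Epc: "E (pc a) = kq c (cst a)" if "na a <= 1" for a
    unfolding pc_def using E(2)[of "residue v a"] residue_ops(1)[OF that that] h(2)[OF that] by simp
  define tn where "tn = nfr ?T pc (yT kk) (wT kk) (zT kk)"
  have tn_closed: "tn b A : carrier ?T" if "!!t. na (b t) <= 1" for b A
    unfolding tn_def nfr_def trmr_def mni_def using pc(1)[OF that that] gT by (intro T.finsum_closed) (auto simp del: pow_nat)
  have Etn: "E (tn b A) = kq c (nfr PB cst yy ww (zz c) b A)" if b: "!!t. na (b t) <= 1" for b A
  proof -
    have "E (tn b A) = nfr ?Q (%a. kq c (cst a)) (E (yT kk)) (E (wT kk)) (E (zT kk)) b A"
      unfolding tn_def by (rule hom_nfr[OF T.is_cring Q.is_cring E(1) gT]) (use pc(1)[OF b b] Epc[OF b] in auto)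
    also have "... = kq c (nfr PB cst yy ww (zz c) b A)" unfolding E(3-5)
      by (rule hom_nfr[where C = "%a. cst a" and D = "%a. kq c (cst a)", OF cring_PB kq_hom(1,2)[OF c], symmetric])
        (use PBc_gens c PBc_const[OF b] in \<open>auto simp: PB_simps\<close>)
    finally show ?thesis .
  qed
  have surj: "E ` carrier ?T = carrier ?Q"
  proof (intro antisym subsetI)
    fix x assume "x : carrier ?Q"
    then obtain f where f: "f : PBc" "x = kq c f" using kq_hom(3)[OF c] by auto
    obtain b A where b: "ncoef b A" "ALL t. na (b t) <= 1" "!!P. P : Sc c ==> na (f P - nsum b A (th P)) <= na nu"
      using rep[OF c, of f] f(1) Sc_S unfolding PBc_def by blast
    \<comment> \<open>Compensates the division of Z by \<open>fst c\<close> in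
      \<open>zz\<close>.\<close>
    define d where "d t = b t*fst c^snd t" for t
    have d: "na (d t) <= 1" for t unfolding d_def by (rule na_mult_le1[OF spec[OF b(2)]]) (simp add: na_power fst_Lam[OF c])
    have db: "d t*inverse (fst c)^snd t = b t" for t using fst_Lam[OF c] by (simp add: d_def power_inverse)
    have A: "finite A" using b(1) by (simp add: ncoef_def)
    obtain P0 where P0: "P0 : S" by (rule S_nonempty)
    have "kq c (nfr PB cst yy ww (zz c) d A) = kq c f"
    proof (subst kq_eq[OF c nfr_PB(2)[OF c A d P0] f(1)], intro ballI)
      fix P assume P: "P : Sc c"
      show "na (nfr PB cst yy ww (zz c) d A P - f P) < 1"
        unfolding nfr_PB(1)[OF c A d Sc_S[OF P]] db using b(3)[OF P] na_nu_less na_diff_commute[of "f P"] by simp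
    qed
    hence "x = E (tn d A)" using Etn[OF d] f(2) by simp
    thus "x : E ` carrier ?T" by (rule image_eqI[OF _ tn_closed[OF d]])
  next
    fix x assume "x : E ` carrier ?T"
    thus "x : carrier ?Q" using E.hom_closed by (elim imageE) simp
  qed
  define J where "J = curve_ideal kk q ?\<zeta>"
  define g1 where "g1 = yT kk \<otimes>\<^bsub>?T\<^esub> wT kk \<ominus>\<^bsub>?T\<^esub> \<one>\<^bsub>?T\<^esub>"
  define g2 where "g2 = zT kk [^]\<^bsub>?T\<^esub> q \<ominus>\<^bsub>?T\<^esub> pc 1 \<otimes>\<^bsub>?T\<^esub> (yT kk [^]\<^bsub>?T\<^esub> mm \<oplus>\<^bsub>?T\<^esub> wT kk [^]\<^bsub>?T\<^esub> mm)"
  have J: "J = Idl\<^bsub>?T\<^esub> {g1, g2}"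
    by (simp add: J_def curve_ideal_def Let_def g1_def g2_def yT_def wT_def zT_def mm_def pc_def)
  have p1: "pc 1 = \<one>\<^bsub>?T\<^esub>" using pc(4)[of 1 1] by simp
  have gc: "g1 : carrier ?T" "g2 : carrier ?T" unfolding g1_def g2_def p1 using gT by simp_all
  interpret J: ideal J ?T unfolding J using gc by (intro T.genideal_ideal) simp
  have gJ: "g1 : J" "g2 : J" unfolding J using T.genideal_self[of "{g1, g2}"] gc by auto
  define K where "K = ?T Quot J"
  define cs where "cs x = J +>\<^bsub>?T\<^esub> x" for x
  have csE: "cs x = cs x' \<longleftrightarrow> x \<ominus>\<^bsub>?T\<^esub> x' : J" if "x : carrier ?T" "x' : carrier ?T" for x x'
    unfolding cs_def using T.quotient_eq_iff_same_a_r_cos[OF J.ideal_axioms that] by simp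
  interpret K: cring K unfolding K_def by (rule J.quotient_is_cring[OF T.is_cring])
  have csh: "cs : ring_hom ?T K" using J.rcos_ring_hom by (simp add: cs_def[abs_def] K_def)
  interpret cs: ring_hom_cring ?T K cs by (intro ring_hom_cring.intro ring_hom_cring_axioms.intro T.is_cring K.is_cring csh)
  have rel: "cs (yT kk) \<otimes>\<^bsub>K\<^esub> cs (wT kk) = \<one>\<^bsub>K\<^esub>" "cs (zT kk) [^]\<^bsub>K\<^esub> q = cs (yT kk) [^]\<^bsub>K\<^esub> mm \<oplus>\<^bsub>K\<^esub> cs (wT kk) [^]\<^bsub>K\<^esub> mm"
    using csE[of "yT kk \<otimes>\<^bsub>?T\<^esub> wT kk" "\<one>\<^bsub>?T\<^esub>"] gJ csE[of "zT kk [^]\<^bsub>?T\<^esub> q" "pc 1 \<otimes>\<^bsub>?T\<^esub> (yT kk [^]\<^bsub>?T\<^esub> mm \<oplus>\<^bsub>?T\<^esub> wT kk [^]\<^bsub>?T\<^esub> mm)"] gT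
    unfolding g1_def g2_def p1 by simp_all
  interpret N: nf_ring F v \<pi> q p K "%a. cs (pc a)" "cs (yT kk)" "cs (wT kk)" "cs (zT kk)"
  proof unfold_locales
    show "cs (pc a) : carrier K" if "na a <= 1" for a by (rule cs.hom_closed[OF pc(1)[OF that that]])
    show "cs (pc (a + b)) = cs (pc a) \<oplus>\<^bsub>K\<^esub> cs (pc b)" "cs (pc (a*b)) = cs (pc a) \<otimes>\<^bsub>K\<^esub> cs (pc b)" if "na a <= 1" "na b <= 1" for a b
      using pc(1)[OF that] pc(1)[OF that(2,1)] pc(2,3)[OF that] by simp_all
    show "cs (pc 1) = \<one>\<^bsub>K\<^esub>" unfolding p1 by (rule cs.hom_one)
  qed (rule cs.hom_closed[OF gT(1)] cs.hom_closed[OF gT(2)] cs.hom_closed[OF gT(3)] rel)+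
  have nf: "cs x : N.Nf" if "x : carrier ?T" for x
  proof (rule T3_induct[where Q = "%x. cs x : N.Nf", OF cring_k that])
    show "cs (poly3_const kk a) : N.Nf" if a: "a : carrier kk" for a
    proof -
      obtain b where "na b <= 1" "a = residue v b" using a by (auto simp: carrier_k)
      thus ?thesis using N.Nf_C[of b] by (simp add: pc_def)
    qed
    show "cs (x \<oplus>\<^bsub>?T\<^esub> x') : N.Nf" if "x : carrier ?T" "x' : carrier ?T" "cs x : N.Nf" "cs x' : N.Nf" for x x'
      using N.Nf_add[OF that(3,4)] that(1,2) by simp
    show "cs (g \<otimes>\<^bsub>?T\<^esub> x) : N.Nf" if "g : {yT kk, wT kk, zT kk}" "x : carrier ?T" "cs x : N.Nf" for g x
      using that N.Nf_gens[OF that(3)] gT by auto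
  qed
  have cs0: "cs x = \<zero>\<^bsub>K\<^esub> \<longleftrightarrow> x : J" if "x : carrier ?T" for x
    using csE[OF that T.zero_closed] that cs.hom_zero by (simp add: a_minus_def)
  have Jk: "J <= a_kernel ?T ?Q E" unfolding J
  proof (rule T.genideal_minimal[OF ring_hom_ring.kernel_is_ideal[OF hr]])
    note k = kq_ops[OF c PBc_gens(1,2)] and kz = kq_ops[OF c PBc_gens(3)[OF c] PBc_gens(1)] and kw = kq_ops[OF c PBc_gens(2,1)]
    have "kq c (\<lambda>P\<in>S. yy P*ww P) = kq c (cst 1)"
      using B.et_ei Sc_S by (subst kq_eq[OF c PBc_mult[OF PBc_gens(1,2)] PBc_const]) (auto simp: yy_def ww_def lift_apply th_Zs)
    hence e1: "kq c yy \<otimes>\<^bsub>?Q\<^esub> kq c ww = \<one>\<^bsub>?Q\<^esub>" by (simp only: k)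
    have z1: "E g1 = \<zero>\<^bsub>?Q\<^esub>" unfolding g1_def using gT kg by (simp add: a_minus_def E(3,4) e1 Q.r_neg)
    have pw: "(\<lambda>P\<in>S. f P^n) : PBc" if "f : PBc" for f n
    proof -
      interpret P: cring PB by (rule cring_PB)
      show ?thesis using P.nat_pow_closed[of f n] that by (simp add: PB_simps PB_pow)
    qed
    have "kq c (\<lambda>P\<in>S. zz c P^q) = kq c (\<lambda>P\<in>S. (\<lambda>P\<in>S. yy P^mm) P + (\<lambda>P\<in>S. ww P^mm) P)"
    proof (subst kq_eq[OF c pw PBc_add], safe)
      fix P assume P: "P : Sc c"
      let ?P = "th P"
      have "zz c P^q - (yy P^mm + ww P^mm) = (B.ZZ ?P^q - fst c*(B.et ?P^mm + B.ei ?P^mm))/fst c"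
        using Sc_S[OF P] fst_Lam[OF c] by (simp add: zz_def yy_def ww_def lift_apply power_divide diff_divide_distrib)
      moreover have "na (B.ZZ ?P^q - fst c*(B.et ?P^mm + B.ei ?P^mm)) < 1" using P by (intro ZZ_rel c) (simp add: Sc_def)
      ultimately show "na ((\<lambda>P\<in>S. zz c P^q) P - (\<lambda>P\<in>S. (\<lambda>P\<in>S. yy P^mm) P + (\<lambda>P\<in>S. ww P^mm) P) P) < 1"
        using Sc_S[OF P] fst_Lam[OF c] by (simp add: na_divide)
    qed (auto simp: PBc_gens c intro: pw)
    hence e2: "kq c (zz c) [^]\<^bsub>?Q\<^esub> q = kq c yy [^]\<^bsub>?Q\<^esub> mm \<oplus>\<^bsub>?Q\<^esub> kq c ww [^]\<^bsub>?Q\<^esub> mm"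
      unfolding kq_ops(2)[OF c pw[OF PBc_gens(1)] pw[OF PBc_gens(2)]] kz(4) k(4) kw(4) .
    have z2: "E g2 = \<zero>\<^bsub>?Q\<^esub>" unfolding g2_def p1 using gT kg by (simp add: a_minus_def E(3-5) e2 Q.r_neg)
    have "g1 : a_kernel ?T ?Q E" "g2 : a_kernel ?T ?Q E" unfolding a_kernel_def' by (rule CollectI, rule conjI, fact, fact)+
    thus "{g1, g2} <= a_kernel ?T ?Q E" by (simp only: insert_subset empty_subsetI simp_thms)
  qed
  have kJ: "x : J" if x: "x : carrier ?T" "E x = \<zero>\<^bsub>?Q\<^esub>" for x
  proof -
    obtain b A where b: "ncoef b A" "ALL t. na (b t) <= 1" "cs x = nfr K (%a. cs (pc a)) (cs (yT kk)) (cs (wT kk)) (cs (zT kk)) b A"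
      using nf[OF x(1)] unfolding N.Nf_def by blast
    have b1: "na (b t) <= 1" for t by (rule spec[OF b(2)])
    have A: "finite A" using b(1) by (simp add: ncoef_def)
    obtain P0 where P0: "P0 : S" by (rule S_nonempty)
    have t: "tn b A : carrier ?T" by (rule tn_closed[OF b1])
    \<comment> \<open>\<open>x\<close> and its normal form agree modulo J, which lies in the kernel,
      so the normal form also has image 0.\<close>
    have cx: "cs x = cs (tn b A)"
      unfolding b(3) tn_def by (rule hom_nfr[OF T.is_cring K.is_cring csh gT, symmetric]) (use pc(1)[OF b1 b1] in auto)
    hence "x \<ominus>\<^bsub>?T\<^esub> tn b A : a_kernel ?T ?Q E" using csE[OF x(1) t] subsetD[OF Jk] by simp
    hence "E (x \<ominus>\<^bsub>?T\<^esub> tn b A) = \<zero>\<^bsub>?Q\<^esub>" unfolding a_kernel_def' by (elim CollectE conjE)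
    moreover have "E (x \<ominus>\<^bsub>?T\<^esub> tn b A) = E x \<oplus>\<^bsub>?Q\<^esub> (\<ominus>\<^bsub>?Q\<^esub> E (tn b A))" unfolding a_minus_def using x(1) t by simp
    moreover have Et: "E (tn b A) : carrier ?Q" by (rule E.hom_closed[OF t])
    ultimately have "\<ominus>\<^bsub>?Q\<^esub> E (tn b A) = \<zero>\<^bsub>?Q\<^esub>" unfolding x(2) by (simp only: Q.l_zero Q.a_inv_closed)
    hence "E (tn b A) = \<zero>\<^bsub>?Q\<^esub>" using Q.minus_minus[OF Et] Q.minus_zero by metis
    hence "kq c (nfr PB cst yy ww (zz c) b A) = kq c (cst 0)" using Etn[OF b1] kq_ops(6)[OF c PBc_gens(1,1)] by simp
    hence s: "na (nsum (%t. b t*inverse (fst c)^snd t) A (th P)) < 1" if P: "P : Sc c" for P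
      using kq_eq[OF c nfr_PB(2)[OF c A b1 P0] PBc_const[of 0]] nfr_PB(1)[OF c A b1 Sc_S[OF P]] P Sc_S[OF P] by fastforce
    have i1: "na (inverse (fst c)^n) = 1" for n using fst_Lam[OF c] by (simp add: na_power na_inverse)
    have "na (b t*inverse (fst c)^snd t) < 1" for t
      by (rule nsum_small_Sc[OF c _ _ s]) (use b(1) b1 i1 in \<open>auto simp: ncoef_def na_mult\<close>)
    hence "residue v (b t) = residue v 0" for t using residue_eq[OF b1, of 0 t] i1 by (simp add: na_mult)
    hence "pc (b t) = pc 0" for t by (simp add: pc_def)
    moreover have "pc 0 = \<zero>\<^bsub>?T\<^esub>" using pc(1,2)[of 0 0] T.add.r_cancel_one[of "pc 0" "pc 0"] by simp
    ultimately have "tn b A = finsum ?T (%_. \<zero>\<^bsub>?T\<^esub>) A"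
      unfolding tn_def nfr_def trmr_def mni_def using gT by (intro T.add.finprod_cong') (auto simp del: pow_nat)
    hence "cs x = \<zero>\<^bsub>K\<^esub>" unfolding cx by (simp add: T.finsum_zero)
    thus ?thesis using cs0[OF x(1)] by simp
  qed
  have ker: "a_kernel ?T ?Q E = J"
  proof (rule antisym[OF subsetI Jk])
    fix x assume "x : a_kernel ?T ?Q E"
    thus "x : J" unfolding a_kernel_def' by (elim CollectE conjE) (rule kJ)
  qed
  let ?\<psi> = "%U. the_elem (E ` U)"
  have psi: "?\<psi> \<in> ring_iso K ?Q" using ring_hom_ring.FactRing_iso_set[OF hr surj] unfolding ker K_def .
  have cr: "closed_subset_ring RR (Vc c) = ?Q" "curve_ring kk q ?\<zeta> = K"
    by (simp_all add: closed_subset_ring_def Inter_Vc[OF c] Qc_def curve_ring_def K_def J_def)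
  \<comment> \<open>The isomorphism theorem gives the map from the curve ring to the ring of the
    component; its inverse is the direction required.\<close>
  have "inv_into (carrier K) ?\<psi> \<in> ring_iso ?Q K" by (rule ring_iso_set_sym[OF K.ring_axioms psi])
  moreover have "inv_into (carrier K) ?\<psi> (closed_subset_restrict RR (Vc c) (reduction_const \<pi> q S a)) = curve_const kk q ?\<zeta> (residue v a)"
    if a: "a : carrier (val_ring v UNIV)" for a
  proof -
    have a1: "na a <= 1" using a by (simp add: carrier_V)
    have e: "closed_subset_restrict RR (Vc c) (reduction_const \<pi> q S a) = kq c (cst a)" "curve_const kk q ?\<zeta> (residue v a) = cs (pc a)"
      by (simp_all add: closed_subset_restrict_def Inter_Vc[OF c] reduction_const_def kq_def cl_def curve_const_def cs_def J_def pc_def)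
    have "?\<psi> (cs (pc a)) = kq c (cst a)"
      using ring_hom_ring.the_elem_simp[OF hr pc(1)[OF a1 a1]] Epc[OF a1] unfolding ker cs_def by simp
    moreover have "inj_on ?\<psi> (carrier K)" using psi by (simp add: ring_iso_def bij_betw_def)
    hence "inv_into (carrier K) ?\<psi> (?\<psi> (cs (pc a))) = cs (pc a)" by (rule inv_into_f_f[OF _ cs.hom_closed[OF pc(1)[OF a1 a1]]])
    ultimately show ?thesis unfolding e by simp
  qed
  ultimately show ?thesis unfolding isomorphic_to_curve_def Let_def cr by (intro bexI) auto
qed

theorem reduction_components:
  "card (connected_components_of Spec) = q*(q - 1)
    & (\<forall>V \<in> connected_components_of Spec. \<exists>\<zeta> \<in> fq_units F v. isomorphic_to_curve v \<pi> q S V \<zeta>)"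
proof -
  have "residue v 1 : fq_units F v" using F_1 v_1 by (auto simp: fq_units_def)
  thus ?thesis using components(2) component_iso unfolding components(1) by blast
qed

end

theorem proposition3p3:
  fixes F :: "'c::{field_char_0,complete_space} set"
    and v :: "'c \<Rightarrow> ereal" and \<pi> :: 'c and q p :: nat
    and S :: "('c \<times> 'c \<times> 'c) set"
  assumes "lubin_tate_setting F v \<pi> q p"
    and "S = Z110 F v \<pi> q \<or> S = Z11inf F v \<pi> q"
  shows "card (connected_components_of (zariski_topology (reduction_ring \<pi> q S))) = q * (q - 1)
    \<and> (\<forall>V \<in> connected_components_of (zariski_topology (reduction_ring \<pi> q S)).
          \<exists>\<zeta> \<in> fq_units F v. isomorphic_to_curve v \<pi> q S V \<zeta>)"
proof -
  interpret A: lt_affinoid F v \<pi> q p by (rule lt_affinoid.intro[OF assms(1)])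
  have "Z11inf F v \<pi> q = {P. A.sw P \<in> A.Zs}"
    by (auto simp: Z11inf_def A.Z110_Zs A.sw_def A.cx_def A.cy_def A.cu_def)
  then have "lt_reduction F v \<pi> q p S (if S = A.Zs then \<lambda>P. P else A.sw)"
    using assms(2) unfolding A.Z110_Zs by unfold_locales auto
  then show ?thesis by (rule lt_reduction.reduction_components)
qed

end
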